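(* Assume that (A1), (A2) and (A5) hold. Then $$\left(\frac{X_n(\lfloor a_n t\rfloor)}{n};\ t\ge 0\right)\ \xrightarrow[n\to\infty]{(d)}\ (Y(t);\ t\ge0)$$ in distribution in $\mathbb D(\mathbb R_+,\mathbb R)$.
   Context: Let $\mathbb N=\{1,2,\dots\}$. For every $n\ge1$ let $(p_{n,k})_{k\ge1}$ be nonnegative reals with $\sum_{k\ge1}p_{n,k}=1$, and let $(X_n(k))_{k\ge0}$ be the discrete-time Markov chain on $\mathbb N$ with $X_n(0)=n$ and $\mathbb P(X_n(k+1)=j\mid X_n(k)=i)=p_{i,j}$. Let $\Pi_n^*(dx)=\sum_{k\ge1}p_{n,k}\,\delta_{\ln k-\ln n}(dx)$. Let $(a_n)_{n\ge0}$ be positive reals, regularly varying with index $\gamma>0$, i.e. $a_{\lfloor xn\rfloor}/a_n\to x^\gamma$ for every $x>0$. Let $\Pi$ be a measure on $\mathbb R\setminus\{0\}$ with $\Pi(\{-1,1\})=0$ and $\int(1\wedge x^2)\,\Pi(dx)<\infty$. (A1): for every continuous $f$ with compact support in $[0,\infty]\setminus\{1\}$, $a_n\,\mathbb E[f(X_n(1)/n)]\to\int_{\mathbb R}f(e^x)\,\Pi(dx)$. (A2): there exist $b\in\mathbb R$, $\sigma^2\ge0$ with $a_n\int_{-1}^1x\,\Pi_n^*(dx)\to b$ and $a_n\int_{-1}^1x^2\,\Pi_n^*(dx)\to\sigma^2+\int_{-1}^1x^2\,\Pi(dx)$. Let $\Psi(\lambda)=\frac12\sigma^2\lambda^2+b\lambda+\int(e^{\lambda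 x}-1-\lambda x\mathbb 1_{|x|\le1})\,\Pi(dx)$ where finite. (A4): there exists $\beta_0>\gamma$ with $\limsup_n a_n\int_1^\infty e^{\beta_0x}\,\Pi_n^*(dx)<\infty$ and $\Psi(\beta_0)<0$. (A5): (A4) holds for some $\beta_0>\gamma$ which moreover satisfies $\mathbb E[X_n(1)^{\beta_0}]=\sum_{k\ge1}k^{\beta_0}p_{n,k}<\infty$ for every $n\ge1$. Let $\xi$ be the Lévy process with $\xi(0)=0$ and $\mathbb E[e^{i\lambda\xi(t)}]=e^{t\Phi(\lambda)}$, $\Phi(\lambda)=-\frac12\sigma^2\lambda^2+ib\lambda+\int(e^{i\lambda x}-1-i\lambda x\mathbb 1_{|x|\le1})\,\Pi(dx)$. Let $I_\infty=\int_0^\infty e^{\gamma\xi(s)}ds$, $\tau(t)=\inf\{u\ge0:\int_0^ue^{\gamma\xi(s)}ds>t\}$, $Y(t)=e^{\xi(\tau(t))}$ for $t<I_\infty$, $Y(t)=0$ for $t\ge I_\infty$. $\mathbb D(\mathbb R_+,\mathbb R)$ carries the Skorokhod $J_1$ topology. *)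

theory Defs
  imports "HOL-Probability.Probability"
begin

text \<open>Paths are functions real => real; only their values on [0,oo) matter.\<close>

definition cadlag :: "(real \<Rightarrow> real) \<Rightarrow> bool" where
  "cadlag x \<longleftrightarrow> (\<forall>t\<ge>0. (x \<longlongrightarrow> x t) (at_right t)) \<and>
                 (\<forall>t>0. \<exists>l. (x \<longlongrightarrow> l) (at_left t))"

definition time_change :: "(real \<Rightarrow> real) \<Rightarrow> bool" where
  "time_change l \<longleftrightarrow> continuous_on {0..} l \<and> strict_mono_on {0..} l \<and> l 0 = 0 \<and>
                      l ` {0..} = {0..}"

text \<open>Convergence in the Skorokhod J1 topology on D(R+,R) (Jacod--Shiryaev VI.1.14).\<close>
definition J1_conv :: "(nat \<Rightarrow> real \<Rightarrow> real) \<Rightarrow> (real \<Rightarrow> real) \<Rightarrow> bool" where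
  "J1_conv xs x \<longleftrightarrow> (\<exists>ls. (\<forall>n. time_change (ls n)) \<and>
      (\<forall>e>0. \<forall>\<^sub>F n in sequentially. \<forall>t\<ge>0. \<bar>ls n t - t\<bar> \<le> e) \<and>
      (\<forall>T e. e > 0 \<longrightarrow> (\<forall>\<^sub>F n in sequentially. \<forall>t\<in>{0..T}. \<bar>xs n (ls n t) - x t\<bar> \<le> e)))"

text \<open>J1-continuity on D (the J1 topology is metrizable, so sequential continuity is continuity).\<close>
definition J1_continuous :: "((real \<Rightarrow> real) \<Rightarrow> real) \<Rightarrow> bool" where
  "J1_continuous G \<longleftrightarrow> (\<forall>xs x. cadlag x \<and> (\<forall>n. cadlag (xs n)) \<and> J1_conv xs x \<longrightarrow>
                           (\<lambda>n. G (xs n)) \<longlonglongrightarrow> G x)"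

definition PathM :: "(real \<Rightarrow> real) measure" where
  "PathM = PiM UNIV (\<lambda>_. borel)"

text \<open>Convergence in distribution in D(R+,R) with J1: for all bounded J1-continuous test
  functionals (taken product-measurable on the path space, so that they can be integrated)
  the expectations converge.\<close>
definition conv_distr_J1 ::
  "(nat \<Rightarrow> 'a measure) \<Rightarrow> (nat \<Rightarrow> 'a \<Rightarrow> real \<Rightarrow> real) \<Rightarrow> 'b measure \<Rightarrow> ('b \<Rightarrow> real \<Rightarrow> real) \<Rightarrow> bool"
  where
  "conv_distr_J1 M Z N Y \<longleftrightarrow>
     (\<forall>G. G \<in> borel_measurable PathM \<and> (\<exists>B. \<forall>x. \<bar>G x\<bar> \<le> B) \<and> J1_continuous G \<longrightarrow>
        (\<lambda>n. \<integral>\<omega>. G (Z n \<omega>) \<partial>M n) \<longlonglongrightarrow> (\<integral>\<omega>. G (Y \<omega>) \<partial>N))"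

definition markov_chain_from :: "'a measure \<Rightarrow> ('a \<Rightarrow> nat \<Rightarrow> nat) \<Rightarrow> (nat \<Rightarrow> nat \<Rightarrow> real) \<Rightarrow> nat \<Rightarrow> bool"
  where
  "markov_chain_from M X p x0 \<longleftrightarrow> prob_space M \<and>
     (\<forall>k. (\<lambda>\<omega>. X \<omega> k) \<in> measurable M (count_space UNIV)) \<and>
     (\<forall>k s. measure M {\<omega>\<in>space M. \<forall>j\<le>k. X \<omega> j = s j} =
            (if s 0 = x0 then 1 else 0) * (\<Prod>j<k. p (s j) (s (Suc j))))"

definition levy_exponent :: "real \<Rightarrow> real \<Rightarrow> real measure \<Rightarrow> real \<Rightarrow> complex" where
  "levy_exponent s2 b Lv \<theta> =
     - complex_of_real (s2 / 2 * \<theta>\<^sup>2) + \<i> * complex_of_real (b * \<theta>) +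
     (\<integral>x. iexp (\<theta> * x) - 1 - \<i> * complex_of_real (\<theta> * x * indicator {-1..1} x) \<partial>Lv)"

definition laplace_integrand :: "real \<Rightarrow> real \<Rightarrow> real" where
  "laplace_integrand lam x = exp (lam * x) - 1 - lam * x * indicator {-1..1} x"

definition Psi :: "real \<Rightarrow> real \<Rightarrow> real measure \<Rightarrow> real \<Rightarrow> real" where
  "Psi s2 b Lv lam = s2 / 2 * lam\<^sup>2 + b * lam + (\<integral>x. laplace_integrand lam x \<partial>Lv)"

definition levy_process :: "'b measure \<Rightarrow> (real \<Rightarrow> 'b \<Rightarrow> real) \<Rightarrow> real \<Rightarrow> real \<Rightarrow> real measure \<Rightarrow> bool"
  where
  "levy_process N xi s2 b Lv \<longleftrightarrow> prob_space N \<and>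
     (\<forall>t. xi t \<in> borel_measurable N) \<and>
     (\<forall>\<omega>\<in>space N. xi 0 \<omega> = 0 \<and> cadlag (\<lambda>t. xi t \<omega>)) \<and>
     (\<forall>k (t::nat \<Rightarrow> real). 0 \<le> t 0 \<and> (\<forall>j<k. t j \<le> t (Suc j)) \<longrightarrow>
        prob_space.indep_vars N (\<lambda>_. borel) (\<lambda>j \<omega>. xi (t (Suc j)) \<omega> - xi (t j) \<omega>) {..<k}) \<and>
     (\<forall>s t \<theta>. 0 \<le> s \<and> s \<le> t \<longrightarrow>
        char (distr N borel (\<lambda>\<omega>. xi t \<omega> - xi s \<omega>)) \<theta> =
          exp (complex_of_real (t - s) * levy_exponent s2 b Lv \<theta>))"

definition I_infty :: "real \<Rightarrow> (real \<Rightarrow> 'b \<Rightarrow> real) \<Rightarrow> 'b \<Rightarrow> ennreal" where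
  "I_infty g xi \<omega> = (\<integral>\<^sup>+ s. ennreal (exp (g * xi s \<omega>)) * indicator {0..} s \<partial>lborel)"

definition time_inv :: "real \<Rightarrow> (real \<Rightarrow> 'b \<Rightarrow> real) \<Rightarrow> 'b \<Rightarrow> real \<Rightarrow> real" where
  "time_inv g xi \<omega> t = Inf {u. 0 \<le> u \<and>
      (\<integral>\<^sup>+ s. ennreal (exp (g * xi s \<omega>)) * indicator {0..u} s \<partial>lborel) > ennreal t}"

definition lamperti :: "real \<Rightarrow> (real \<Rightarrow> 'b \<Rightarrow> real) \<Rightarrow> 'b \<Rightarrow> real \<Rightarrow> real" where
  "lamperti g xi \<omega> t =
     (if ennreal t < I_infty g xi \<omega> then exp (xi (time_inv g xi \<omega> t) \<omega>) else 0)"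

text \<open>f continuous on [0,oo] (i.e. continuous on [0,oo) with a finite limit at oo)
  whose support is a compact subset of [0,oo] minus {1}, i.e. f vanishes near 1.\<close>
definition A1_test :: "(real \<Rightarrow> real) \<Rightarrow> bool" where
  "A1_test f \<longleftrightarrow> continuous_on {0..} f \<and> (\<exists>L. (f \<longlongrightarrow> L) at_top) \<and>
                  (\<exists>d>0. \<forall>x. \<bar>x - 1\<bar> < d \<longrightarrow> f x = 0)"

end

theory Submission
  imports Defs "HOL-Real_Asymp.Real_Asymp"
begin

text \<open>
  Under the intrinsic clock that advances by \<open>1 / a z\<close> at each visit of a state \<open>z\<close>, the logarithm of
  the chain, started far from the origin, is close to the Levy process. Fix a small \<open>h\<close> and cut the chain
  into cells of intrinsic length \<open>h\<close>. The increments of the logarithm over the cells, quantised to a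
  lattice of mesh \<open>q\<close>, converge jointly in law to the quantised increments \<open>W\<close> of the Levy process, by
  convergence of characteristic functions. With probability close to 1 no cell contains two large moves,
  and, since \<open>\<Psi>(\<beta>) < 0\<close> for some \<open>\<beta> > \<gamma>\<close>, a maximal inequality for \<open>x powr \<beta>\<close> keeps the chain
  small once it is small; such trajectories are determined by their quantised increments up to a small
  \<open>J1\<close> error. Hence \<open>E (G Z)\<close> is, up to a small error, at most the expectation of the supremum of \<open>G\<close> over
  all trajectories compatible with \<open>W\<close>. As \<open>h\<close> and \<open>q\<close> tend to 0, any choice of trajectories compatible
  with \<open>W\<close> converges in \<open>J1\<close> to the Lamperti transform of the Levy path, by a deterministic argument, so
  these suprema have upper limit at most \<open>G Y\<close>. Applied to \<open>G\<close> and to \<open>- G\<close> this gives the convergence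
  without any tightness criterion.
\<close>

section \<open>Regular variation\<close>

text \<open>Two obstacles shape the proof. The one-step hypotheses concern large states only, while
  the chain descends: a cell is therefore abandoned below the square root of its starting state, and
  each estimate of a cell telescopes, the error of a step at \<open>z\<close>, of order
  \<open>1 / a z\<close>, being paid by the clock. Moreover \<open>G\<close> is only sequentially
  continuous, with no modulus. Suprema over sets of deterministic paths turn it into a function of
  finitely many integers, whose law is a matter of finitely many probabilities and which needs no
  measurable choice of paths. The exponent \<beta> serves twice. For the Levy process
  \<open>exp (\<beta> * \<xi>)\<close> decreases in mean, so \<xi> drifts to minus infinity. For the
  chain the mean of \<open>x powr \<beta>\<close> grows by at most a constant per step; over
  \<open>a n * T\<close> steps this is of order \<open>a n\<close>, negligible against
  \<open>n powr \<beta>\<close> because \<beta> > \<gamma>. The exponential moment of the Levy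
  process is itself inherited from the chain through the weak limit, so on the Levy side only the
  characteristic exponent enters.\<close>

lemma slow_var_uniform:
  fixes g :: "nat \<Rightarrow> real"
  assumes lim: "\<And>x. x > 0 \<Longrightarrow> (\<lambda>n. g (nat \<lfloor>x * real n\<rfloor>) - g n) \<longlonglongrightarrow> 0"
    and c: "c \<ge> 1" and e: "\<epsilon> > 0"
  shows "\<exists>n0>0. \<forall>n\<ge>n0. \<forall>m. real n / c \<le> real m \<and> real m \<le> c * real n \<longrightarrow> \<bar>g m - g n\<bar> \<le> \<epsilon>"
proof -
  \<comment> \<open>The integration proof of the uniform convergence theorem: pointwise convergence
    makes the set of those \<open>y\<close> at which \<open>g\<close> deviates on the scale
    \<open>n\<close> small in measure. If \<open>g m\<close> and \<open>g n\<close> were far apart,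
    each \<open>y\<close> in \<open>{1..2}\<close> would be bad for \<open>n\<close> or its rescaled
    image bad for \<open>m\<close>, which is more measure than is available. The interval from
    \<open>1/c\<close> to \<open>2*c\<close> contains both \<open>y\<close> and the image.\<close>
  define bad :: "nat \<Rightarrow> real \<Rightarrow> real" where
    "bad n y = indicator {1/c..2*c} y * indicator {\<epsilon>/2<..} \<bar>g (nat \<lfloor>y * real n\<rfloor>) - g n\<bar>" for n y
  have meas[measurable]: "(\<lambda>y. g (nat \<lfloor>y * real n\<rfloor>)) \<in> borel_measurable borel" for n
    by measurable
  have bm[measurable]: "bad n \<in> borel_measurable borel" for n
    unfolding bad_def by measurable
  have ub: "integrable lborel (indicator {1/c..2*c} :: real \<Rightarrow> real)"
    by (rule integrable_real_indicator) (auto simp: emeasure_lborel_Icc_eq)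
  have pt: "(\<lambda>n. bad n y) \<longlonglongrightarrow> (0::real)" for y
  proof (cases "y \<in> {1/c..2*c}")
    case True
    then have "y > 0" using c by (smt (verit) atLeastAtMost_iff divide_pos_pos)
    from tendstoD[OF lim[OF this], of "\<epsilon>/2"] e
    have "\<forall>\<^sub>F n in sequentially. \<bar>g (nat \<lfloor>y * real n\<rfloor>) - g n\<bar> < \<epsilon>/2" by (simp add: dist_real_def)
    then have "\<forall>\<^sub>F n in sequentially. bad n y = 0"
      by eventually_elim (auto simp: bad_def)
    then show ?thesis by (rule tendsto_eventually)
  qed (simp add: bad_def)
  have le: "norm (bad n y) \<le> indicator {1/c..2*c} y" for n y
    by (auto simp: bad_def indicator_def)
  have "(\<lambda>n. integral\<^sup>L lborel (bad n)) \<longlonglongrightarrow> integral\<^sup>L lborel (\<lambda>_. 0 :: real)"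
    using integral_dominated_convergence[of "\<lambda>_. 0::real" lborel bad "indicator {1/c..2*c}"] ub pt le by simp
  then have l0: "(\<lambda>n. integral\<^sup>L lborel (bad n)) \<longlonglongrightarrow> 0" by simp
  have ib: "integrable lborel (bad n)" for n
    by (rule Bochner_Integration.integrable_bound[OF ub]) (use le in \<open>auto simp: bad_def indicator_def\<close>)
  from tendstoD[OF l0, of "1/(4*c)"] c obtain n1 where n1: "\<And>n. n \<ge> n1 \<Longrightarrow> \<bar>integral\<^sup>L lborel (bad n)\<bar> < 1/(4*c)"
    by (auto simp: eventually_sequentially)
  \<comment> \<open>The factor \<open>c\<close> makes every \<open>m \<ge> n / c\<close> exceed
    \<open>n1\<close> as well.\<close>
  define n0 where "n0 = Suc (nat \<lceil>c * real (Suc n1)\<rceil>)"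
  have "\<bar>g m - g n\<bar> \<le> \<epsilon>" if n: "n \<ge> n0" and m: "real n / c \<le> real m" "real m \<le> c * real n" for n m
  proof (rule ccontr)
    assume *: "\<not> ?thesis"
    have nn: "real n \<ge> c * real (Suc n1)" using n unfolding n0_def by linarith
    then have "real n / c \<ge> real (Suc n1)" using c by (simp add: field_simps)
    then have mm: "m \<ge> Suc n1" using m by linarith
    have "real n \<ge> real (Suc n1)" by (rule order_trans[OF _ nn]) (use c in \<open>simp add: mult_le_cancel_right1\<close>)
    then have nn1: "n \<ge> Suc n1" by linarith
    have m0: "real m > 0" "real n > 0" using mm nn1 by auto
    define r where "r = real n / real m"
    have r: "r > 0" "r \<le> c" "1 / c \<le> r" using m m0 c unfolding r_def by (auto simp: field_simps)
    have cover: "indicator {1..2} y \<le> bad n y + bad m (0 + r * y)" for y :: real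
    proof (cases "y \<in> {1..2}")
      case True
      have 1: "y \<in> {1/c..2*c}" using True c mult_mono[of 1 c 1 y] by (auto simp: field_simps)
      have "r * y \<ge> 1/c * 1" using r True c by (intro mult_mono) auto
      moreover have "r * y \<le> c * 2" using r True c by (intro mult_mono) auto
      ultimately have 2: "r * y \<in> {1/c..2*c}" by auto
      \<comment> \<open>The rescaled point samples \<open>g\<close> at exactly the same index,
        floors included, so both deviations are measured from one value \<open>G\<close>.\<close>
      have 3: "r * y * real m = y * real n" using m0 by (simp add: r_def)
      define G where "G = g (nat \<lfloor>y * real n\<rfloor>)"
      have "\<bar>G - g n\<bar> > \<epsilon>/2 \<or> \<bar>G - g m\<bar> > \<epsilon>/2" using * by linarith
      then show ?thesis using 1 2 by (auto simp: bad_def 3 G_def[symmetric] split: split_indicator)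
    qed (auto simp: bad_def)
    have ib2: "integrable lborel (\<lambda>y. bad m (0 + r * y))"
      using ib[of m] r by (subst lborel_integrable_real_affine_iff) auto
    have "1 = integral\<^sup>L lborel (indicator {1..2::real} :: real \<Rightarrow> real)" by simp
    also have "\<dots> \<le> integral\<^sup>L lborel (\<lambda>y. bad n y + bad m (0 + r * y))"
      by (intro integral_mono cover Bochner_Integration.integrable_add ib ib2) auto
    also have "\<dots> = integral\<^sup>L lborel (bad n) + integral\<^sup>L lborel (\<lambda>y. bad m (0 + r * y))"
      by (intro Bochner_Integration.integral_add ib ib2)
    also have "integral\<^sup>L lborel (\<lambda>y. bad m (0 + r * y)) = integral\<^sup>L lborel (bad m) / r"
      using r by (subst lborel_integral_real_affine[of r "bad m" 0]) auto
    also have "integral\<^sup>L lborel (bad m) / r \<le> 1/(4*c) / (1/c)"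
    proof (rule frac_le)
      show "integral\<^sup>L lborel (bad m) \<le> 1/(4*c)" using n1[of m] mm by auto
    qed (use r c in auto)
    also have "1/(4*c) / (1/c) = 1/4" using c by simp
    also have "integral\<^sup>L lborel (bad n) \<le> 1/(4*c)" using n1[of n] nn1 by auto
    also have "1/(4*c) \<le> 1/4" using c by (simp add: field_simps)
    finally show False by simp
  qed
  moreover have "n0 > 0" by (simp add: n0_def)
  ultimately show ?thesis by blast
qed

locale reg_varying =
  fixes a :: "nat \<Rightarrow> real" and \<gamma> :: real
  assumes a_pos: "\<And>n. 0 < a n"
    and gamma_pos: "0 < \<gamma>"
    and reg_var: "\<And>x. x > 0 \<Longrightarrow> (\<lambda>n. a (nat \<lfloor>x * real n\<rfloor>) / a n) \<longlonglongrightarrow> x powr \<gamma>"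
begin

text \<open>The logarithm of the slowly varying factor of \<open>a\<close>; in this additive form
  regular variation becomes \<open>sv_lim\<close>, to which \<open>slow_var_uniform\<close>
  applies.\<close>

definition sv :: "nat \<Rightarrow> real" where "sv n = ln (a n) - \<gamma> * ln (real n)"

lemma a_sv: "n > 0 \<Longrightarrow> a n = real n powr \<gamma> * exp (sv n)"
  using a_pos[of n] by (simp add: sv_def exp_diff powr_def mult.commute)

lemma sv_lim:
  assumes x: "x > 0"
  shows "(\<lambda>n. sv (nat \<lfloor>x * real n\<rfloor>) - sv n) \<longlonglongrightarrow> 0"
proof -
  have "(\<lambda>n. ln (a (nat \<lfloor>x * real n\<rfloor>) / a n)) \<longlonglongrightarrow> ln (x powr \<gamma>)"
    using reg_var[OF x] x by (intro tendsto_ln) auto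
  then have 1: "(\<lambda>n. ln (a (nat \<lfloor>x * real n\<rfloor>)) - ln (a n)) \<longlonglongrightarrow> \<gamma> * ln x"
    using a_pos x by (simp add: ln_div ln_powr less_imp_neq[symmetric])
  have fl: "(\<lambda>n. real (nat \<lfloor>x * real n\<rfloor>) / real n) \<longlonglongrightarrow> x"
  proof (rule tendsto_sandwich)
    show "\<forall>\<^sub>F n in sequentially. x - 1 / real n \<le> real (nat \<lfloor>x * real n\<rfloor>) / real n"
      using eventually_gt_at_top[of 0]
    proof eventually_elim
      case (elim n)
      have "x * real n - 1 \<le> real (nat \<lfloor>x * real n\<rfloor>)" by linarith
      then have "(x * real n - 1) / real n \<le> real (nat \<lfloor>x * real n\<rfloor>) / real n" by (rule divide_right_mono) simp
      then show ?case using elim by (simp add: diff_divide_distrib)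
    qed
    show "\<forall>\<^sub>F n in sequentially. real (nat \<lfloor>x * real n\<rfloor>) / real n \<le> x"
      using eventually_gt_at_top[of 0]
    proof eventually_elim
      case (elim n)
      have "real (nat \<lfloor>x * real n\<rfloor>) \<le> x * real n" using x by (simp add: of_nat_floor)
      then show ?case using elim by (simp add: field_simps)
    qed
    show "(\<lambda>n. x - 1 / real n) \<longlonglongrightarrow> x" by real_asymp
  qed simp
  then have "(\<lambda>n. ln (real (nat \<lfloor>x * real n\<rfloor>) / real n)) \<longlonglongrightarrow> ln x" using x by (intro tendsto_ln) auto
  moreover have "\<forall>\<^sub>F n in sequentially. ln (real (nat \<lfloor>x * real n\<rfloor>) / real n) = ln (real (nat \<lfloor>x * real n\<rfloor>)) - ln (real n)"
    using order_tendstoD(1)[OF fl x]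
  proof eventually_elim
    case (elim n)
    then have n: "real n > 0" by (cases n) auto
    with elim have "real (nat \<lfloor>x * real n\<rfloor>) > 0" by (metis zero_less_divide_iff not_less_iff_gr_or_eq)
    then show ?case using n by (metis ln_div less_numeral_extra(3))
  qed
  ultimately have 2: "(\<lambda>n. ln (real (nat \<lfloor>x * real n\<rfloor>)) - ln (real n)) \<longlonglongrightarrow> ln x"
    by (rule Lim_transform_eventually)
  have "(\<lambda>n. (ln (a (nat \<lfloor>x * real n\<rfloor>)) - ln (a n)) - \<gamma> * (ln (real (nat \<lfloor>x * real n\<rfloor>)) - ln (real n))) \<longlonglongrightarrow> \<gamma> * ln x - \<gamma> * ln x"
    by (intro tendsto_intros 1 2)
  then show ?thesis by (simp add: sv_def algebra_simps)
qed

lemma sv_uniform: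
  assumes "c \<ge> 1" "\<epsilon> > 0"
  shows "\<exists>n0>0. \<forall>n\<ge>n0. \<forall>m. real n / c \<le> real m \<and> real m \<le> c * real n \<longrightarrow> \<bar>sv m - sv n\<bar> \<le> \<epsilon>"
  by (rule slow_var_uniform) (use assms sv_lim in auto)

text \<open>A weak Potter bound, by halving: passing from \<open>m\<close> to \<open>m div 2\<close>
  changes \<open>sv\<close> by at most \<open>\<epsilon> * ln 2\<close>, and
  \<open>\<epsilon> * ln m\<close> drops by at least as much. The factor 3 in the use of
  \<open>sv_uniform\<close> accommodates odd \<open>m\<close>.\<close>

lemma sv_growth:
  assumes e: "\<epsilon> > 0"
  shows "\<exists>C. \<forall>m>0. \<bar>sv m\<bar> \<le> C + \<epsilon> * ln (real m)"
proof -
  obtain n0 where n0: "n0 > 0" "\<And>n m. n \<ge> n0 \<Longrightarrow> real n / 3 \<le> real m \<Longrightarrow> real m \<le> 3 * real n \<Longrightarrow> \<bar>sv m - sv n\<bar> \<le> \<epsilon> * ln 2"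
    using sv_uniform[of 3 "\<epsilon> * ln 2"] e by auto
  define C where "C = Max ((\<lambda>m. \<bar>sv m\<bar>) ` {..2*n0})"
  have C: "\<bar>sv m\<bar> \<le> C" if "m \<le> 2*n0" for m unfolding C_def using that by (intro Max_ge) auto
  have "m > 0 \<longrightarrow> \<bar>sv m\<bar> \<le> C + \<epsilon> * ln (real m)" for m
  proof (induction m rule: less_induct)
    case (less m)
    show ?case
    proof
      assume m: "m > 0"
      show "\<bar>sv m\<bar> \<le> C + \<epsilon> * ln (real m)"
      proof (cases "m \<le> 2*n0")
        case True
        have "\<epsilon> * ln (real m) \<ge> 0" using m e by simp
        then show ?thesis using C[OF True] by linarith
      next
        case False
        define k where "k = m div 2"
        have k: "k \<ge> n0" "k < m" "2 * k \<le> m" "m \<le> 3 * k" "k > 0" using False n0(1) unfolding k_def by linarith+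
        have "real k / 3 \<le> real m" "real m \<le> 3 * real k" using k by linarith+
        then have 1: "\<bar>sv m - sv k\<bar> \<le> \<epsilon> * ln 2" using n0(2)[OF k(1)] by blast
        have 2: "\<bar>sv k\<bar> \<le> C + \<epsilon> * ln (real k)" using less[OF k(2)] k(5) by blast
        have "ln 2 + ln (real k) = ln (2 * real k)" using k by (simp add: ln_mult)
        also have "\<dots> \<le> ln (real m)" using k by simp
        finally have "\<epsilon> * (ln 2 + ln (real k)) \<le> \<epsilon> * ln (real m)" using e by simp
        then show ?thesis using 1 2 by (simp add: algebra_simps)
      qed
    qed
  qed
  then show ?thesis by blast
qed

lemma a_at_top: "filterlim a at_top sequentially"
proof -
  obtain C where C: "\<And>m. m > 0 \<Longrightarrow> \<bar>sv m\<bar> \<le> C + \<gamma>/2 * ln (real m)"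
    using sv_growth[of "\<gamma>/2"] gamma_pos by auto
  have g: "\<gamma> > 0" by (rule gamma_pos)
  have "filterlim (\<lambda>m. exp (- C) * real m powr (\<gamma>/2)) at_top sequentially"
    using g by real_asymp
  then show ?thesis
  proof (rule filterlim_at_top_mono)
    show "\<forall>\<^sub>F m in sequentially. exp (- C) * real m powr (\<gamma>/2) \<le> a m"
      using eventually_gt_at_top[of 0]
    proof eventually_elim
      case (elim m)
      have "sv m \<ge> - C - \<gamma>/2 * ln (real m)" using C[OF elim] by linarith
      then have "- C + \<gamma>/2 * ln (real m) \<le> \<gamma> * ln (real m) + sv m" by (simp add: algebra_simps)
      then show ?case using elim by (simp add: a_sv powr_def flip: exp_add)
    qed
  qed
qed

text \<open>Half of the gap between \<beta> and \<gamma> absorbs the slowly varying factor, the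
  other half gives the decay. Later this makes the number of steps of the chain negligible against
  \<open>n powr \<beta>\<close>.\<close>

lemma a_powr_lim:
  assumes b: "\<beta> > \<gamma>"
  shows "(\<lambda>n. a n / real n powr \<beta>) \<longlonglongrightarrow> 0"
proof -
  define d where "d = (\<beta> - \<gamma>) / 2"
  have d: "d > 0" using b by (simp add: d_def)
  obtain C where C: "\<And>m. m > 0 \<Longrightarrow> \<bar>sv m\<bar> \<le> C + d * ln (real m)"
    using sv_growth[OF d] by auto
  have lim: "(\<lambda>n. exp C * real n powr (- d)) \<longlonglongrightarrow> 0" using d by real_asymp
  show ?thesis
  proof (rule Lim_null_comparison[OF _ lim])
    show "\<forall>\<^sub>F n in sequentially. norm (a n / real n powr \<beta>) \<le> exp C * real n powr (- d)"
      using eventually_gt_at_top[of 0]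
    proof eventually_elim
      case (elim m)
      have "sv m \<le> C + d * ln (real m)" using C[OF elim] by linarith
      then have "\<gamma> * ln (real m) + sv m - \<beta> * ln (real m) \<le> C - d * ln (real m)"
        by (simp add: d_def field_simps)
      then have "exp (\<gamma> * ln (real m) + sv m - \<beta> * ln (real m)) \<le> exp (C - d * ln (real m))" by simp
      then show ?case using elim a_pos[of m]
        by (simp add: a_sv powr_def exp_diff exp_add exp_minus field_simps)
    qed
  qed
qed

text \<open>Uniformity over all states within a factor \<open>c\<close> of \<open>n\<close> is what
  converts the intrinsic clock, which ticks \<open>1 / a z\<close>, into a number of steps in units
  of \<open>a n\<close>.\<close>

lemma a_ratio:
  assumes c: "c \<ge> 1" and e: "\<epsilon> > 0"
  shows "\<exists>n0>0. \<forall>n\<ge>n0. \<forall>m. real n / c \<le> real m \<and> real m \<le> c * real n \<longrightarrow>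
     exp (- \<epsilon>) * (real m / real n) powr \<gamma> \<le> a m / a n \<and> a m / a n \<le> exp \<epsilon> * (real m / real n) powr \<gamma>"
proof -
  obtain n0 where n0: "n0 > 0" "\<And>n m. n \<ge> n0 \<Longrightarrow> real n / c \<le> real m \<Longrightarrow> real m \<le> c * real n \<Longrightarrow> \<bar>sv m - sv n\<bar> \<le> \<epsilon>"
    using sv_uniform[OF c e] by blast
  show ?thesis
  proof (intro exI[of _ n0] conjI n0(1) allI impI)
    fix n m assume n: "n \<ge> n0" and m: "real n / c \<le> real m \<and> real m \<le> c * real n"
    have np: "n > 0" using n n0 by simp
    have mp: "m > 0" using m np c by (cases m) (auto simp: field_simps)
    have eq: "a m / a n = exp (sv m - sv n) * (real m / real n) powr \<gamma>"
      using np mp by (simp add: a_sv powr_divide exp_diff mult.commute)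
    have s: "\<bar>sv m - sv n\<bar> \<le> \<epsilon>" using n0(2)[OF n] m by blast
    show "exp (- \<epsilon>) * (real m / real n) powr \<gamma> \<le> a m / a n"
      unfolding eq using s by (intro mult_right_mono) auto
    show "a m / a n \<le> exp \<epsilon> * (real m / real n) powr \<gamma>"
      unfolding eq using s by (intro mult_right_mono) auto
  qed
qed

end

section \<open>One step of the chain\<close>

lemma pmf_nat_sums:
  fixes f :: "nat \<Rightarrow> real" and q :: "nat pmf"
  assumes "integrable q f"
  shows "(\<lambda>k. pmf q k * f k) sums (\<integral>k. f k \<partial>q)"
proof -
  have "integrable (count_space UNIV) (\<lambda>k. pmf q k *\<^sub>R f k)"
    using assms by (simp add: measure_pmf_eq_density integrable_density)
  from sums_integral_count_space_nat[OF this]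
  show ?thesis by (simp add: measure_pmf_eq_density integral_density)
qed

lemma pmf_nat_integrable:
  fixes f :: "nat \<Rightarrow> real" and q :: "nat pmf"
  assumes "summable (\<lambda>k. pmf q k * \<bar>f k\<bar>)"
  shows "integrable q f"
proof -
  have "integrable (count_space UNIV) (\<lambda>k. pmf q k *\<^sub>R f k)"
    using assms by (simp add: integrable_count_space_nat_iff abs_mult)
  then show ?thesis by (simp add: measure_pmf_eq_density integrable_density)
qed

definition cl :: "real \<Rightarrow> real" where "cl t = max 0 (min 1 t)"

lemma cl_simps: "0 \<le> cl t" "cl t \<le> 1" "t \<le> 0 \<Longrightarrow> cl t = 0" "1 \<le> t \<Longrightarrow> cl t = 1"
  by (auto simp: cl_def)

lemma cl_cont[continuous_intros]: "continuous_on A f \<Longrightarrow> continuous_on A (\<lambda>x. cl (f x))"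
  unfolding cl_def by (intro continuous_intros)

lemma cl_measurable[measurable (raw)]: "f \<in> borel_measurable M \<Longrightarrow> (\<lambda>x. cl (f x)) \<in> borel_measurable M"
  unfolding cl_def by (intro borel_measurable_max borel_measurable_min borel_measurable_const)

text \<open>\<open>chi d\<close> cuts off neighbourhoods of 0, of the discontinuities at \<open>1\<close> and \<open>-1\<close> and of infinity; \<open>bump\<close>
  and \<open>ltail\<close> dominate what is lost near \<open>1\<close>, \<open>-1\<close> and near minus infinity.\<close>
definition chi :: "real \<Rightarrow> real \<Rightarrow> real" where
  "chi d x = cl ((\<bar>x\<bar> - d) / d) * cl ((\<bar>\<bar>x\<bar> - 1\<bar> - d) / d) * cl (1 / d + 1 - \<bar>x\<bar>)"

definition bump :: "real \<Rightarrow> real \<Rightarrow> real" where "bump d x = cl (3 - \<bar>\<bar>x\<bar> - 1\<bar> / d)"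

definition ltail :: "real \<Rightarrow> real \<Rightarrow> real" where "ltail d x = cl (1 - 1 / d - x)"

lemma chi_bounds: "0 \<le> chi d x" "chi d x \<le> 1"
  unfolding chi_def using cl_simps by (auto intro!: mult_nonneg_nonneg mult_le_one)

lemma chi_cont: "d > 0 \<Longrightarrow> continuous_on A (chi d)"
  unfolding chi_def by (intro continuous_intros) auto

lemma chi_measurable[measurable]: "chi d \<in> borel_measurable borel"
  unfolding chi_def by measurable

lemma chi_0: assumes "d > 0" "\<bar>x\<bar> \<le> d \<or> \<bar>\<bar>x\<bar> - 1\<bar> \<le> d \<or> \<bar>x\<bar> \<ge> 1 / d + 1" shows "chi d x = 0"
  using assms by (auto simp: chi_def divide_le_0_iff cl_simps(3))

lemma chi_1: assumes "d > 0" "\<bar>x\<bar> \<ge> 2 * d" "\<bar>\<bar>x\<bar> - 1\<bar> \<ge> 2 * d" "\<bar>x\<bar> \<le> 1 / d" shows "chi d x = 1"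
  using assms by (auto simp: chi_def cl_simps(4) field_simps)

text \<open>Cut-off widths tending to 0. Below 1/4 the neighbourhoods of 0, 1 and -1 that
  \<open>chi\<close> removes stay apart.\<close>

definition dd :: "nat \<Rightarrow> real" where "dd j = 1 / (real j + 5)"

lemma dd: "0 < dd j" "dd j < 1/4" "1 / dd j = real j + 5" by (auto simp: dd_def field_simps)

lemma dd_lim: "dd \<longlonglongrightarrow> 0" unfolding dd_def by real_asymp

text \<open>The state space is the positive integers inside \<open>nat\<close>, hence
  \<open>p_zero\<close>. The witnesses of the existential assumption on exponential moments become
  the parameters \<open>\<beta>0\<close> and \<open>C0\<close>, so that every later constant refers
  to the same exponent.\<close>

locale chain_kernel = reg_varying a \<gamma> for a :: "nat \<Rightarrow> real" and \<gamma> :: real +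
  fixes p :: "nat \<Rightarrow> nat \<Rightarrow> real" and Lv :: "real measure" and b s2 \<beta>0 C0 :: real
  assumes p_nonneg: "\<And>n k. n \<ge> 1 \<Longrightarrow> 0 \<le> p n k"
    and p_zero: "\<And>n. n \<ge> 1 \<Longrightarrow> p n 0 = 0"
    and p_sums: "\<And>n. n \<ge> 1 \<Longrightarrow> p n sums 1"
    and Pi_sets: "sets Lv = sets borel"
    and Pi_0: "emeasure Lv {0} = 0"
    and Pi_pm1: "emeasure Lv {-1, 1} = 0"
    and Pi_int: "(\<integral>\<^sup>+ x. ennreal (min 1 (x\<^sup>2)) \<partial>Lv) < \<infinity>"
    and A1: "\<And>f. A1_test f \<Longrightarrow>
               (\<lambda>n. a n * (\<Sum>k. p n k * f (real k / real n))) \<longlonglongrightarrow> (\<integral>x. f (exp x) \<partial>Lv)"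
    and A2_b: "(\<lambda>n. a n * (\<Sum>k\<in>{k. 1 \<le> k \<and> \<bar>ln (real k) - ln (real n)\<bar> \<le> 1}.
                  p n k * (ln (real k) - ln (real n)))) \<longlonglongrightarrow> b"
    and A2_s: "0 \<le> s2"
    and A2_s2: "(\<lambda>n. a n * (\<Sum>k\<in>{k. 1 \<le> k \<and> \<bar>ln (real k) - ln (real n)\<bar> \<le> 1}.
                  p n k * (ln (real k) - ln (real n))\<^sup>2))
                \<longlonglongrightarrow> s2 + (\<integral>x. x\<^sup>2 * indicator {-1..1} x \<partial>Lv)"
    and beta0: "\<beta>0 > \<gamma>"
    and exp_tail: "\<forall>\<^sub>F n in sequentially.
                  summable (\<lambda>k. p n k * exp (\<beta>0 * (ln (real k) - ln (real n)))
                                 * indicator {1<..} (ln (real k) - ln (real n))) \<and>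
                  a n * (\<Sum>k. p n k * exp (\<beta>0 * (ln (real k) - ln (real n)))
                                 * indicator {1<..} (ln (real k) - ln (real n))) \<le> C0"
    and laplace_int: "integrable Lv (laplace_integrand \<beta>0)"
    and Psi_neg: "Psi s2 b Lv \<beta>0 < 0"
    and moments: "\<And>n. n \<ge> 1 \<Longrightarrow> summable (\<lambda>k. real k powr \<beta>0 * p n k)"
begin

text \<open>At 0, which is not a state, the kernel is the point mass at 1; this way
  \<open>K_pos\<close> holds without a hypothesis on the starting state.\<close>

definition K :: "nat \<Rightarrow> nat pmf" where
  "K n = (if n \<ge> 1 then embed_pmf (p n) else return_pmf 1)"

lemma pmf_K: assumes n: "n \<ge> 1" shows "pmf (K n) k = p n k"
proof -
  have "(\<integral>\<^sup>+x. ennreal (p n x) \<partial>count_space UNIV) = (\<Sum>k. ennreal (p n k))"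
    by (rule nn_integral_count_space_nat)
  also have "\<dots> = ennreal (\<Sum>k. p n k)"
    using p_sums[OF n] p_nonneg[OF n] by (intro suminf_ennreal2) (auto simp: sums_iff)
  also have "\<dots> = 1" using p_sums[OF n] by (simp add: sums_iff)
  finally show ?thesis using n p_nonneg[OF n] by (simp add: K_def pmf_embed_pmf)
qed

lemma K_pos: assumes k: "k \<in> set_pmf (K n)" shows "k \<ge> 1"
proof (cases "n \<ge> 1")
  case True
  have "pmf (K n) 0 = 0" using True by (simp add: pmf_K p_zero del: One_nat_def)
  then have "k \<noteq> 0" using k by (metis set_pmf_iff)
  then show ?thesis by simp
next
  case False
  then show ?thesis using k by (auto simp: K_def)
qed

text \<open>The law of one increment of the logarithm from state \<open>n\<close>, that is, the
  measure \<open>Pi_n^*\<close> of the assumptions.\<close>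

definition S :: "nat \<Rightarrow> real pmf" where
  "S n = map_pmf (\<lambda>k. ln (real k) - ln (real n)) (K n)"

lemma S_sum:
  assumes n: "n \<ge> 1" and i: "integrable (S n) g"
  shows "(\<integral>u. g u \<partial>S n) = (\<Sum>k. p n k * g (ln (real k) - ln (real n)))"
  using pmf_nat_sums[of "K n" "\<lambda>k. g (ln (real k) - ln (real n))"] i
  by (simp add: S_def pmf_K[OF n] sums_iff)

lemma beta0_pos: "\<beta>0 > 0" using beta0 gamma_pos by simp

lemma S_exp_integrable:
  assumes n: "n \<ge> 1" shows "integrable (S n) (\<lambda>u. exp (\<beta>0 * u))"
proof -
  \<comment> \<open>At \<open>k = 0\<close> the two exponential expressions differ, since
    \<open>ln 0 = 0\<close>, but both carry the weight \<open>p n 0 = 0\<close>.\<close>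
  have eq: "pmf (K n) k * \<bar>exp (\<beta>0 * (ln (real k) - ln (real n)))\<bar> = real n powr (-\<beta>0) * (real k powr \<beta>0 * p n k)" for k
  proof (cases "k = 0")
    case True then show ?thesis using p_zero[OF n] by (simp add: pmf_K[OF n])
  next
    case False then show ?thesis using n
      by (simp add: pmf_K[OF n] powr_def right_diff_distrib exp_diff exp_minus field_simps)
  qed
  have "summable (\<lambda>k. pmf (K n) k * \<bar>exp (\<beta>0 * (ln (real k) - ln (real n)))\<bar>)"
    unfolding eq by (intro summable_mult moments n)
  from pmf_nat_integrable[OF this] show ?thesis by (simp add: S_def)
qed

lemma S_integrable:
  fixes g :: "real \<Rightarrow> real"
  assumes n: "n \<ge> 1" and bd: "\<And>u. \<bar>g u\<bar> \<le> B * (1 + exp (\<beta>0 * u))"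
  shows "integrable (S n) g"
proof (rule Bochner_Integration.integrable_bound)
  show "integrable (S n) (\<lambda>u. B * (1 + exp (\<beta>0 * u)))"
    by (intro integrable_mult_right Bochner_Integration.integrable_add S_exp_integrable n) auto
  show "AE u in S n. norm (g u) \<le> norm (B * (1 + exp (\<beta>0 * u)))"
  proof (rule AE_I2)
    fix u show "norm (g u) \<le> norm (B * (1 + exp (\<beta>0 * u)))"
      using bd[of u] by simp
  qed
qed simp

lemma S_integrable_bdd:
  fixes g :: "real \<Rightarrow> real"
  assumes bd: "\<And>u. \<bar>g u\<bar> \<le> B"
  shows "integrable (S n) g"
  by (rule measure_pmf.integrable_const_bound[where B = B]) (use bd in auto)

section \<open>Extending the convergence (A1) on the logarithmic scale\<close>

lemma A1_log:
  assumes c: "continuous_on UNIV g" and d: "d > 0" "\<And>x. \<bar>x\<bar> < d \<Longrightarrow> g x = 0"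
    and bot: "(g \<longlongrightarrow> l1) at_bot" and top: "(g \<longlongrightarrow> l2) at_top" and B: "\<And>x. \<bar>g x\<bar> \<le> B"
  shows "(\<lambda>n. a n * (\<integral>u. g u \<partial>S n)) \<longlonglongrightarrow> (\<integral>x. g x \<partial>Lv)"
proof -
  \<comment> \<open>The point 0 of the compactified half line is minus infinity on the logarithmic
    scale, so \<open>f\<close> takes the limit of \<open>g\<close> at minus infinity there; the
    limit at plus infinity is the one that \<open>A1_test\<close> asks for.\<close>
  define f where "f x = (if x \<le> 0 then l1 else g (ln x))" for x
  have fr: "(f \<longlongrightarrow> l1) (at_right 0)"
  proof -
    have "((\<lambda>x. g (ln x)) \<longlongrightarrow> l1) (at_right 0)"
      by (rule filterlim_compose[OF bot ln_at_0])
    then show ?thesis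
      by (rule Lim_transform_eventually) (auto simp: f_def eventually_at_filter)
  qed
  have "continuous (at x within {0..}) f" if "x \<ge> 0" for x
  proof (cases "x = 0")
    case True
    have "at (0::real) within {0..} = at_right 0" by (rule at_within_Ici_at_right)
    then show ?thesis unfolding True continuous_within using fr by (simp add: f_def)
  next
    case False
    with that have x: "x > 0" by simp
    have "isCont (\<lambda>x. g (ln x)) x"
      using c x by (intro isCont_o2[of _ ln g] isCont_ln) (auto simp: continuous_on_eq_continuous_at)
    moreover have "\<forall>\<^sub>F y in nhds x. f y = g (ln y)"
      using eventually_nhds_in_open[of "{0<..}" x] x by (auto simp: f_def elim!: eventually_mono)
    ultimately have "isCont f x" by (simp add: isCont_cong)
    then show ?thesis by (rule continuous_at_imp_continuous_at_within)
  qed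
  then have fc: "continuous_on {0..} f" by (simp add: continuous_on_eq_continuous_within)
  have "((\<lambda>x. g (ln x)) \<longlongrightarrow> l2) at_top" by (rule filterlim_compose[OF top ln_at_top])
  then have ft: "(f \<longlongrightarrow> l2) at_top"
    by (rule Lim_transform_eventually, intro eventually_mono[OF eventually_gt_at_top[of "0::real"]])
       (auto simp: f_def)
  have f1: "\<exists>d>0. \<forall>x. \<bar>x - 1\<bar> < d \<longrightarrow> f x = 0"
  proof -
    have "isCont ln (1::real)" by (intro isCont_ln) simp
    then obtain e where e: "e > 0" "\<And>x. dist x 1 < e \<Longrightarrow> \<bar>ln x - ln 1\<bar> < d"
      using d(1) unfolding continuous_at_eps_delta dist_real_def[of "ln _"] by blast
    show ?thesis
    proof (intro exI[of _ "min e 1"] conjI allI impI)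
      fix x :: real assume x: "\<bar>x - 1\<bar> < min e 1"
      then have "\<bar>ln x\<bar> < d" "x > 0" using e(2)[of x] by (auto simp: dist_real_def)
      then show "f x = 0" using d(2) by (simp add: f_def)
    qed (use e in auto)
  qed
  have "A1_test f" unfolding A1_test_def using fc ft f1 by blast
  from A1[OF this] have L: "(\<lambda>n. a n * (\<Sum>k. p n k * f (real k / real n))) \<longlonglongrightarrow> (\<integral>x. f (exp x) \<partial>Lv)" .
  have "\<forall>\<^sub>F n in sequentially. a n * (\<Sum>k. p n k * f (real k / real n)) = a n * (\<integral>u. g u \<partial>S n)"
    using eventually_ge_at_top[of 1]
  proof eventually_elim
    case (elim n)
    have "p n k * f (real k / real n) = p n k * g (ln (real k) - ln (real n))" for k
      using elim p_zero[OF elim] by (cases "k = 0") (auto simp: f_def ln_divide_pos divide_le_0_iff)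
    then show ?case by (simp only: S_sum[OF elim S_integrable_bdd[OF B]])
  qed
  moreover have "(\<lambda>x. f (exp x)) = g" by (auto simp: f_def)
  ultimately show ?thesis using Lim_transform_eventually[OF L] by simp
qed

text \<open>The index set is finite, as \<open>k\<close> is at most \<open>exp 1 * n\<close>; hence
  the set sum in (A2) has its intended value and equals a truncated moment of
  \<open>S n\<close>.\<close>

lemma A2_conv:
  fixes g :: "real \<Rightarrow> real"
  assumes n: "n \<ge> 1"
  shows "(\<Sum>k\<in>{k. 1 \<le> k \<and> \<bar>ln (real k) - ln (real n)\<bar> \<le> 1}. p n k * g (ln (real k) - ln (real n)))
     = (\<integral>u. g u * indicator {-1..1} u \<partial>S n)"
proof -
  let ?A = "{k. 1 \<le> k \<and> \<bar>ln (real k) - ln (real n)\<bar> \<le> 1}"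
  have "k \<le> nat \<lceil>exp 1 * real n\<rceil>" if "k \<in> ?A" for k
  proof -
    have "ln (real k) \<le> ln (exp 1 * real n)" using that n by (auto simp: ln_mult)
    then have "real k \<le> exp 1 * real n" using that n by (subst (asm) ln_le_cancel_iff) auto
    then show ?thesis by linarith
  qed
  then have fin: "finite ?A" by (meson finite_nat_set_iff_bounded_le)
  have "(\<integral>u. g u * indicator {-1..1} u \<partial>S n) = (\<Sum>k\<in>?A. pmf (K n) k *\<^sub>R (g (ln (real k) - ln (real n)) * indicator {-1..1} (ln (real k) - ln (real n))))"
    unfolding S_def integral_map_pmf
    by (rule integral_measure_pmf[OF fin]) (use K_pos in \<open>fastforce simp: indicator_def split: if_splits\<close>)
  also have "\<dots> = (\<Sum>k\<in>?A. p n k * g (ln (real k) - ln (real n)))"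
    by (intro sum.cong refl) (auto simp: pmf_K[OF n] indicator_def abs_le_iff)
  finally show ?thesis ..
qed

lemma A2_b': "(\<lambda>n. a n * (\<integral>u. u * indicator {-1..1} u \<partial>S n)) \<longlonglongrightarrow> b"
proof (rule Lim_transform_eventually[OF A2_b])
  show "\<forall>\<^sub>F n in sequentially. a n * (\<Sum>k\<in>{k. 1 \<le> k \<and> \<bar>ln (real k) - ln (real n)\<bar> \<le> 1}. p n k * (ln (real k) - ln (real n))) = a n * (\<integral>u. u * indicator {-1..1} u \<partial>S n)"
    using eventually_ge_at_top[of 1]
  proof eventually_elim
    case (elim n)
    show ?case using A2_conv[OF elim, of "\<lambda>u. u"] by simp
  qed
qed

lemma A2_s2': "(\<lambda>n. a n * (\<integral>u. u\<^sup>2 * indicator {-1..1} u \<partial>S n)) \<longlonglongrightarrow> s2 + (\<integral>x. x\<^sup>2 * indicator {-1..1} x \<partial>Lv)"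
proof (rule Lim_transform_eventually[OF A2_s2])
  show "\<forall>\<^sub>F n in sequentially. a n * (\<Sum>k\<in>{k. 1 \<le> k \<and> \<bar>ln (real k) - ln (real n)\<bar> \<le> 1}. p n k * (ln (real k) - ln (real n))\<^sup>2) = a n * (\<integral>u. u\<^sup>2 * indicator {-1..1} u \<partial>S n)"
    using eventually_ge_at_top[of 1]
  proof eventually_elim
    case (elim n)
    show ?case using A2_conv[OF elim, of "\<lambda>u. u\<^sup>2"] by simp
  qed
qed

lemma exp_tail': "\<forall>\<^sub>F n in sequentially. a n * (\<integral>u. exp (\<beta>0 * u) * indicator {1<..} u \<partial>S n) \<le> C0"
  using exp_tail eventually_ge_at_top[of 1]
proof eventually_elim
  case (elim n)
  have "integrable (S n) (\<lambda>u. exp (\<beta>0 * u) * indicator {1<..} u)"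
    by (rule S_integrable[where B = 1, OF elim(2)]) (auto simp: indicator_def)
  from S_sum[OF elim(2) this] show ?case using elim by (simp add: mult.assoc)
qed

lemma Lv_sets_eq[measurable_cong]: "sets Lv = sets borel" by (rule Pi_sets)

lemma Lv_min_int: "integrable Lv (\<lambda>x. min 1 (x\<^sup>2))"
  by (rule integrableI_nonneg) (use Pi_int in auto)

text \<open>For \<open>x > 1\<close> the compensator is off, so the exponential is the Laplace
  integrand plus 1, and there 1 equals \<open>min 1 (x\<^sup>2)\<close>.\<close>

lemma Lv_exp_int: "integrable Lv (\<lambda>x. exp (\<beta>0 * x) * indicator {1<..} x)"
proof (rule Bochner_Integration.integrable_bound)
  show "integrable Lv (\<lambda>x. \<bar>laplace_integrand \<beta>0 x\<bar> + min 1 (x\<^sup>2))"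
    by (intro Bochner_Integration.integrable_add integrable_abs laplace_int Lv_min_int)
  show "AE x in Lv. norm (exp (\<beta>0 * x) * indicator {1<..} x) \<le> norm (\<bar>laplace_integrand \<beta>0 x\<bar> + min 1 (x\<^sup>2))"
  proof (rule AE_I2)
    fix x :: real
    show "norm (exp (\<beta>0 * x) * indicator {1<..} x) \<le> norm (\<bar>laplace_integrand \<beta>0 x\<bar> + min 1 (x\<^sup>2))"
    proof (cases "x > 1")
      case True
      then have "x\<^sup>2 \<ge> 1" by (simp add: one_le_power)
      then show ?thesis using True by (auto simp: laplace_integrand_def)
    qed simp
  qed
qed measurable

lemma AE_Lv: "AE x in Lv. x \<noteq> 0 \<and> x \<noteq> 1 \<and> x \<noteq> -1"
proof -
  have "{0} \<in> null_sets Lv" "{-1,1} \<in> null_sets Lv"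
    using Pi_0 Pi_pm1 by (auto simp: null_sets_def Pi_sets)
  then have "AE x in Lv. x \<notin> {0}" "AE x in Lv. x \<notin> {-1,1}" by (auto dest: AE_not_in)
  then show ?thesis by eventually_elim auto
qed

text \<open>Conditions on a test function under which (A1) extends to it. Jumps are tolerated at 1
  and -1, which carry no mass of \<open>Lv\<close>; smallness against \<open>x\<^sup>2\<close> at 0
  is controlled by the bounded truncated second moments; a growth exponent strictly below
  \<open>\<beta>0\<close> makes the right tail uniformly integrable.\<close>

context
  fixes g :: "real \<Rightarrow> real" and B \<beta>' :: real
  assumes gm[measurable]: "g \<in> borel_measurable borel"
    and cont: "\<And>x. x \<noteq> 0 \<Longrightarrow> x \<noteq> 1 \<Longrightarrow> x \<noteq> -1 \<Longrightarrow> isCont g x"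
    and small: "\<And>e. e > 0 \<Longrightarrow> \<exists>d>0. \<forall>x. \<bar>x\<bar> \<le> d \<longrightarrow> \<bar>g x\<bar> \<le> e * x\<^sup>2"
    and bd1: "\<And>x. x \<le> 1 \<Longrightarrow> \<bar>g x\<bar> \<le> B" and bd2: "\<And>x. x > 1 \<Longrightarrow> \<bar>g x\<bar> \<le> B * exp (\<beta>' * x)"
    and b': "0 \<le> \<beta>'" "\<beta>' < \<beta>0"
begin

lemma step_B: "B \<ge> 0" using bd1[of 0] by simp

lemma step_bd: "\<bar>g x\<bar> \<le> B * (1 + exp (\<beta>0 * x))"
proof (cases "x \<le> 1")
  case True
  have "B * 1 \<le> B * (1 + exp (\<beta>0 * x))" by (intro mult_left_mono step_B) auto
  then show ?thesis using bd1[OF True] by simp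
next
  case False
  have "exp (\<beta>' * x) \<le> exp (\<beta>0 * x)" using False b' by (simp add: mult_right_mono)
  then have "exp (\<beta>' * x) \<le> 1 + exp (\<beta>0 * x)" by linarith
  then have "B * exp (\<beta>' * x) \<le> B * (1 + exp (\<beta>0 * x))" by (intro mult_left_mono step_B)
  then show ?thesis using bd2[of x] False by simp
qed

lemma step_g_int: "integrable Lv g"
proof -
  obtain d where d: "d > 0" "\<And>x. \<bar>x\<bar> \<le> d \<Longrightarrow> \<bar>g x\<bar> \<le> 1 * x\<^sup>2" using small[of 1] by auto
  define d1 where "d1 = min d 1"
  have d1: "0 < d1" "d1 \<le> d" "d1 \<le> 1" using d by (auto simp: d1_def)
  \<comment> \<open>Away from 0 the bound \<open>B\<close> is paid by
    \<open>min 1 (x\<^sup>2) \<ge> d1\<^sup>2\<close>; the summand 1 covers the range where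
    \<open>g\<close> is at most \<open>x\<^sup>2\<close>.\<close>
  define B1 where "B1 = B / d1\<^sup>2 + 1"
  show ?thesis
  proof (rule Bochner_Integration.integrable_bound)
    show "integrable Lv (\<lambda>x. B1 * min 1 (x\<^sup>2) + B * (exp (\<beta>0 * x) * indicator {1<..} x))"
      by (intro Bochner_Integration.integrable_add integrable_mult_right Lv_min_int Lv_exp_int)
    show "AE x in Lv. norm (g x) \<le> norm (B1 * min 1 (x\<^sup>2) + B * (exp (\<beta>0 * x) * indicator {1<..} x))"
    proof (rule AE_I2)
      fix x
      have B1: "B1 \<ge> 1" using step_B by (simp add: B1_def)
      have nn: "B1 * min 1 (x\<^sup>2) \<ge> 0" using B1 by simp
      show "norm (g x) \<le> norm (B1 * min 1 (x\<^sup>2) + B * (exp (\<beta>0 * x) * indicator {1<..} x))"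
      proof (cases "x \<le> 1")
        case True
        have "\<bar>g x\<bar> \<le> B1 * min 1 (x\<^sup>2)"
        proof (cases "\<bar>x\<bar> \<le> d1")
          case True
          then have "x\<^sup>2 \<le> 1" using d1 by (simp add: abs_square_le_1)
          moreover have "\<bar>g x\<bar> \<le> x\<^sup>2" using d(2)[of x] True d1 by simp
          moreover have "1 * x\<^sup>2 \<le> B1 * x\<^sup>2" using B1 by (intro mult_right_mono) auto
          ultimately show ?thesis by simp
        next
          case False
          have "d1\<^sup>2 \<le> min 1 (x\<^sup>2)" using False d1 by (auto simp: power_le_one_iff abs_le_square_iff[symmetric])
          then have "B1 * d1\<^sup>2 \<le> B1 * min 1 (x\<^sup>2)" using B1 by (intro mult_left_mono) auto
          moreover have "B \<le> B1 * d1\<^sup>2" using d1 by (simp add: B1_def field_simps)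
          ultimately show ?thesis using bd1[OF True] by simp
        qed
        then show ?thesis using True by simp
      next
        case False
        then have "\<bar>g x\<bar> \<le> B * exp (\<beta>' * x)" using bd2 by simp
        also have "\<dots> \<le> B * exp (\<beta>0 * x)" using False b' step_B by (intro mult_left_mono) (auto intro: mult_right_mono)
        finally show ?thesis using False nn by simp
      qed
    qed
  qed measurable
qed

lemma step_chi:
  assumes d: "0 < d" "d < 1/4"
  shows "(\<lambda>n. a n * (\<integral>u. g u * chi d u \<partial>S n)) \<longlonglongrightarrow> (\<integral>x. g x * chi d x \<partial>Lv)"
proof (rule A1_log)
  show "continuous_on UNIV (\<lambda>x. g x * chi d x)"
  proof (subst continuous_on_eq_continuous_at, simp, intro ballI)
    fix x :: real
    have cc: "isCont (chi d) x" using chi_cont[OF d(1), of UNIV] by (simp add: continuous_on_eq_continuous_at)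
    show "isCont (\<lambda>x. g x * chi d x) x"
    proof (cases "x = 0 \<or> x = 1 \<or> x = -1")
      case False
      then show ?thesis using cont cc by (intro continuous_intros) auto
    next
      case True
      have "\<forall>\<^sub>F y in nhds x. g y * chi d y = 0"
        unfolding eventually_nhds_metric
      proof (intro exI[of _ d] conjI allI impI d(1))
        fix y assume "dist y x < d"
        then have "\<bar>y\<bar> \<le> d \<or> \<bar>\<bar>y\<bar> - 1\<bar> \<le> d" using True d by (auto simp: dist_real_def)
        then show "g y * chi d y = 0" using chi_0[OF d(1)] by auto
      qed
      then show ?thesis using isCont_cong[of "\<lambda>y. g y * chi d y" "\<lambda>_. 0" x] by simp
    qed
  qed
  show "d > 0" by fact
  show "\<And>x. \<bar>x\<bar> < d \<Longrightarrow> g x * chi d x = 0" using chi_0[OF d(1)] by auto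
  have z: "\<bar>x\<bar> \<ge> 1/d + 1 \<Longrightarrow> g x * chi d x = 0" for x using chi_0[OF d(1)] by auto
  show "((\<lambda>x. g x * chi d x) \<longlongrightarrow> 0) at_bot"
    by (rule tendsto_eventually, rule eventually_mono[OF eventually_le_at_bot[of "-(1/d+1)"]]) (auto intro!: z[simplified])
  show "((\<lambda>x. g x * chi d x) \<longlongrightarrow> 0) at_top"
    by (rule tendsto_eventually, rule eventually_mono[OF eventually_ge_at_top[of "1/d+1"]]) (auto intro!: z[simplified])
  fix x
  show "\<bar>g x * chi d x\<bar> \<le> B * (1 + exp (\<beta>0 * (1/d + 1)))"
  proof (cases "\<bar>x\<bar> \<ge> 1/d + 1")
    case True show ?thesis unfolding z[OF True] using step_B by (auto intro!: mult_nonneg_nonneg add_nonneg_nonneg)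
  next
    case False
    have "\<bar>g x * chi d x\<bar> \<le> \<bar>g x\<bar> * 1" unfolding abs_mult using chi_bounds[of d x] by (intro mult_left_mono) auto
    also have "\<dots> \<le> B * (1 + exp (\<beta>0 * x))" using step_bd by simp
    also have "\<dots> \<le> B * (1 + exp (\<beta>0 * (1/d + 1)))" using False step_B beta0_pos
      by (intro mult_left_mono add_left_mono) auto
    finally show ?thesis .
  qed
qed

text \<open>Each region removed by \<open>chi\<close> has its own majorant: the second moment times
  \<open>e\<close> near 0, \<open>bump\<close> near 1 and -1, \<open>ltail\<close> to the left. To
  the right the exponent is raised from \<open>\<beta>'\<close> to \<open>\<beta>0\<close>, and as
  \<open>x > 1 / d\<close> there, this gains the factor
  \<open>exp (- (\<beta>0 - \<beta>') / d)\<close>.\<close>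

lemma step_rest:
  assumes d: "0 < d" "d < 1/4" and e: "\<And>x. \<bar>x\<bar> \<le> 2 * d \<Longrightarrow> \<bar>g x\<bar> \<le> e * x\<^sup>2" "e \<ge> 0"
  shows "\<bar>g x\<bar> * (1 - chi d x) \<le> e * (x\<^sup>2 * indicator {-1..1} x) + B * exp (\<beta>0 * 2) * bump d x
     + B * ltail d x + B * exp (- (\<beta>0 - \<beta>') / d) * (exp (\<beta>0 * x) * indicator {1<..} x)"
    (is "_ \<le> ?e + ?b + ?l + ?t")
proof -
  have nn: "?e \<ge> 0" "?b \<ge> 0" "?l \<ge> 0" "?t \<ge> 0" using e step_B cl_simps(1) by (auto simp: bump_def ltail_def)
  have le: "\<bar>g x\<bar> * (1 - chi d x) \<le> \<bar>g x\<bar>"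
    using chi_bounds[of d x] mult_left_mono[of "1 - chi d x" 1 "\<bar>g x\<bar>"] by simp
  consider "chi d x = 1" | "\<bar>x\<bar> < 2 * d" | "\<bar>\<bar>x\<bar> - 1\<bar> < 2 * d" | "x < - (1 / d)" | "x > 1 / d"
    using chi_1[OF d(1), of x] by linarith
  then show ?thesis
  proof cases
    case 1 then show ?thesis using nn by simp
  next
    case 2
    then have "x \<in> {-1..1}" using d by auto
    then have "\<bar>g x\<bar> \<le> ?e" using e(1)[of x] 2 by simp
    then show ?thesis using nn le by linarith
  next
    case 3
    then have "\<bar>\<bar>x\<bar> - 1\<bar> / d \<le> 2" using d by (simp add: field_simps)
    then have b1: "bump d x = 1" unfolding bump_def by (intro cl_simps) simp
    have x2: "x \<le> 2" using 3 d by linarith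
    have "\<bar>g x\<bar> \<le> B * exp (\<beta>0 * 2)"
    proof (cases "x \<le> 1")
      case True
      have "B * 1 \<le> B * exp (\<beta>0 * 2)" using step_B beta0_pos by (intro mult_left_mono) auto
      then show ?thesis using bd1[OF True] by simp
    next
      case False
      have "\<beta>' * x \<le> \<beta>0 * 2" using b' x2 False by (intro mult_mono) auto
      then have "B * exp (\<beta>' * x) \<le> B * exp (\<beta>0 * 2)" using step_B by (intro mult_left_mono) auto
      then show ?thesis using bd2[of x] False by simp
    qed
    then show ?thesis using nn le b1 by simp
  next
    case 4
    then have l1: "ltail d x = 1" unfolding ltail_def by (intro cl_simps) simp
    have "1 / d > 0" using d by simp
    then have "x \<le> 1" using 4 by linarith
    then have "\<bar>g x\<bar> \<le> ?l" using l1 bd1 by simp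
    then show ?thesis using nn le by linarith
  next
    case 5
    have "1 / d > 4" using d by (simp add: field_simps)
    then have x1: "x > 1" using 5 by linarith
    have "(\<beta>0 - \<beta>') * (1 / d) \<le> (\<beta>0 - \<beta>') * x" using 5 b' by (intro mult_left_mono) auto
    then have "\<beta>' * x \<le> - (\<beta>0 - \<beta>') / d + \<beta>0 * x" by (simp add: algebra_simps diff_divide_distrib)
    then have "B * exp (\<beta>' * x) \<le> B * exp (- (\<beta>0 - \<beta>') / d + \<beta>0 * x)" using step_B by (intro mult_left_mono) auto
    then have "\<bar>g x\<bar> \<le> ?t" using bd2[OF x1] x1 by (simp add: exp_add)
    then show ?thesis using nn le by linarith
  qed
qed

end

lemma bump_lim: assumes d: "0 < d" "d < 1/4"
  shows "(\<lambda>n. a n * (\<integral>u. bump d u \<partial>S n)) \<longlonglongrightarrow> (\<integral>x. bump d x \<partial>Lv)"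
proof (rule A1_log[where d = "1/4" and B=1])
  show "continuous_on UNIV (bump d)" unfolding bump_def using d by (intro continuous_intros) auto
  have z: "bump d x = 0" if "\<bar>\<bar>x\<bar> - 1\<bar> \<ge> 3/4" for x
    unfolding bump_def using that d by (intro cl_simps) (auto simp: field_simps)
  show "\<bar>x\<bar> < 1/4 \<Longrightarrow> bump d x = 0" for x by (rule z) linarith
  show "(bump d \<longlongrightarrow> 0) at_bot"
    by (rule tendsto_eventually, rule eventually_mono[OF eventually_le_at_bot[of "-2"]]) (auto intro!: z)
  show "(bump d \<longlongrightarrow> 0) at_top"
    by (rule tendsto_eventually, rule eventually_mono[OF eventually_ge_at_top[of "2"]]) (auto intro!: z)
  show "\<bar>bump d x\<bar> \<le> 1" for x unfolding bump_def using cl_simps by (simp add: abs_le_iff order_trans[of _ 0])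
qed simp

lemma ltail_lim: assumes d: "0 < d" "d < 1/4"
  shows "(\<lambda>n. a n * (\<integral>u. ltail d u \<partial>S n)) \<longlonglongrightarrow> (\<integral>x. ltail d x \<partial>Lv)"
proof (rule A1_log[where d = "1" and B=1])
  have d4: "1 / d > 4" using d by (simp add: field_simps)
  show "continuous_on UNIV (ltail d)" unfolding ltail_def by (intro continuous_intros)
  show "\<bar>x\<bar> < 1 \<Longrightarrow> ltail d x = 0" for x unfolding ltail_def using d4 by (intro cl_simps) linarith
  show "(ltail d \<longlongrightarrow> 1) at_bot"
    by (rule tendsto_eventually, rule eventually_mono[OF eventually_le_at_bot[of "-1/d"]]) (auto simp: ltail_def intro!: cl_simps)
  show "(ltail d \<longlongrightarrow> 0) at_top"
    by (rule tendsto_eventually, rule eventually_mono[OF eventually_ge_at_top[of "1"]], unfold ltail_def, rule cl_simps) (use d4 in linarith)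
  show "\<bar>ltail d x\<bar> \<le> 1" for x unfolding ltail_def using cl_simps by (simp add: abs_le_iff order_trans[of _ 0])
qed simp

text \<open>The bumps shrink to the points 1 and -1, which are null for \<open>Lv\<close>. They
  vanish for \<open>\<bar>x\<bar> < 1/4\<close>, so 16 times \<open>min 1 (x\<^sup>2)\<close> is an
  integrable majorant.\<close>

lemma bump_int_lim: "(\<lambda>j. \<integral>x. bump (dd j) x \<partial>Lv) \<longlonglongrightarrow> 0"
proof -
  have "(\<lambda>j. \<integral>x. bump (dd j) x \<partial>Lv) \<longlonglongrightarrow> (\<integral>x. 0 \<partial>Lv)"
  proof (rule integral_dominated_convergence[where w = "\<lambda>x. 16 * min 1 (x\<^sup>2)"])
    show "integrable Lv (\<lambda>x. 16 * min 1 (x\<^sup>2))" by (intro integrable_mult_right Lv_min_int)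
    show "AE x in Lv. (\<lambda>j. bump (dd j) x) \<longlonglongrightarrow> 0"
      using AE_Lv
    proof eventually_elim
      case (elim x)
      define e where "e = \<bar>\<bar>x\<bar> - 1\<bar>"
      have e: "e > 0" using elim by (auto simp: e_def)
      have "\<forall>\<^sub>F j in sequentially. dd j < e / 3" using order_tendstoD(2)[OF dd_lim, of "e/3"] e by simp
      then have "\<forall>\<^sub>F j in sequentially. bump (dd j) x = 0"
      proof eventually_elim
        case (elim j)
        then have "e / dd j \<ge> 3" using dd(1)[of j] by (simp add: field_simps)
        then show ?case unfolding bump_def e_def[symmetric] by (intro cl_simps) simp
      qed
      then show ?case by (rule tendsto_eventually)
    qed
    show "AE x in Lv. norm (bump (dd j) x) \<le> 16 * min 1 (x\<^sup>2)" for j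
    proof (rule AE_I2)
      fix x :: real
      show "norm (bump (dd j) x) \<le> 16 * min 1 (x\<^sup>2)"
      proof (cases "\<bar>x\<bar> \<ge> 1/4")
        case True
        then have "(1/4)\<^sup>2 \<le> \<bar>x\<bar>\<^sup>2" by (intro power_mono) auto
        then have "16 * min 1 (x\<^sup>2) \<ge> 1" by (simp add: power2_eq_square)
        moreover have "\<bar>bump (dd j) x\<bar> \<le> 1" unfolding bump_def using cl_simps by (simp add: abs_le_iff order_trans[of _ 0])
        ultimately show ?thesis by simp
      next
        case False
        then have "\<bar>\<bar>x\<bar> - 1\<bar> / dd j \<ge> 3" using dd[of j] by (simp add: field_simps)
        then show ?thesis by (simp add: bump_def cl_simps)
      qed
    qed
  qed (auto simp: bump_def)
  then show ?thesis by simp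
qed

lemma ltail_int_lim: "(\<lambda>j. \<integral>x. ltail (dd j) x \<partial>Lv) \<longlonglongrightarrow> 0"
proof -
  have "(\<lambda>j. \<integral>x. ltail (dd j) x \<partial>Lv) \<longlonglongrightarrow> (\<integral>x. 0 \<partial>Lv)"
  proof (rule integral_dominated_convergence[where w = "\<lambda>x. 1 * min 1 (x\<^sup>2)"])
    show "integrable Lv (\<lambda>x. 1 * min 1 (x\<^sup>2))" by (intro integrable_mult_right Lv_min_int)
    show "AE x in Lv. (\<lambda>j. ltail (dd j) x) \<longlonglongrightarrow> 0"
    proof (rule AE_I2)
      fix x :: real
      have "\<forall>\<^sub>F j in sequentially. ltail (dd j) x = 0"
        using eventually_ge_at_top[of "nat \<lceil>-x\<rceil>"]
      proof eventually_elim
        case (elim j)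
        then have "1 - 1 / dd j - x \<le> 0" unfolding dd by linarith
        then show ?case unfolding ltail_def by (intro cl_simps)
      qed
      then show "(\<lambda>j. ltail (dd j) x) \<longlonglongrightarrow> 0" by (rule tendsto_eventually)
    qed
    show "AE x in Lv. norm (ltail (dd j) x) \<le> 1 * min 1 (x\<^sup>2)" for j
    proof (rule AE_I2)
      fix x :: real
      show "norm (ltail (dd j) x) \<le> 1 * min 1 (x\<^sup>2)"
      proof (cases "x \<le> -1")
        case True
        then have "1 \<le> x\<^sup>2" using one_le_power[of "-x" 2] by simp
        moreover have "\<bar>ltail (dd j) x\<bar> \<le> 1" unfolding ltail_def using cl_simps by (simp add: abs_le_iff order_trans[of _ 0])
        ultimately show ?thesis by simp
      next
        case False
        then have "1 - 1 / dd j - x \<le> 0" unfolding dd by linarith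
        then show ?thesis by (simp add: ltail_def cl_simps)
      qed
    qed
  qed (auto simp: ltail_def)
  then show ?thesis by simp
qed

lemma a_int_bounded:
  "\<exists>C. \<forall>\<^sub>F n in sequentially. a n * (\<integral>u. u\<^sup>2 * indicator {-1..1} u \<partial>S n) \<le> C"
  by (intro exI, rule eventually_mono[OF order_tendstoD(2)[OF A2_s2', OF less_add_one]]) (rule less_imp_le)

text \<open>The width of the cut-off is fixed before \<open>n\<close>: at width \<open>dd j\<close>
  the part kept by \<open>chi\<close> converges by (A1), and the majorants of
  \<open>step_rest\<close> have limits or bounds that are small once \<open>j\<close> is
  large.\<close>

lemma step_lim:
  fixes g :: "real \<Rightarrow> real"
  assumes gm[measurable]: "g \<in> borel_measurable borel"
    and cont: "\<And>x. x \<noteq> 0 \<Longrightarrow> x \<noteq> 1 \<Longrightarrow> x \<noteq> -1 \<Longrightarrow> isCont g x"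
    and small: "\<And>e. e > 0 \<Longrightarrow> \<exists>d>0. \<forall>x. \<bar>x\<bar> \<le> d \<longrightarrow> \<bar>g x\<bar> \<le> e * x\<^sup>2"
    and bd1: "\<And>x. x \<le> 1 \<Longrightarrow> \<bar>g x\<bar> \<le> B" and bd2: "\<And>x. x > 1 \<Longrightarrow> \<bar>g x\<bar> \<le> B * exp (\<beta>' * x)"
    and b': "0 \<le> \<beta>'" "\<beta>' < \<beta>0"
  shows "integrable Lv g" "(\<lambda>n. a n * (\<integral>u. g u \<partial>S n)) \<longlonglongrightarrow> (\<integral>x. g x \<partial>Lv)"
proof -
  show gi: "integrable Lv g" by (rule step_g_int[OF assms])
  have B: "B \<ge> 0" by (rule step_B[OF assms])
  obtain C where C: "\<forall>\<^sub>F n in sequentially. a n * (\<integral>u. u\<^sup>2 * indicator {-1..1} u \<partial>S n) \<le> C"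
    using a_int_bounded by blast
  define C1 where "C1 = max C 1"
  define C2 where "C2 = max C0 1"
  define V where "V j = \<bar>(\<integral>x. g x * chi (dd j) x \<partial>Lv) - (\<integral>x. g x \<partial>Lv)\<bar>" for j
  have V0: "V \<longlonglongrightarrow> 0"
  proof -
    have "(\<lambda>j. \<integral>x. g x * chi (dd j) x \<partial>Lv) \<longlonglongrightarrow> (\<integral>x. g x \<partial>Lv)"
    proof (rule integral_dominated_convergence[where w = "\<lambda>x. \<bar>g x\<bar>"])
      show "integrable Lv (\<lambda>x. \<bar>g x\<bar>)" using gi by simp
      show "(\<lambda>x. g x * chi (dd j) x) \<in> borel_measurable Lv" for j by measurable
      show "AE x in Lv. norm (g x * chi (dd j) x) \<le> \<bar>g x\<bar>" for j
      proof (rule AE_I2)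
        fix x show "norm (g x * chi (dd j) x) \<le> \<bar>g x\<bar>"
          using chi_bounds[of "dd j" x] mult_left_mono[of "chi (dd j) x" 1 "\<bar>g x\<bar>"] by (simp add: abs_mult)
      qed
      show "AE x in Lv. (\<lambda>j. g x * chi (dd j) x) \<longlonglongrightarrow> g x"
        using AE_Lv
      proof eventually_elim
        case (elim x)
        define e where "e = min \<bar>\<bar>x\<bar> - 1\<bar> \<bar>x\<bar>"
        have e: "e > 0" using elim by (auto simp: e_def)
        have "\<forall>\<^sub>F j in sequentially. dd j < e / 2" using order_tendstoD(2)[OF dd_lim, of "e/2"] e by simp
        moreover have "\<forall>\<^sub>F j in sequentially. j \<ge> nat \<lceil>\<bar>x\<bar>\<rceil>" by (rule eventually_ge_at_top)
        ultimately have "\<forall>\<^sub>F j in sequentially. g x * chi (dd j) x = g x"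
        proof eventually_elim
          case (elim j)
          have "\<bar>x\<bar> \<le> 1 / dd j" unfolding dd using elim(2) by linarith
          then have "chi (dd j) x = 1" using elim(1) by (intro chi_1 dd) (auto simp: e_def)
          then show ?case by simp
        qed
        then show ?case by (rule tendsto_eventually)
      qed
    qed measurable
    then show ?thesis unfolding V_def by (auto intro: tendsto_rabs_zero simp: LIM_zero_iff)
  qed
  show "(\<lambda>n. a n * (\<integral>u. g u \<partial>S n)) \<longlonglongrightarrow> (\<integral>x. g x \<partial>Lv)"
  proof (rule tendstoI)
    fix e0 :: real assume e0: "e0 > 0"
    \<comment> \<open>Six errors of size \<open>e0 / 10\<close> have to fit under \<open>e0\<close>;
      the one near 0 is multiplied by the bound \<open>C1\<close> on the second moments.\<close>
    define e where "e = e0 / (10 * C1)"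
    have C1: "C1 > 0" "C2 > 0" by (auto simp: C1_def C2_def)
    have e: "e > 0" "e * C1 = e0 / 10" using e0 C1 by (auto simp: e_def)
    obtain d0 where d0: "d0 > 0" "\<And>x. \<bar>x\<bar> \<le> d0 \<Longrightarrow> \<bar>g x\<bar> \<le> e * x\<^sup>2" using small[OF e(1)] by auto
    define c where "c = \<beta>0 - \<beta>'"
    have c: "c > 0" using b' by (simp add: c_def)
    then have "(\<lambda>j. exp (- c * (real j + 5))) \<longlonglongrightarrow> 0" by real_asymp
    then have T0: "(\<lambda>j. B * exp (- (\<beta>0 - \<beta>') * (real j + 5)) * C2) \<longlonglongrightarrow> 0"
      unfolding c_def by (intro tendsto_mult_left_zero tendsto_mult_right_zero)
    have bb: "(\<lambda>j. B * exp (\<beta>0 * 2) * (\<integral>x. bump (dd j) x \<partial>Lv)) \<longlonglongrightarrow> 0" using tendsto_mult_right_zero[OF bump_int_lim] .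
    have ll: "(\<lambda>j. B * (\<integral>x. ltail (dd j) x \<partial>Lv)) \<longlonglongrightarrow> 0" using tendsto_mult_right_zero[OF ltail_int_lim] .
    have "\<forall>\<^sub>F j in sequentially. dd j < d0 / 2 \<and> V j < e0 / 10 \<and> B * exp (- (\<beta>0 - \<beta>') * (real j + 5)) * C2 < e0 / 10
      \<and> B * exp (\<beta>0 * 2) * (\<integral>x. bump (dd j) x \<partial>Lv) < e0 / 10 \<and> B * (\<integral>x. ltail (dd j) x \<partial>Lv) < e0 / 10"
      using order_tendstoD(2)[OF dd_lim, of "d0/2"] order_tendstoD(2)[OF V0, of "e0/10"] order_tendstoD(2)[OF T0, of "e0/10"]
         order_tendstoD(2)[OF bb, of "e0/10"] order_tendstoD(2)[OF ll, of "e0/10"] e0 d0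
      by (intro eventually_conj) auto
    then obtain j where j: "dd j < d0 / 2" "V j < e0 / 10" "B * exp (- (\<beta>0 - \<beta>') * (real j + 5)) * C2 < e0 / 10"
      "B * exp (\<beta>0 * 2) * (\<integral>x. bump (dd j) x \<partial>Lv) < e0 / 10" "B * (\<integral>x. ltail (dd j) x \<partial>Lv) < e0 / 10"
      by (auto simp: eventually_sequentially)
    define d where "d = dd j"
    have d: "0 < d" "d < 1/4" "1 / d = real j + 5" using dd[of j] by (auto simp: d_def)
    have r: "\<bar>g x\<bar> * (1 - chi d x) \<le> e * (x\<^sup>2 * indicator {-1..1} x) + B * exp (\<beta>0 * 2) * bump d x
     + B * ltail d x + B * exp (- (\<beta>0 - \<beta>') / d) * (exp (\<beta>0 * x) * indicator {1<..} x)" for x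
      by (rule step_rest[OF assms d(1,2)]) (use d0 j e in \<open>auto simp: d_def\<close>)
    have E1: "\<forall>\<^sub>F n in sequentially. \<bar>a n * (\<integral>u. g u * chi d u \<partial>S n) - (\<integral>x. g x * chi d x \<partial>Lv)\<bar> < e0 / 10"
      using tendstoD[OF step_chi[OF assms d(1,2)], of "e0/10"] e0 by (simp add: dist_real_def)
    have E2: "\<forall>\<^sub>F n in sequentially. B * exp (\<beta>0 * 2) * (a n * (\<integral>u. bump d u \<partial>S n)) < e0 / 10"
      by (rule order_tendstoD(2)[OF tendsto_mult_left[OF bump_lim[OF d(1,2)]]]) (use j d_def in auto)
    have E3: "\<forall>\<^sub>F n in sequentially. B * (a n * (\<integral>u. ltail d u \<partial>S n)) < e0 / 10"
      by (rule order_tendstoD(2)[OF tendsto_mult_left[OF ltail_lim[OF d(1,2)]]]) (use j d_def in auto)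
    show "\<forall>\<^sub>F n in sequentially. dist (a n * (\<integral>u. g u \<partial>S n)) (\<integral>x. g x \<partial>Lv) < e0"
      using E1 E2 E3 C exp_tail' eventually_ge_at_top[of 1]
    proof eventually_elim
      case (elim n)
      have an: "a n \<ge> 0" using a_pos[of n] by simp
      have ib: "integrable (S n) (bump d)" "integrable (S n) (ltail d)"
        by (rule S_integrable_bdd[where B=1]; use cl_simps in \<open>simp add: bump_def ltail_def abs_le_iff order_trans[of _ 0]\<close>)+
      have i2: "integrable (S n) (\<lambda>x. x\<^sup>2 * indicator {-1..1} x)"
        by (rule S_integrable_bdd[where B=1]) (auto simp: indicator_def abs_square_le_1 abs_le_iff)
      have i3: "integrable (S n) (\<lambda>u. exp (\<beta>0 * u) * indicator {1<..} u)"
        by (rule S_integrable[where B = 1]) (use elim in \<open>auto simp: indicator_def\<close>)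
      have ig: "integrable (S n) g" by (rule S_integrable[OF _ step_bd[OF assms]]) (use elim in auto)
      have igc: "integrable (S n) (\<lambda>x. g x * chi d x)"
      proof (rule Bochner_Integration.integrable_bound[OF ig])
        show "AE x in S n. norm (g x * chi d x) \<le> norm (g x)"
        proof (rule AE_I2)
          fix x show "norm (g x * chi d x) \<le> norm (g x)"
            using chi_bounds[of d x] mult_left_mono[of "chi d x" 1 "\<bar>g x\<bar>"] by (simp add: abs_mult)
        qed
      qed simp
      have "\<bar>(\<integral>u. g u \<partial>S n) - (\<integral>u. g u * chi d u \<partial>S n)\<bar> = \<bar>\<integral>u. g u - g u * chi d u \<partial>S n\<bar>"
        using ig igc by simp
      also have "\<dots> \<le> (\<integral>u. e * (u\<^sup>2 * indicator {-1..1} u) + B * exp (\<beta>0 * 2) * bump d u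
     + B * ltail d u + B * exp (- (\<beta>0 - \<beta>') / d) * (exp (\<beta>0 * u) * indicator {1<..} u) \<partial>S n)"
      proof (rule integral_abs_bound_integral)
        fix u
        have "\<bar>g u - g u * chi d u\<bar> = \<bar>g u * (1 - chi d u)\<bar>" by (simp add: algebra_simps)
        also have "\<dots> = \<bar>g u\<bar> * (1 - chi d u)" using chi_bounds[of d u] by (simp add: abs_mult)
        finally show "\<bar>g u - g u * chi d u\<bar> \<le> e * (u\<^sup>2 * indicator {-1..1} u) + B * exp (\<beta>0 * 2) * bump d u
     + B * ltail d u + B * exp (- (\<beta>0 - \<beta>') / d) * (exp (\<beta>0 * u) * indicator {1<..} u)" using r[of u] by simp
      qed (use ib i2 i3 ig igc in \<open>auto intro!: Bochner_Integration.integrable_add integrable_mult_right Bochner_Integration.integrable_diff\<close>)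
      also have "\<dots> = e * (\<integral>u. u\<^sup>2 * indicator {-1..1} u \<partial>S n) + B * exp (\<beta>0 * 2) * (\<integral>u. bump d u \<partial>S n)
     + B * (\<integral>u. ltail d u \<partial>S n) + B * exp (- (\<beta>0 - \<beta>') / d) * (\<integral>u. exp (\<beta>0 * u) * indicator {1<..} u \<partial>S n)"
        using ib i2 i3 by simp
      finally have "a n * \<bar>(\<integral>u. g u \<partial>S n) - (\<integral>u. g u * chi d u \<partial>S n)\<bar> \<le> a n * \<dots>"
        using an by (intro mult_left_mono)
      also have "\<dots> = e * (a n * (\<integral>u. u\<^sup>2 * indicator {-1..1} u \<partial>S n)) + B * exp (\<beta>0 * 2) * (a n * (\<integral>u. bump d u \<partial>S n))
     + B * (a n * (\<integral>u. ltail d u \<partial>S n)) + B * exp (- (\<beta>0 - \<beta>') / d) * (a n * (\<integral>u. exp (\<beta>0 * u) * indicator {1<..} u \<partial>S n))"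
        by (simp add: algebra_simps)
      also have "\<dots> \<le> e * C1 + e0 / 10 + e0 / 10 + B * exp (- (\<beta>0 - \<beta>') / d) * C2"
        using elim e B by (intro add_mono mult_left_mono) (auto simp: C1_def C2_def)
      also have "- (\<beta>0 - \<beta>') / d = - (\<beta>0 - \<beta>') * (real j + 5)" unfolding d(3)[symmetric] by simp
      also have "e * C1 + e0 / 10 + e0 / 10 + B * exp (- (\<beta>0 - \<beta>') * (real j + 5)) * C2 \<le> 4 * e0 / 10"
        using j(3) e(2) by simp
      finally have "\<bar>a n * (\<integral>u. g u \<partial>S n) - a n * (\<integral>u. g u * chi d u \<partial>S n)\<bar> \<le> 4 * e0 / 10"
        using an by (simp add: abs_mult right_diff_distrib[symmetric])
      then show ?case using elim(1) j(2) e0 unfolding V_def d_def[symmetric] dist_real_def by linarith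
    qed
  qed
qed

end

section \<open>Drift and exponential moments of a step\<close>

text \<open>Real and imaginary part of one third-order Taylor estimate of the exponential on the
  imaginary axis.\<close>

lemma cos_sin_cubic:
  fixes t :: real
  shows "\<bar>cos t - 1 + t\<^sup>2 / 2\<bar> \<le> \<bar>t\<bar> ^ 3" "\<bar>sin t - t\<bar> \<le> \<bar>t\<bar> ^ 3"
proof -
  let ?z = "\<i> * complex_of_real t"
  have "cmod (exp ?z - (\<Sum>k\<le>2. ?z ^ k / fact k)) \<le> exp \<bar>Re ?z\<bar> * cmod ?z ^ Suc 2 / fact 2"
    by (rule Taylor_exp)
  also have "\<dots> = \<bar>t\<bar> ^ 3 / 2" by (simp add: norm_mult)
  also have "\<dots> \<le> \<bar>t\<bar> ^ 3" by simp
  finally have *: "cmod (exp ?z - (\<Sum>k\<le>2. ?z ^ k / fact k)) \<le> \<bar>t\<bar> ^ 3" .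
  have eq: "exp ?z - (\<Sum>k\<le>2. ?z ^ k / fact k) = Complex (cos t - 1 + t\<^sup>2 / 2) (sin t - t)"
    by (simp add: complex_eq_iff Re_exp Im_exp eval_nat_numeral)
  show "\<bar>cos t - 1 + t\<^sup>2 / 2\<bar> \<le> \<bar>t\<bar> ^ 3" using abs_Re_le_cmod order_trans[OF _ *] unfolding eq by fastforce
  show "\<bar>sin t - t\<bar> \<le> \<bar>t\<bar> ^ 3" using abs_Im_le_cmod order_trans[OF _ *] unfolding eq by fastforce
qed

lemma exp_cubic:
  fixes t :: real
  assumes "\<bar>t\<bar> \<le> 1"
  shows "\<bar>exp t - 1 - t - t\<^sup>2 / 2\<bar> \<le> 3 * \<bar>t\<bar> ^ 3"
proof -
  have "norm (exp t - (\<Sum>k\<le>2. t ^ k / fact k)) \<le> exp (norm t) * (norm t ^ Suc 2) / fact 2"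
    by (rule Taylor_exp_field)
  also have "\<dots> \<le> 3 * \<bar>t\<bar> ^ 3"
  proof -
    have "exp \<bar>t\<bar> \<le> exp 1" using assms by simp
    then have "exp \<bar>t\<bar> \<le> 3" using exp_le by linarith
    then have "exp \<bar>t\<bar> * \<bar>t\<bar> ^ 3 \<le> 3 * \<bar>t\<bar> ^ 3" by (rule mult_right_mono) simp
    moreover have "0 \<le> exp \<bar>t\<bar> * \<bar>t\<bar> ^ 3" by simp
    moreover have "exp (norm t) * (norm t ^ Suc 2) / fact 2 = exp \<bar>t\<bar> * \<bar>t\<bar> ^ 3 / 2" by simp
    ultimately show ?thesis by linarith
  qed
  finally show ?thesis by (simp add: eval_nat_numeral algebra_simps)
qed

text \<open>Brings a cubic remainder into the form of the smallness hypothesis of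
  \<open>step_lim\<close>.\<close>

lemma cubic_small:
  fixes f :: "real \<Rightarrow> real"
  assumes c: "c \<ge> 0" "d0 > 0" and f: "\<And>x. \<bar>x\<bar> \<le> d0 \<Longrightarrow> \<bar>f x\<bar> \<le> c * \<bar>x\<bar> ^ 3" and e: "e > 0"
  shows "\<exists>d>0. \<forall>x. \<bar>x\<bar> \<le> d \<longrightarrow> \<bar>f x\<bar> \<le> e * x\<^sup>2"
proof (intro exI[of _ "min d0 (e / (c + 1))"] conjI allI impI)
  fix x assume x: "\<bar>x\<bar> \<le> min d0 (e / (c + 1))"
  then have "\<bar>x\<bar> * (c + 1) \<le> e" using c by (simp add: field_simps)
  then have "c * \<bar>x\<bar> \<le> e" by (simp add: algebra_simps)
  then have "(c * \<bar>x\<bar>) * x\<^sup>2 \<le> e * x\<^sup>2" by (rule mult_right_mono) simp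
  moreover have "\<bar>f x\<bar> \<le> c * \<bar>x\<bar> ^ 3" using f x by simp
  moreover have "c * \<bar>x\<bar> ^ 3 = (c * \<bar>x\<bar>) * x\<^sup>2" by (simp add: power3_eq_cube power2_eq_square)
  ultimately show "\<bar>f x\<bar> \<le> e * x\<^sup>2" by linarith
qed (use c e in auto)

lemma isCont_ind: "x \<noteq> 1 \<Longrightarrow> x \<noteq> -1 \<Longrightarrow> isCont (indicator {-1..1::real} :: real \<Rightarrow> real) x"
  by (simp add: isCont_indicator frontier_def)

text \<open>A bounded Lyapunov function of the displacement \<open>v\<close>: it vanishes at 0 and
  is 1 once \<open>\<bar>v\<bar>\<close> exceeds \<eta>, so its expectation dominates exit
  probabilities.\<close>

definition fcap :: "real \<Rightarrow> real \<Rightarrow> real" where "fcap \<eta> v = min 1 (v\<^sup>2 / \<eta>\<^sup>2)"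

lemma fcap_bounds: "0 \<le> fcap \<eta> v" "fcap \<eta> v \<le> 1" by (auto simp: fcap_def)

lemma fcap_0[simp]: "fcap \<eta> 0 = 0" by (simp add: fcap_def)

lemma fcap_1: "\<eta> > 0 \<Longrightarrow> \<bar>v\<bar> > \<eta> \<Longrightarrow> fcap \<eta> v = 1"
  using abs_le_square_iff[of \<eta> v] by (simp add: fcap_def)

text \<open>Semiconcavity of the truncated square replaces a second-order Taylor expansion.\<close>
lemma fcap_ineq:
  assumes \<eta>: "\<eta> > 0" and r: "r \<ge> 1"
  shows "\<exists>s. \<bar>s\<bar> \<le> 2 / \<eta> \<and> (\<forall>u. fcap \<eta> (v + u) \<le> fcap \<eta> v + s * (u * indicator {-1..1} u)
     + (u\<^sup>2 * indicator {-1..1} u) / \<eta>\<^sup>2 + (2 * r / \<eta> + r\<^sup>2 / \<eta>\<^sup>2) * (1 - indicator {-1..1} u) + cl (\<bar>u\<bar> - r + 1) * (1 - indicator {-1..1} u))"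
proof (cases "\<bar>v\<bar> \<le> \<eta>")
  case True
  have fv: "fcap \<eta> v = v\<^sup>2 / \<eta>\<^sup>2" using True \<eta> abs_le_square_iff[of v \<eta>] by (simp add: fcap_def)
  have *: "fcap \<eta> (v + u) \<le> fcap \<eta> v + (2 * v / \<eta>\<^sup>2) * u + u\<^sup>2 / \<eta>\<^sup>2" for u
  proof -
    have "fcap \<eta> (v + u) \<le> (v + u)\<^sup>2 / \<eta>\<^sup>2" by (simp add: fcap_def)
    also have "\<dots> = v\<^sup>2 / \<eta>\<^sup>2 + (2 * v / \<eta>\<^sup>2) * u + u\<^sup>2 / \<eta>\<^sup>2"
      by (simp add: power2_eq_square add_divide_distrib algebra_simps)
    finally show ?thesis using fv by simp
  qed
  have s: "\<bar>2 * v / \<eta>\<^sup>2\<bar> \<le> 2 / \<eta>"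
    using True \<eta> by (simp add: abs_mult power2_eq_square field_simps)
  show ?thesis
  proof (intro exI[of _ "2 * v / \<eta>\<^sup>2"] conjI s allI)
    fix u
    consider "u \<in> {-1..1}" | "u \<notin> {-1..1}" "\<bar>u\<bar> \<le> r" | "u \<notin> {-1..1}" "\<bar>u\<bar> > r" by linarith
    then show "fcap \<eta> (v + u) \<le> fcap \<eta> v + 2 * v / \<eta>\<^sup>2 * (u * indicator {-1..1} u)
     + (u\<^sup>2 * indicator {-1..1} u) / \<eta>\<^sup>2 + (2 * r / \<eta> + r\<^sup>2 / \<eta>\<^sup>2) * (1 - indicator {-1..1} u) + cl (\<bar>u\<bar> - r + 1) * (1 - indicator {-1..1} u)"
    proof cases
      case 1 then show ?thesis using *[of u] by simp
    next
      case 2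
      have "2 * v / \<eta>\<^sup>2 * u \<le> \<bar>2 * v / \<eta>\<^sup>2\<bar> * \<bar>u\<bar>" by (metis abs_ge_self abs_mult)
      also have "\<dots> \<le> 2 / \<eta> * r" using s 2 \<eta> by (intro mult_mono) auto
      finally have "2 * v / \<eta>\<^sup>2 * u \<le> 2 * r / \<eta>" by simp
      moreover have "u\<^sup>2 / \<eta>\<^sup>2 \<le> r\<^sup>2 / \<eta>\<^sup>2" using 2(2) r abs_le_square_iff[of u r] by (intro divide_right_mono) auto
      moreover have "cl (\<bar>u\<bar> - r + 1) \<ge> 0" by (rule cl_simps)
      ultimately show ?thesis using *[of u] 2 by simp
    next
      case 3
      have "cl (\<bar>u\<bar> - r + 1) = 1" using 3 by (intro cl_simps) simp
      moreover have "2 * r / \<eta> + r\<^sup>2 / \<eta>\<^sup>2 \<ge> 0" using r \<eta> by simp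
      ultimately show ?thesis using 3 fcap_bounds[of \<eta> "v + u"] fcap_bounds[of \<eta> v] by simp
    qed
  qed
next
  case False
  then have "fcap \<eta> v = 1" using fcap_1 \<eta> by simp
  moreover have "0 \<le> 2 * r / \<eta> + r\<^sup>2 / \<eta>\<^sup>2" using r \<eta> by simp
  moreover have "fcap \<eta> (v + u) \<le> 1" "0 \<le> (u\<^sup>2 * indicator {-1..1} u) / \<eta>\<^sup>2" "0 \<le> cl (\<bar>u\<bar> - r + 1) * (1 - indicator {-1..1} u)"
    "0 \<le> 1 - indicat_real {-1..1} u" for u
    using cl_simps by (auto simp: fcap_bounds indicator_def)
  ultimately show ?thesis using \<eta>
    by (intro exI[of _ 0]) (simp add: add_increasing2 mult_nonneg_nonneg)
qed

context chain_kernel begin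

lemma Lv_sq_int: "integrable Lv (\<lambda>x. x\<^sup>2 * indicator {-1..1} x)"
  by (rule Bochner_Integration.integrable_bound[OF Lv_min_int])
     (auto intro!: AE_I2 simp: indicator_def abs_square_le_1 abs_le_iff)

lemma S_sq_int: "integrable (S n) (\<lambda>x. x\<^sup>2 * indicator {-1..1} x)"
  by (rule S_integrable_bdd[where B=1]) (auto simp: indicator_def abs_square_le_1 abs_le_iff)

lemma S_id_int: "integrable (S n) (\<lambda>x. x * indicator {-1..1} x)"
  by (rule S_integrable_bdd[where B=1]) (auto simp: indicator_def)

text \<open>Adding the truncated square makes the integrand cubic at 0, hence admissible for
  \<open>step_lim\<close>. When it is subtracted again, (A2) leaves exactly the Gaussian term,
  because its limit exceeds the second moment of \<open>Lv\<close> by \<open>s2\<close>.\<close>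

lemma step_cos:
  "integrable Lv (\<lambda>x. cos (\<theta> * x) - 1)"
  "(\<lambda>n. a n * (\<integral>u. cos (\<theta> * u) - 1 \<partial>S n)) \<longlonglongrightarrow> - (s2 / 2 * \<theta>\<^sup>2) + (\<integral>x. cos (\<theta> * x) - 1 \<partial>Lv)"
proof -
  let ?g = "\<lambda>x. cos (\<theta> * x) - 1 + \<theta>\<^sup>2 / 2 * (x\<^sup>2 * indicator {-1..1} x)"
  have bd: "\<bar>?g x\<bar> \<le> 2 + \<theta>\<^sup>2 / 2" for x
  proof -
    have "\<bar>\<theta>\<^sup>2 / 2 * (x\<^sup>2 * indicator {-1..1} x)\<bar> \<le> \<theta>\<^sup>2 / 2 * 1"
      by (auto simp: abs_mult indicator_def abs_square_le_1 abs_le_iff mult_left_le)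
    moreover have "\<bar>cos (\<theta> * x) - 1\<bar> \<le> 2" using cos_ge_minus_one[of "\<theta>*x"] cos_le_one[of "\<theta>*x"] by linarith
    ultimately show ?thesis by linarith
  qed
  have cub: "\<bar>?g x\<bar> \<le> \<bar>\<theta>\<bar> ^ 3 * \<bar>x\<bar> ^ 3" if "\<bar>x\<bar> \<le> 1" for x
    using cos_sin_cubic(1)[of "\<theta> * x"] that by (auto simp: abs_mult power_mult_distrib abs_le_iff)
  have m: "?g \<in> borel_measurable borel" by measurable
  have c: "isCont ?g x" if "x \<noteq> 0" "x \<noteq> 1" "x \<noteq> -1" for x
    using that by (intro continuous_intros isCont_ind)
  have sm: "\<exists>d>0. \<forall>x. \<bar>x\<bar> \<le> d \<longrightarrow> \<bar>?g x\<bar> \<le> e * x\<^sup>2" if "e > 0" for e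
    by (rule cubic_small[where ?d0.0=1 and c="\<bar>\<theta>\<bar>^3"]) (use that cub in auto)
  have bd2: "\<bar>?g x\<bar> \<le> (2 + \<theta>\<^sup>2 / 2) * exp (0 * x)" for x
    using bd[of x] by (simp only: mult_zero_left exp_zero mult_1_right)
  note 1 = step_lim[of ?g "2 + \<theta>\<^sup>2 / 2" 0, OF m c sm bd bd2 order_refl beta0_pos]
  have 2: "integrable Lv (\<lambda>x. ?g x - \<theta>\<^sup>2 / 2 * (x\<^sup>2 * indicator {-1..1} x))"
    by (intro Bochner_Integration.integrable_diff 1 integrable_mult_right Lv_sq_int)
  then show ci: "integrable Lv (\<lambda>x. cos (\<theta> * x) - 1)" by simp
  have Lg: "(\<integral>x. ?g x \<partial>Lv) = (\<integral>x. cos (\<theta> * x) - 1 \<partial>Lv) + \<theta>\<^sup>2 / 2 * (\<integral>x. x\<^sup>2 * indicator {-1..1} x \<partial>Lv)"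
    using ci Lv_sq_int by simp
  have Sg: "(\<integral>x. ?g x \<partial>S n) = (\<integral>x. cos (\<theta> * x) - 1 \<partial>S n) + \<theta>\<^sup>2 / 2 * (\<integral>x. x\<^sup>2 * indicator {-1..1} x \<partial>S n)" for n
  proof -
    have "integrable (S n) (\<lambda>x. cos (\<theta> * x) - 1)"
    proof (rule S_integrable_bdd)
      fix u show "\<bar>cos (\<theta> * u) - 1\<bar> \<le> 2" using cos_ge_minus_one[of "\<theta>*u"] cos_le_one[of "\<theta>*u"] by linarith
    qed
    then show ?thesis using S_sq_int by simp
  qed
  have "(\<lambda>n. a n * (\<integral>u. ?g u \<partial>S n) - \<theta>\<^sup>2 / 2 * (a n * (\<integral>x. x\<^sup>2 * indicator {-1..1} x \<partial>S n))) \<longlonglongrightarrow>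
    (\<integral>x. ?g x \<partial>Lv) - \<theta>\<^sup>2 / 2 * (s2 + (\<integral>x. x\<^sup>2 * indicator {-1..1} x \<partial>Lv))"
    by (intro tendsto_intros 1 A2_s2')
  then show "(\<lambda>n. a n * (\<integral>u. cos (\<theta> * u) - 1 \<partial>S n)) \<longlonglongrightarrow> - (s2 / 2 * \<theta>\<^sup>2) + (\<integral>x. cos (\<theta> * x) - 1 \<partial>Lv)"
    unfolding Sg Lg by (simp add: algebra_simps)
qed

text \<open>The sine minus the truncated linear term is cubic at 0; that term itself contributes the
  drift \<open>b\<close> through (A2).\<close>

lemma step_sin:
  "integrable Lv (\<lambda>x. sin (\<theta> * x) - \<theta> * x * indicator {-1..1} x)"
  "(\<lambda>n. a n * (\<integral>u. sin (\<theta> * u) \<partial>S n)) \<longlonglongrightarrow> b * \<theta> + (\<integral>x. sin (\<theta> * x) - \<theta> * x * indicator {-1..1} x \<partial>Lv)"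
proof -
  let ?g = "\<lambda>x. sin (\<theta> * x) - \<theta> * x * indicator {-1..1} x"
  have bd: "\<bar>?g x\<bar> \<le> 1 + \<bar>\<theta>\<bar>" for x
  proof -
    have "\<bar>\<theta> * x * indicator {-1..1} x\<bar> \<le> \<bar>\<theta>\<bar> * 1"
      by (auto simp: abs_mult indicator_def mult_left_le)
    moreover have "\<bar>sin (\<theta> * x)\<bar> \<le> 1" by simp
    ultimately show ?thesis by linarith
  qed
  have cub: "\<bar>?g x\<bar> \<le> \<bar>\<theta>\<bar> ^ 3 * \<bar>x\<bar> ^ 3" if "\<bar>x\<bar> \<le> 1" for x
    using cos_sin_cubic(2)[of "\<theta> * x"] that by (auto simp: abs_mult power_mult_distrib abs_le_iff)
  have m: "?g \<in> borel_measurable borel" by measurable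
  have c: "isCont ?g x" if "x \<noteq> 0" "x \<noteq> 1" "x \<noteq> -1" for x
    using that by (intro continuous_intros isCont_ind)
  have sm: "\<exists>d>0. \<forall>x. \<bar>x\<bar> \<le> d \<longrightarrow> \<bar>?g x\<bar> \<le> e * x\<^sup>2" if "e > 0" for e
    by (rule cubic_small[where ?d0.0=1 and c="\<bar>\<theta>\<bar>^3"]) (use that cub in auto)
  have bd2: "\<bar>?g x\<bar> \<le> (1 + \<bar>\<theta>\<bar>) * exp (0 * x)" for x
    using bd[of x] by (simp only: mult_zero_left exp_zero mult_1_right)
  note 1 = step_lim[of ?g "1 + \<bar>\<theta>\<bar>" 0, OF m c sm bd bd2 order_refl beta0_pos]
  show "integrable Lv ?g" by (rule 1)
  have Sg: "(\<integral>x. ?g x \<partial>S n) = (\<integral>x. sin (\<theta> * x) \<partial>S n) - \<theta> * (\<integral>x. x * indicator {-1..1} x \<partial>S n)" for n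
  proof -
    have "integrable (S n) (\<lambda>x. sin (\<theta> * x))" by (rule S_integrable_bdd[where B=1]) simp
    then show ?thesis using S_id_int[of n] by (simp add: mult.assoc)
  qed
  have "(\<lambda>n. a n * (\<integral>u. ?g u \<partial>S n) + \<theta> * (a n * (\<integral>x. x * indicator {-1..1} x \<partial>S n))) \<longlonglongrightarrow>
    (\<integral>x. ?g x \<partial>Lv) + \<theta> * b"
    by (intro tendsto_intros 1 A2_b')
  then show "(\<lambda>n. a n * (\<integral>u. sin (\<theta> * u) \<partial>S n)) \<longlonglongrightarrow> b * \<theta> + (\<integral>x. ?g x \<partial>Lv)"
    unfolding Sg by (simp add: algebra_simps)
qed

lemma iexp_cs: "iexp t = complex_of_real (cos t) + \<i> * complex_of_real (sin t)"
  by (simp add: complex_eq_iff Re_exp Im_exp)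

lemma step_char:
  "(\<lambda>n. complex_of_real (a n) * ((\<integral>u. iexp (\<theta> * u) \<partial>S n) - 1)) \<longlonglongrightarrow> levy_exponent s2 b Lv \<theta>"
proof -
  have Sn: "complex_of_real (a n) * ((\<integral>u. iexp (\<theta> * u) \<partial>S n) - 1) =
     complex_of_real (a n * (\<integral>u. cos (\<theta> * u) - 1 \<partial>S n)) + \<i> * complex_of_real (a n * (\<integral>u. sin (\<theta> * u) \<partial>S n))" for n
  proof -
    have i: "integrable (S n) (\<lambda>u. cos (\<theta> * u))" "integrable (S n) (\<lambda>u. sin (\<theta> * u))"
      by (rule S_integrable_bdd[where B=1]; simp)+
    have "(\<integral>u. iexp (\<theta> * u) \<partial>S n) = (\<integral>u. complex_of_real (cos (\<theta> * u)) + \<i> * complex_of_real (sin (\<theta> * u)) \<partial>S n)"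
      by (simp only: iexp_cs)
    also have "\<dots> = complex_of_real (\<integral>u. cos (\<theta> * u) \<partial>S n) + \<i> * complex_of_real (\<integral>u. sin (\<theta> * u) \<partial>S n)"
      using i by simp
    finally show ?thesis using i by (simp add: algebra_simps)
  qed
  have Le: "levy_exponent s2 b Lv \<theta> = complex_of_real (- (s2 / 2 * \<theta>\<^sup>2) + (\<integral>x. cos (\<theta> * x) - 1 \<partial>Lv))
     + \<i> * complex_of_real (b * \<theta> + (\<integral>x. sin (\<theta> * x) - \<theta> * x * indicator {-1..1} x \<partial>Lv))"
  proof -
    have "(\<integral>x. iexp (\<theta> * x) - 1 - \<i> * complex_of_real (\<theta> * x * indicator {-1..1} x) \<partial>Lv) =
      (\<integral>x. complex_of_real (cos (\<theta> * x) - 1) + \<i> * complex_of_real (sin (\<theta> * x) - \<theta> * x * indicator {-1..1} x) \<partial>Lv)"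
      unfolding iexp_cs by (rule Bochner_Integration.integral_cong) (simp_all add: algebra_simps)
    also have "\<dots> = complex_of_real (\<integral>x. cos (\<theta> * x) - 1 \<partial>Lv) + \<i> * complex_of_real (\<integral>x. sin (\<theta> * x) - \<theta> * x * indicator {-1..1} x \<partial>Lv)"
      by (subst Bochner_Integration.integral_add)
         (use step_cos(1)[of \<theta>] step_sin(1)[of \<theta>] in \<open>auto simp del: of_real_diff of_real_mult\<close>)
    finally show ?thesis unfolding levy_exponent_def by (simp add: algebra_simps)
  qed
  show ?thesis unfolding Sn Le by (intro tendsto_intros step_cos step_sin)
qed

lemma a_inv_lim: "(\<lambda>n. 1 / a n) \<longlonglongrightarrow> 0"
  by (rule tendsto_divide_0[OF tendsto_const filterlim_at_top_imp_at_infinity[OF a_at_top]])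

text \<open>Multiplicative form of \<open>step_char\<close>: the compensated characteristic function
  of one step is 1 up to a small multiple of \<open>1 / a n\<close>. Along a cell such errors are
  summed by the clock.\<close>

lemma step_char_mult:
  assumes e: "\<epsilon> > 0"
  shows "\<forall>\<^sub>F n in sequentially. cmod ((\<integral>u. iexp (\<theta> * u) \<partial>S n) * exp (- levy_exponent s2 b Lv \<theta> / complex_of_real (a n)) - 1) \<le> \<epsilon> / a n"
proof -
  define \<Phi> where "\<Phi> = levy_exponent s2 b Lv \<theta>"
  define A where "A n = complex_of_real (a n) * ((\<integral>u. iexp (\<theta> * u) \<partial>S n) - 1)" for n
  define z where "z n = complex_of_real (1 / a n)" for n
  define r where "r n = (exp (- \<Phi> * z n) - 1 + \<Phi> * z n) * complex_of_real (a n)" for n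
  have A: "A \<longlonglongrightarrow> \<Phi>" unfolding A_def \<Phi>_def by (rule step_char)
  have z0: "z \<longlonglongrightarrow> 0" unfolding z_def using tendsto_of_real[OF a_inv_lim, where 'a = complex] by simp
  have az: "complex_of_real (a n) * z n = 1" for n using a_pos[of n] by (simp add: z_def)
  have "\<forall>\<^sub>F n in sequentially. norm (r n) \<le> norm (z n) * (3 * cmod \<Phi> ^ 2)"
  proof -
    have "(\<lambda>n. cmod (- \<Phi> * z n)) \<longlonglongrightarrow> 0" using tendsto_norm_zero[OF tendsto_mult_right_zero[OF z0]] by blast
    from order_tendstoD(2)[OF this, of 1]
    have "\<forall>\<^sub>F n in sequentially. cmod (- \<Phi> * z n) < 1" by simp
    then show ?thesis
    proof eventually_elim
      case (elim n)
      let ?w = "- \<Phi> * z n"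
      have "cmod (exp ?w - (\<Sum>k\<le>1. ?w ^ k / fact k)) \<le> exp \<bar>Re ?w\<bar> * cmod ?w ^ Suc 1 / fact 1" by (rule Taylor_exp)
      also have "\<dots> \<le> 3 * cmod ?w ^ 2"
      proof -
        have "\<bar>Re ?w\<bar> \<le> 1" using abs_Re_le_cmod[of ?w] elim by linarith
        then have "exp \<bar>Re ?w\<bar> \<le> exp 1" by simp
        then have "exp \<bar>Re ?w\<bar> \<le> 3" using exp_le by linarith
        from mult_right_mono[OF this, of "cmod ?w ^ 2"] show ?thesis by (simp add: eval_nat_numeral)
      qed
      finally have 1: "cmod (exp ?w - 1 - ?w) \<le> 3 * cmod ?w ^ 2" by (simp add: algebra_simps)
      have "norm (r n) = cmod (exp ?w - 1 - ?w) * a n" using a_pos[of n] by (simp add: r_def norm_mult)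
      also have "\<dots> \<le> 3 * cmod ?w ^ 2 * a n" using 1 a_pos[of n] by (intro mult_right_mono) auto
      also have "\<dots> = norm (z n) * (3 * cmod \<Phi> ^ 2) * norm (complex_of_real (a n) * z n)"
        using a_pos[of n] by (simp add: norm_mult power2_eq_square)
      also have "\<dots> = norm (z n) * (3 * cmod \<Phi> ^ 2)" by (simp only: az norm_one mult_1_right)
      finally show ?case .
    qed
  qed
  moreover have "(\<lambda>n. norm (z n) * (3 * cmod \<Phi> ^ 2)) \<longlonglongrightarrow> 0"
    by (rule tendsto_mult_left_zero[OF tendsto_norm_zero[OF z0]])
  ultimately have r0: "r \<longlonglongrightarrow> 0" by (rule Lim_null_comparison)
  \<comment> \<open>With \<open>z n = 1 / a n\<close> both factors are expanded to first order, the
    remainder of the exponential being \<open>r n * z n\<close>; every term on the right tends to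
    0.\<close>
  have eq: "complex_of_real (a n) * ((\<integral>u. iexp (\<theta> * u) \<partial>S n) * exp (- \<Phi> / complex_of_real (a n)) - 1)
     = (A n - \<Phi>) + r n - A n * \<Phi> * z n + A n * z n * r n" for n
  proof -
    have I: "(\<integral>u. iexp (\<theta> * u) \<partial>S n) = 1 + A n * z n" using az[of n] by (simp add: A_def algebra_simps)
    have E: "exp (- \<Phi> / complex_of_real (a n)) = 1 - \<Phi> * z n + r n * z n"
      using az[of n] by (simp add: r_def z_def algebra_simps divide_inverse of_real_inverse)
    have "complex_of_real (a n) * ((1 + A n * z n) * (1 - \<Phi> * z n + r n * z n) - 1)
       = (complex_of_real (a n) * z n) * ((A n - \<Phi>) + r n - A n * \<Phi> * z n + A n * z n * r n)"
      by (simp add: algebra_simps)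
    then show ?thesis by (simp only: I E az mult_1_left)
  qed
  have "(\<lambda>n. complex_of_real (a n) * ((\<integral>u. iexp (\<theta> * u) \<partial>S n) * exp (- \<Phi> / complex_of_real (a n)) - 1))
    \<longlonglongrightarrow> (\<Phi> - \<Phi>) + 0 - \<Phi> * \<Phi> * 0 + \<Phi> * 0 * 0"
    unfolding eq by (intro tendsto_intros A z0 r0)
  then have "(\<lambda>n. cmod (complex_of_real (a n) * ((\<integral>u. iexp (\<theta> * u) \<partial>S n) * exp (- \<Phi> / complex_of_real (a n)) - 1))) \<longlonglongrightarrow> 0"
    by (intro tendsto_norm_zero) simp
  from order_tendstoD(2)[OF this e]
  show ?thesis
  proof eventually_elim
    case (elim n)
    then show ?case using a_pos[of n] unfolding \<Phi>_def norm_mult by (simp add: field_simps)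
  qed
qed

section \<open>Drift of the truncated square: how fast the logarithm can leave a window\<close>

definition jump :: "real \<Rightarrow> real" where "jump u = 1 - indicator {-1..1} u"

lemma jump_lim: "\<exists>C. \<forall>\<^sub>F n in sequentially. a n * (\<integral>u. jump u \<partial>S n) \<le> C"
proof -
  have "(\<lambda>n. a n * (\<integral>u. jump u \<partial>S n)) \<longlonglongrightarrow> (\<integral>x. jump x \<partial>Lv)"
  proof (rule step_lim(2)[where B = 1 and \<beta>' = 0])
    show "jump \<in> borel_measurable borel" unfolding jump_def by measurable
    show "x \<noteq> 0 \<Longrightarrow> x \<noteq> 1 \<Longrightarrow> x \<noteq> -1 \<Longrightarrow> isCont jump x" for x
      unfolding jump_def by (intro continuous_intros isCont_ind)
    show "e > 0 \<Longrightarrow> \<exists>d>0. \<forall>x. \<bar>x\<bar> \<le> d \<longrightarrow> \<bar>jump x\<bar> \<le> e * x\<^sup>2" for e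
      by (intro exI[of _ 1]) (auto simp: jump_def indicator_def abs_le_iff)
  qed (auto simp: jump_def indicator_def beta0_pos)
  from order_tendstoD(2)[OF this less_add_one] show ?thesis
    by (intro exI) (erule eventually_mono, erule less_imp_le)
qed

text \<open>\<open>Lv\<close> has little mass far out, and \<open>step_lim\<close> transfers this to
  the rate of moves larger than \<open>r\<close>; the ramp \<open>cl\<close> keeps the test function
  continuous at the threshold.\<close>

lemma far_small:
  assumes e: "\<epsilon> > 0"
  shows "\<exists>r\<ge>2. \<forall>\<^sub>F n in sequentially. a n * (\<integral>u. cl (\<bar>u\<bar> - r + 1) * jump u \<partial>S n) \<le> \<epsilon>"
proof -
  define t where "t r u = cl (\<bar>u\<bar> - r + 1) * jump u" for r u :: real
  have tm[measurable]: "t r \<in> borel_measurable borel" for r unfolding t_def jump_def by measurable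
  have t01: "0 \<le> t r u" "t r u \<le> 1" for r u using cl_simps by (auto simp: t_def jump_def indicator_def)
  have L: "(\<lambda>n. a n * (\<integral>u. t r u \<partial>S n)) \<longlonglongrightarrow> (\<integral>x. t r x \<partial>Lv)" for r
  proof (rule step_lim(2)[where B = 1 and \<beta>' = 0])
    show "x \<noteq> 0 \<Longrightarrow> x \<noteq> 1 \<Longrightarrow> x \<noteq> -1 \<Longrightarrow> isCont (t r) x" for x
      unfolding t_def jump_def cl_def by (intro continuous_intros isCont_ind)
    show "e > 0 \<Longrightarrow> \<exists>d>0. \<forall>x. \<bar>x\<bar> \<le> d \<longrightarrow> \<bar>t r x\<bar> \<le> e * x\<^sup>2" for e
      by (intro exI[of _ 1]) (auto simp: t_def jump_def indicator_def abs_le_iff)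
  qed (use t01 beta0_pos in \<open>auto simp: abs_of_nonneg\<close>)
  have "(\<lambda>j. \<integral>x. t (real j) x \<partial>Lv) \<longlonglongrightarrow> (\<integral>x. 0 \<partial>Lv)"
  proof (rule integral_dominated_convergence[where w = "\<lambda>x. min 1 (x\<^sup>2)"])
    show "AE x in Lv. (\<lambda>j. t (real j) x) \<longlonglongrightarrow> 0"
    proof (rule AE_I2, rule tendsto_eventually)
      fix x :: real
      show "\<forall>\<^sub>F j in sequentially. t (real j) x = 0"
        using eventually_ge_at_top[of "nat \<lceil>\<bar>x\<bar> + 1\<rceil>"]
      proof eventually_elim
        case (elim j)
        then have "\<bar>x\<bar> - real j + 1 \<le> 0" by linarith
        then show ?case by (simp add: t_def cl_simps)
      qed
    qed
    show "AE x in Lv. norm (t (real j) x) \<le> min 1 (x\<^sup>2)" for j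
    proof (rule AE_I2)
      fix x :: real
      show "norm (t (real j) x) \<le> min 1 (x\<^sup>2)"
      proof (cases "\<bar>x\<bar> \<le> 1")
        case True then show ?thesis by (auto simp: t_def jump_def indicator_def abs_le_iff)
      next
        case False
        then have "1\<^sup>2 \<le> x\<^sup>2" using abs_le_square_iff[of 1 x] by simp
        then show ?thesis using t01[of "real j" x] by simp
      qed
    qed
  qed (use Lv_min_int in measurable)
  then have l0: "(\<lambda>j. \<integral>x. t (real j) x \<partial>Lv) \<longlonglongrightarrow> 0" by simp
  have "\<forall>\<^sub>F j in sequentially. (\<integral>x. t (real j) x \<partial>Lv) < \<epsilon> \<and> j \<ge> 2"
    using order_tendstoD(2)[OF l0 e] eventually_ge_at_top[of "2::nat"] by eventually_elim auto
  then obtain j where j: "(\<integral>x. t (real j) x \<partial>Lv) < \<epsilon>" "j \<ge> 2" by (auto simp: eventually_sequentially)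
  from order_tendstoD(2)[OF L j(1)] have "\<forall>\<^sub>F n in sequentially. a n * (\<integral>u. t (real j) u \<partial>S n) \<le> \<epsilon>"
    by eventually_elim simp
  then show ?thesis using j(2) by (intro exI[of _ "real j"]) (auto simp: t_def)
qed

text \<open>The slope \<open>s\<close> from \<open>fcap_ineq\<close> depends on \<open>v\<close> but
  is at most \<open>2 / \<eta>\<close>, so the increase is bounded by moments of \<open>S n\<close>
  that do not involve \<open>v\<close>.\<close>

lemma fcap_step:
  assumes \<eta>: "\<eta> > 0" and r: "r \<ge> 1"
  shows "(\<integral>u. fcap \<eta> (v + u) \<partial>S n) \<le> fcap \<eta> v + 2 / \<eta> * \<bar>\<integral>u. u * indicator {-1..1} u \<partial>S n\<bar>
     + (\<integral>u. u\<^sup>2 * indicator {-1..1} u \<partial>S n) / \<eta>\<^sup>2 + (2 * r / \<eta> + r\<^sup>2 / \<eta>\<^sup>2) * (\<integral>u. jump u \<partial>S n) + (\<integral>u. cl (\<bar>u\<bar> - r + 1) * jump u \<partial>S n)"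
proof -
  obtain s where s: "\<bar>s\<bar> \<le> 2 / \<eta>" "\<And>u. fcap \<eta> (v + u) \<le> fcap \<eta> v + s * (u * indicator {-1..1} u)
     + (u\<^sup>2 * indicator {-1..1} u) / \<eta>\<^sup>2 + (2 * r / \<eta> + r\<^sup>2 / \<eta>\<^sup>2) * jump u + cl (\<bar>u\<bar> - r + 1) * jump u"
    using fcap_ineq[OF assms, of v] unfolding jump_def by blast
  have i: "integrable (S n) jump" by (rule S_integrable_bdd[where B = 1]) (auto simp: jump_def indicator_def)
  have i2: "integrable (S n) (\<lambda>u. cl (\<bar>u\<bar> - r + 1) * jump u)"
    by (rule S_integrable_bdd[where B = 1]) (auto simp: jump_def indicator_def cl_def)
  have i3: "integrable (S n) (\<lambda>u. fcap \<eta> (v + u))"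
    by (rule S_integrable_bdd[where B = 1]) (simp add: fcap_bounds abs_of_nonneg)
  have "(\<integral>u. fcap \<eta> (v + u) \<partial>S n) \<le> (\<integral>u. fcap \<eta> v + s * (u * indicator {-1..1} u)
     + (u\<^sup>2 * indicator {-1..1} u) / \<eta>\<^sup>2 + (2 * r / \<eta> + r\<^sup>2 / \<eta>\<^sup>2) * jump u + cl (\<bar>u\<bar> - r + 1) * jump u \<partial>S n)"
    by (rule integral_mono[OF i3 _ s(2)])
       (intro Bochner_Integration.integrable_add integrable_mult_right integrable_divide i i2 S_id_int S_sq_int, simp)
  also have "\<dots> = fcap \<eta> v + s * (\<integral>u. u * indicator {-1..1} u \<partial>S n)
     + (\<integral>u. u\<^sup>2 * indicator {-1..1} u \<partial>S n) / \<eta>\<^sup>2 + (2 * r / \<eta> + r\<^sup>2 / \<eta>\<^sup>2) * (\<integral>u. jump u \<partial>S n) + (\<integral>u. cl (\<bar>u\<bar> - r + 1) * jump u \<partial>S n)"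
    using i i2 S_id_int[of n] S_sq_int[of n] by simp
  also have "s * (\<integral>u. u * indicator {-1..1} u \<partial>S n) \<le> 2 / \<eta> * \<bar>\<integral>u. u * indicator {-1..1} u \<partial>S n\<bar>"
  proof -
    have "s * (\<integral>u. u * indicator {-1..1} u \<partial>S n) \<le> \<bar>s\<bar> * \<bar>\<integral>u. u * indicator {-1..1} u \<partial>S n\<bar>" by (metis abs_ge_self abs_mult)
    also have "\<dots> \<le> 2 / \<eta> * \<bar>\<integral>u. u * indicator {-1..1} u \<partial>S n\<bar>" by (rule mult_right_mono[OF s(1)]) simp
    finally show ?thesis .
  qed
  finally show ?thesis by simp
qed

lemma id_bounded: "\<exists>C. \<forall>\<^sub>F n in sequentially. a n * \<bar>\<integral>u. u * indicator {-1..1} u \<partial>S n\<bar> \<le> C"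
proof -
  have "\<forall>\<^sub>F n in sequentially. \<bar>a n * (\<integral>u. u * indicator {-1..1} u \<partial>S n)\<bar> < \<bar>b\<bar> + 1"
    by (rule order_tendstoD(2)[OF tendsto_rabs[OF A2_b']]) simp
  then show ?thesis using a_pos
    by (intro exI[of _ "\<bar>b\<bar> + 1"]) (auto elim!: eventually_mono simp: abs_mult less_imp_le)
qed

lemma fcap_drift:
  assumes \<eta>: "\<eta> > 0"
  shows "\<exists>C\<ge>0. \<forall>\<^sub>F n in sequentially. \<forall>v. (\<integral>u. fcap \<eta> (v + u) \<partial>S n) \<le> fcap \<eta> v + C / a n"
proof -
  obtain C1 where C1: "\<forall>\<^sub>F n in sequentially. a n * \<bar>\<integral>u. u * indicator {-1..1} u \<partial>S n\<bar> \<le> C1" using id_bounded by blast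
  obtain C2 where C2: "\<forall>\<^sub>F n in sequentially. a n * (\<integral>u. u\<^sup>2 * indicator {-1..1} u \<partial>S n) \<le> C2" using a_int_bounded by blast
  obtain C3 where C3: "\<forall>\<^sub>F n in sequentially. a n * (\<integral>u. jump u \<partial>S n) \<le> C3" using jump_lim by blast
  obtain r where r: "r \<ge> 2" "\<forall>\<^sub>F n in sequentially. a n * (\<integral>u. cl (\<bar>u\<bar> - r + 1) * jump u \<partial>S n) \<le> 1" using far_small[of 1] by auto
  define c where "c = 2 * r / \<eta> + r\<^sup>2 / \<eta>\<^sup>2"
  have c: "c \<ge> 0" using r \<eta> by (simp add: c_def)
  define C where "C = 2 / \<eta> * C1 + C2 / \<eta>\<^sup>2 + c * C3 + 1"
  have "\<forall>\<^sub>F n in sequentially. \<forall>v. (\<integral>u. fcap \<eta> (v + u) \<partial>S n) \<le> fcap \<eta> v + max C 0 / a n"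
    using C1 C2 C3 r(2)
  proof eventually_elim
    case (elim n)
    show ?case
    proof
      fix v
      have an: "a n > 0" by (rule a_pos)
      let ?R = "2 / \<eta> * \<bar>\<integral>u. u * indicator {-1..1} u \<partial>S n\<bar>
     + (\<integral>u. u\<^sup>2 * indicator {-1..1} u \<partial>S n) / \<eta>\<^sup>2 + c * (\<integral>u. jump u \<partial>S n) + (\<integral>u. cl (\<bar>u\<bar> - r + 1) * jump u \<partial>S n)"
      have "a n * ?R = 2 / \<eta> * (a n * \<bar>\<integral>u. u * indicator {-1..1} u \<partial>S n\<bar>) + (a n * (\<integral>u. u\<^sup>2 * indicator {-1..1} u \<partial>S n)) / \<eta>\<^sup>2
        + c * (a n * (\<integral>u. jump u \<partial>S n)) + a n * (\<integral>u. cl (\<bar>u\<bar> - r + 1) * jump u \<partial>S n)"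
        by (simp add: algebra_simps)
      also have "\<dots> \<le> C" unfolding C_def using elim c \<eta> by (intro add_mono mult_left_mono divide_right_mono) auto
      finally have "?R \<le> max C 0 / a n" using an by (simp add: pos_le_divide_eq mult.commute le_max_iff_disj)
      moreover have "(\<integral>u. fcap \<eta> (v + u) \<partial>S n) \<le> fcap \<eta> v + ?R"
        using fcap_step[OF \<eta>, of r n v] r by (simp add: c_def)
      ultimately show "(\<integral>u. fcap \<eta> (v + u) \<partial>S n) \<le> fcap \<eta> v + max C 0 / a n" by linarith
    qed
  qed
  then show ?thesis by (intro exI[of _ "max C 0"]) auto
qed

text \<open>With \<open>r\<close> fixed, all contributions but the far jumps vanish as the window
  grows. Hence \<open>r\<close> is chosen first, to bring the rate of far jumps below half of
  \<epsilon>.\<close>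

lemma fcap_drift_small:
  assumes e: "\<epsilon> > 0"
  shows "\<exists>R>0. \<forall>\<^sub>F n in sequentially. \<forall>v. (\<integral>u. fcap R (v + u) \<partial>S n) \<le> fcap R v + \<epsilon> / a n"
proof -
  obtain C1 where C1: "\<forall>\<^sub>F n in sequentially. a n * \<bar>\<integral>u. u * indicator {-1..1} u \<partial>S n\<bar> \<le> C1" using id_bounded by blast
  obtain C2 where C2: "\<forall>\<^sub>F n in sequentially. a n * (\<integral>u. u\<^sup>2 * indicator {-1..1} u \<partial>S n) \<le> C2" using a_int_bounded by blast
  obtain C3 where C3: "\<forall>\<^sub>F n in sequentially. a n * (\<integral>u. jump u \<partial>S n) \<le> C3" using jump_lim by blast
  obtain r where r: "r \<ge> 2" "\<forall>\<^sub>F n in sequentially. a n * (\<integral>u. cl (\<bar>u\<bar> - r + 1) * jump u \<partial>S n) \<le> \<epsilon> / 2" using far_small[of "\<epsilon>/2"] e by auto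
  have "((\<lambda>R. 2 / R * C1 + C2 / R\<^sup>2 + (2 * r / R + r\<^sup>2 / R\<^sup>2) * C3) \<longlongrightarrow> 0) at_top" by real_asymp
  then have "\<forall>\<^sub>F R in at_top. 2 / R * C1 + C2 / R\<^sup>2 + (2 * r / R + r\<^sup>2 / R\<^sup>2) * C3 < \<epsilon> / 2 \<and> R > 0"
    using e by (intro eventually_conj order_tendstoD(2) eventually_gt_at_top) auto
  then obtain \<eta> where \<eta>: "2 / \<eta> * C1 + C2 / \<eta>\<^sup>2 + (2 * r / \<eta> + r\<^sup>2 / \<eta>\<^sup>2) * C3 < \<epsilon> / 2" "\<eta> > 0"
    by (auto simp: eventually_at_top_linorder)
  define c where "c = 2 * r / \<eta> + r\<^sup>2 / \<eta>\<^sup>2"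
  have c: "c \<ge> 0" using r \<eta> by (simp add: c_def)
  have "\<forall>\<^sub>F n in sequentially. \<forall>v. (\<integral>u. fcap \<eta> (v + u) \<partial>S n) \<le> fcap \<eta> v + \<epsilon> / a n"
    using C1 C2 C3 r(2)
  proof eventually_elim
    case (elim n)
    show ?case
    proof
      fix v
      have an: "a n > 0" by (rule a_pos)
      let ?R = "2 / \<eta> * \<bar>\<integral>u. u * indicator {-1..1} u \<partial>S n\<bar>
     + (\<integral>u. u\<^sup>2 * indicator {-1..1} u \<partial>S n) / \<eta>\<^sup>2 + c * (\<integral>u. jump u \<partial>S n) + (\<integral>u. cl (\<bar>u\<bar> - r + 1) * jump u \<partial>S n)"
      have "a n * ?R = 2 / \<eta> * (a n * \<bar>\<integral>u. u * indicator {-1..1} u \<partial>S n\<bar>) + (a n * (\<integral>u. u\<^sup>2 * indicator {-1..1} u \<partial>S n)) / \<eta>\<^sup>2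
        + c * (a n * (\<integral>u. jump u \<partial>S n)) + a n * (\<integral>u. cl (\<bar>u\<bar> - r + 1) * jump u \<partial>S n)"
        by (simp add: algebra_simps)
      also have "\<dots> \<le> 2 / \<eta> * C1 + C2 / \<eta>\<^sup>2 + c * C3 + \<epsilon> / 2" using elim c \<eta> by (intro add_mono mult_left_mono divide_right_mono) auto
      also have "\<dots> \<le> \<epsilon>" using \<eta>(1) unfolding c_def by linarith
      finally have "?R \<le> \<epsilon> / a n" using an by (simp add: pos_le_divide_eq mult.commute)
      moreover have "(\<integral>u. fcap \<eta> (v + u) \<partial>S n) \<le> fcap \<eta> v + ?R"
        using fcap_step[OF \<eta>(2), of r n v] r by (simp add: c_def)
      ultimately show "(\<integral>u. fcap \<eta> (v + u) \<partial>S n) \<le> fcap \<eta> v + \<epsilon> / a n" by linarith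
    qed
  qed
  then show ?thesis using \<eta>(2) by blast
qed

section \<open>Exponential moments of a step and their negative drift\<close>

lemma step_exp:
  assumes \<beta>: "0 < \<beta>" "\<beta> < \<beta>0"
  shows "integrable Lv (laplace_integrand \<beta>)"
    "(\<lambda>n. a n * ((\<integral>u. exp (\<beta> * u) \<partial>S n) - 1)) \<longlonglongrightarrow> Psi s2 b Lv \<beta>"
proof -
  \<comment> \<open>Besides the linear compensator the truncated quadratic part is removed as well,
    which leaves a cubic remainder; (A2) restores both as the drift and Gaussian terms of
    \<open>Psi\<close>.\<close>
  let ?g = "\<lambda>x. laplace_integrand \<beta> x - \<beta>\<^sup>2 / 2 * (x\<^sup>2 * indicator {-1..1} x)"
  define B where "B = exp \<beta> + 1 + \<beta> + \<beta>\<^sup>2"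
  have bd1: "\<bar>?g x\<bar> \<le> B" if "x \<le> 1" for x
  proof -
    have "\<bar>\<beta>\<^sup>2 / 2 * (x\<^sup>2 * indicator {-1..1} x)\<bar> \<le> \<beta>\<^sup>2 / 2 * 1"
      by (auto simp: abs_mult indicator_def abs_square_le_1 abs_le_iff mult_left_le)
    moreover have "\<bar>\<beta> * x * indicator {-1..1} x\<bar> \<le> \<beta> * 1"
      using \<beta> by (auto simp: abs_mult indicator_def mult_left_le)
    moreover have "exp (\<beta> * x) \<le> exp \<beta>" using that \<beta> by (simp add: mult_left_le)
    moreover have "exp (\<beta> * x) > 0" "\<beta>\<^sup>2 \<ge> 0" by simp_all
    ultimately show ?thesis unfolding B_def laplace_integrand_def by argo
  qed
  have bd2: "\<bar>?g x\<bar> \<le> B * exp (\<beta> * x)" if "x > 1" for x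
  proof -
    have "1 \<le> exp (\<beta> * x)" using that \<beta> by simp
    moreover have "1 * exp (\<beta> * x) \<le> B * exp (\<beta> * x)" using \<beta> by (intro mult_right_mono) (auto simp: B_def)
    moreover have "?g x = exp (\<beta> * x) - 1" using that by (simp add: laplace_integrand_def)
    moreover have "exp (\<beta> * x) > 0" by simp
    ultimately show ?thesis by linarith
  qed
  have cub: "\<bar>?g x\<bar> \<le> 3 * \<beta> ^ 3 * \<bar>x\<bar> ^ 3" if "\<bar>x\<bar> \<le> min 1 (1 / \<beta>)" for x
  proof -
    have "\<bar>\<beta> * x\<bar> \<le> 1" using that \<beta> by (simp add: abs_mult field_simps)
    from exp_cubic[OF this] show ?thesis using that \<beta>
      by (auto simp: abs_mult power_mult_distrib laplace_integrand_def abs_le_iff)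
  qed
  have m[measurable]: "laplace_integrand \<beta> \<in> borel_measurable borel" unfolding laplace_integrand_def by measurable
  have c: "isCont ?g x" if "x \<noteq> 1" "x \<noteq> -1" for x
    unfolding laplace_integrand_def using that by (intro continuous_intros isCont_ind)
  have sm: "\<exists>d>0. \<forall>x. \<bar>x\<bar> \<le> d \<longrightarrow> \<bar>?g x\<bar> \<le> e * x\<^sup>2" if "e > 0" for e
    by (rule cubic_small[where ?d0.0="min 1 (1 / \<beta>)" and c="3 * \<beta>^3"]) (use that cub \<beta> in auto)
  have 1: "integrable Lv ?g" "(\<lambda>n. a n * (\<integral>u. ?g u \<partial>S n)) \<longlonglongrightarrow> (\<integral>x. ?g x \<partial>Lv)"
    using step_lim[of ?g B \<beta>, OF _ c sm bd1 bd2] \<beta> by auto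
  have "integrable Lv (\<lambda>x. ?g x + \<beta>\<^sup>2 / 2 * (x\<^sup>2 * indicator {-1..1} x))"
    by (intro Bochner_Integration.integrable_add 1 integrable_mult_right Lv_sq_int)
  then show li: "integrable Lv (laplace_integrand \<beta>)" by simp
  have Lg: "(\<integral>x. ?g x \<partial>Lv) = (\<integral>x. laplace_integrand \<beta> x \<partial>Lv) - \<beta>\<^sup>2 / 2 * (\<integral>x. x\<^sup>2 * indicator {-1..1} x \<partial>Lv)"
    using li Lv_sq_int by simp
  have Sg: "(\<integral>x. ?g x \<partial>S n) = (\<integral>u. exp (\<beta> * u) \<partial>S n) - 1 - \<beta> * (\<integral>x. x * indicator {-1..1} x \<partial>S n) - \<beta>\<^sup>2 / 2 * (\<integral>x. x\<^sup>2 * indicator {-1..1} x \<partial>S n)" if n: "n \<ge> 1" for n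
  proof -
    have "integrable (S n) (\<lambda>u. exp (\<beta> * u))"
    proof (rule S_integrable[where B = 1, OF n])
      fix u :: real
      show "\<bar>exp (\<beta> * u)\<bar> \<le> 1 * (1 + exp (\<beta>0 * u))"
      proof (cases "u \<le> 0")
        case True
        then have "exp (\<beta> * u) \<le> 1" using \<beta> by (simp add: mult_le_0_iff)
        then show ?thesis by (simp add: add_increasing2)
      next
        case False
        then have "exp (\<beta> * u) \<le> exp (\<beta>0 * u)" using \<beta> by (simp add: mult_right_mono)
        then show ?thesis by (simp add: add_increasing)
      qed
    qed
    then show ?thesis using S_id_int[of n] S_sq_int[of n] unfolding laplace_integrand_def by (simp add: mult.assoc)
  qed
  have "(\<lambda>n. a n * (\<integral>u. ?g u \<partial>S n) + \<beta> * (a n * (\<integral>x. x * indicator {-1..1} x \<partial>S n)) + \<beta>\<^sup>2 / 2 * (a n * (\<integral>x. x\<^sup>2 * indicator {-1..1} x \<partial>S n))) \<longlonglongrightarrow>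
    (\<integral>x. ?g x \<partial>Lv) + \<beta> * b + \<beta>\<^sup>2 / 2 * (s2 + (\<integral>x. x\<^sup>2 * indicator {-1..1} x \<partial>Lv))"
    by (intro tendsto_intros 1 A2_s2' A2_b')
  also have "(\<integral>x. ?g x \<partial>Lv) + \<beta> * b + \<beta>\<^sup>2 / 2 * (s2 + (\<integral>x. x\<^sup>2 * indicator {-1..1} x \<partial>Lv)) = Psi s2 b Lv \<beta>"
    unfolding Lg Psi_def by (simp add: algebra_simps)
  finally show "(\<lambda>n. a n * ((\<integral>u. exp (\<beta> * u) \<partial>S n) - 1)) \<longlonglongrightarrow> Psi s2 b Lv \<beta>"
  proof (rule Lim_transform_eventually)
    show "\<forall>\<^sub>F n in sequentially. a n * (\<integral>u. ?g u \<partial>S n) + \<beta> * (a n * (\<integral>x. x * indicator {-1..1} x \<partial>S n)) + \<beta>\<^sup>2 / 2 * (a n * (\<integral>x. x\<^sup>2 * indicator {-1..1} x \<partial>S n)) = a n * ((\<integral>u. exp (\<beta> * u) \<partial>S n) - 1)"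
      using eventually_ge_at_top[of 1] by eventually_elim (simp only: Sg, simp add: algebra_simps)
  qed
qed

text \<open>Convexity of the exponential between 0 and \<open>\<beta>0\<close>: the jump part is at
  most \<open>t\<close> times its value at \<open>\<beta>0\<close>, the drift is linear, and the
  Gaussian part uses \<open>t * t \<le> t\<close>.\<close>

lemma Psi_neg_below:
  assumes \<beta>: "0 < \<beta>" "\<beta> < \<beta>0"
  shows "Psi s2 b Lv \<beta> < 0"
proof -
  define t where "t = \<beta> / \<beta>0"
  have t: "0 < t" "t < 1" "\<beta> = t * \<beta>0" using \<beta> by (auto simp: t_def)
  have le: "laplace_integrand \<beta> x \<le> t * laplace_integrand \<beta>0 x" for x
  proof -
    have "exp ((1 - t) *\<^sub>R 0 + t *\<^sub>R (\<beta>0 * x)) \<le> (1 - t) * exp 0 + t * exp (\<beta>0 * x)"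
      using t by (intro convex_onD[OF exp_convex]) auto
    then have "exp (\<beta> * x) \<le> (1 - t) + t * exp (\<beta>0 * x)" by (simp add: t(3) mult.assoc)
    then show ?thesis by (simp add: laplace_integrand_def t(3) algebra_simps)
  qed
  have "(\<integral>x. laplace_integrand \<beta> x \<partial>Lv) \<le> (\<integral>x. t * laplace_integrand \<beta>0 x \<partial>Lv)"
    by (intro integral_mono step_exp(1) \<beta> integrable_mult_right laplace_int le)
  then have 1: "(\<integral>x. laplace_integrand \<beta> x \<partial>Lv) \<le> t * (\<integral>x. laplace_integrand \<beta>0 x \<partial>Lv)" by simp
  have "t * t \<le> t * 1" using t by (intro mult_left_mono) auto
  then have "s2 / 2 * \<beta>0\<^sup>2 * (t * t) \<le> s2 / 2 * \<beta>0\<^sup>2 * t" using A2_s by (intro mult_left_mono) auto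
  then have "s2 / 2 * \<beta>\<^sup>2 \<le> t * (s2 / 2 * \<beta>0\<^sup>2)" by (simp add: t(3) power2_eq_square mult_ac)
  then have "Psi s2 b Lv \<beta> \<le> t * Psi s2 b Lv \<beta>0" using 1 unfolding Psi_def by (simp add: t(3) algebra_simps)
  also have "\<dots> < 0" using t Psi_neg by (simp add: mult_pos_neg)
  finally show ?thesis .
qed

text \<open>Any exponent strictly between \<open>\<gamma>\<close> and \<open>\<beta>0\<close> would do: the moments of order \<open>\<beta>0\<close> give uniform
  integrability, and convexity of \<open>Psi\<close> makes it negative on \<open>]0, \<beta>0]\<close>.\<close>
definition \<beta> :: real where "\<beta> = (\<gamma> + \<beta>0) / 2"
text \<open>Half of the limiting rate of decay; the other half is the margin that lets
  \<open>exp_drift\<close> hold for all large states.\<close>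

definition c0 :: real where "c0 = - Psi s2 b Lv \<beta> / 2"

lemma \<beta>: "\<gamma> < \<beta>" "\<beta> < \<beta>0" "0 < \<beta>" using beta0 gamma_pos by (auto simp: \<beta>_def)

lemma c0: "c0 > 0" using Psi_neg_below[OF \<beta>(3,2)] by (simp add: c0_def)

lemma exp_drift: "\<forall>\<^sub>F n in sequentially. (\<integral>u. exp (\<beta> * u) \<partial>S n) \<le> exp (- c0 / a n)"
proof -
  have "Psi s2 b Lv \<beta> < - c0" using Psi_neg_below[OF \<beta>(3,2)] by (simp add: c0_def)
  from order_tendstoD(2)[OF step_exp(2)[OF \<beta>(3,2)] this]
  show ?thesis
  proof eventually_elim
    case (elim n)
    then have "(\<integral>u. exp (\<beta> * u) \<partial>S n) \<le> 1 + (- c0 / a n)" using a_pos[of n] by (simp add: field_simps)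
    also have "\<dots> \<le> exp (- c0 / a n)" by (rule exp_ge_add_one_self)
    finally show ?case .
  qed
qed

lemma S_exp_int: "n \<ge> 1 \<Longrightarrow> integrable (S n) (\<lambda>u. exp (\<beta> * u))"
proof (rule S_integrable[where B = 1])
  fix u :: real
  show "\<bar>exp (\<beta> * u)\<bar> \<le> 1 * (1 + exp (\<beta>0 * u))"
  proof (cases "u \<le> 0")
    case True
    then have "exp (\<beta> * u) \<le> 1" using \<beta> by (simp add: mult_le_0_iff)
    then show ?thesis by (simp add: add_increasing2)
  next
    case False
    then have "exp (\<beta> * u) \<le> exp (\<beta>0 * u)" using \<beta> by (simp add: mult_right_mono)
    then show ?thesis by (simp add: add_increasing)
  qed
qed auto

lemma powr_moment:
  assumes n: "n \<ge> 1"
  shows "integrable (K n) (\<lambda>k. real k powr \<beta>)" "(\<integral>k. real k powr \<beta> \<partial>K n) = real n powr \<beta> * (\<integral>u. exp (\<beta> * u) \<partial>S n)"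
proof -
  have eq: "real k powr \<beta> = real n powr \<beta> * exp (\<beta> * (ln (real k) - ln (real n)))" if "k \<in> set_pmf (K n)" for k
    using K_pos[OF that] n by (simp add: powr_def right_diff_distrib exp_diff)
  have i: "integrable (K n) (\<lambda>k. exp (\<beta> * (ln (real k) - ln (real n))))"
    using S_exp_int[OF n] by (simp add: S_def)
  have ae: "AE k in K n. real k powr \<beta> = real n powr \<beta> * exp (\<beta> * (ln (real k) - ln (real n)))"
    using eq by (simp add: AE_measure_pmf_iff)
  show "integrable (K n) (\<lambda>k. real k powr \<beta>)"
    by (subst integrable_cong_AE[OF _ _ ae]) (use i in auto)
  have "(\<integral>k. real k powr \<beta> \<partial>K n) = (\<integral>k. real n powr \<beta> * exp (\<beta> * (ln (real k) - ln (real n))) \<partial>K n)"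
    by (rule integral_cong_AE[OF _ _ ae]) auto
  also have "\<dots> = real n powr \<beta> * (\<integral>u. exp (\<beta> * u) \<partial>S n)" using i by (simp add: S_def)
  finally show "(\<integral>k. real k powr \<beta> \<partial>K n) = real n powr \<beta> * (\<integral>u. exp (\<beta> * u) \<partial>S n)" .
qed

text \<open>Large states contract on average by \<open>exp_drift\<close>; \<open>CV\<close> is the
  sum of the moments of the finitely many others. All states are covered, as the maximal inequality
  requires once the chain has come down.\<close>

lemma powr_drift: "\<exists>CV\<ge>0. \<forall>n\<ge>1. (\<integral>k. real k powr \<beta> \<partial>K n) \<le> real n powr \<beta> + CV"
proof -
  obtain n0 where n0: "\<And>n. n \<ge> n0 \<Longrightarrow> (\<integral>u. exp (\<beta> * u) \<partial>S n) \<le> exp (- c0 / a n)"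
    using exp_drift by (auto simp: eventually_sequentially)
  define CV where "CV = (\<Sum>n<n0. \<integral>k. real k powr \<beta> \<partial>K n)"
  have nn: "(\<integral>k. real k powr \<beta> \<partial>K n) \<ge> 0" for n by simp
  have "(\<integral>k. real k powr \<beta> \<partial>K n) \<le> real n powr \<beta> + CV" if n: "n \<ge> 1" for n
  proof (cases "n < n0")
    case True
    have "(\<integral>k. real k powr \<beta> \<partial>K n) \<le> CV" unfolding CV_def
      by (rule member_le_sum) (use True in auto)
    then show ?thesis by (simp add: add_increasing)
  next
    case False
    have "exp (- c0 / a n) \<le> 1" using c0 a_pos[of n] by simp
    then have "(\<integral>u. exp (\<beta> * u) \<partial>S n) \<le> 1" using n0[of n] False by linarith
    then have "real n powr \<beta> * (\<integral>u. exp (\<beta> * u) \<partial>S n) \<le> real n powr \<beta> * 1" by (intro mult_left_mono) auto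
    moreover have "CV \<ge> 0" unfolding CV_def by (intro sum_nonneg nn)
    ultimately show ?thesis using powr_moment(2)[OF n] by simp
  qed
  moreover have "CV \<ge> 0" unfolding CV_def by (intro sum_nonneg nn)
  ultimately show ?thesis by blast
qed

end

section \<open>Running the chain by its intrinsic clock\<close>

lemma pmf_integrable_bdd:
  fixes f :: "'a \<Rightarrow> 'b::{banach, second_countable_topology}"
  assumes "\<And>x. x \<in> set_pmf q \<Longrightarrow> norm (f x) \<le> B"
  shows "integrable (measure_pmf q) f"
  by (rule measure_pmf.integrable_const_bound[where B = B]) (use assms in \<open>auto simp: AE_measure_pmf_iff\<close>)

text \<open>The bound is available on the support only; \<open>g\<close> is \<open>f\<close> with
  the values that violate it replaced by 0, which changes none of the integrals.\<close>

lemma integral_bind_real: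
  fixes f :: "'a \<Rightarrow> real"
  assumes bd: "\<And>y. y \<in> set_pmf (bind_pmf M N) \<Longrightarrow> \<bar>f y\<bar> \<le> B"
  shows "(\<integral>y. f y \<partial>bind_pmf M N) = (\<integral>x. (\<integral>y. f y \<partial>N x) \<partial>M)"
proof -
  define g where "g y = (if \<bar>f y\<bar> \<le> B then f y else 0)" for y
  have ag: "(\<integral>y. f y \<partial>q) = (\<integral>y. g y \<partial>q)" if "set_pmf q \<subseteq> set_pmf (bind_pmf M N)" for q
  proof (rule integral_cong_AE)
    have "f y = g y" if y: "y \<in> set_pmf q" for y
      using bd[of y] y \<open>set_pmf q \<subseteq> set_pmf (bind_pmf M N)\<close> by (auto simp: g_def simp del: set_bind_pmf)
    then show "AE y in q. f y = g y" by (simp add: AE_measure_pmf_iff)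
  qed auto
  have "(\<integral>y. f y \<partial>bind_pmf M N) = (\<integral>y. g y \<partial>bind_pmf M N)" by (rule ag) simp
  also have "\<dots> = (\<integral>x. (\<integral>y. g y \<partial>N x) \<partial>M)"
    unfolding measure_pmf_bind
  proof (rule integral_bind[where K = "count_space UNIV" and B = "\<bar>B\<bar>" and B' = 1])
    show "\<bar>g x\<bar> \<le> \<bar>B\<bar>" for x by (simp add: g_def)
    show "finite_measure (measure_pmf M)" by unfold_locales simp
  qed (auto intro: measure_pmf_in_subprob_algebra)
  also have "\<dots> = (\<integral>x. (\<integral>y. f y \<partial>N x) \<partial>M)"
    by (rule integral_cong_AE) (auto simp: AE_measure_pmf_iff intro!: ag[symmetric])
  finally show ?thesis .
qed

lemma integral_bind_complex:
  fixes f :: "'a \<Rightarrow> complex"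
  assumes bd: "\<And>y. y \<in> set_pmf (bind_pmf M N) \<Longrightarrow> norm (f y) \<le> B"
  shows "(\<integral>y. f y \<partial>bind_pmf M N) = (\<integral>x. (\<integral>y. f y \<partial>N x) \<partial>M)"
proof -
  have i: "integrable (bind_pmf M N) f" by (rule pmf_integrable_bdd[OF bd])
  have iN: "integrable (N x) f" if "x \<in> set_pmf M" for x
    by (rule pmf_integrable_bdd[where B = B]) (use bd that in auto)
  have nb: "norm (\<integral>y. f y \<partial>N x) \<le> B" if "x \<in> set_pmf M" for x
  proof -
    have "norm (\<integral>y. f y \<partial>N x) \<le> (\<integral>y. norm (f y) \<partial>N x)" by simp
    also have "\<dots> \<le> (\<integral>y. B \<partial>N x)"
      by (rule integral_mono_AE) (use iN[OF that] bd that in \<open>auto simp: AE_measure_pmf_iff\<close>)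
    finally show ?thesis by simp
  qed
  have iM: "integrable M (\<lambda>x. \<integral>y. f y \<partial>N x)" by (rule pmf_integrable_bdd[OF nb])
  have R: "(\<integral>y. Re (f y) \<partial>bind_pmf M N) = (\<integral>x. (\<integral>y. Re (f y) \<partial>N x) \<partial>M)"
    by (rule integral_bind_real[where B = B]) (use bd abs_Re_le_cmod order_trans in blast)
  have I: "(\<integral>y. Im (f y) \<partial>bind_pmf M N) = (\<integral>x. (\<integral>y. Im (f y) \<partial>N x) \<partial>M)"
    by (rule integral_bind_real[where B = B]) (use bd abs_Im_le_cmod order_trans in blast)
  have R2: "(\<integral>x. (\<integral>y. Re (f y) \<partial>N x) \<partial>M) = (\<integral>x. Re (\<integral>y. f y \<partial>N x) \<partial>M)"
    by (rule integral_cong_AE) (use iN in \<open>auto simp: AE_measure_pmf_iff\<close>)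
  have I2: "(\<integral>x. (\<integral>y. Im (f y) \<partial>N x) \<partial>M) = (\<integral>x. Im (\<integral>y. f y \<partial>N x) \<partial>M)"
    by (rule integral_cong_AE) (use iN in \<open>auto simp: AE_measure_pmf_iff\<close>)
  show ?thesis using R I R2 I2 i iM by (simp add: complex_eq_iff)
qed

lemma prob_bind_pmf: "measure_pmf.prob (bind_pmf M N) A = (\<integral>x. measure_pmf.prob (N x) A \<partial>M)"
proof -
  have "(\<integral>y. indicator A y \<partial>bind_pmf M N) = (\<integral>x. (\<integral>y. indicator A y \<partial>N x) \<partial>M :: real)"
    by (rule integral_bind_real[where B = 1]) (simp add: indicator_def)
  then show ?thesis by simp
qed

definition lr :: "nat \<Rightarrow> nat \<Rightarrow> real" where "lr x y = ln (real y) - ln (real x)"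

lemma lr_self[simp]: "lr x x = 0" by (simp add: lr_def)
lemma lr_add: "lr x y + lr y z = lr x z" by (simp add: lr_def)

definition calm :: "real \<Rightarrow> nat \<Rightarrow> nat list \<Rightarrow> bool" where "calm \<eta> r ys \<longleftrightarrow> (\<forall>y\<in>set ys. \<bar>lr r y\<bar> \<le> \<eta>)"

lemma calm_simps[simp]: "calm \<eta> r []" "calm \<eta> r (y # ys) \<longleftrightarrow> \<bar>lr r y\<bar> \<le> \<eta> \<and> calm \<eta> r ys"
  by (auto simp: calm_def)

text \<open>At most one large move: the list stays near \<open>r\<close> up to a first exit, and
  from there on near the exit state. An exit is measured by the displacement from \<open>r\<close>,
  not by the size of a single step.\<close>

primrec good2 :: "real \<Rightarrow> nat \<Rightarrow> nat list \<Rightarrow> bool" where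
  "good2 \<eta> r [] \<longleftrightarrow> True"
| "good2 \<eta> r (y # ys) \<longleftrightarrow> (if \<bar>lr r y\<bar> \<le> \<eta> then good2 \<eta> r ys else calm \<eta> y ys)"

definition fin :: "nat \<Rightarrow> nat list \<Rightarrow> nat" where "fin x ys = last (x # ys)"

lemma fin_simps[simp]: "fin x [] = x" "fin x (y # ys) = fin y ys" by (auto simp: fin_def)

lemma fin_append: "fin x (ys @ zs) = fin (fin x ys) zs" by (induction ys arbitrary: x) auto

context chain_kernel begin

primrec traj :: "nat \<Rightarrow> nat \<Rightarrow> nat list pmf" where
  "traj 0 x = return_pmf []"
| "traj (Suc N) x = bind_pmf (K x) (\<lambda>y. map_pmf ((#) y) (traj N y))"

text \<open>The clock advances by \<open>1 / a z\<close> at each visit of \<open>z\<close>: it measures the time of the Levy process.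
  A cell is aborted in states far below its start, where the asymptotics of a step are not available.\<close>
primrec run :: "nat \<Rightarrow> real \<Rightarrow> nat \<Rightarrow> real \<Rightarrow> nat \<Rightarrow> nat list pmf" where
  "run 0 h x0 c x = return_pmf []"
| "run (Suc k) h x0 c x = (if h \<le> c \<or> x * x < x0 then return_pmf []
     else bind_pmf (K x) (\<lambda>y. map_pmf ((#) y) (run k h x0 (c + 1 / a x) y)))"

primrec clk :: "nat list \<Rightarrow> nat \<Rightarrow> real" where
  "clk [] x = 0"
| "clk (y # ys) x = 1 / a x + clk ys y"

lemma traj_length: "ys \<in> set_pmf (traj N x) \<Longrightarrow> length ys = N"
  by (induction N arbitrary: x ys) auto

lemma traj_take0: "map_pmf (take N) (traj N x) = traj N x"
proof -
  have "map_pmf (take N) (traj N x) = map_pmf (\<lambda>ys. ys) (traj N x)"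
    by (rule map_pmf_cong) (auto dest: traj_length)
  then show ?thesis by simp
qed

text \<open>The strong Markov property at the end of a cell: continuing from its last state gives
  back the law of the chain. The truncation to \<open>N\<close> takes care of cells longer than
  \<open>N\<close>.\<close>

lemma run_traj:
  "bind_pmf (run k h x0 c x) (\<lambda>ys. map_pmf (\<lambda>zs. take N (ys @ zs)) (traj (N - length ys) (fin x ys))) = traj N x"
proof (induction k arbitrary: N c x)
  case 0
  then show ?case by (simp add: bind_return_pmf traj_take0)
next
  case (Suc k)
  show ?case
  proof (cases "h \<le> c \<or> x * x < x0")
    case True
    then show ?thesis by (simp add: bind_return_pmf traj_take0)
  next
    case False
    show ?thesis
    proof (cases N)
      case 0 then show ?thesis by (simp add: map_pmf_const)
    next
      case N': (Suc N')
      have "bind_pmf (run (Suc k) h x0 c x) (\<lambda>ys. map_pmf (\<lambda>zs. take N (ys @ zs)) (traj (N - length ys) (fin x ys)))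
        = bind_pmf (K x) (\<lambda>y. bind_pmf (run k h x0 (c + 1 / a x) y)
            (\<lambda>ys. map_pmf ((#) y) (map_pmf (\<lambda>zs. take N' (ys @ zs)) (traj (N' - length ys) (fin y ys)))))"
        using False N' by (simp add: bind_assoc_pmf bind_map_pmf map_pmf_comp)
      also have "\<dots> = bind_pmf (K x) (\<lambda>y. map_pmf ((#) y) (traj N' y))"
        by (simp only: map_bind_pmf[symmetric] Suc.IH)
      finally show ?thesis by (simp add: N')
    qed
  qed
qed

lemma run_pos: "ys \<in> set_pmf (run k h x0 c x) \<Longrightarrow> x \<ge> 1 \<Longrightarrow> \<forall>y\<in>set (x # ys). y \<ge> 1"
proof (induction k arbitrary: c x ys)
  case (Suc k)
  show ?case
  proof (cases "h \<le> c \<or> x * x < x0")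
    case False
    with Suc.prems obtain y zs where y: "y \<in> set_pmf (K x)" "zs \<in> set_pmf (run k h x0 (c + 1 / a x) y)" "ys = y # zs" by auto
    then show ?thesis using Suc.IH[OF y(2)] K_pos[OF y(1)] Suc.prems(2) by auto
  qed (use Suc.prems in auto)
qed auto

lemma fin_pos: assumes "\<forall>y\<in>set (x # ys). y \<ge> 1" shows "fin x ys \<ge> 1"
  using assms unfolding fin_def by (metis last_in_set list.distinct(1))

text \<open>A run stops as soon as the clock has reached \<open>h\<close>, so it overshoots by at
  most one tick.\<close>

lemma run_clk:
  assumes dl: "\<And>z. z \<ge> 1 \<Longrightarrow> z * z \<ge> x0 \<Longrightarrow> 1 / a z \<le> \<delta>" and "\<delta> \<ge> 0"
  shows "ys \<in> set_pmf (run k h x0 c x) \<Longrightarrow> x \<ge> 1 \<Longrightarrow> c \<le> h + \<delta> \<Longrightarrow> c + clk ys x \<le> h + \<delta>"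
proof (induction k arbitrary: c x ys)
  case (Suc k)
  show ?case
  proof (cases "h \<le> c \<or> x * x < x0")
    case False
    with Suc.prems obtain y zs where y: "y \<in> set_pmf (K x)" "zs \<in> set_pmf (run k h x0 (c + 1 / a x) y)" "ys = y # zs" by auto
    have "c + 1 / a x \<le> h + \<delta>" using dl[OF Suc.prems(2)] False by linarith
    then show ?thesis using Suc.IH[OF y(2) K_pos[OF y(1)]] y(3) by simp
  qed (use Suc.prems in auto)
qed auto

lemma run_incomplete:
  "ys \<in> set_pmf (run k h x0 c x) \<Longrightarrow> c + clk ys x < h \<Longrightarrow> fin x ys * fin x ys < x0 \<or> length ys = k"
proof (induction k arbitrary: c x ys)
  case (Suc k)
  show ?case
  proof (cases "h \<le> c \<or> x * x < x0")
    case False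
    with Suc.prems obtain y zs where y: "y \<in> set_pmf (K x)" "zs \<in> set_pmf (run k h x0 (c + 1 / a x) y)" "ys = y # zs" by auto
    then show ?thesis using Suc.IH[OF y(2)] Suc.prems by (auto simp: add.assoc)
  qed (use Suc.prems in auto)
qed auto

lemma clk_ge:
  assumes "A > 0"
  shows "\<forall>z\<in>set (x # ys). a z \<le> A \<Longrightarrow> clk ys x \<ge> real (length ys) / A"
proof (induction ys arbitrary: x)
  case (Cons y ys)
  have "1 / A \<le> 1 / a x" using Cons.prems a_pos[of x] assms by (intro divide_left_mono) auto
  moreover have "real (length ys) / A \<le> clk ys y" using Cons by simp
  ultimately show ?case by (simp add: add_divide_distrib)
qed simp

section \<open>Estimates within one cell\<close>

context
  fixes x0 :: nat and \<eta> C \<delta> h :: real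
  assumes st: "\<And>z v. z \<ge> 1 \<Longrightarrow> z * z \<ge> x0 \<Longrightarrow> (\<integral>u. fcap \<eta> (v + u) \<partial>S z) \<le> fcap \<eta> v + C / a z"
    and dl: "\<And>z. z \<ge> 1 \<Longrightarrow> z * z \<ge> x0 \<Longrightarrow> 1 / a z \<le> \<delta>"
    and eta: "\<eta> > 0" and C: "C \<ge> 0" and delta: "\<delta> \<ge> 0" and h: "h > 0"
begin

text \<open>The induction step shared by \<open>run_calm\<close> and \<open>run_good2\<close>: the
  drift \<open>C / a x\<close> of \<open>fcap\<close> is exactly what the term
  \<open>C * (h + \<delta> - c)\<close> loses in that step, so the bracket behaves as a
  supermartingale.\<close>

lemma run_step_bound:
  assumes x: "x \<ge> 1" "c < h" "x * x \<ge> x0" and W: "W \<ge> 0"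
    and IH: "\<And>y. y \<in> set_pmf (K x) \<Longrightarrow> measure_pmf.prob (run k h x0 (c + 1 / a x) y) ((#) y -` A)
      \<le> W * (fcap \<eta> (lr r y) + C * (h + \<delta> - (c + 1 / a x)))"
  shows "measure_pmf.prob (run (Suc k) h x0 c x) A \<le> W * (fcap \<eta> (lr r x) + C * (h + \<delta> - c))"
proof -
  have i: "integrable (K x) (\<lambda>y. fcap \<eta> (lr r y))"
    by (rule pmf_integrable_bdd[where B = 1]) (simp add: fcap_bounds)
  have "measure_pmf.prob (run (Suc k) h x0 c x) A = (\<integral>y. measure_pmf.prob (run k h x0 (c + 1 / a x) y) ((#) y -` A) \<partial>K x)"
    using x by (simp add: prob_bind_pmf)
  also have "\<dots> \<le> (\<integral>y. W * (fcap \<eta> (lr r y) + C * (h + \<delta> - (c + 1 / a x))) \<partial>K x)"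
  proof (rule integral_mono_AE)
    show "integrable (K x) (\<lambda>y. measure_pmf.prob (run k h x0 (c + 1 / a x) y) ((#) y -` A))"
      by (rule pmf_integrable_bdd[where B = 1]) simp
    show "AE y in K x. measure_pmf.prob (run k h x0 (c + 1 / a x) y) ((#) y -` A) \<le> W * (fcap \<eta> (lr r y) + C * (h + \<delta> - (c + 1 / a x)))"
      using IH by (simp add: AE_measure_pmf_iff)
  qed (use i in auto)
  also have "\<dots> = W * ((\<integral>y. fcap \<eta> (lr r y) \<partial>K x) + C * (h + \<delta> - (c + 1 / a x)))" using i by simp
  also have "\<dots> \<le> W * (fcap \<eta> (lr r x) + C * (h + \<delta> - c))"
  proof (rule mult_left_mono[OF _ W])
    have "(\<integral>y. fcap \<eta> (lr r y) \<partial>K x) = (\<integral>u. fcap \<eta> (lr r x + u) \<partial>S x)"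
      by (simp add: S_def lr_def algebra_simps)
    also have "\<dots> \<le> fcap \<eta> (lr r x) + C / a x" by (rule st) (use x in auto)
    finally show "(\<integral>y. fcap \<eta> (lr r y) \<partial>K x) + C * (h + \<delta> - (c + 1 / a x)) \<le> fcap \<eta> (lr r x) + C * (h + \<delta> - c)"
      by (simp add: algebra_simps)
  qed
  finally show ?thesis .
qed

text \<open>An exit makes \<open>fcap\<close> equal to 1, so the claimed bound is at least 1 and
  nothing remains to be shown; without an exit the event is unchanged by the step.\<close>

lemma run_calm:
  "x \<ge> 1 \<Longrightarrow> c \<le> h + \<delta> \<Longrightarrow> measure_pmf.prob (run k h x0 c x) {ys. \<not> calm \<eta> r ys} \<le> fcap \<eta> (lr r x) + C * (h + \<delta> - c)"
proof (induction k arbitrary: c x)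
  case 0
  then show ?case using C by (auto simp: fcap_bounds intro!: add_nonneg_nonneg mult_nonneg_nonneg)
next
  case (Suc k)
  show ?case
  proof (cases "h \<le> c \<or> x * x < x0")
    case True
    then show ?thesis using C Suc.prems by (auto simp: fcap_bounds intro!: add_nonneg_nonneg mult_nonneg_nonneg)
  next
    case False
    have c': "c + 1 / a x \<le> h + \<delta>" using dl[OF Suc.prems(1)] False by linarith
    have "measure_pmf.prob (run (Suc k) h x0 c x) {ys. \<not> calm \<eta> r ys} \<le> 1 * (fcap \<eta> (lr r x) + C * (h + \<delta> - c))"
    proof (rule run_step_bound)
      fix y assume y: "y \<in> set_pmf (K x)"
      show "measure_pmf.prob (run k h x0 (c + 1 / a x) y) ((#) y -` {ys. \<not> calm \<eta> r ys}) \<le> 1 * (fcap \<eta> (lr r y) + C * (h + \<delta> - (c + 1 / a x)))"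
      proof (cases "\<bar>lr r y\<bar> \<le> \<eta>")
        case True
        then have "(#) y -` {ys. \<not> calm \<eta> r ys} = {ys. \<not> calm \<eta> r ys}" by auto
        then show ?thesis using Suc.IH[OF K_pos[OF y] c'] by simp
      next
        case False
        then have "fcap \<eta> (lr r y) = 1" using eta by (intro fcap_1) auto
        moreover have "C * (h + \<delta> - (c + 1 / a x)) \<ge> 0" using C c' by simp
        ultimately have "1 \<le> 1 * (fcap \<eta> (lr r y) + C * (h + \<delta> - (c + 1 / a x)))" by simp
        then show ?thesis using measure_pmf.prob_le_1 order_trans by blast
      qed
    qed (use False Suc.prems in auto)
    then show ?thesis by simp
  qed
qed

text \<open>Two successive moves larger than \<open>\<eta>\<close>: the first costs a factor of order \<open>h\<close> and restarts the
  estimate for the second one.\<close>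
lemma run_good2:
  "x \<ge> 1 \<Longrightarrow> 0 \<le> c \<Longrightarrow> c \<le> h + \<delta> \<Longrightarrow> measure_pmf.prob (run k h x0 c x) {ys. \<not> good2 \<eta> r ys}
     \<le> (C * (h + \<delta>)) * (fcap \<eta> (lr r x) + C * (h + \<delta> - c))"
proof (induction k arbitrary: c x)
  case 0
  then show ?case using C h delta by (auto simp: fcap_bounds intro!: add_nonneg_nonneg mult_nonneg_nonneg)
next
  case (Suc k)
  show ?case
  proof (cases "h \<le> c \<or> x * x < x0")
    case True
    then show ?thesis using C Suc.prems h delta by (auto simp: fcap_bounds intro!: add_nonneg_nonneg mult_nonneg_nonneg)
  next
    case False
    have c': "c + 1 / a x \<le> h + \<delta>" using dl[OF Suc.prems(1)] False by linarith
    have c0: "0 \<le> c + 1 / a x" using Suc.prems a_pos[of x] by (simp add: less_imp_le)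
    show ?thesis
    proof (rule run_step_bound)
      fix y assume y: "y \<in> set_pmf (K x)"
      show "measure_pmf.prob (run k h x0 (c + 1 / a x) y) ((#) y -` {ys. \<not> good2 \<eta> r ys}) \<le> (C * (h + \<delta>)) * (fcap \<eta> (lr r y) + C * (h + \<delta> - (c + 1 / a x)))"
      proof (cases "\<bar>lr r y\<bar> \<le> \<eta>")
        case True
        then have "(#) y -` {ys. \<not> good2 \<eta> r ys} = {ys. \<not> good2 \<eta> r ys}" by auto
        then show ?thesis using Suc.IH[OF K_pos[OF y] c0 c'] by simp
      next
        case False
        then have f1: "fcap \<eta> (lr r y) = 1" using eta by (intro fcap_1) auto
        have "(#) y -` {ys. \<not> good2 \<eta> r ys} = {ys. \<not> calm \<eta> y ys}" using False by auto
        then have "measure_pmf.prob (run k h x0 (c + 1 / a x) y) ((#) y -` {ys. \<not> good2 \<eta> r ys}) \<le> C * (h + \<delta> - (c + 1 / a x))"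
          using run_calm[OF K_pos[OF y] c', of k y] by simp
        also have "\<dots> \<le> (C * (h + \<delta>)) * 1" using C c0 by (simp add: mult_left_mono)
        also have "\<dots> \<le> (C * (h + \<delta>)) * (fcap \<eta> (lr r y) + C * (h + \<delta> - (c + 1 / a x)))"
          using C c' h delta by (intro mult_left_mono) (auto simp: f1)
        finally show ?thesis .
      qed
    qed (use False Suc.prems C h delta in auto)
  qed
qed

end

text \<open>A limit of positive multiples of real parts of characteristic functions minus 1. It
  keeps the compensators \<open>exp (t * \<Phi>)\<close> bounded by 1 for
  \<open>t \<ge> 0\<close>.\<close>

lemma Re_levy_exponent: "Re (levy_exponent s2 b Lv \<theta>) \<le> 0"
proof (rule tendsto_upperbound[OF tendsto_Re[OF step_char]])
  show "\<forall>\<^sub>F n in sequentially. Re (complex_of_real (a n) * ((\<integral>u. iexp (\<theta> * u) \<partial>S n) - 1)) \<le> 0"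
  proof (rule always_eventually, rule allI)
    fix n
    have "cmod (\<integral>u. iexp (\<theta> * u) \<partial>S n) \<le> (\<integral>u. cmod (iexp (\<theta> * u)) \<partial>S n)" by (rule integral_norm_bound)
    then have "cmod (\<integral>u. iexp (\<theta> * u) \<partial>S n) \<le> 1" by simp
    then have "Re (\<integral>u. iexp (\<theta> * u) \<partial>S n) \<le> 1" using complex_Re_le_cmod order_trans by blast
    then show "Re (complex_of_real (a n) * ((\<integral>u. iexp (\<theta> * u) \<partial>S n) - 1)) \<le> 0"
      using a_pos[of n] by (simp add: mult_le_0_iff)
  qed
qed simp

context
  fixes x0 :: nat and \<epsilon> \<delta> h \<theta> :: real and \<Phi> :: complex
  assumes st: "\<And>z. z \<ge> 1 \<Longrightarrow> z * z \<ge> x0 \<Longrightarrow> cmod ((\<integral>u. iexp (\<theta> * u) \<partial>S z) * exp (- \<Phi> / complex_of_real (a z)) - 1) \<le> \<epsilon> / a z"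
    and dl: "\<And>z. z \<ge> 1 \<Longrightarrow> z * z \<ge> x0 \<Longrightarrow> 1 / a z \<le> \<delta>"
    and Re: "Re \<Phi> \<le> 0" and eps: "\<epsilon> \<ge> 0" and delta: "\<delta> \<ge> 0" and h: "h > 0"
begin

text \<open>The integrand would be a martingale if a step from \<open>x\<close> had characteristic
  function \<open>exp (\<Phi> / a x)\<close>. Each step costs at most
  \<open>\<epsilon> / a x\<close>, and the clock sums these costs. Because of the overshoot the
  exponent \<open>h - c - clk ys x\<close> can go down to \<open>- \<delta>\<close>, where the
  compensator is still bounded by \<open>exp (\<delta> * \<bar>Re \<Phi>\<bar>)\<close>.\<close>

lemma run_char:
  "x \<ge> 1 \<Longrightarrow> 0 \<le> c \<Longrightarrow> c \<le> h + \<delta> \<Longrightarrow>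
     cmod ((\<integral>ys. iexp (\<theta> * lr x (fin x ys)) * exp (complex_of_real (h - c - clk ys x) * \<Phi>) \<partial>run k h x0 c x)
        - exp (complex_of_real (h - c) * \<Phi>)) \<le> \<epsilon> * (h + \<delta> - c)"
proof (induction k arbitrary: c x)
  case 0
  then show ?case using eps by simp
next
  case (Suc k)
  show ?case
  proof (cases "h \<le> c \<or> x * x < x0")
    case True
    then have "run (Suc k) h x0 c x = return_pmf []" by auto
    then show ?thesis using eps Suc.prems by simp
  next
    case False
    define c' where "c' = c + 1 / a x"
    have c': "c' \<le> h + \<delta>" "0 \<le> c'" using dl[OF Suc.prems(1)] False Suc.prems a_pos[of x] unfolding c'_def
      by (linarith, simp add: less_imp_le)
    define F where "F c x ys = iexp (\<theta> * lr x (fin x ys)) * exp (complex_of_real (h - c - clk ys x) * \<Phi>)" for c x ys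
    define G where "G y = (\<integral>ys. F c' y ys \<partial>run k h x0 c' y)" for y
    have FB: "cmod (F c y ys) \<le> exp (\<delta> * \<bar>Re \<Phi>\<bar>)" if "c + clk ys y \<le> h + \<delta>" for c y ys
    proof -
      have "- \<delta> \<le> h - c - clk ys y" using that by linarith
      then have "(h - c - clk ys y) * Re \<Phi> \<le> - \<delta> * Re \<Phi>" using Re by (rule mult_right_mono_neg)
      then show ?thesis using Re by (simp add: F_def norm_mult)
    qed
    have FC: "F c x (y # ys) = iexp (\<theta> * lr x y) * F c' y ys" for y ys
    proof -
      have "\<theta> * lr x (fin y ys) = \<theta> * lr x y + \<theta> * lr y (fin y ys)" by (simp add: lr_def algebra_simps)
      then show ?thesis by (simp add: F_def c'_def exp_add algebra_simps)
    qed
    have FB': "cmod (F c' y ys) \<le> exp (\<delta> * \<bar>Re \<Phi>\<bar>)" if "y \<in> set_pmf (K x)" "ys \<in> set_pmf (run k h x0 c' y)" for y ys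
      by (rule FB) (use run_clk[OF dl delta that(2) K_pos[OF that(1)] c'(1)] in simp)
    have "(\<integral>ys. F c x ys \<partial>run (Suc k) h x0 c x) = (\<integral>y. (\<integral>ys. F c x ys \<partial>map_pmf ((#) y) (run k h x0 c' y)) \<partial>K x)"
    proof -
      have "run (Suc k) h x0 c x = bind_pmf (K x) (\<lambda>y. map_pmf ((#) y) (run k h x0 c' y))" using False by (simp add: c'_def)
      then show ?thesis
        by (simp only:) (rule integral_bind_complex[where B = "exp (\<delta> * \<bar>Re \<Phi>\<bar>)"],
            use FB' in \<open>auto simp: FC norm_mult\<close>)
    qed
    also have "\<dots> = (\<integral>y. iexp (\<theta> * lr x y) * G y \<partial>K x)"
      by (simp add: FC G_def)
    finally have E: "(\<integral>ys. F c x ys \<partial>run (Suc k) h x0 c x) = (\<integral>y. iexp (\<theta> * lr x y) * G y \<partial>K x)" .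
    define H where "H = exp (complex_of_real (h - c') * \<Phi>)"
    have Gd: "cmod (G y - H) \<le> \<epsilon> * (h + \<delta> - c')" if "y \<in> set_pmf (K x)" for y
      using Suc.IH[OF K_pos[OF that] c'(2,1)] unfolding G_def F_def H_def .
    have iI: "integrable (K x) (\<lambda>y. iexp (\<theta> * lr x y))" by (rule pmf_integrable_bdd[where B = 1]) simp
    have Gb: "cmod (G y) \<le> \<epsilon> * (h + \<delta> - c') + cmod H" if "y \<in> set_pmf (K x)" for y
      using Gd[OF that] norm_triangle_ineq2[of "G y" H] by linarith
    have iG: "integrable (K x) (\<lambda>y. iexp (\<theta> * lr x y) * G y)"
      by (rule pmf_integrable_bdd[where B = "\<epsilon> * (h + \<delta> - c') + cmod H"]) (use Gb in \<open>simp add: norm_mult\<close>)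
    have "cmod ((\<integral>y. iexp (\<theta> * lr x y) * G y \<partial>K x) - (\<integral>y. iexp (\<theta> * lr x y) \<partial>K x) * H)
       = cmod (\<integral>y. iexp (\<theta> * lr x y) * (G y - H) \<partial>K x)"
      using iI iG by (simp add: right_diff_distrib)
    also have "\<dots> \<le> (\<integral>y. cmod (iexp (\<theta> * lr x y) * (G y - H)) \<partial>K x)" by (rule integral_norm_bound)
    also have "\<dots> \<le> (\<integral>y. \<epsilon> * (h + \<delta> - c') \<partial>K x)"
    proof (rule integral_mono_AE)
      show "integrable (K x) (\<lambda>y. cmod (iexp (\<theta> * lr x y) * (G y - H)))"
        by (rule pmf_integrable_bdd[where B = "\<epsilon> * (h + \<delta> - c')"]) (use Gd in \<open>simp add: norm_mult\<close>)
      show "AE y in K x. cmod (iexp (\<theta> * lr x y) * (G y - H)) \<le> \<epsilon> * (h + \<delta> - c')"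
        using Gd by (simp add: AE_measure_pmf_iff norm_mult)
    qed simp
    finally have 1: "cmod ((\<integral>y. iexp (\<theta> * lr x y) * G y \<partial>K x) - (\<integral>y. iexp (\<theta> * lr x y) \<partial>K x) * H) \<le> \<epsilon> * (h + \<delta> - c')" by simp
    have K_S: "(\<integral>y. iexp (\<theta> * lr x y) \<partial>K x) = (\<integral>u. iexp (\<theta> * u) \<partial>S x)" by (simp add: S_def lr_def)
    define H0 where "H0 = exp (complex_of_real (h - c) * \<Phi>)"
    have HH: "H = H0 * exp (- \<Phi> / complex_of_real (a x))"
      unfolding H_def H0_def exp_add[symmetric] by (rule arg_cong[where f = exp]) (simp add: c'_def algebra_simps)
    have "cmod ((\<integral>u. iexp (\<theta> * u) \<partial>S x) * H - H0) = cmod H0 * cmod ((\<integral>u. iexp (\<theta> * u) \<partial>S x) * exp (- \<Phi> / complex_of_real (a x)) - 1)"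
      unfolding HH norm_mult[symmetric] by (simp add: algebra_simps)
    also have "\<dots> \<le> 1 * (\<epsilon> / a x)"
    proof (rule mult_mono)
      show "cmod H0 \<le> 1" using False Re by (simp add: H0_def mult_le_0_iff)
      show "cmod ((\<integral>u. iexp (\<theta> * u) \<partial>S x) * exp (- \<Phi> / complex_of_real (a x)) - 1) \<le> \<epsilon> / a x"
        by (rule st) (use False Suc.prems in auto)
    qed auto
    finally have 2: "cmod ((\<integral>u. iexp (\<theta> * u) \<partial>S x) * H - H0) \<le> \<epsilon> / a x" by simp
    have "cmod ((\<integral>ys. F c x ys \<partial>run (Suc k) h x0 c x) - H0) \<le> \<epsilon> * (h + \<delta> - c') + \<epsilon> / a x"
      using norm_triangle_ineq[of "(\<integral>y. iexp (\<theta> * lr x y) * G y \<partial>K x) - (\<integral>y. iexp (\<theta> * lr x y) \<partial>K x) * H" "(\<integral>u. iexp (\<theta> * u) \<partial>S x) * H - H0"]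
        1 2 unfolding E K_S by simp
    also have "\<dots> = \<epsilon> * (h + \<delta> - c)" by (simp add: c'_def algebra_simps)
    finally show ?thesis unfolding F_def H0_def .
  qed
qed

end

text \<open>A supermartingale with initial value 1: the factor \<open>exp (c0 / a x)\<close>
  contributed by the clock is compensated by the decay of the exponential moment of the
  step.\<close>

lemma run_exp:
  assumes st: "\<And>z. z \<ge> 1 \<Longrightarrow> z * z \<ge> x0 \<Longrightarrow> (\<integral>u. exp (\<beta> * u) \<partial>S z) \<le> exp (- c0 / a z)"
  shows "x \<ge> 1 \<Longrightarrow> (\<integral>\<^sup>+ys. ennreal (exp (\<beta> * lr x (fin x ys) + c0 * clk ys x)) \<partial>run k h x0 c x) \<le> 1"
proof (induction k arbitrary: c x)
  case (Suc k)
  show ?case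
  proof (cases "h \<le> c \<or> x * x < x0")
    case True
    then have "run (Suc k) h x0 c x = return_pmf []" by auto
    then show ?thesis by simp
  next
    case False
    have eq: "exp (\<beta> * lr x (fin y ys) + c0 * clk (y # ys) x) = exp (\<beta> * lr x y + c0 / a x) * exp (\<beta> * lr y (fin y ys) + c0 * clk ys y)" for y ys
      unfolding exp_add[symmetric] by (rule arg_cong[where f = exp]) (simp add: lr_def algebra_simps)
    have "(\<integral>\<^sup>+ys. ennreal (exp (\<beta> * lr x (fin x ys) + c0 * clk ys x)) \<partial>run (Suc k) h x0 c x)
      = (\<integral>\<^sup>+y. ennreal (exp (\<beta> * lr x y + c0 / a x)) * (\<integral>\<^sup>+ys. ennreal (exp (\<beta> * lr y (fin y ys) + c0 * clk ys y)) \<partial>run k h x0 (c + 1 / a x) y) \<partial>K x)"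
      using False by (simp add: eq ennreal_mult nn_integral_cmult del: clk.simps)
    also have "\<dots> \<le> (\<integral>\<^sup>+y. ennreal (exp (\<beta> * lr x y + c0 / a x)) * 1 \<partial>K x)"
      by (rule nn_integral_mono_AE, unfold AE_measure_pmf_iff, intro ballI mult_left_mono Suc.IH K_pos) auto
    also have "\<dots> = (\<integral>\<^sup>+y. ennreal (exp (c0 / a x)) * ennreal (exp (\<beta> * lr x y)) \<partial>K x)"
      by (simp add: exp_add ennreal_mult mult.commute)
    also have "\<dots> = ennreal (exp (c0 / a x)) * (\<integral>\<^sup>+y. ennreal (exp (\<beta> * lr x y)) \<partial>K x)" by (simp add: nn_integral_cmult)
    also have "(\<integral>\<^sup>+y. ennreal (exp (\<beta> * lr x y)) \<partial>K x) = (\<integral>\<^sup>+u. ennreal (exp (\<beta> * u)) \<partial>S x)" by (simp add: S_def lr_def)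
    also have "\<dots> = ennreal (\<integral>u. exp (\<beta> * u) \<partial>S x)" by (rule nn_integral_eq_integral[OF S_exp_int[OF Suc.prems]]) simp
    also have "\<dots> \<le> ennreal (exp (- c0 / a x))" by (rule ennreal_leI, rule st) (use False Suc.prems in auto)
    also have "ennreal (exp (c0 / a x)) * ennreal (exp (- c0 / a x)) = 1"
      by (simp add: ennreal_mult[symmetric] exp_add[symmetric])
    finally show ?thesis by (simp add: mult_left_mono)
  qed
qed simp

text \<open>Induction instead of optional stopping, with the potential
  \<open>x powr \<beta> + CV * M\<close>, where \<open>M\<close> counts the steps still observed: a
  step raises the first term by at most \<open>CV\<close> in mean, and above the level
  \<open>v\<close> the bound is at least 1 anyway.\<close>

lemma max_inequality:
  assumes CV: "CV \<ge> 0" "\<And>n. n \<ge> 1 \<Longrightarrow> (\<integral>k. real k powr \<beta> \<partial>K n) \<le> real n powr \<beta> + CV" and v: "v > 0"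
  shows "x \<ge> 1 \<Longrightarrow> measure_pmf.prob (traj N x) {ys. \<exists>y\<in>set (take M ys). real y > v} \<le> (real x powr \<beta> + CV * real M) / v powr \<beta>"
proof (induction N arbitrary: x M)
  case 0
  then show ?case using CV by simp
next
  case (Suc N)
  have vp: "v powr \<beta> > 0" using v by simp
  show ?case
  proof (cases M)
    case 0 then show ?thesis by simp
  next
    case M: (Suc M')
    have ik: "integrable (K x) (\<lambda>k. real k powr \<beta>)" by (rule powr_moment[OF Suc.prems])
    have "measure_pmf.prob (traj (Suc N) x) {ys. \<exists>y\<in>set (take M ys). real y > v}
      = (\<integral>y. measure_pmf.prob (traj N y) ((#) y -` {ys. \<exists>y\<in>set (take M ys). real y > v}) \<partial>K x)"
      by (simp add: prob_bind_pmf)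
    also have "\<dots> \<le> (\<integral>y. (real y powr \<beta> + CV * real M') / v powr \<beta> \<partial>K x)"
    proof (rule integral_mono_AE)
      show "integrable (K x) (\<lambda>y. measure_pmf.prob (traj N y) ((#) y -` {ys. \<exists>y\<in>set (take M ys). real y > v}))"
        by (rule pmf_integrable_bdd[where B = 1]) simp
      show "integrable (K x) (\<lambda>y. (real y powr \<beta> + CV * real M') / v powr \<beta>)" using ik by auto
      have "measure_pmf.prob (traj N y) ((#) y -` {ys. \<exists>y\<in>set (take M ys). real y > v}) \<le> (real y powr \<beta> + CV * real M') / v powr \<beta>"
        if y: "y \<in> set_pmf (K x)" for y
      proof (cases "real y > v")
        case True
        have "v powr \<beta> \<le> real y powr \<beta>" using True v \<beta>(3) by (intro powr_mono2) auto
        then have "1 \<le> real y powr \<beta> / v powr \<beta>" using vp by simp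
        also have "\<dots> \<le> (real y powr \<beta> + CV * real M') / v powr \<beta>" using CV by (intro divide_right_mono) auto
        finally show ?thesis using measure_pmf.prob_le_1 order_trans by blast
      next
        case False
        then have "(#) y -` {ys. \<exists>y\<in>set (take M ys). real y > v} = {ys. \<exists>y\<in>set (take M' ys). real y > v}"
          by (auto simp: M)
        then show ?thesis using Suc.IH[OF K_pos[OF y], of M'] by simp
      qed
      then show "AE y in K x. measure_pmf.prob (traj N y) ((#) y -` {ys. \<exists>y\<in>set (take M ys). real y > v}) \<le> (real y powr \<beta> + CV * real M') / v powr \<beta>"
        by (simp add: AE_measure_pmf_iff)
    qed
    also have "\<dots> = ((\<integral>y. real y powr \<beta> \<partial>K x) + CV * real M') / v powr \<beta>" using ik by simp
    also have "\<dots> \<le> (real x powr \<beta> + CV * real M) / v powr \<beta>"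
      using CV(2)[OF Suc.prems] vp by (intro divide_right_mono) (auto simp: M algebra_simps)
    finally show ?thesis .
  qed
qed

end

section \<open>Cells and quantised increments\<close>

text \<open>Rounding up, for positive \<open>q\<close>: the represented value
  \<open>o' + q * quant o' q d\<close> is at least \<open>d\<close> and exceeds it by less than
  \<open>q\<close>. The offset makes it possible to keep atoms off the lattice.\<close>

definition quant :: "real \<Rightarrow> real \<Rightarrow> real \<Rightarrow> int" where "quant o' q d = \<lceil>(d - o') / q\<rceil>"

lemma quant_eq: "q > 0 \<Longrightarrow> quant o' q d = z \<longleftrightarrow> o' + q * (real_of_int z - 1) < d \<and> d \<le> o' + q * real_of_int z"
  unfolding quant_def ceiling_eq_iff by (auto simp: field_simps)

lemma quant_set: "q > 0 \<Longrightarrow> {d. quant o' q d = z} = {o' + q * (real_of_int z - 1)<..o' + q * real_of_int z}"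
  by (auto simp: quant_eq)

lemma quant_measurable[measurable]: "quant o' q \<in> measurable borel (count_space UNIV)"
  unfolding quant_def by measurable

primrec quants :: "real \<Rightarrow> real \<Rightarrow> nat list list \<Rightarrow> nat \<Rightarrow> int list" where
  "quants o' q [] x = []"
| "quants o' q (ys # cs) x = quant o' q (lr x (fin x ys)) # quants o' q cs (fin x ys)"

text \<open>The reason for abandoning cells at the square root of the start: the states above it
  still tend to infinity with the start, so the one-step asymptotics hold uniformly there, whereas a
  bounded displacement of the logarithm cannot lead below it when the start is large.\<close>

lemma eventually_low:
  assumes "\<forall>\<^sub>F n in sequentially. P n"
  shows "\<forall>\<^sub>F x in sequentially. \<forall>z. z * z \<ge> x \<longrightarrow> P z"
proof -
  obtain n0 where n0: "\<And>n. n \<ge> n0 \<Longrightarrow> P n" using assms by (auto simp: eventually_sequentially)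
  show ?thesis using eventually_ge_at_top[of "n0 * n0"]
  proof eventually_elim
    case (elim x)
    show ?case
    proof (intro allI impI n0)
      fix z assume "x \<le> z * z"
      then have "n0 * n0 \<le> z * z" using elim by simp
      then show "n0 \<le> z" by (metis power2_eq_square power2_nat_le_eq_le)
    qed
  qed
qed

lemma expectation_affine_indicator:
  fixes c d :: real
  shows "(\<integral>x. c + d * indicator A x \<partial>measure_pmf q) = c + d * measure_pmf.prob q A"
proof -
  have "integrable q (\<lambda>x. d * indicator A x)"
    by (rule pmf_integrable_bdd[where B = "\<bar>d\<bar>"]) (auto simp: indicator_def)
  then show ?thesis by simp
qed

context chain_kernel begin

text \<open>A number of steps that a calm cell cannot use up: at states comparable to
  \<open>x\<close> each tick is at least a fixed fraction of \<open>1 / a x\<close>, so the clock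
  would reach the order of \<open>x\<close>, far above \<open>h\<close>. It makes a cell a finite
  recursion.\<close>

definition cap :: "nat \<Rightarrow> nat" where "cap x = nat \<lceil>real x * a x\<rceil>"

definition cell :: "real \<Rightarrow> nat \<Rightarrow> nat list pmf" where "cell h x = run (cap x) h x 0 x"

lemma eventually_inv_a: "\<delta> > 0 \<Longrightarrow> \<forall>\<^sub>F n in sequentially. 1 / a n \<le> \<delta>"
  by (rule eventually_mono[OF order_tendstoD(2)[OF a_inv_lim]]) auto

lemma cell_calm:
  assumes h: "h > 0" and e: "\<epsilon> > 0"
  shows "\<exists>R>0. \<forall>\<^sub>F x in sequentially. measure_pmf.prob (cell h x) {ys. \<not> calm R x ys} \<le> \<epsilon>"
proof -
  define e1 where "e1 = \<epsilon> / (h + 1)"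
  have e1: "e1 > 0" "e1 * (h + 1) = \<epsilon>" using h e by (auto simp: e1_def)
  obtain R where R: "R > 0" "\<forall>\<^sub>F n in sequentially. \<forall>v. (\<integral>u. fcap R (v + u) \<partial>S n) \<le> fcap R v + e1 / a n"
    using fcap_drift_small[OF e1(1)] by blast
  have "\<forall>\<^sub>F x in sequentially. measure_pmf.prob (cell h x) {ys. \<not> calm R x ys} \<le> \<epsilon>"
    using eventually_low[OF R(2)] eventually_low[OF eventually_inv_a[OF zero_less_one]] eventually_ge_at_top[of 1]
  proof eventually_elim
    case (elim x)
    have "measure_pmf.prob (run (cap x) h x 0 x) {ys. \<not> calm R x ys} \<le> fcap R (lr x x) + e1 * (h + 1 - 0)"
      by (rule run_calm) (use elim R h e1 in auto)
    then show ?case using e1(2) by (simp add: cell_def)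
  qed
  then show ?thesis using R(1) by blast
qed

text \<open>\<open>C\<close> is chosen before \<open>h\<close>: a fixed Levy time takes about
  \<open>1 / h\<close> cells, so \<open>C * h\<^sup>2\<close> per cell adds up to order
  \<open>h\<close>. The overshoot allowance is taken equal to \<open>h\<close>, which produces the
  constant \<open>4 * C\<^sup>2\<close>.\<close>

lemma cell_good2:
  assumes \<eta>: "\<eta> > 0"
  shows "\<exists>C\<ge>0. \<forall>h>0. \<forall>\<^sub>F x in sequentially. measure_pmf.prob (cell h x) {ys. \<not> good2 \<eta> x ys} \<le> C * h\<^sup>2"
proof -
  obtain C where C: "C \<ge> 0" "\<forall>\<^sub>F n in sequentially. \<forall>v. (\<integral>u. fcap \<eta> (v + u) \<partial>S n) \<le> fcap \<eta> v + C / a n"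
    using fcap_drift[OF \<eta>] by blast
  have "\<forall>\<^sub>F x in sequentially. measure_pmf.prob (cell h x) {ys. \<not> good2 \<eta> x ys} \<le> 4 * C\<^sup>2 * h\<^sup>2" if h: "h > 0" for h
    using eventually_low[OF C(2)] eventually_low[OF eventually_inv_a[OF h]] eventually_ge_at_top[of 1]
  proof eventually_elim
    case (elim x)
    have "measure_pmf.prob (run (cap x) h x 0 x) {ys. \<not> good2 \<eta> x ys} \<le> (C * (h + h)) * (fcap \<eta> (lr x x) + C * (h + h - 0))"
      by (rule run_good2) (use elim \<eta> h C in auto)
    then show ?case by (simp add: cell_def power2_eq_square algebra_simps)
  qed
  then show ?thesis by (intro exI[of _ "4 * C\<^sup>2"]) simp
qed

lemma cell_clk:
  assumes h: "h > 0" and d: "\<delta> > 0"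
  shows "\<forall>\<^sub>F x in sequentially. \<forall>ys\<in>set_pmf (cell h x). clk ys x \<le> h + \<delta>"
  using eventually_low[OF eventually_inv_a[OF d]] eventually_ge_at_top[of 1]
proof eventually_elim
  case (elim x)
  show ?case
  proof
    fix ys assume "ys \<in> set_pmf (cell h x)"
    then have "0 + clk ys x \<le> h + \<delta>" unfolding cell_def by (intro run_clk) (use elim h d in auto)
    then show "clk ys x \<le> h + \<delta>" by simp
  qed
qed

text \<open>In a calm cell all states are within the factor \<open>c = exp R\<close> of the start,
  so for large \<open>x\<close> it neither falls below the square root of \<open>x\<close> nor runs
  out of steps. Here the window \<open>R\<close> is large, depending on \<epsilon>, unlike the small
  \<eta> of \<open>cell_good2\<close>.\<close>

lemma cell_complete:
  assumes h: "h > 0" and e: "\<epsilon> > 0"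
  shows "\<forall>\<^sub>F x in sequentially. measure_pmf.prob (cell h x) {ys. clk ys x < h} \<le> \<epsilon>"
proof -
  obtain R where R: "R > 0" "\<forall>\<^sub>F x in sequentially. measure_pmf.prob (cell h x) {ys. \<not> calm R x ys} \<le> \<epsilon>"
    using cell_calm[OF h e] by blast
  define c where "c = exp R"
  have c: "c \<ge> 1" using R by (simp add: c_def)
  obtain n0 where n0: "\<And>n m. n \<ge> n0 \<Longrightarrow> real n / c \<le> real m \<Longrightarrow> real m \<le> c * real n \<Longrightarrow> a m / a n \<le> exp 1 * (real m / real n) powr \<gamma>"
    using a_ratio[OF c, of 1] by auto
  define A where "A = exp 1 * c powr \<gamma>"
  have A: "A > 0" using c by (simp add: A_def)
  show ?thesis
    using R(2) eventually_ge_at_top[of n0] eventually_ge_at_top[of "nat \<lceil>c * c\<rceil>"] eventually_ge_at_top[of "nat \<lceil>A * h\<rceil>"] eventually_ge_at_top[of 1]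
  proof eventually_elim
    case (elim x)
    \<comment> \<open>Two of these thresholds exclude the two ways of stopping early:
      \<open>c * c\<close> the descent to a low state, \<open>A * h\<close> the exhaustion of the
      steps.\<close>
    have x: "real x \<ge> c * c" "real x \<ge> A * h" "real x \<ge> 1" using elim by linarith+
    have sub: "\<not> calm R x ys" if ys: "ys \<in> set_pmf (cell h x)" "clk ys x < h" for ys
    proof
      assume cm: "calm R x ys"
      have pos: "\<forall>y\<in>set (x # ys). y \<ge> 1" using run_pos[OF ys(1)[unfolded cell_def]] elim by blast
      have rng: "real x / c \<le> real z \<and> real z \<le> c * real x" if z: "z \<in> set (x # ys)" for z
      proof -
        have "\<bar>lr x z\<bar> \<le> R" using z cm R by (auto simp: calm_def)
        then have l: "ln (real z) \<le> ln (real x) + R" "ln (real x) \<le> ln (real z) + R" by (auto simp: lr_def)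
        have z1: "real z > 0" using pos z by force
        have "exp (ln (real z)) \<le> exp (ln (real x) + R)" "exp (ln (real x)) \<le> exp (ln (real z) + R)"
          using l by simp_all
        then have "real z \<le> real x * c" "real x \<le> real z * c" using z1 x by (simp_all add: exp_add c_def)
        then show ?thesis using c by (simp add: field_simps)
      qed
      from run_incomplete[OF ys(1)[unfolded cell_def]] ys(2)
      have "fin x ys * fin x ys < x \<or> length ys = cap x" by simp
      then show False
      proof
        assume f: "fin x ys * fin x ys < x"
        have "fin x ys \<in> set (x # ys)" by (simp add: fin_def)
        then have r: "real x / c \<le> real (fin x ys)" using rng by blast
        have "real x / c * (real x / c) \<le> real (fin x ys) * real (fin x ys)"
          using r x c by (intro mult_mono) auto
        moreover have "real x / c * (real x / c) = real x * (real x / (c * c))" by simp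
        moreover have "real x * 1 \<le> real x * (real x / (c * c))" using x c by (intro mult_left_mono) auto
        moreover have "real (fin x ys) * real (fin x ys) < real x" using f by (metis of_nat_less_iff of_nat_mult)
        ultimately show False by linarith
      next
        assume len: "length ys = cap x"
        have "a z \<le> A * a x" if z: "z \<in> set (x # ys)" for z
        proof -
          have "a z / a x \<le> exp 1 * (real z / real x) powr \<gamma>" using n0[of x z] elim rng[OF z] by blast
          also have "\<dots> \<le> exp 1 * c powr \<gamma>"
            using rng[OF z] x gamma_pos by (intro mult_left_mono powr_mono2) (auto simp: field_simps)
          finally show ?thesis using a_pos[of x] by (simp add: A_def field_simps)
        qed
        then have "real (length ys) / (A * a x) \<le> clk ys x" by (intro clk_ge) (use A a_pos in auto)
        moreover have "real (length ys) \<ge> real x * a x" unfolding len cap_def by linarith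
        then have "real x * a x / (A * a x) \<le> real (length ys) / (A * a x)"
          using A a_pos[of x] by (intro divide_right_mono) auto
        moreover have "real x * a x / (A * a x) = real x / A" using a_pos[of x] by simp
        moreover have "real x / A \<ge> h" using x A by (simp add: field_simps)
        ultimately show False using ys(2) by linarith
      qed
    qed
    have "measure_pmf.prob (cell h x) {ys. clk ys x < h} \<le> measure_pmf.prob (cell h x) {ys. \<not> calm R x ys}"
      by (rule measure_pmf.finite_measure_mono_AE) (use sub in \<open>auto simp: AE_measure_pmf_iff\<close>)
    then show ?case using elim(1) by linarith
  qed
qed

lemma cell_char:
  assumes h: "h > 0"
  shows "(\<lambda>x. \<integral>ys. iexp (\<theta> * lr x (fin x ys)) \<partial>cell h x) \<longlonglongrightarrow> exp (complex_of_real h * levy_exponent s2 b Lv \<theta>)"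
proof (rule tendstoI)
  fix e0 :: real assume e0: "e0 > 0"
  define \<Phi> where "\<Phi> = levy_exponent s2 b Lv \<theta>"
  have Re: "Re \<Phi> \<le> 0" unfolding \<Phi>_def by (rule Re_levy_exponent)
  have "isCont (\<lambda>s. exp (complex_of_real s * \<Phi>)) 0" by (intro continuous_intros)
  then obtain d0 where d0: "d0 > 0" "\<And>s. dist s 0 < d0 \<Longrightarrow> dist (exp (complex_of_real s * \<Phi>)) 1 < e0 / 8"
    using e0 unfolding continuous_at_eps_delta by (force dest: spec[of _ "e0/8"])
  define \<delta> where "\<delta> = min 1 (d0 / 2)"
  have \<delta>: "\<delta> > 0" "\<delta> < d0" "\<delta> \<le> 1" using d0 by (auto simp: \<delta>_def)
  define \<epsilon> where "\<epsilon> = e0 / (8 * (h + 1))"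
  have \<epsilon>: "\<epsilon> > 0" "\<epsilon> * (h + 1) = e0 / 8" using e0 h by (auto simp: \<epsilon>_def field_simps)
  have "e0 / 8 > 0" using e0 by simp
  show "\<forall>\<^sub>F x in sequentially. dist (\<integral>ys. iexp (\<theta> * lr x (fin x ys)) \<partial>cell h x) (exp (complex_of_real h * levy_exponent s2 b Lv \<theta>)) < e0"
    using eventually_low[OF step_char_mult[OF \<epsilon>(1), of \<theta>]] eventually_low[OF eventually_inv_a[OF \<delta>(1)]]
      cell_complete[OF h \<open>e0 / 8 > 0\<close>] cell_clk[OF h \<delta>(1)] eventually_ge_at_top[of 1]
  proof eventually_elim
    case (elim x)
    \<comment> \<open>The discrepancy between the time \<open>h\<close> and the clock of the cell.
      It is close to 1 on complete cells, which overshoot by at most \<delta>, and has modulus at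
      most 1 on the rare incomplete ones.\<close>
    define J where "J ys = exp (complex_of_real (h - clk ys x) * \<Phi>)" for ys
    define I where "I ys = iexp (\<theta> * lr x (fin x ys))" for ys
    have 1: "cmod ((\<integral>ys. I ys * J ys \<partial>cell h x) - exp (complex_of_real h * \<Phi>)) \<le> \<epsilon> * (h + \<delta>)"
      using run_char[of x \<theta> \<Phi> \<epsilon> \<delta> h x 0 "cap x"] elim Re \<epsilon> \<delta> h
      by (simp add: I_def J_def cell_def \<Phi>_def)
    have Jd: "cmod (1 - J ys) \<le> e0 / 8 + 2 * indicator {ys. clk ys x < h} ys" if ys: "ys \<in> set_pmf (cell h x)" for ys
    proof (cases "clk ys x < h")
      case True
      have "cmod (J ys) \<le> 1" using True Re by (simp add: J_def mult_le_0_iff)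
      then have "cmod (1 - J ys) \<le> 2" using norm_triangle_ineq4[of 1 "J ys"] by simp
      then show ?thesis using True e0 by simp
    next
      case False
      then have "dist (h - clk ys x) 0 < d0" using elim(4) ys \<delta> by (auto simp: dist_real_def)
      from d0(2)[OF this] have "cmod (1 - J ys) < e0 / 8" by (simp add: J_def dist_norm norm_minus_commute)
      then show ?thesis by (simp add: indicator_def)
    qed
    have Jb: "cmod (1 - J ys) \<le> e0 / 8 + 2" if "ys \<in> set_pmf (cell h x)" for ys
      proof -
      have "indicator {ys. clk ys x < h} ys \<le> (1::real)" by (simp add: indicator_def)
      then show ?thesis using Jd[OF that] by linarith
    qed
    have iI: "integrable (cell h x) I" by (rule pmf_integrable_bdd[where B = 1]) (simp add: I_def)
    have iID: "integrable (cell h x) (\<lambda>ys. I ys * (1 - J ys))"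
      by (rule pmf_integrable_bdd[where B = "e0 / 8 + 2"]) (use Jb in \<open>simp add: I_def norm_mult\<close>)
    have iIJ: "integrable (cell h x) (\<lambda>ys. I ys * J ys)"
      using Bochner_Integration.integrable_diff[OF iI iID] by (simp add: algebra_simps)
    have "cmod ((\<integral>ys. I ys \<partial>cell h x) - (\<integral>ys. I ys * J ys \<partial>cell h x)) = cmod (\<integral>ys. I ys * (1 - J ys) \<partial>cell h x)"
      using iI iIJ by (simp add: right_diff_distrib)
    also have "\<dots> \<le> (\<integral>ys. cmod (I ys * (1 - J ys)) \<partial>cell h x)" by (rule integral_norm_bound)
    also have "\<dots> \<le> (\<integral>ys. e0 / 8 + 2 * indicator {ys. clk ys x < h} ys \<partial>cell h x)"
    proof (rule integral_mono_AE)
      show "integrable (cell h x) (\<lambda>ys. cmod (I ys * (1 - J ys)))" using iID by (rule integrable_norm)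
      show "integrable (cell h x) (\<lambda>ys. e0 / 8 + 2 * indicator {ys. clk ys x < h} ys)"
        by (rule pmf_integrable_bdd[where B = "e0 / 8 + 2"]) (use e0 in \<open>auto simp: indicator_def\<close>)
      show "AE ys in cell h x. cmod (I ys * (1 - J ys)) \<le> e0 / 8 + 2 * indicator {ys. clk ys x < h} ys"
        using Jd by (simp add: AE_measure_pmf_iff I_def norm_mult)
    qed
    also have "\<dots> = e0 / 8 + 2 * measure_pmf.prob (cell h x) {ys. clk ys x < h}"
      by (rule expectation_affine_indicator)
    also have "\<dots> \<le> e0 / 8 + 2 * (e0 / 8)" using elim(3) by simp
    finally have 2: "cmod ((\<integral>ys. I ys \<partial>cell h x) - (\<integral>ys. I ys * J ys \<partial>cell h x)) \<le> 3 * e0 / 8" by simp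
    have "\<epsilon> * (h + \<delta>) \<le> \<epsilon> * (h + 1)" using \<epsilon> \<delta> by (intro mult_left_mono) auto
    then have "cmod ((\<integral>ys. I ys \<partial>cell h x) - exp (complex_of_real h * \<Phi>)) < e0"
      using 1 2 \<epsilon>(2) e0 norm_triangle_ineq[of "(\<integral>ys. I ys \<partial>cell h x) - (\<integral>ys. I ys * J ys \<partial>cell h x)" "(\<integral>ys. I ys * J ys \<partial>cell h x) - exp (complex_of_real h * \<Phi>)"]
      by simp
    then show ?case by (simp add: dist_norm I_def \<Phi>_def)
  qed
qed

text \<open>On a complete cell the clock contributes at least \<open>c0 * h\<close> to the exponent
  in \<open>run_exp\<close>; the indicator removes the cells without this gain.\<close>

lemma cell_exp:
  assumes h: "h > 0"
  shows "\<forall>\<^sub>F x in sequentially. (\<integral>\<^sup>+ys. ennreal (exp (\<beta> * lr x (fin x ys))) * indicator {ys. h \<le> clk ys x} ys \<partial>cell h x) \<le> ennreal (exp (- c0 * h))"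
  using eventually_low[OF exp_drift] eventually_ge_at_top[of 1]
proof eventually_elim
  case (elim x)
  have "(\<integral>\<^sup>+ys. ennreal (exp (\<beta> * lr x (fin x ys))) * indicator {ys. h \<le> clk ys x} ys \<partial>cell h x)
    \<le> (\<integral>\<^sup>+ys. ennreal (exp (- c0 * h)) * ennreal (exp (\<beta> * lr x (fin x ys) + c0 * clk ys x)) \<partial>cell h x)"
  proof (rule nn_integral_mono)
    fix ys
    show "ennreal (exp (\<beta> * lr x (fin x ys))) * indicator {ys. h \<le> clk ys x} ys \<le> ennreal (exp (- c0 * h)) * ennreal (exp (\<beta> * lr x (fin x ys) + c0 * clk ys x))"
    proof (cases "h \<le> clk ys x")
      case True
      then have "c0 * h \<le> c0 * clk ys x" using c0 by (simp add: mult_left_mono)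
      then have "exp (\<beta> * lr x (fin x ys)) \<le> exp (- c0 * h) * exp (\<beta> * lr x (fin x ys) + c0 * clk ys x)"
        unfolding exp_add[symmetric] by simp
      then show ?thesis using True by (simp add: ennreal_mult[symmetric] ennreal_leI)
    qed simp
  qed
  also have "\<dots> = ennreal (exp (- c0 * h)) * (\<integral>\<^sup>+ys. ennreal (exp (\<beta> * lr x (fin x ys) + c0 * clk ys x)) \<partial>cell h x)"
    by (rule nn_integral_cmult) simp
  also have "\<dots> \<le> ennreal (exp (- c0 * h)) * 1"
    unfolding cell_def by (intro mult_left_mono run_exp) (use elim in auto)
  finally show ?case by simp
qed

section \<open>Weak limits of the cell increments\<close>

definition cell_law :: "real \<Rightarrow> nat \<Rightarrow> real measure" where
  "cell_law h x = distr (measure_pmf (cell h x)) borel (\<lambda>ys. lr x (fin x ys))"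

lemma cell_law_rd: "real_distribution (cell_law h x)"
  unfolding cell_law_def real_distribution_def real_distribution_axioms_def
  by (auto intro!: measure_pmf.prob_space_distr)

context
  fixes \<nu> :: "real measure" and h :: real
  assumes nu: "real_distribution \<nu>" and h: "h > 0"
    and ch: "\<And>\<theta>. char \<nu> \<theta> = exp (complex_of_real h * levy_exponent s2 b Lv \<theta>)"
begin

lemma cell_weak: "weak_conv_m (cell_law h) \<nu>"
proof (rule levy_continuity[OF cell_law_rd nu])
  fix t
  have "char (cell_law h x) t = (\<integral>ys. iexp (t * lr x (fin x ys)) \<partial>cell h x)" for x
    unfolding char_def cell_law_def by (subst integral_distr) auto
  then show "(\<lambda>x. char (cell_law h x) t) \<longlonglongrightarrow> char \<nu> t" using cell_char[OF h, of t] ch[of t] by simp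
qed

text \<open>With no atom of the limit on the lattice, the quantisation intervals are continuity
  sets.\<close>

lemma cell_quant:
  assumes q: "q > 0" and o': "\<And>z::int. measure \<nu> {o' + q * real_of_int z} = 0"
  shows "(\<lambda>x. measure_pmf.prob (cell h x) {ys. quant o' q (lr x (fin x ys)) = z}) \<longlonglongrightarrow> measure \<nu> {d. quant o' q d = z}"
proof -
  interpret N: real_distribution \<nu> by (rule nu)
  let ?A = "{d. quant o' q d = z}"
  have A: "?A = {o' + q * (real_of_int z - 1)<..o' + q * real_of_int z}" using quant_set[OF q] .
  have "closure ?A \<subseteq> {o' + q * (real_of_int z - 1)..o' + q * real_of_int z}" unfolding A by (rule closure_minimal) auto
  moreover have "{o' + q * (real_of_int z - 1)<..<o' + q * real_of_int z} \<subseteq> interior ?A" unfolding A by (rule interior_maximal) auto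
  ultimately have fr: "frontier ?A \<subseteq> {o' + q * (real_of_int z - 1)} \<union> {o' + q * real_of_int z}"
    unfolding frontier_def by force
  have "measure \<nu> {o' + q * (real_of_int z - 1)} = 0" using o'[of "z - 1"] by simp
  then have "{o' + q * (real_of_int z - 1)} \<union> {o' + q * real_of_int z} \<in> null_sets \<nu>" using o'[of z]
    by (intro null_sets.Un) (auto simp: null_sets_def N.emeasure_eq_measure)
  then have "emeasure \<nu> (frontier ?A) = 0" using fr emeasure_mono[OF fr, of \<nu>] by (auto simp: null_sets_def)
  then have "(\<lambda>x. measure (cell_law h x) ?A) \<longlonglongrightarrow> measure \<nu> ?A"
    by (intro weak_conv_imp_continuity_set_conv[OF cell_law_rd nu cell_weak]) (simp_all add: A)
  moreover have "measure (cell_law h x) ?A = measure_pmf.prob (cell h x) {ys. quant o' q (lr x (fin x ys)) = z}" for x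
    unfolding cell_law_def A by (subst measure_distr) (auto simp: quant_eq[OF q] vimage_def)
  ultimately show ?thesis by simp
qed

text \<open>The exponential moment is inherited from the chain: truncated at \<open>k\<close> the
  exponential is bounded and continuous, so the weak limit applies, and the bound survives the
  monotone limit in \<open>k\<close>. Incomplete cells cost at most \<open>k\<close> times their
  probability, which is small for each fixed \<open>k\<close>.\<close>

lemma nu_exp: "(\<integral>\<^sup>+x. ennreal (exp (\<beta> * x)) \<partial>\<nu>) \<le> ennreal (exp (- c0 * h))"
proof -
  interpret N: real_distribution \<nu> by (rule nu)
  define f :: "nat \<Rightarrow> real \<Rightarrow> real" where "f k x = min (exp (\<beta> * x)) (real k)" for k x
  have fb: "0 \<le> f k x" "f k x \<le> real k" for k x by (auto simp: f_def)
  have fm[measurable]: "f k \<in> borel_measurable borel" for k unfolding f_def by measurable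
  have "(\<integral>\<^sup>+x. ennreal (f k x) \<partial>\<nu>) \<le> ennreal (exp (- c0 * h))" for k
  proof -
    have L: "(\<lambda>x. \<integral>u. f k u \<partial>cell_law h x) \<longlonglongrightarrow> (\<integral>u. f k u \<partial>\<nu>)"
      by (rule weak_conv_imp_integral_bdd_continuous_conv[OF cell_law_rd nu cell_weak, where B = "real k"])
         (auto simp: f_def intro!: continuous_intros)
    have "(\<integral>u. f k u \<partial>\<nu>) \<le> exp (- c0 * h) + \<epsilon>" if \<epsilon>: "\<epsilon> > 0" for \<epsilon>
    proof (rule tendsto_upperbound[OF L])
      define e1 where "e1 = \<epsilon> / (real k + 1)"
      have e1: "e1 > 0" "real k * e1 \<le> \<epsilon>" using \<epsilon> by (auto simp: e1_def field_simps)
      show "\<forall>\<^sub>F x in sequentially. (\<integral>u. f k u \<partial>cell_law h x) \<le> exp (- c0 * h) + \<epsilon>"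
        using cell_exp[OF h] cell_complete[OF h e1(1)]
      proof eventually_elim
        case (elim x)
        define G where "G ys = exp (\<beta> * lr x (fin x ys)) * indicator {ys. h \<le> clk ys x} ys" for ys
        have Gn: "(\<integral>\<^sup>+ys. ennreal (G ys) \<partial>cell h x) \<le> ennreal (exp (- c0 * h))"
          using elim(1) by (simp add: G_def ennreal_mult ennreal_indicator)
        have iG: "integrable (cell h x) G"
          by (rule integrableI_bounded) (use Gn in \<open>auto simp: G_def top_unique less_top[symmetric]\<close>)
        have "ennreal (\<integral>ys. G ys \<partial>cell h x) \<le> ennreal (exp (- c0 * h))"
        proof -
          have "(\<integral>\<^sup>+ys. ennreal (G ys) \<partial>cell h x) = ennreal (\<integral>ys. G ys \<partial>cell h x)"
            by (rule nn_integral_eq_integral[OF iG]) (simp add: G_def)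
          then show ?thesis using Gn by simp
        qed
        then have G1: "(\<integral>ys. G ys \<partial>cell h x) \<le> exp (- c0 * h)" by (simp add: ennreal_le_iff)
        have iI: "integrable (cell h x) (indicator {ys. clk ys x < h} :: _ \<Rightarrow> real)"
          by (rule pmf_integrable_bdd[where B = 1]) (auto simp: indicator_def)
        have "(\<integral>u. f k u \<partial>cell_law h x) = (\<integral>ys. f k (lr x (fin x ys)) \<partial>cell h x)"
          unfolding cell_law_def by (subst integral_distr) auto
        also have "\<dots> \<le> (\<integral>ys. G ys + real k * indicator {ys. clk ys x < h} ys \<partial>cell h x)"
        proof (rule integral_mono)
          show "integrable (cell h x) (\<lambda>ys. f k (lr x (fin x ys)))"
            by (rule pmf_integrable_bdd[where B = "real k"]) (use fb in simp)
          show "integrable (cell h x) (\<lambda>ys. G ys + real k * indicator {ys. clk ys x < h} ys)"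
            using iG iI by auto
          fix ys show "f k (lr x (fin x ys)) \<le> G ys + real k * indicator {ys. clk ys x < h} ys"
            by (cases "clk ys x < h") (auto simp: G_def f_def)
        qed
        also have "\<dots> = (\<integral>ys. G ys \<partial>cell h x) + real k * measure_pmf.prob (cell h x) {ys. clk ys x < h}"
          using iG iI by simp
        also have "\<dots> \<le> exp (- c0 * h) + real k * e1" using G1 elim(2) by (intro add_mono mult_left_mono) auto
        finally show ?case using e1 by linarith
      qed
    qed simp
    then have le: "(\<integral>u. f k u \<partial>\<nu>) \<le> exp (- c0 * h)" by (rule field_le_epsilon)
    have "integrable \<nu> (f k)" by (rule N.integrable_const_bound[where B = "real k"]) (use fb in auto)
    then show ?thesis using le fb by (subst nn_integral_eq_integral) (auto simp: ennreal_leI)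
  qed
  moreover have "(\<lambda>k. \<integral>\<^sup>+x. ennreal (f k x) \<partial>\<nu>) \<longlonglongrightarrow> (\<integral>\<^sup>+x. ennreal (exp (\<beta> * x)) \<partial>\<nu>)"
  proof (rule nn_integral_LIMSEQ)
    show "incseq (\<lambda>k x. ennreal (f k x))" by (auto simp: incseq_def le_fun_def f_def intro!: ennreal_leI)
    fix x
    have "\<forall>\<^sub>F k in sequentially. ennreal (f k x) = ennreal (exp (\<beta> * x))"
      using eventually_ge_at_top[of "nat \<lceil>exp (\<beta> * x)\<rceil>"]
    proof eventually_elim
      case (elim k)
      then have "exp (\<beta> * x) \<le> real k" by linarith
      then show ?case by (simp add: f_def)
    qed
    then show "(\<lambda>k. ennreal (f k x)) \<longlonglongrightarrow> ennreal (exp (\<beta> * x))" by (rule tendsto_eventually)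
  qed measurable
  ultimately show ?thesis by (intro LIMSEQ_le_const2) auto
qed

end

text \<open>A probability has countably many atoms, so only countably many offsets are
  excluded.\<close>

lemma exists_offset:
  assumes nu: "real_distribution \<nu>"
  shows "\<exists>o'\<in>{0..1}. \<forall>z::int. measure \<nu> {o' + q * real_of_int z} = 0"
proof -
  interpret N: real_distribution \<nu> by (rule nu)
  define B where "B = (\<Union>z::int. (\<lambda>t. t - q * real_of_int z) ` {t. measure \<nu> {t} \<noteq> 0})"
  have "countable B" unfolding B_def by (intro countable_UN countable_image N.countable_support) auto
  moreover have "uncountable {0..1::real}" by (simp add: uncountable_closed_interval)
  ultimately obtain o' where o': "o' \<in> {0..1}" "o' \<notin> B" by (meson countable_subset subsetI)
  have "measure \<nu> {o' + q * real_of_int z} = 0" for z :: int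
  proof (rule ccontr)
    assume "measure \<nu> {o' + q * real_of_int z} \<noteq> 0"
    then have "o' \<in> B" unfolding B_def by (intro UN_I[of z] image_eqI[of _ _ "o' + q * real_of_int z"]) auto
    then show False using o' by blast
  qed
  then show ?thesis using o'(1) by blast
qed

section \<open>Chaining cells\<close>

primrec prog :: "nat \<Rightarrow> real \<Rightarrow> nat \<Rightarrow> nat list list pmf" where
  "prog 0 h x = return_pmf []"
| "prog (Suc m) h x = bind_pmf (cell h x) (\<lambda>ys. map_pmf ((#) ys) (prog m h (fin x ys)))"

primrec okc :: "real \<Rightarrow> real \<Rightarrow> real \<Rightarrow> nat list list \<Rightarrow> nat \<Rightarrow> bool" where
  "okc h \<delta> \<eta> [] x \<longleftrightarrow> True"
| "okc h \<delta> \<eta> (ys # cs) x \<longleftrightarrow> h \<le> clk ys x \<and> clk ys x \<le> h + \<delta> \<and> good2 \<eta> x ys \<and> okc h \<delta> \<eta> cs (fin x ys)"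

lemma prog_traj:
  "bind_pmf (prog m h x) (\<lambda>cs. map_pmf (\<lambda>zs. take N (concat cs @ zs)) (traj (N - length (concat cs)) (fin x (concat cs)))) = traj N x"
proof (induction m arbitrary: x N)
  case 0
  then show ?case by (simp add: bind_return_pmf traj_take0)
next
  case (Suc m)
  have [simp]: "N - (k + min j (N - k)) = N - (k + j)" for k j by arith
  have "bind_pmf (prog (Suc m) h x) (\<lambda>cs. map_pmf (\<lambda>zs. take N (concat cs @ zs)) (traj (N - length (concat cs)) (fin x (concat cs))))
    = bind_pmf (cell h x) (\<lambda>ys. map_pmf (\<lambda>zs. take N (ys @ zs)) (bind_pmf (prog m h (fin x ys))
        (\<lambda>cs. map_pmf (\<lambda>zs. take (N - length ys) (concat cs @ zs)) (traj (N - length ys - length (concat cs)) (fin (fin x ys) (concat cs))))))"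
    by (simp add: bind_assoc_pmf bind_map_pmf map_bind_pmf map_pmf_comp fin_append diff_diff_left)
  also have "\<dots> = traj N x" unfolding Suc.IH cell_def by (rule run_traj)
  finally show ?case .
qed

lemma fin_lower:
  assumes x: "x \<ge> 1" and f: "fin x ys \<ge> 1" and q: "q > 0" "quant o' q (lr x (fin x ys)) \<ge> z"
  shows "real (fin x ys) \<ge> real x * exp (o' + q * (real_of_int z - 1))"
proof -
  have "o' + q * (real_of_int z - 1) \<le> o' + q * (real_of_int (quant o' q (lr x (fin x ys))) - 1)"
    using q by (intro add_left_mono mult_left_mono) auto
  also have "\<dots> \<le> lr x (fin x ys)" using quant_eq[OF q(1), of o' "lr x (fin x ys)" "quant o' q (lr x (fin x ys))"] by simp
  finally have "ln (real x) + (o' + q * (real_of_int z - 1)) \<le> ln (real (fin x ys))" by (simp add: lr_def)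
  then have "exp (ln (real x) + (o' + q * (real_of_int z - 1))) \<le> exp (ln (real (fin x ys)))" by simp
  then show ?thesis using x f by (simp add: exp_add)
qed

lemma cell_fin_pos: "ys \<in> set_pmf (cell h x) \<Longrightarrow> x \<ge> 1 \<Longrightarrow> fin x ys \<ge> 1"
  unfolding cell_def by (intro fin_pos run_pos)

text \<open>A lower bound on the quantised increment keeps the end of a cell at least proportional
  to its start; statements about large states thereby pass to the start of the next cell.\<close>

lemma eventually_fin:
  assumes "\<forall>\<^sub>F x in sequentially. P x" and q: "q > 0"
  shows "\<forall>\<^sub>F x in sequentially. \<forall>ys\<in>set_pmf (cell h x). quant o' q (lr x (fin x ys)) \<ge> z \<longrightarrow> P (fin x ys)"
proof -
  obtain n0 where n0: "\<And>n. n \<ge> n0 \<Longrightarrow> P n" using assms by (auto simp: eventually_sequentially)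
  define E where "E = exp (o' + q * (real_of_int z - 1))"
  have E: "E > 0" by (simp add: E_def)
  show ?thesis using eventually_ge_at_top[of "nat \<lceil>real n0 / E\<rceil>"] eventually_ge_at_top[of 1]
  proof eventually_elim
    case (elim x)
    show ?case
    proof (intro ballI impI n0)
      fix ys assume ys: "ys \<in> set_pmf (cell h x)" "z \<le> quant o' q (lr x (fin x ys))"
      have "real (fin x ys) \<ge> real x * E" unfolding E_def
        by (rule fin_lower) (use ys elim q cell_fin_pos in auto)
      moreover have "real x \<ge> real n0 / E" using elim by linarith
      then have "real x * E \<ge> real n0" using E by (simp add: field_simps)
      ultimately show "n0 \<le> fin x ys" by linarith
    qed
  qed
qed

text \<open>Independence arises in the limit: by \<open>eventually_fin\<close> the probability of
  the later quantised increments, given the first one, converges to the same product whatever the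
  end state of the first cell.\<close>

lemma prog_quants:
  assumes q: "q > 0" and lim: "\<And>z. (\<lambda>x. measure_pmf.prob (cell h x) {ys. quant o' q (lr x (fin x ys)) = z}) \<longlonglongrightarrow> \<pi> z"
  shows "(\<lambda>x. measure_pmf.prob (prog (length w) h x) {cs. quants o' q cs x = w}) \<longlonglongrightarrow> prod_list (map \<pi> w)"
proof (induction w)
  case Nil
  then show ?case by simp
next
  case (Cons z w)
  define L where "L = prod_list (map \<pi> w)"
  define Q where "Q x y = measure_pmf.prob (prog (length w) h y) {cs. quants o' q cs y = w}" for x y :: nat
  have eq: "measure_pmf.prob (prog (length (z # w)) h x) {cs. quants o' q cs x = z # w}
    = (\<integral>ys. indicator {ys. quant o' q (lr x (fin x ys)) = z} ys * Q x (fin x ys) \<partial>cell h x)" for x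
  proof -
    have "(#) ys -` {cs. quants o' q cs x = z # w} = (if quant o' q (lr x (fin x ys)) = z then {cs. quants o' q cs (fin x ys) = w} else {})" for ys
      by auto
    then show ?thesis by (simp add: prob_bind_pmf Q_def if_distrib cong: if_cong) (auto intro!: Bochner_Integration.integral_cong simp: indicator_def)
  qed
  have "(\<lambda>x. measure_pmf.prob (prog (length (z # w)) h x) {cs. quants o' q cs x = z # w} - measure_pmf.prob (cell h x) {ys. quant o' q (lr x (fin x ys)) = z} * L) \<longlonglongrightarrow> 0"
  proof (rule tendstoI)
    fix e :: real assume e: "e > 0"
    have "\<forall>\<^sub>F y in sequentially. \<bar>measure_pmf.prob (prog (length w) h y) {cs. quants o' q cs y = w} - L\<bar> < e / 2"
      using tendstoD[OF Cons.IH, of "e/2"] e unfolding L_def[symmetric] by (simp add: dist_real_def)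
    from eventually_fin[OF this q, of h z o']
    show "\<forall>\<^sub>F x in sequentially. dist (measure_pmf.prob (prog (length (z # w)) h x) {cs. quants o' q cs x = z # w} - measure_pmf.prob (cell h x) {ys. quant o' q (lr x (fin x ys)) = z} * L) 0 < e"
    proof eventually_elim
      case (elim x)
      let ?I = "indicator {ys. quant o' q (lr x (fin x ys)) = z} :: nat list \<Rightarrow> real"
      have i1: "integrable (cell h x) (\<lambda>ys. ?I ys * Q x (fin x ys))"
        by (rule pmf_integrable_bdd[where B = 1]) (auto simp: indicator_def Q_def)
      have i2: "integrable (cell h x) (\<lambda>ys. ?I ys * L)"
        by (rule pmf_integrable_bdd[where B = "\<bar>L\<bar>"]) (auto simp: indicator_def)
      have "measure_pmf.prob (prog (length (z # w)) h x) {cs. quants o' q cs x = z # w} - measure_pmf.prob (cell h x) {ys. quant o' q (lr x (fin x ys)) = z} * L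
        = (\<integral>ys. ?I ys * Q x (fin x ys) - ?I ys * L \<partial>cell h x)"
        unfolding eq using i1 i2 by simp
      also have "\<bar>\<dots>\<bar> \<le> (\<integral>ys. e / 2 \<partial>cell h x)"
      proof (rule order_trans[OF integral_abs_bound], rule integral_mono_AE)
        show "integrable (cell h x) (\<lambda>ys. \<bar>?I ys * Q x (fin x ys) - ?I ys * L\<bar>)" using i1 i2 by auto
        show "AE ys in cell h x. \<bar>?I ys * Q x (fin x ys) - ?I ys * L\<bar> \<le> e / 2"
          using elim e by (auto simp: AE_measure_pmf_iff indicator_def Q_def less_imp_le)
      qed simp
      finally show ?case using e by (simp add: dist_real_def)
    qed
  qed
  moreover have "(\<lambda>x. measure_pmf.prob (cell h x) {ys. quant o' q (lr x (fin x ys)) = z} * L) \<longlonglongrightarrow> \<pi> z * L"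
    by (intro tendsto_intros lim)
  ultimately have "(\<lambda>x. measure_pmf.prob (prog (length (z # w)) h x) {cs. quants o' q cs x = z # w} - measure_pmf.prob (cell h x) {ys. quant o' q (lr x (fin x ys)) = z} * L
     + measure_pmf.prob (cell h x) {ys. quant o' q (lr x (fin x ys)) = z} * L) \<longlonglongrightarrow> 0 + \<pi> z * L"
    by (rule tendsto_add)
  then show ?case by (simp add: L_def)
qed

text \<open>A union bound over the cells. Finiteness of \<open>F\<close> yields the lower bound
  \<open>z0\<close> on increments that \<open>eventually_fin\<close> asks for.\<close>

lemma prog_bad:
  assumes q: "q > 0" and F: "finite F"
    and bad: "\<forall>\<^sub>F x in sequentially. measure_pmf.prob (cell h x)
      {ys. \<not> (h \<le> clk ys x \<and> clk ys x \<le> h + \<delta> \<and> good2 \<eta> x ys \<and> quant o' q (lr x (fin x ys)) \<in> F)} \<le> e"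
    and e: "e \<ge> 0"
  shows "\<forall>\<^sub>F x in sequentially. measure_pmf.prob (prog m h x) {cs. \<not> (okc h \<delta> \<eta> cs x \<and> set (quants o' q cs x) \<subseteq> F)} \<le> real m * e"
proof (induction m)
  case 0
  then show ?case by simp
next
  case (Suc m)
  obtain z0 where z0: "\<And>z. z \<in> F \<Longrightarrow> z0 \<le> z"
  proof (cases "F = {}")
    case True then show ?thesis using that by auto
  next
    case False then show ?thesis using that[of "Min F"] F by auto
  qed
  show ?case using eventually_fin[OF Suc.IH q, of h z0 o'] bad
  proof eventually_elim
    case (elim x)
    let ?B = "{ys. \<not> (h \<le> clk ys x \<and> clk ys x \<le> h + \<delta> \<and> good2 \<eta> x ys \<and> quant o' q (lr x (fin x ys)) \<in> F)}"
    let ?C = "{cs. \<not> (okc h \<delta> \<eta> cs x \<and> set (quants o' q cs x) \<subseteq> F)}"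
    have "measure_pmf.prob (prog (Suc m) h x) ?C = (\<integral>ys. measure_pmf.prob (prog m h (fin x ys)) ((#) ys -` ?C) \<partial>cell h x)"
      by (simp add: prob_bind_pmf)
    also have "\<dots> \<le> (\<integral>ys. indicator ?B ys + real m * e \<partial>cell h x)"
    proof (rule integral_mono_AE)
      show "integrable (cell h x) (\<lambda>ys. measure_pmf.prob (prog m h (fin x ys)) ((#) ys -` ?C))"
        by (rule pmf_integrable_bdd[where B = 1]) simp
      show "integrable (cell h x) (\<lambda>ys. indicator ?B ys + real m * e)"
        by (rule pmf_integrable_bdd[where B = "1 + real m * e"]) (use e in \<open>auto simp: indicator_def\<close>)
      have "measure_pmf.prob (prog m h (fin x ys)) ((#) ys -` ?C) \<le> indicator ?B ys + real m * e" if ys: "ys \<in> set_pmf (cell h x)" for ys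
      proof (cases "ys \<in> ?B")
        case True
        have "measure_pmf.prob (prog m h (fin x ys)) ((#) ys -` ?C) \<le> 1" by simp
        then show ?thesis using True e by (simp add: add_increasing2)
      next
        case False
        then have "(#) ys -` ?C = {cs. \<not> (okc h \<delta> \<eta> cs (fin x ys) \<and> set (quants o' q cs (fin x ys)) \<subseteq> F)}" by auto
        moreover have "quant o' q (lr x (fin x ys)) \<ge> z0" using False z0 by auto
        ultimately show ?thesis using elim(1) ys False by simp
      qed
      then show "AE ys in cell h x. measure_pmf.prob (prog m h (fin x ys)) ((#) ys -` ?C) \<le> indicator ?B ys + real m * e"
        by (simp add: AE_measure_pmf_iff)
    qed
    also have "\<dots> = measure_pmf.prob (cell h x) ?B + real m * e"
      using expectation_affine_indicator[where c = "real m * e" and d = 1 and A = ?B and q = "cell h x"] by (simp only: mult_1_left add.commute)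
    also have "\<dots> \<le> e + real m * e" using elim(2) by simp
    finally show ?case by (simp add: algebra_simps)
  qed
qed

end

section \<open>Cadlag paths and time changes\<close>

text \<open>Time changes may be chosen separately for each tolerance and horizon: at index
  \<open>n\<close> the diagonal choice takes the best level \<open>k \<le> n\<close> that is
  available, and the identity if there is none.\<close>

lemma J1_convI:
  assumes "\<And>e T. e > 0 \<Longrightarrow> \<forall>\<^sub>F n in sequentially. \<exists>l. time_change l \<and> (\<forall>t\<ge>0. \<bar>l t - t\<bar> \<le> e) \<and> (\<forall>t\<in>{0..T}. \<bar>xs n (l t) - x t\<bar> \<le> e)"
  shows "J1_conv xs x"
proof -
  define Q where "Q k n l \<longleftrightarrow> time_change l \<and> (\<forall>t\<ge>0. \<bar>l t - t\<bar> \<le> 1 / real (Suc k)) \<and> (\<forall>t\<in>{0..real k}. \<bar>xs n (l t) - x t\<bar> \<le> 1 / real (Suc k))" for k n l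
  have ev: "\<forall>\<^sub>F n in sequentially. \<exists>l. Q k n l" for k
    unfolding Q_def by (rule assms) simp
  have mono: "Q k' n l" if "Q k n l" "k' \<le> k" for k k' n l
  proof -
    have "1 / real (Suc k) \<le> 1 / real (Suc k')" using that(2) by (intro divide_left_mono) auto
    moreover have "{0..real k'} \<subseteq> {0..real k}" using that(2) by auto
    ultimately show ?thesis using that(1) unfolding Q_def by (meson order_trans subsetD)
  qed
  define A where "A n = {k. k \<le> n \<and> (\<exists>l. Q k n l)}" for n
  have fA: "finite (A n)" for n unfolding A_def by simp
  define ls where "ls n = (if A n = {} then (\<lambda>t. t) else (SOME l. Q (Max (A n)) n l))" for n
  have ls: "Q (Max (A n)) n (ls n)" if "A n \<noteq> {}" for n
  proof -
    have "Max (A n) \<in> A n" using fA that by (rule Max_in)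
    then have "\<exists>l. Q (Max (A n)) n l" by (simp add: A_def)
    then show ?thesis unfolding ls_def using that by (simp add: someI_ex)
  qed
  have evk: "\<forall>\<^sub>F n in sequentially. Q k n (ls n)" for k
    using ev[of k] eventually_ge_at_top[of k]
  proof eventually_elim
    case (elim n)
    then have k: "k \<in> A n" by (simp add: A_def)
    then have "k \<le> Max (A n)" using fA by simp
    then show ?case using mono[OF ls] k by auto
  qed
  have tc: "time_change (ls n)" for n
  proof (cases "A n = {}")
    case True then show ?thesis by (auto simp: ls_def time_change_def strict_mono_on_def)
  next
    case False then show ?thesis using ls by (auto simp: Q_def)
  qed
  have small: "\<exists>k. 1 / real (Suc k) \<le> e \<and> T \<le> real k" if e0: "e > 0" for e T
  proof -
    obtain k1 where "inverse (real (Suc k1)) < e" using reals_Archimedean[OF e0] by blast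
    then have "1 / real (Suc k1) < e" by (simp add: inverse_eq_divide)
    moreover obtain k2 where "T \<le> real k2" using real_arch_simple by blast
    moreover have "1 / real (Suc (max k1 k2)) \<le> 1 / real (Suc k1)" by (intro divide_left_mono) auto
    ultimately show ?thesis by (intro exI[of _ "max k1 k2"]) (auto simp: le_max_iff_disj)
  qed
  show ?thesis unfolding J1_conv_def
  proof (intro exI[of _ ls] conjI allI impI tc)
    fix e :: real assume "e > 0"
    then obtain k where k: "1 / real (Suc k) \<le> e" using small[of e 0] by blast
    show "\<forall>\<^sub>F n in sequentially. \<forall>t\<ge>0. \<bar>ls n t - t\<bar> \<le> e"
      using evk[of k] by eventually_elim (use k in \<open>force simp: Q_def\<close>)
  next
    fix T e :: real assume "e > 0"
    then obtain k where k: "1 / real (Suc k) \<le> e" "T \<le> real k" using small[of e T] by blast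
    show "\<forall>\<^sub>F n in sequentially. \<forall>t\<in>{0..T}. \<bar>xs n (ls n t) - x t\<bar> \<le> e"
      using evk[of k] by eventually_elim (use k in \<open>force simp: Q_def\<close>)
  qed
qed

text \<open>Bisection: partitions of adjacent intervals concatenate, and near each point the
  one-sided limits give blocks of small oscillation. The guard \<open>0 \<le> a\<close> in
  \<open>P\<close> reflects that paths are controlled on the half line only.\<close>

lemma cadlag_partition:
  assumes x: "cadlag x" and S: "0 \<le> S" and e: "\<epsilon> > 0"
  shows "\<exists>r t. t 0 = 0 \<and> t r = S \<and> (\<forall>k<r. t k < t (Suc k)) \<and> (\<forall>k<r. \<forall>u\<in>{t k..<t (Suc k)}. \<forall>v\<in>{t k..<t (Suc k)}. \<bar>x u - x v\<bar> \<le> \<epsilon>)"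
proof -
  define P where "P a b \<longleftrightarrow> 0 \<le> a \<longrightarrow> (\<exists>r t. t 0 = a \<and> t r = b \<and> (\<forall>k<r. t k < t (Suc k)) \<and> (\<forall>k<r. \<forall>u\<in>{t k..<t (Suc k)}. \<forall>v\<in>{t k..<t (Suc k)}. \<bar>x u - x v\<bar> \<le> \<epsilon>))"
    for a b :: real
  have P1: "P a b" if "a < b" "\<And>u v. a \<le> u \<Longrightarrow> u < b \<Longrightarrow> a \<le> v \<Longrightarrow> v < b \<Longrightarrow> \<bar>x u - x v\<bar> \<le> \<epsilon>" for a b
    unfolding P_def by (intro impI exI[of _ 1] exI[of _ "\<lambda>k. if k = 0 then a else b"]) (use that in auto)
  have P0: "P a a" for a unfolding P_def by (intro impI exI[of _ 0] exI[of _ "\<lambda>k. a"]) auto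
  have trans: "P a c" if ab: "P a b" and bc: "P b c" and le: "a \<le> b" "b \<le> c" for a b c
    unfolding P_def
  proof
    assume a0: "0 \<le> a"
    obtain r1 t1 where 1: "t1 0 = a" "t1 r1 = b" "\<And>k. k < r1 \<Longrightarrow> t1 k < t1 (Suc k)" "\<And>k u v. k < r1 \<Longrightarrow> u \<in> {t1 k..<t1 (Suc k)} \<Longrightarrow> v \<in> {t1 k..<t1 (Suc k)} \<Longrightarrow> \<bar>x u - x v\<bar> \<le> \<epsilon>"
      using ab a0 unfolding P_def by blast
    have "0 \<le> b" using a0 le by simp
    then obtain r2 t2 where 2: "t2 0 = b" "t2 r2 = c" "\<And>k. k < r2 \<Longrightarrow> t2 k < t2 (Suc k)" "\<And>k u v. k < r2 \<Longrightarrow> u \<in> {t2 k..<t2 (Suc k)} \<Longrightarrow> v \<in> {t2 k..<t2 (Suc k)} \<Longrightarrow> \<bar>x u - x v\<bar> \<le> \<epsilon>"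
      using bc unfolding P_def by blast
    define t where "t k = (if k \<le> r1 then t1 k else t2 (k - r1))" for k
    have ta: "k < r1 \<Longrightarrow> t k = t1 k \<and> t (Suc k) = t1 (Suc k)" for k by (simp add: t_def)
    have tb: "t k = t2 (k - r1) \<and> t (Suc k) = t2 (Suc (k - r1))" if "\<not> k < r1" for k
      using that 1(2) 2(1) by (cases "k = r1") (auto simp: t_def Suc_diff_le)
    show "\<exists>r t. t 0 = a \<and> t r = c \<and> (\<forall>k<r. t k < t (Suc k)) \<and> (\<forall>k<r. \<forall>u\<in>{t k..<t (Suc k)}. \<forall>v\<in>{t k..<t (Suc k)}. \<bar>x u - x v\<bar> \<le> \<epsilon>)"
    proof (intro exI[of _ "r1 + r2"] exI[of _ t] conjI allI impI ballI)
      show "t 0 = a" using 1 by (simp add: t_def)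
      show "t (r1 + r2) = c" using 1 2 by (auto simp: t_def)
    next
      fix k assume k: "k < r1 + r2"
      then show "t k < t (Suc k)" using ta[of k] tb[of k] 1(3)[of k] 2(3)[of "k - r1"] by (cases "k < r1") auto
    next
      fix k u v assume k: "k < r1 + r2" and u: "u \<in> {t k..<t (Suc k)}" and v: "v \<in> {t k..<t (Suc k)}"
      show "\<bar>x u - x v\<bar> \<le> \<epsilon>"
      proof (cases "k < r1")
        case True then show ?thesis using 1(4)[of k u v] u v ta[of k] by auto
      next
        case False then show ?thesis using 2(4)[of "k - r1" u v] u v tb[of k] k by auto
      qed
    qed
  qed
  have "P 0 S" using S
  proof (induction rule: Bolzano)
    case (trans a b c) then show ?case using \<open>\<And>a b c. P a b \<Longrightarrow> P b c \<Longrightarrow> a \<le> b \<Longrightarrow> b \<le> c \<Longrightarrow> P a c\<close> by blast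
  next
    case (local s)
    have s0: "s \<ge> 0" using local by simp
    have "(x \<longlongrightarrow> x s) (at_right s)" using x s0 by (simp add: cadlag_def)
    then have "\<forall>\<^sub>F u in at_right s. dist (x u) (x s) < \<epsilon>/2" using e by (intro tendstoD) auto
    then obtain d1 where d1: "d1 > s" "\<And>u. s < u \<Longrightarrow> u < d1 \<Longrightarrow> dist (x u) (x s) < \<epsilon>/2"
      by (auto simp: eventually_at_right_field)
    have R: "\<bar>x u - x v\<bar> \<le> \<epsilon>" if "s \<le> u" "u < d1" "s \<le> v" "v < d1" for u v
    proof -
      have "dist (x u) (x s) < \<epsilon>/2" using d1(2)[of u] that e by (cases "u = s") auto
      moreover have "dist (x v) (x s) < \<epsilon>/2" using d1(2)[of v] that e by (cases "v = s") auto
      ultimately show ?thesis unfolding dist_real_def by linarith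
    qed
    have "\<exists>d2<s. \<forall>u v. d2 < u \<longrightarrow> u < s \<longrightarrow> d2 < v \<longrightarrow> v < s \<longrightarrow> 0 \<le> u \<longrightarrow> 0 \<le> v \<longrightarrow> \<bar>x u - x v\<bar> \<le> \<epsilon>"
    proof (cases "s = 0")
      case True then show ?thesis by (intro exI[of _ "-1"]) auto
    next
      case False
      then have "s > 0" using s0 by simp
      then obtain l where "(x \<longlongrightarrow> l) (at_left s)" using x unfolding cadlag_def by blast
      then have "\<forall>\<^sub>F u in at_left s. dist (x u) l < \<epsilon>/2" using e by (intro tendstoD) auto
      then obtain d2 where d2: "d2 < s" "\<And>u. d2 < u \<Longrightarrow> u < s \<Longrightarrow> dist (x u) l < \<epsilon>/2"
        by (auto simp: eventually_at_left_field)
      show ?thesis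
      proof (intro exI[of _ d2] conjI d2(1) allI impI)
        fix u v assume "d2 < u" "u < s" "d2 < v" "v < s"
        then show "\<bar>x u - x v\<bar> \<le> \<epsilon>" using d2(2)[of u] d2(2)[of v] unfolding dist_real_def by linarith
      qed
    qed
    then obtain d2 where d2: "d2 < s" "\<And>u v. d2 < u \<Longrightarrow> u < s \<Longrightarrow> d2 < v \<Longrightarrow> v < s \<Longrightarrow> 0 \<le> u \<Longrightarrow> 0 \<le> v \<Longrightarrow> \<bar>x u - x v\<bar> \<le> \<epsilon>" by blast
    show ?case
    proof (intro exI[of _ "min (d1 - s) (s - d2)"] conjI allI impI)
      show "0 < min (d1 - s) (s - d2)" using d1 d2 by simp
      fix a b assume ab: "a \<le> s \<and> s \<le> b \<and> b - a < min (d1 - s) (s - d2)"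
      have "P a b" if a0: "0 \<le> a"
      proof -
        have "P a s"
        proof (cases "a = s")
          case False
          show ?thesis by (rule P1) (use ab False a0 in \<open>auto intro!: d2(2)\<close>)
        qed (simp add: P0)
        moreover have "P s b"
        proof (cases "b = s")
          case False
          show ?thesis by (rule P1) (use ab False in \<open>auto intro!: R\<close>)
        qed (simp add: P0)
        ultimately show ?thesis using ab \<open>\<And>a b c. P a b \<Longrightarrow> P b c \<Longrightarrow> a \<le> b \<Longrightarrow> b \<le> c \<Longrightarrow> P a c\<close> by blast
      qed
      then show "P a b" unfolding P_def by blast
    qed
  qed
  then show ?thesis unfolding P_def by auto
qed

lemma partition_cell:
  fixes t :: "nat \<Rightarrow> real"
  assumes "\<And>k. k < r \<Longrightarrow> t k < t (Suc k)" "t 0 \<le> s" "s < t r"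
  shows "\<exists>k<r. t k \<le> s \<and> s < t (Suc k)"
  using assms
proof (induction r)
  case (Suc r)
  show ?case
  proof (cases "s < t r")
    case True
    then show ?thesis using Suc by (metis less_Suc_eq)
  next
    case False
    then show ?thesis using Suc by (intro exI[of _ r]) auto
  qed
qed simp

lemma partition_mono:
  fixes t :: "nat \<Rightarrow> real"
  assumes "\<And>k. k < r \<Longrightarrow> t k < t (Suc k)" "i \<le> j" "j \<le> r"
  shows "t i \<le> t j"
  using assms(2,3)
proof (induction j)
  case (Suc j)
  then show ?case using assms(1)[of j] by (cases "i = Suc j") (auto intro: order_trans less_imp_le)
qed simp

lemma cadlag_bounded:
  assumes x: "cadlag x" and S: "0 \<le> S"
  shows "\<exists>B. \<forall>s\<in>{0..S}. \<bar>x s\<bar> \<le> B"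
proof -
  obtain r t where t: "t 0 = 0" "t r = S" "\<And>k. k < r \<Longrightarrow> t k < t (Suc k)"
    "\<And>k u v. k < r \<Longrightarrow> u \<in> {t k..<t (Suc k)} \<Longrightarrow> v \<in> {t k..<t (Suc k)} \<Longrightarrow> \<bar>x u - x v\<bar> \<le> 1"
    using cadlag_partition[OF x S, of 1] by auto
  define B where "B = Max ((\<lambda>k. \<bar>x (t k)\<bar>) ` {..r}) + 1"
  have B: "\<bar>x (t k)\<bar> + 1 \<le> B" if "k \<le> r" for k unfolding B_def using that by auto
  have "\<bar>x s\<bar> \<le> B" if s: "s \<in> {0..S}" for s
  proof (cases "s = S")
    case True then show ?thesis using B[of r] t by simp
  next
    case False
    then obtain k where k: "k < r" "t k \<le> s" "s < t (Suc k)" using partition_cell[of r t s] t s by auto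
    have "\<bar>x s - x (t k)\<bar> \<le> 1" using t(4)[of k s "t k"] k t(3)[OF k(1)] by simp
    then show ?thesis using B[of k] k by linarith
  qed
  then show ?thesis by blast
qed

text \<open>Outside the countably many points of the partitions for all horizons and all tolerances
  \<open>1 / Suc n\<close>, a point is interior to blocks of arbitrarily small oscillation.\<close>

lemma cadlag_AE_cont:
  assumes x: "cadlag x"
  shows "AE s in lborel. 0 < s \<longrightarrow> isCont x s"
proof -
  have "\<exists>r t. t 0 = 0 \<and> t r = real N \<and> (\<forall>k<r. t k < t (Suc k)) \<and> (\<forall>k<r. \<forall>u\<in>{t k..<t (Suc k)}. \<forall>v\<in>{t k..<t (Suc k)}. \<bar>x u - x v\<bar> \<le> 1 / real (Suc n))" for N n
    by (rule cadlag_partition[OF x]) auto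
  then obtain r t where t: "\<And>N n. t N n 0 = 0" "\<And>N n. t N n (r N n) = real N" "\<And>N n k. k < r N n \<Longrightarrow> t N n k < t N n (Suc k)"
    "\<And>N n k u v. k < r N n \<Longrightarrow> u \<in> {t N n k..<t N n (Suc k)} \<Longrightarrow> v \<in> {t N n k..<t N n (Suc k)} \<Longrightarrow> \<bar>x u - x v\<bar> \<le> 1 / real (Suc n)"
    by metis
  define D where "D = (\<Union>N n k. {t N n k})"
  have "countable D" unfolding D_def by auto
  then have "D \<in> null_sets lborel" by (rule countable_imp_null_set_lborel)
  then have "AE s in lborel. s \<notin> D" by (rule AE_not_in)
  then show ?thesis
  proof eventually_elim
    case (elim s)
    show ?case
    proof
      assume s: "0 < s"
      obtain N where N: "s < real N" using reals_Archimedean2 by blast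
      show "isCont x s" unfolding continuous_at_eps_delta
      proof (intro allI impI)
        fix e :: real assume "e > 0"
        then obtain n where n: "1 / real (Suc n) < e" using reals_Archimedean by (auto simp: inverse_eq_divide)
        obtain k where k: "k < r N n" "t N n k \<le> s" "s < t N n (Suc k)"
          using partition_cell[of "r N n" "t N n" s] t s N by auto
        have "t N n k \<noteq> s" using elim unfolding D_def by auto
        then have lt: "t N n k < s" using k by simp
        show "\<exists>d>0. \<forall>x'. dist x' s < d \<longrightarrow> dist (x x') (x s) < e"
        proof (intro exI[of _ "min (s - t N n k) (t N n (Suc k) - s)"] conjI allI impI)
          show "0 < min (s - t N n k) (t N n (Suc k) - s)" using lt k by simp
          fix x' assume "dist x' s < min (s - t N n k) (t N n (Suc k) - s)"
          then have "x' \<in> {t N n k..<t N n (Suc k)}" by (auto simp: dist_real_def)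
          then have "\<bar>x x' - x s\<bar> \<le> 1 / real (Suc n)" using t(4)[OF k(1), of x' s] k by simp
          then show "dist (x x') (x s) < e" using n by (simp add: dist_real_def)
        qed
      qed
    qed
  qed
qed

text \<open>The \<open>+ 1\<close> places the grid point strictly to the right of \<open>s\<close>,
  where right continuity applies.\<close>

lemma cadlag_approx:
  assumes x: "cadlag x" and s: "0 \<le> s"
  shows "(\<lambda>n. x ((real_of_int \<lfloor>s * real (Suc n)\<rfloor> + 1) / real (Suc n))) \<longlonglongrightarrow> x s"
proof -
  define f where "f n = (real_of_int \<lfloor>s * real (Suc n)\<rfloor> + 1) / real (Suc n)" for n
  have f1: "s < f n" "f n \<le> s + 1 / real (Suc n)" for n
  proof -
    have "s * real (Suc n) < real_of_int \<lfloor>s * real (Suc n)\<rfloor> + 1" by linarith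
    then show "s < f n" unfolding f_def by (subst pos_less_divide_eq) auto
    have "real_of_int \<lfloor>s * real (Suc n)\<rfloor> + 1 \<le> s * real (Suc n) + 1" by linarith
    then have "f n \<le> (s * real (Suc n) + 1) / real (Suc n)" unfolding f_def by (rule divide_right_mono) simp
    then show "f n \<le> s + 1 / real (Suc n)" by (simp add: add_divide_distrib)
  qed
  have "f \<longlonglongrightarrow> s"
  proof (rule tendsto_sandwich[of "\<lambda>_. s" f _ "\<lambda>n. s + 1 / real (Suc n)"])
    show "(\<lambda>n. s + 1 / real (Suc n)) \<longlonglongrightarrow> s" by real_asymp
  qed (auto intro!: always_eventually less_imp_le[OF f1(1)] f1(2)[simplified])
  then have "filterlim f (at_right s) sequentially"
    using f1(1) by (simp add: filterlim_at less_imp_neq[symmetric])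
  moreover have "(x \<longlongrightarrow> x s) (at_right s)" using x s by (simp add: cadlag_def)
  ultimately show ?thesis unfolding f_def[symmetric] by (rule filterlim_compose[rotated])
qed

text \<open>A limit of step functions by \<open>cadlag_approx\<close>; the indicator removes
  negative times, at which the path is arbitrary.\<close>

lemma cadlag_measurable:
  fixes f :: "real \<Rightarrow> real"
  assumes x: "cadlag x" and [measurable]: "f \<in> borel_measurable borel"
  shows "(\<lambda>s. indicator {0..} s * f (x s)) \<in> borel_measurable borel"
proof -
  define X where "X n s = x ((real_of_int \<lfloor>s * real (Suc n)\<rfloor> + 1) / real (Suc n))" for n and s :: real
  have m1: "X n \<in> borel_measurable borel" for n
  proof -
    have "(\<lambda>z::int. x ((real_of_int z + 1) / real (Suc n))) \<in> measurable (count_space UNIV) borel" by simp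
    moreover have "(\<lambda>s. \<lfloor>s * real (Suc n)\<rfloor>) \<in> measurable borel (count_space UNIV)" by measurable
    ultimately show ?thesis unfolding X_def by (rule measurable_compose[rotated])
  qed
  have "(\<lambda>s. indicator {0..} s * x s) \<in> borel_measurable borel"
  proof (rule borel_measurable_LIMSEQ_real)
    show "(\<lambda>n. indicator {0..} s * X n s) \<longlonglongrightarrow> indicator {0..} s * x s" for s
      unfolding X_def using cadlag_approx[OF x, of s] by (cases "s \<ge> 0") (auto intro!: tendsto_intros)
    show "(\<lambda>s. indicator {0..} s * X n s) \<in> borel_measurable borel" for n using m1[of n] by measurable
  qed
  note this[measurable]
  have "(\<lambda>s. indicator {0..} s * f (indicator {0..} s * x s)) \<in> borel_measurable borel" by measurable
  moreover have "(\<lambda>s. indicator {0..} s * f (indicator {0..} s * x s)) = (\<lambda>s. indicator {0..} s * f (x s))"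
    by (auto simp: indicator_def)
  ultimately show ?thesis by simp
qed

text \<open>Piecewise linear interpolation that sends \<open>u k\<close> to \<open>d k\<close> for
  \<open>k \<le> r\<close> and continues with slope 1, so that its distance from the identity is
  governed by the nodes.\<close>

primrec pl :: "(nat \<Rightarrow> real) \<Rightarrow> (nat \<Rightarrow> real) \<Rightarrow> nat \<Rightarrow> real \<Rightarrow> real" where
  "pl u d 0 t = t"
| "pl u d (Suc r) t = (if t \<le> u r then pl u d r t
     else if t \<le> u (Suc r) then d r + (t - u r) * ((d (Suc r) - d r) / (u (Suc r) - u r)) else d (Suc r) + (t - u (Suc r)))"

lemma pl_props:
  assumes u0: "u 0 = 0" "d 0 = 0" and e: "\<epsilon> \<ge> 0"
  shows "(\<And>k. k < r \<Longrightarrow> u k < u (Suc k)) \<Longrightarrow> (\<And>k. k < r \<Longrightarrow> d k < d (Suc k)) \<Longrightarrow> (\<And>k. k \<le> r \<Longrightarrow> \<bar>d k - u k\<bar> \<le> \<epsilon>) \<Longrightarrow>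
    continuous_on {0..} (pl u d r) \<and> strict_mono_on {0..} (pl u d r) \<and> (\<forall>k\<le>r. pl u d r (u k) = d k) \<and>
    (\<forall>t\<ge>u r. pl u d r t = d r + (t - u r)) \<and> (\<forall>t\<ge>0. \<bar>pl u d r t - t\<bar> \<le> \<epsilon>)"
proof (induction r)
  case 0
  then show ?case using u0 e by (auto simp: strict_mono_on_def)
next
  case (Suc r)
  have IH: "continuous_on {0..} (pl u d r)" "strict_mono_on {0..} (pl u d r)" "\<And>k. k \<le> r \<Longrightarrow> pl u d r (u k) = d k"
    "\<And>t. t \<ge> u r \<Longrightarrow> pl u d r t = d r + (t - u r)" "\<And>t. t \<ge> 0 \<Longrightarrow> \<bar>pl u d r t - t\<bar> \<le> \<epsilon>"
    using Suc.IH Suc.prems by auto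
  have ur: "u r < u (Suc r)" "d r < d (Suc r)" using Suc.prems by auto
  have ur0: "0 \<le> u r" using partition_mono[of "Suc r" u 0 r] Suc.prems u0 by auto
  define m where "m = (d (Suc r) - d r) / (u (Suc r) - u r)"
  have m: "m > 0" "m * (u (Suc r) - u r) = d (Suc r) - d r" using ur by (auto simp: m_def)
  define f where "f = pl u d (Suc r)"
  have f1: "f t = pl u d r t" if "t \<le> u r" for t using that by (simp add: f_def)
  have f2: "f t = d r + (t - u r) * m" if "u r \<le> t" "t \<le> u (Suc r)" for t
    using that IH(3)[of r] by (cases "t = u r") (auto simp: f_def m_def)
  have f3: "f t = d (Suc r) + (t - u (Suc r))" if "u (Suc r) \<le> t" for t
    using that ur f2[of t] m(2) by (cases "t = u (Suc r)") (auto simp: f_def algebra_simps)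
  have c: "continuous_on {0..} f"
  proof -
    have "continuous_on ({0..u r} \<union> ({u r..u (Suc r)} \<union> {u (Suc r)..})) f"
    proof (intro continuous_on_closed_Un)
      show "continuous_on {0..u r} f"
        by (subst continuous_on_cong[OF refl f1]) (auto intro: continuous_on_subset[OF IH(1)])
      show "continuous_on {u r..u (Suc r)} f"
        by (subst continuous_on_cong[OF refl f2]) (auto intro!: continuous_intros)
      show "continuous_on {u (Suc r)..} f"
        by (subst continuous_on_cong[OF refl f3]) (auto intro!: continuous_intros)
    qed (auto intro!: closed_Un)
    moreover have "{0..u r} \<union> ({u r..u (Suc r)} \<union> {u (Suc r)..}) = {0..}" using ur ur0 by auto
    ultimately show ?thesis by simp
  qed
  have mono: "strict_mono_on {0..} f"
  proof (rule strict_mono_onI)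
    fix s t :: real assume st: "s \<in> {0..}" "t \<in> {0..}" "s < t"
    have 1: "f s < f t" if "t \<le> u r" using that st IH(2) f1 unfolding strict_mono_on_def by simp
    have 3: "f s < f t" if "u (Suc r) \<le> s" using that st f3[of s] f3[of t] by simp
    have le1: "f s \<le> f (u r)" if "s \<le> u r"
      using that st IH(2) f1 ur0 unfolding strict_mono_on_def by (cases "s = u r") (auto intro: less_imp_le)
    have le2: "f s \<le> f (u (Suc r))" if "u r \<le> s" "s \<le> u (Suc r)" for s :: real
      using that f2[of s] f2[of "u (Suc r)"] m ur by (simp add: mult_right_mono less_imp_le)
    have ge2: "f (u r) < f t" if "u r < t" "t \<le> u (Suc r)" for t :: real
      using that f2[of t] f2[of "u r"] m ur by simp
    have ge3: "f (u (Suc r)) < f t" if "u (Suc r) < t" using that f3[of t] f3[of "u (Suc r)"] by simp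
    have mid: "f (u r) < f (u (Suc r))" using ge2 ur by simp
    consider "t \<le> u r" | "s \<le> u r" "u r < t" "t \<le> u (Suc r)" | "s \<le> u r" "u (Suc r) < t"
      | "u r \<le> s" "t \<le> u (Suc r)" | "u r \<le> s" "s \<le> u (Suc r)" "u (Suc r) < t" | "u (Suc r) \<le> s"
      by linarith
    then show "f s < f t"
    proof cases
      case 1 then show ?thesis by (rule \<open>t \<le> u r \<Longrightarrow> f s < f t\<close>)
    next
      case 2 then show ?thesis using le1 ge2[of t] by linarith
    next
      case 3 then show ?thesis using le1 mid ge3 by linarith
    next
      case 4 then show ?thesis using f2[of s] f2[of t] m st by simp
    next
      case 5 then show ?thesis using le2[of s] ge3 by linarith
    next
      case 6 then show ?thesis by (rule \<open>u (Suc r) \<le> s \<Longrightarrow> f s < f t\<close>)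
    qed
  qed
  have k: "f (u k) = d k" if "k \<le> Suc r" for k
  proof (cases "k \<le> r")
    case True
    have "u k \<le> u r" by (rule partition_mono[of "Suc r" u]) (use Suc.prems True in auto)
    then show ?thesis using f1 IH(3) True by simp
  next
    case False
    then have "k = Suc r" using that by simp
    then show ?thesis using f3 by simp
  qed
  have dist: "\<bar>f t - t\<bar> \<le> \<epsilon>" if "t \<ge> 0" for t
  proof -
    consider "t \<le> u r" | "u r \<le> t" "t \<le> u (Suc r)" | "u (Suc r) \<le> t" by linarith
    then show ?thesis
    proof cases
      case 1 then show ?thesis using f1 IH(5) that by simp
    next
      case 2
      \<comment> \<open>On a linear piece the deviation from the identity is a convex combination of
        the deviations at its two ends.\<close>
      define w where "w = (t - u r) / (u (Suc r) - u r)"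
      have w: "0 \<le> w" "w \<le> 1" using 2 ur by (auto simp: w_def)
      have wt: "w * (u (Suc r) - u r) = t - u r" using ur by (simp add: w_def)
      have "(t - u r) * m = w * (d (Suc r) - d r)" unfolding m(2)[symmetric] wt[symmetric] by simp
      then have "f t - t = (1 - w) * (d r - u r) + w * (d (Suc r) - u (Suc r))"
        using f2[OF 2] wt by (simp add: algebra_simps)
      also have "\<bar>\<dots>\<bar> \<le> \<bar>(1 - w) * (d r - u r)\<bar> + \<bar>w * (d (Suc r) - u (Suc r))\<bar>" by (rule abs_triangle_ineq)
      also have "\<dots> = (1 - w) * \<bar>d r - u r\<bar> + w * \<bar>d (Suc r) - u (Suc r)\<bar>" using w by (simp add: abs_mult)
      also have "\<dots> \<le> (1 - w) * \<epsilon> + w * \<epsilon>" using w Suc.prems(3) by (intro add_mono mult_left_mono) auto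
      finally show ?thesis by (simp add: algebra_simps)
    next
      case 3 then show ?thesis using f3 Suc.prems(3)[of "Suc r"] by simp
    qed
  qed
  show ?case using c mono k f3 dist unfolding f_def by blast
qed

lemma pl_time_change:
  assumes "u 0 = 0" "d 0 = 0" "\<epsilon> \<ge> 0" "\<And>k. k < r \<Longrightarrow> u k < u (Suc k)" "\<And>k. k < r \<Longrightarrow> d k < d (Suc k)" "\<And>k. k \<le> r \<Longrightarrow> \<bar>d k - u k\<bar> \<le> \<epsilon>"
  shows "time_change (pl u d r)"
proof -
  define f where "f = pl u d r"
  have f: "continuous_on {0..} f" "strict_mono_on {0..} f" "\<And>k. k \<le> r \<Longrightarrow> f (u k) = d k" "\<And>t. t \<ge> 0 \<Longrightarrow> \<bar>f t - t\<bar> \<le> \<epsilon>"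
    using pl_props[of u d \<epsilon> r] assms unfolding f_def by auto
  have f0: "f 0 = 0" using f(3)[of 0] assms by simp
  have "f ` {0..} = {0..}"
  proof (intro equalityI subsetI)
    fix y assume "y \<in> f ` {0..}"
    then obtain t where "t \<ge> 0" "y = f t" by auto
    moreover have "f 0 < f t" if "t \<noteq> 0" using \<open>t \<ge> 0\<close> that by (intro strict_mono_onD[OF f(2)]) auto
    ultimately show "y \<in> {0..}" using f0 by (cases "t = 0") auto
  next
    fix y :: real assume y: "y \<in> {0..}"
    have "\<exists>t\<ge>0. t \<le> y + \<epsilon> \<and> f t = y"
    proof (rule IVT')
      show "f 0 \<le> y" using f0 y by simp
      show "y \<le> f (y + \<epsilon>)" using f(4)[of "y + \<epsilon>"] y assms by simp
      show "continuous_on {0..y + \<epsilon>} f" by (rule continuous_on_subset[OF f(1)]) auto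
    qed (use y assms in auto)
    then show "y \<in> f ` {0..}" by auto
  qed
  then show ?thesis unfolding time_change_def f_def[symmetric] using f f0 by simp
qed

section \<open>The Lamperti transform of a path\<close>

locale lamperti_path =
  fixes x :: "real \<Rightarrow> real" and \<gamma> :: real
  assumes cad: "cadlag x" and g: "\<gamma> > 0"
begin

text \<open>The real time that has elapsed at Levy time \<open>s\<close>. A real-valued integral is
  enough because paths are bounded on compact intervals; \<open>tau\<close> inverts it.\<close>

definition C :: "real \<Rightarrow> real" where "C s = (\<integral>u. indicator {0..s} u * exp (\<gamma> * x u) \<partial>lborel)"

text \<open>The definitions for random paths are instantiated on a one-point sample space, so that a
  deterministic path can be studied with them.\<close>

definition Y :: "real \<Rightarrow> real" where "Y t = lamperti \<gamma> (\<lambda>s (_::unit). x s) () t"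

definition tau :: "real \<Rightarrow> real" where "tau t = time_inv \<gamma> (\<lambda>s (_::unit). x s) () t"

lemma meas0[measurable]: "(\<lambda>u. indicator {0..} u * exp (\<gamma> * x u)) \<in> borel_measurable borel"
  by (rule cadlag_measurable[OF cad]) measurable

lemma ind_eq: "indicator {0..s} u * exp (\<gamma> * x u) = indicator {..s} u * (indicator {0..} u * exp (\<gamma> * x u))"
  by (auto simp: indicator_def)

lemma meas[measurable]: "(\<lambda>u. indicator {0..s} u * exp (\<gamma> * x u)) \<in> borel_measurable borel"
  unfolding ind_eq by measurable

lemma integ: "integrable lborel (\<lambda>u. indicator {0..s} u * exp (\<gamma> * x u))"
proof (cases "s \<ge> 0")
  case True
  obtain B where B: "\<And>u. u \<in> {0..s} \<Longrightarrow> \<bar>x u\<bar> \<le> B" using cadlag_bounded[OF cad True] by blast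
  show ?thesis
  proof (rule Bochner_Integration.integrable_bound)
    show "integrable lborel (\<lambda>u. indicator {0..s} u * exp (\<gamma> * B))"
      by (intro integrable_mult_left integrable_real_indicator) (auto simp: emeasure_lborel_Icc_eq)
    show "AE u in lborel. norm (indicator {0..s} u * exp (\<gamma> * x u)) \<le> norm (indicator {0..s} u * exp (\<gamma> * B))"
    proof (rule AE_I2)
      fix u show "norm (indicator {0..s} u * exp (\<gamma> * x u)) \<le> norm (indicator {0..s} u * exp (\<gamma> * B))"
        using B[of u] g by (auto simp: indicator_def abs_le_iff)
    qed
  qed measurable
qed simp

text \<open>Boundedness of the path makes \<open>C\<close> Lipschitz with Lipschitz inverse on
  compact intervals; strict monotonicity and continuity both come from here.\<close>

lemma C_diff:
  assumes "0 \<le> s" "s \<le> s'" and B: "\<And>u. u \<in> {0..s'} \<Longrightarrow> \<bar>x u\<bar> \<le> B"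
  shows "exp (- \<gamma> * B) * (s' - s) \<le> C s' - C s" "C s' - C s \<le> exp (\<gamma> * B) * (s' - s)"
proof -
  have eq: "C s' - C s = (\<integral>u. indicator {0..s'} u * exp (\<gamma> * x u) - indicator {0..s} u * exp (\<gamma> * x u) \<partial>lborel)"
    unfolding C_def using integ by simp
  have i: "integrable lborel (\<lambda>u. c * indicator {s<..s'} u :: real)" for c
    by (intro integrable_mult_right integrable_real_indicator) (auto simp: emeasure_lborel_Ioc assms)
  have i2: "integrable lborel (\<lambda>u. indicator {0..s'} u * exp (\<gamma> * x u) - indicator {0..s} u * exp (\<gamma> * x u))"
    by (intro Bochner_Integration.integrable_diff integ)
  have v: "(\<integral>u. c * indicator {s<..s'} u \<partial>lborel) = c * (s' - s)" for c :: real
    using assms by simp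
  have bd: "exp (- \<gamma> * B) \<le> exp (\<gamma> * x u) \<and> exp (\<gamma> * x u) \<le> exp (\<gamma> * B)" if "u \<in> {0..s'}" for u
  proof -
    have "- B \<le> x u" "x u \<le> B" using B[OF that] by auto
    then have "\<gamma> * (- B) \<le> \<gamma> * x u" "\<gamma> * x u \<le> \<gamma> * B" using g by (intro mult_left_mono; simp)+
    then show ?thesis by simp
  qed
  show "exp (- \<gamma> * B) * (s' - s) \<le> C s' - C s"
    unfolding eq v[symmetric]
  proof (rule integral_mono[OF i i2])
    fix u show "exp (- \<gamma> * B) * indicator {s<..s'} u \<le> indicator {0..s'} u * exp (\<gamma> * x u) - indicator {0..s} u * exp (\<gamma> * x u)"
      using bd[of u] assms(1,2) by (auto simp: indicator_def)
  qed
  show "C s' - C s \<le> exp (\<gamma> * B) * (s' - s)"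
    unfolding eq v[symmetric]
  proof (rule integral_mono[OF i2 i])
    fix u show "indicator {0..s'} u * exp (\<gamma> * x u) - indicator {0..s} u * exp (\<gamma> * x u) \<le> exp (\<gamma> * B) * indicator {s<..s'} u"
      using bd[of u] assms(1,2) by (auto simp: indicator_def)
  qed
qed

lemma C_0: "C 0 = 0"
proof -
  have "AE u in lborel. u \<noteq> (0::real)" by (rule AE_lborel_singleton)
  then have "AE u in lborel. indicator {0..0} u * exp (\<gamma> * x u) = 0" by eventually_elim auto
  then show ?thesis unfolding C_def by (rule integral_eq_zero_AE)
qed

lemma C_less: assumes "0 \<le> s" "s < s'" shows "C s < C s'"
proof -
  obtain B where B: "\<And>u. u \<in> {0..s'} \<Longrightarrow> \<bar>x u\<bar> \<le> B" using cadlag_bounded[OF cad, of s'] order_trans[OF assms(1) less_imp_le[OF assms(2)]] by blast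
  have "exp (- \<gamma> * B) * (s' - s) \<le> C s' - C s" by (rule C_diff) (use assms B in auto)
  moreover have "exp (- \<gamma> * B) * (s' - s) > 0" using assms by simp
  ultimately show ?thesis by linarith
qed

lemma C_nonneg: "0 \<le> s \<Longrightarrow> 0 \<le> C s"
  using C_less[of 0 s] C_0 by (cases "s = 0") auto

lemma C_le_iff: "0 \<le> s \<Longrightarrow> 0 \<le> s' \<Longrightarrow> C s \<le> C s' \<longleftrightarrow> s \<le> s'"
  using C_less[of s s'] C_less[of s' s] by (cases s s' rule: linorder_cases) auto

lemma C_nn: "(\<integral>\<^sup>+u. ennreal (exp (\<gamma> * x u)) * indicator {0..s} u \<partial>lborel) = ennreal (C s)"
proof -
  have "(\<integral>\<^sup>+u. ennreal (exp (\<gamma> * x u)) * indicator {0..s} u \<partial>lborel) = (\<integral>\<^sup>+u. ennreal (indicator {0..s} u * exp (\<gamma> * x u)) \<partial>lborel)"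
    by (rule nn_integral_cong) (auto simp: indicator_def)
  also have "\<dots> = ennreal (C s)" unfolding C_def
    by (rule nn_integral_eq_integral[OF integ]) simp
  finally show ?thesis .
qed

lemma tau_def': "t \<ge> 0 \<Longrightarrow> tau t = Inf {u. 0 \<le> u \<and> C u > t}"
  unfolding tau_def time_inv_def C_nn
  by (rule arg_cong[where f = Inf]) (auto simp: ennreal_less_iff C_nonneg)

text \<open>The witness \<open>u\<close> with \<open>t < C u\<close> ensures that the infimum
  defining \<open>tau\<close> is taken over a nonempty set.\<close>

lemma tau_ge:
  assumes "0 \<le> s" "C s \<le> t" "0 \<le> u" "t < C u"
  shows "s \<le> tau t"
proof -
  have t: "t \<ge> 0" using C_nonneg[OF assms(1)] assms(2) by simp
  show ?thesis unfolding tau_def'[OF t]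
  proof (rule cInf_greatest)
    show "{u. 0 \<le> u \<and> t < C u} \<noteq> {}" using assms by auto
    fix w assume "w \<in> {u. 0 \<le> u \<and> t < C u}"
    then show "s \<le> w" using C_le_iff[of w s] assms by fastforce
  qed
qed

lemma tau_less:
  assumes t: "0 \<le> t" "0 \<le> s" "t < C s"
  shows "tau t < s"
proof -
  have s: "s > 0" using t C_0 by (cases "s = 0") auto
  obtain B where B: "\<And>u. u \<in> {0..s} \<Longrightarrow> \<bar>x u\<bar> \<le> B" using cadlag_bounded[OF cad less_imp_le[OF s]] by blast
  \<comment> \<open>Going back by \<open>d\<close> lowers \<open>C\<close> by at most half of the
    excess \<open>C s - t\<close>, so the inequality for the infimum is strict.\<close>
  define d where "d = (C s - t) / (2 * exp (\<gamma> * B))"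
  define s'' where "s'' = max 0 (s - d)"
  have d: "d > 0" using t by (simp add: d_def)
  have s'': "0 \<le> s''" "s'' < s" "s - s'' \<le> d" using s d by (auto simp: s''_def)
  have "C s - C s'' \<le> exp (\<gamma> * B) * (s - s'')" by (rule C_diff) (use s'' B in auto)
  also have "\<dots> \<le> exp (\<gamma> * B) * d" using s'' by simp
  also have "\<dots> = (C s - t) / 2" by (simp add: d_def)
  finally have "C s - C s'' \<le> (C s - t) / 2" .
  moreover have "(C s - t) / 2 < C s - t" using t(3) by simp
  ultimately have "t < C s''" by simp
  then have "tau t \<le> s''" unfolding tau_def'[OF t(1)]
    by (intro cInf_lower) (use s'' in \<open>auto intro!: bdd_belowI[of _ 0]\<close>)
  then show ?thesis using s'' by linarith
qed

lemma I_inf_gt: "0 \<le> t \<Longrightarrow> 0 \<le> u \<Longrightarrow> t < C u \<Longrightarrow> ennreal t < I_infty \<gamma> (\<lambda>s (_::unit). x s) ()"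
proof -
  assume t: "0 \<le> t" "0 \<le> u" "t < C u"
  have "ennreal t < ennreal (C u)" using t by (simp add: ennreal_less_iff)
  also have "\<dots> \<le> I_infty \<gamma> (\<lambda>s (_::unit). x s) ()"
    unfolding C_nn[symmetric] I_infty_def by (intro nn_integral_mono) (auto simp: indicator_def)
  finally show ?thesis .
qed

text \<open>Monotone convergence over the finite horizons \<open>n\<close>.\<close>

lemma I_inf_ex:
  assumes t: "0 \<le> t" "ennreal t < I_infty \<gamma> (\<lambda>s (_::unit). x s) ()"
  shows "\<exists>u\<ge>0. t < C u"
proof -
  have "I_infty \<gamma> (\<lambda>s (_::unit). x s) () = (\<integral>\<^sup>+u. (SUP n. ennreal (indicator {0..real n} u * exp (\<gamma> * x u))) \<partial>lborel)"
    unfolding I_infty_def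
  proof (rule nn_integral_cong)
    fix u :: real
    show "ennreal (exp (\<gamma> * x u)) * indicator {0..} u = (SUP n. ennreal (indicator {0..real n} u * exp (\<gamma> * x u)))"
    proof (cases "u \<ge> 0")
      case True
      show ?thesis
      proof (rule antisym)
        obtain n where "u \<le> real n" using real_arch_simple by blast
        then show "ennreal (exp (\<gamma> * x u)) * indicator {0..} u \<le> (SUP n. ennreal (indicator {0..real n} u * exp (\<gamma> * x u)))"
          using True by (intro SUP_upper2[of n]) auto
        show "(SUP n. ennreal (indicator {0..real n} u * exp (\<gamma> * x u))) \<le> ennreal (exp (\<gamma> * x u)) * indicator {0..} u"
          using True by (intro SUP_least) (auto simp: indicator_def)
      qed
    qed simp
  qed
  also have "\<dots> = (SUP n. \<integral>\<^sup>+u. ennreal (indicator {0..real n} u * exp (\<gamma> * x u)) \<partial>lborel)"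
  proof (rule nn_integral_monotone_convergence_SUP)
    show "incseq (\<lambda>n u. ennreal (indicator {0..real n} u * exp (\<gamma> * x u)))"
      by (auto simp: incseq_def le_fun_def indicator_def)
  qed measurable
  also have "\<dots> = (SUP n. ennreal (C (real n)))"
    unfolding C_def by (intro SUP_cong refl nn_integral_eq_integral integ) simp
  finally have "ennreal t < (SUP n. ennreal (C (real n)))" using t by simp
  then obtain n where "ennreal t < ennreal (C (real n))" by (auto simp: less_SUP_iff)
  then show ?thesis using t by (intro exI[of _ "real n"]) (simp add: ennreal_less_iff)
qed

lemma Y_before: "0 \<le> t \<Longrightarrow> 0 \<le> u \<Longrightarrow> t < C u \<Longrightarrow> Y t = exp (x (tau t))"
  using I_inf_gt[of t u] by (simp add: Y_def lamperti_def tau_def)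

lemma Y_cases:
  assumes "0 \<le> t"
  obtains "Y t = 0" | u where "0 \<le> u" "t < C u" "Y t = exp (x (tau t))"
proof (cases "ennreal t < I_infty \<gamma> (\<lambda>s (_::unit). x s) ()")
  case True
  then obtain u where "u \<ge> 0" "t < C u" using I_inf_ex[OF assms] by blast
  then show ?thesis using that(2) Y_before[OF assms] by blast
next
  case False
  then show ?thesis using that(1) by (simp add: Y_def lamperti_def)
qed

end

text \<open>The logarithm of \<open>v\<close> follows the grid values \<open>g\<close> along the times \<open>\<sigma>\<close>, with a single possibly large
  move, at \<open>\<rho> j\<close>, in each cell; the duration of a cell is the Lamperti time change of \<open>h\<close>, with both
  bounds stated through the end values since \<open>v\<close> is nearly constant before and after \<open>\<rho> j\<close>.\<close>
definition near_path :: "real \<Rightarrow> real \<Rightarrow> real \<Rightarrow> nat \<Rightarrow> real \<Rightarrow> real \<Rightarrow> (nat \<Rightarrow> real) \<Rightarrow> (nat \<Rightarrow> real) \<Rightarrow> (nat \<Rightarrow> nat) \<Rightarrow> (nat \<Rightarrow> nat) \<Rightarrow> bool" where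
  "near_path \<gamma> A h m T \<eta> g v \<sigma> \<rho> \<longleftrightarrow> A > 0 \<and> (\<forall>k. v k \<ge> 0) \<and> \<sigma> 0 = 0 \<and> (\<forall>j<m. \<sigma> j < \<rho> j \<and> \<rho> j \<le> \<sigma> (Suc j)) \<and>
    (\<forall>k\<le>\<sigma> m. v k > 0) \<and>
    (\<forall>j\<le>m. \<bar>ln (v (\<sigma> j)) - g j\<bar> \<le> \<eta>) \<and>
    (\<forall>j<m. \<forall>k. \<sigma> j \<le> k \<and> k < \<rho> j \<longrightarrow> \<bar>ln (v k) - ln (v (\<sigma> j))\<bar> \<le> \<eta>) \<and>
    (\<forall>j<m. \<forall>k. \<rho> j \<le> k \<and> k \<le> \<sigma> (Suc j) \<longrightarrow> \<bar>ln (v k) - ln (v (\<sigma> (Suc j)))\<bar> \<le> \<eta>) \<and>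
    (\<forall>j<m. h * exp (- \<eta>) * exp (\<gamma> * min (ln (v (\<sigma> j))) (ln (v (\<sigma> (Suc j))))) \<le> (real (\<sigma> (Suc j)) - real (\<sigma> j)) / A \<and>
       (real (\<sigma> (Suc j)) - real (\<sigma> j)) / A \<le> h * exp \<eta> * exp (\<gamma> * max (ln (v (\<sigma> j))) (ln (v (\<sigma> (Suc j)))))) \<and>
    (\<forall>k. \<sigma> m \<le> k \<and> real k \<le> A * T \<longrightarrow> v k \<le> \<eta>)"

text \<open>All randomness has been removed: arbitrary near paths along one fixed path
  \<open>x\<close>, with meshes tending to 0 and horizons to infinity. The hypothesis
  \<open>drift\<close> is the source of absorption at 0: it makes the limit small after a finite
  Levy time.\<close>

locale near_seq = lamperti_path x \<gamma> for x :: "real \<Rightarrow> real" and \<gamma> :: real +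
  fixes A h T \<eta> :: "nat \<Rightarrow> real" and m :: "nat \<Rightarrow> nat" and v :: "nat \<Rightarrow> nat \<Rightarrow> real" and \<sigma> \<rho> :: "nat \<Rightarrow> nat \<Rightarrow> nat"
  assumes drift: "\<And>R. \<exists>S\<ge>0. \<forall>s\<ge>S. x s \<le> R"
    and h: "\<And>i. h i > 0" and h0: "h \<longlonglongrightarrow> 0" and mh: "filterlim (\<lambda>i. real (m i) * h i) at_top sequentially"
    and T: "filterlim T at_top sequentially" and \<eta>: "\<eta> \<longlonglongrightarrow> 0"
    and np: "\<And>i. near_path \<gamma> (A i) (h i) (m i) (T i) (\<eta> i) (\<lambda>j. x (real j * h i)) (v i) (\<sigma> i) (\<rho> i)"
begin

lemma A: "A i > 0" and v0: "v i k \<ge> 0" and s0: "\<sigma> i 0 = 0"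
  and sr: "j < m i \<Longrightarrow> \<sigma> i j < \<rho> i j \<and> \<rho> i j \<le> \<sigma> i (Suc j)"
  and vpos: "k \<le> \<sigma> i (m i) \<Longrightarrow> v i k > 0"
  and D1: "j \<le> m i \<Longrightarrow> \<bar>ln (v i (\<sigma> i j)) - x (real j * h i)\<bar> \<le> \<eta> i"
  and D2: "j < m i \<Longrightarrow> \<sigma> i j \<le> k \<Longrightarrow> k < \<rho> i j \<Longrightarrow> \<bar>ln (v i k) - ln (v i (\<sigma> i j))\<bar> \<le> \<eta> i"
  and D2': "j < m i \<Longrightarrow> \<rho> i j \<le> k \<Longrightarrow> k \<le> \<sigma> i (Suc j) \<Longrightarrow> \<bar>ln (v i k) - ln (v i (\<sigma> i (Suc j)))\<bar> \<le> \<eta> i"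
  and D3: "j < m i \<Longrightarrow> h i * exp (- \<eta> i) * exp (\<gamma> * min (ln (v i (\<sigma> i j))) (ln (v i (\<sigma> i (Suc j))))) \<le> (real (\<sigma> i (Suc j)) - real (\<sigma> i j)) / A i"
  and D3': "j < m i \<Longrightarrow> (real (\<sigma> i (Suc j)) - real (\<sigma> i j)) / A i \<le> h i * exp (\<eta> i) * exp (\<gamma> * max (ln (v i (\<sigma> i j))) (ln (v i (\<sigma> i (Suc j)))))"
  and D4: "\<sigma> i (m i) \<le> k \<Longrightarrow> real k \<le> A i * T i \<Longrightarrow> v i k \<le> \<eta> i"
  using np[of i] unfolding near_path_def by blast+

lemma s_mono: "j \<le> j' \<Longrightarrow> j' \<le> m i \<Longrightarrow> \<sigma> i j \<le> \<sigma> i j'"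
proof (induction j')
  case (Suc j')
  then show ?case using sr[of j' i] by (cases "j = Suc j'") auto
qed simp

text \<open>The duration of a cell divided by \<open>h\<close> lies, up to small factors, between
  the values of \<open>exp (\<gamma> * x)\<close> suggested by its two ends, so the sum of the
  durations is the integral of a step function \<open>\<phi>\<close>. This function converges at
  continuity points of \<open>x\<close>, hence almost everywhere, and dominated convergence
  applies.\<close>

lemma real_time:
  assumes J: "\<forall>\<^sub>F i in sequentially. J i \<le> m i" and lim: "(\<lambda>i. real (J i) * h i) \<longlonglongrightarrow> s" and s: "s \<ge> 0"
  shows "(\<lambda>i. real (\<sigma> i (J i)) / A i) \<longlonglongrightarrow> C s"
proof -
  define \<Delta> where "\<Delta> i j = (real (\<sigma> i (Suc j)) - real (\<sigma> i j)) / A i" for i j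
  define \<phi> where "\<phi> i u = (\<Sum>j<J i. indicator {real j * h i..<(real j + 1) * h i} u * (\<Delta> i j / h i))" for i and u :: real
  have phim[measurable]: "\<phi> i \<in> borel_measurable borel" for i unfolding \<phi>_def by measurable
  have int: "(\<integral>u. \<phi> i u \<partial>lborel) = real (\<sigma> i (J i)) / A i" for i
  proof -
    have "(\<integral>u. \<phi> i u \<partial>lborel) = (\<Sum>j<J i. (\<integral>u. indicator {real j * h i..<(real j + 1) * h i} u * (\<Delta> i j / h i) \<partial>lborel))"
      unfolding \<phi>_def by (rule Bochner_Integration.integral_sum)
        (intro integrable_mult_left integrable_real_indicator, auto simp: emeasure_lborel_Ico h less_imp_le mult_right_mono)
    also have "\<dots> = (\<Sum>j<J i. \<Delta> i j)"
    proof (rule sum.cong[OF refl])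
      fix j
      have "real j * h i \<le> (real j + 1) * h i" using h[of i] by (simp add: algebra_simps)
      then show "(\<integral>u. indicator {real j * h i..<(real j + 1) * h i} u * (\<Delta> i j / h i) \<partial>lborel) = \<Delta> i j"
        using h[of i] by (simp add: algebra_simps)
    qed
    also have "\<dots> = (\<Sum>j<J i. real (\<sigma> i (Suc j)) - real (\<sigma> i j)) / A i" by (simp add: \<Delta>_def sum_divide_distrib)
    also have "\<dots> = real (\<sigma> i (J i)) / A i" by (subst sum_lessThan_telescope) (simp add: s0)
    finally show ?thesis .
  qed
  have val: "\<phi> i u = (if j < J i then \<Delta> i j / h i else 0)" if u: "real j * h i \<le> u" "u < (real j + 1) * h i" for i u j
  proof -
    have "indicator {real k * h i..<(real k + 1) * h i} u = (if k = j then 1 else (0::real))" for k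
    proof (cases k j rule: linorder_cases)
      case less
      then have "(real k + 1) * h i \<le> real j * h i" using h[of i] by (intro mult_right_mono) auto
      then show ?thesis using u less by auto
    next
      case greater
      then have "(real j + 1) * h i \<le> real k * h i" using h[of i] by (intro mult_right_mono) auto
      then show ?thesis using u greater by auto
    qed (use u in auto)
    then have "\<phi> i u = (\<Sum>k<J i. if k = j then \<Delta> i j / h i else 0)"
      unfolding \<phi>_def by (intro sum.cong) auto
    then show ?thesis by simp
  qed
  define jj where "jj i u = nat \<lfloor>u / h i\<rfloor>" for i and u :: real
  have jj: "real (jj i u) * h i \<le> u" "u < (real (jj i u) + 1) * h i" if "u \<ge> 0" for i u
  proof -
    have "0 \<le> u / h i" using that h[of i] by simp
    then have "real (jj i u) = real_of_int \<lfloor>u / h i\<rfloor>" by (simp add: jj_def)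
    then have "real (jj i u) \<le> u / h i" "u / h i < real (jj i u) + 1" by linarith+
    then show "real (jj i u) * h i \<le> u" "u < (real (jj i u) + 1) * h i" using h[of i] by (simp_all add: field_simps)
  qed
  have neg: "\<phi> i u = 0" if "u < 0" for i u
  proof -
    have "indicator {real k * h i..<(real k + 1) * h i} u = (0::real)" for k
    proof -
      have "0 \<le> real k * h i" using h[of i] by simp
      then show ?thesis using that by simp
    qed
    then show ?thesis unfolding \<phi>_def by simp
  qed
  obtain B where B: "\<And>u. u \<in> {0..s+1} \<Longrightarrow> \<bar>x u\<bar> \<le> B" using cadlag_bounded[OF cad, of "s+1"] add_nonneg_nonneg[OF s zero_le_one] by blast
  \<comment> \<open>A bound on durations per unit of Levy time, from the bound \<open>B\<close> of
    \<open>x\<close> on a window one unit longer than \<open>s\<close>; the 1 added to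
    \<open>B\<close> absorbs the tolerance.\<close>
  define W where "W = exp 1 * exp (\<gamma> * (B + 1))"
  have ev: "\<forall>\<^sub>F i in sequentially. J i \<le> m i \<and> real (J i) * h i < s + 1 \<and> \<eta> i < 1"
    using J order_tendstoD(2)[OF lim less_add_one] order_tendstoD(2)[OF \<eta> zero_less_one] by eventually_elim auto
  then obtain i0 where i0: "\<And>i. i \<ge> i0 \<Longrightarrow> J i \<le> m i \<and> real (J i) * h i < s + 1 \<and> \<eta> i < 1"
    by (auto simp: eventually_sequentially)
  have \<Delta>0: "0 \<le> \<Delta> i j" if "j < m i" for i j
    using sr[OF that] A[of i] by (simp add: \<Delta>_def)
  have \<Delta>W: "\<Delta> i j / h i \<le> W" if i: "i \<ge> i0" and j: "j < J i" for i j
  proof -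
    have l: "ln (v i (\<sigma> i k)) \<le> B + 1" if "k \<le> J i" for k
    proof -
      have "real k * h i \<le> real (J i) * h i" using that h[of i] by (intro mult_right_mono) auto
      then have "real k * h i \<le> s + 1" using i0[OF i] by linarith
      then have "real k * h i \<in> {0..s+1}" using h[of i] by simp
      from B[OF this] show ?thesis using D1[of k i] that i0[OF i] by linarith
    qed
    have "\<gamma> * max (ln (v i (\<sigma> i j))) (ln (v i (\<sigma> i (Suc j)))) \<le> \<gamma> * (B + 1)"
      using l[of j] l[of "Suc j"] j g by (intro mult_left_mono) auto
    then have "h i * exp (\<eta> i) * exp (\<gamma> * max (ln (v i (\<sigma> i j))) (ln (v i (\<sigma> i (Suc j))))) \<le> h i * exp 1 * exp (\<gamma> * (B + 1))"
      using i0[OF i] h[of i] by (intro mult_mono) auto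
    then have "\<Delta> i j \<le> h i * W" using D3'[of j i] j i0[OF i] by (simp add: \<Delta>_def W_def mult.assoc)
    then show ?thesis using h[of i] by (simp add: field_simps)
  qed
  have "(\<lambda>i. \<integral>u. \<phi> (i + i0) u \<partial>lborel) \<longlonglongrightarrow> (\<integral>u. indicator {0..s} u * exp (\<gamma> * x u) \<partial>lborel)"
  proof (rule integral_dominated_convergence[where w = "\<lambda>u. W * indicator {0..s+1} u"])
    show "integrable lborel (\<lambda>u. W * indicator {0..s+1} u)"
      by (intro integrable_mult_right integrable_real_indicator) (auto simp: emeasure_lborel_Icc_eq)
    show "AE u in lborel. norm (\<phi> (i + i0) u) \<le> W * indicator {0..s+1} u" for i
    proof (rule AE_I2)
      fix u :: real
      show "norm (\<phi> (i + i0) u) \<le> W * indicator {0..s+1} u"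
      proof (cases "u \<ge> 0")
        case True
        define j where "j = jj (i + i0) u"
        note j = jj[OF True, of "i + i0", folded j_def]
        show ?thesis
        proof (cases "j < J (i + i0)")
          case True
          have "(real j + 1) * h (i + i0) \<le> real (J (i + i0)) * h (i + i0)"
            using True h[of "i + i0"] by (intro mult_right_mono) auto
          then have "u \<in> {0..s+1}" using j \<open>u \<ge> 0\<close> i0[of "i + i0"] by simp
          moreover have "0 \<le> \<Delta> (i + i0) j / h (i + i0)"
            using \<Delta>0[of j "i + i0"] True i0[of "i + i0"] h[of "i + i0"] by simp
          ultimately show ?thesis using val[OF j] True \<Delta>W[of "i + i0" j] by simp
        next
          case False then show ?thesis using val[OF j] by (simp add: W_def)
        qed
      qed (simp add: neg W_def)
    qed
    have "AE u in lborel. u \<noteq> s" by (rule AE_lborel_singleton)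
    moreover have "AE u in lborel. u \<noteq> (0::real)" by (rule AE_lborel_singleton)
    moreover note cadlag_AE_cont[OF cad]
    ultimately show "AE u in lborel. (\<lambda>i. \<phi> (i + i0) u) \<longlonglongrightarrow> indicator {0..s} u * exp (\<gamma> * x u)"
    proof eventually_elim
      case (elim u)
      have "(\<lambda>i. \<phi> i u) \<longlonglongrightarrow> indicator {0..s} u * exp (\<gamma> * x u)"
      proof -
        consider "u < 0" | "u > s" "u > 0" | "0 < u" "u < s" using elim by linarith
        then show ?thesis
        proof cases
          case 1 then show ?thesis by (simp add: neg)
        next
          case 2
          have "\<forall>\<^sub>F i in sequentially. \<phi> i u = 0"
            using order_tendstoD(2)[OF lim 2(1)]
          proof eventually_elim
            case (elim i)
            have "u \<ge> 0" using 2 by simp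
            note j = jj[OF this, of i]
            have "\<not> jj i u < J i"
            proof
              assume "jj i u < J i"
              then have "(real (jj i u) + 1) * h i \<le> real (J i) * h i" using h[of i] by (intro mult_right_mono) auto
              then show False using j elim by linarith
            qed
            then show ?case using val[OF j] by simp
          qed
          then show ?thesis using 2 by (auto intro: tendsto_eventually)
        next
          case 3
          then have u: "u \<ge> 0" by simp
          have cu: "isCont x u" using elim 3 by blast
          define j where "j i = jj i u" for i
          note j = jj[OF u, folded j_def]
          have jl: "(\<lambda>i. real (j i) * h i) \<longlonglongrightarrow> u"
          proof (rule tendsto_sandwich[of "\<lambda>i. u - h i" _ _ "\<lambda>i. u"])
            show "\<forall>\<^sub>F i in sequentially. u - h i \<le> real (j i) * h i"
            proof (intro always_eventually allI)
              fix i show "u - h i \<le> real (j i) * h i" using j(2)[of i] by (simp add: algebra_simps)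
            qed
            show "(\<lambda>i. u - h i) \<longlonglongrightarrow> u" using tendsto_diff[OF tendsto_const h0] by simp
          qed (use j in auto)
          have jl': "(\<lambda>i. real (Suc (j i)) * h i) \<longlonglongrightarrow> u"
            using tendsto_add[OF jl h0] by (simp add: algebra_simps)
          have evj: "\<forall>\<^sub>F i in sequentially. j i < J i \<and> J i \<le> m i"
            using order_tendstoD(1)[OF lim 3(2)] J
          proof eventually_elim
            case (elim i)
            have "j i < J i"
            proof (rule ccontr)
              assume "\<not> j i < J i"
              then have "real (J i) * h i \<le> real (j i) * h i" using h[of i] by (intro mult_right_mono) auto
              then show False using j(1)[of i] elim by linarith
            qed
            then show ?case using elim by simp
          qed
          have lnl: "(\<lambda>i. ln (v i (\<sigma> i (k i)))) \<longlonglongrightarrow> x u"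
            if kl: "(\<lambda>i. real (k i) * h i) \<longlonglongrightarrow> u" and km: "\<forall>\<^sub>F i in sequentially. k i \<le> m i" for k
          proof -
            have "(\<lambda>i. x (real (k i) * h i)) \<longlonglongrightarrow> x u" by (rule isCont_tendsto_compose[OF cu kl])
            moreover have "(\<lambda>i. ln (v i (\<sigma> i (k i))) - x (real (k i) * h i)) \<longlonglongrightarrow> 0"
            proof (rule Lim_null_comparison[OF _ \<eta>])
              show "\<forall>\<^sub>F i in sequentially. norm (ln (v i (\<sigma> i (k i))) - x (real (k i) * h i)) \<le> \<eta> i"
                using km by eventually_elim (use D1 in simp)
            qed
            ultimately have "(\<lambda>i. (ln (v i (\<sigma> i (k i))) - x (real (k i) * h i)) + x (real (k i) * h i)) \<longlonglongrightarrow> 0 + x u"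
              by (rule tendsto_add[rotated])
            then show ?thesis by simp
          qed
          have l1: "(\<lambda>i. ln (v i (\<sigma> i (j i)))) \<longlonglongrightarrow> x u"
            by (rule lnl[OF jl]) (use evj in \<open>auto elim!: eventually_mono\<close>)
          have l2: "(\<lambda>i. ln (v i (\<sigma> i (Suc (j i))))) \<longlonglongrightarrow> x u"
            by (rule lnl[OF jl']) (use evj in \<open>auto elim!: eventually_mono\<close>)
          have "(\<lambda>i. \<Delta> i (j i) / h i) \<longlonglongrightarrow> exp (\<gamma> * x u)"
          proof (rule tendsto_sandwich)
            show "\<forall>\<^sub>F i in sequentially. exp (- \<eta> i) * exp (\<gamma> * min (ln (v i (\<sigma> i (j i)))) (ln (v i (\<sigma> i (Suc (j i)))))) \<le> \<Delta> i (j i) / h i"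
              using evj
            proof eventually_elim
              case (elim i)
              then show ?case using D3[of "j i" i] h[of i] by (simp add: \<Delta>_def[symmetric] field_simps)
            qed
            show "\<forall>\<^sub>F i in sequentially. \<Delta> i (j i) / h i \<le> exp (\<eta> i) * exp (\<gamma> * max (ln (v i (\<sigma> i (j i)))) (ln (v i (\<sigma> i (Suc (j i))))))"
              using evj
            proof eventually_elim
              case (elim i)
              then show ?case using D3'[of "j i" i] h[of i] by (simp add: \<Delta>_def[symmetric] field_simps)
            qed
            have "(\<lambda>i. exp (- \<eta> i) * exp (\<gamma> * min (ln (v i (\<sigma> i (j i)))) (ln (v i (\<sigma> i (Suc (j i))))))) \<longlonglongrightarrow> exp (- 0) * exp (\<gamma> * min (x u) (x u))"
              by (intro tendsto_intros \<eta> l1 l2)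
            then show "(\<lambda>i. exp (- \<eta> i) * exp (\<gamma> * min (ln (v i (\<sigma> i (j i)))) (ln (v i (\<sigma> i (Suc (j i))))))) \<longlonglongrightarrow> exp (\<gamma> * x u)" by simp
            have "(\<lambda>i. exp (\<eta> i) * exp (\<gamma> * max (ln (v i (\<sigma> i (j i)))) (ln (v i (\<sigma> i (Suc (j i))))))) \<longlonglongrightarrow> exp 0 * exp (\<gamma> * max (x u) (x u))"
              by (intro tendsto_intros \<eta> l1 l2)
            then show "(\<lambda>i. exp (\<eta> i) * exp (\<gamma> * max (ln (v i (\<sigma> i (j i)))) (ln (v i (\<sigma> i (Suc (j i))))))) \<longlonglongrightarrow> exp (\<gamma> * x u)" by simp
          qed
          moreover have "\<forall>\<^sub>F i in sequentially. \<Delta> i (j i) / h i = \<phi> i u"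
            using evj by eventually_elim (use val[OF j] in simp)
          ultimately have "(\<lambda>i. \<phi> i u) \<longlonglongrightarrow> exp (\<gamma> * x u)" by (rule Lim_transform_eventually)
          then show ?thesis using 3 by simp
        qed
      qed
      then show ?case by (rule LIMSEQ_ignore_initial_segment)
    qed
  qed measurable
  then have "(\<lambda>i. real (\<sigma> (i + i0) (J (i + i0))) / A (i + i0)) \<longlonglongrightarrow> C s" unfolding int C_def .
  then show ?thesis by (rule LIMSEQ_offset)
qed

text \<open>An index is attached to the grid point on its own side of the large move: to the left
  end of its cell before \<open>\<rho> i j\<close>, to the right end from then on. So the path and
  the grid pass the move together, which is what the last two conjuncts record.\<close>

lemma locate:
  assumes idx: "idx < \<sigma> i (m i)"
  shows "\<exists>j\<le>m i. \<bar>ln (v i idx) - x (real j * h i)\<bar> \<le> 2 * \<eta> i \<and>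
    (\<forall>j0<m i. \<rho> i j0 \<le> idx \<longrightarrow> j0 + 1 \<le> j) \<and> (\<forall>j1<m i. idx < \<rho> i j1 \<longrightarrow> j \<le> j1)"
proof -
  have "\<exists>j<m i. real (\<sigma> i j) \<le> real idx \<and> real idx < real (\<sigma> i (Suc j))"
  proof (rule partition_cell)
    show "real (\<sigma> i k) < real (\<sigma> i (Suc k))" if "k < m i" for k using sr[OF that] by simp
  qed (use s0 idx in auto)
  then obtain j where j: "j < m i" "\<sigma> i j \<le> idx" "idx < \<sigma> i (Suc j)" by auto
  have before: "idx < \<rho> i j1" if "j < j1" "j1 < m i" for j1
    using s_mono[of "Suc j" j1 i] sr[of j1 i] that j by linarith
  have after: "\<rho> i j0 \<le> idx" if "j0 < j" for j0
    using s_mono[of "Suc j0" j i] sr[of j0 i] that j by linarith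
  show ?thesis
  proof (cases "idx < \<rho> i j")
    case True
    show ?thesis
    proof (intro exI[of _ j] conjI allI impI)
      show "\<bar>ln (v i idx) - x (real j * h i)\<bar> \<le> 2 * \<eta> i" using D2[OF j(1,2) True] D1[of j i] j by linarith
      fix j0 assume "j0 < m i" "\<rho> i j0 \<le> idx"
      then show "j0 + 1 \<le> j" using before[of j0] True by (cases j0 j rule: linorder_cases) auto
    next
      fix j1 assume "j1 < m i" "idx < \<rho> i j1"
      then show "j \<le> j1" using after[of j1] by (cases "j \<le> j1") auto
    qed (use j in simp)
  next
    case False
    show ?thesis
    proof (intro exI[of _ "Suc j"] conjI allI impI)
      have "\<bar>ln (v i idx) - ln (v i (\<sigma> i (Suc j)))\<bar> \<le> \<eta> i" by (rule D2'[OF j(1)]) (use False j in auto)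
      then show "\<bar>ln (v i idx) - x (real (Suc j) * h i)\<bar> \<le> 2 * \<eta> i" using D1[of "Suc j" i] j by linarith
      fix j0 assume "j0 < m i" "\<rho> i j0 \<le> idx"
      then show "j0 + 1 \<le> Suc j" using before[of j0] by (cases "j < j0") auto
    next
      fix j1 assume "j1 < m i" "idx < \<rho> i j1"
      then show "Suc j \<le> j1" using after[of j1] False by (cases j1 j rule: linorder_cases) auto
    qed (use j in simp)
  qed
qed

text \<open>The time change sends \<open>C (t k)\<close>, the real time of a partition point of
  \<open>x\<close>, to the instant of the large move in the cell containing \<open>t k\<close>.
  Between consecutive nodes both paths then stay in one block of small oscillation, wherever the
  move sits within its cell; after the Levy time \<open>S\<close> both are small.\<close>

theorem J1: "J1_conv (\<lambda>i t. v i (nat \<lfloor>A i * t\<rfloor>)) Y"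
proof (rule J1_convI)
  fix \<epsilon> Tm :: real assume \<epsilon>: "\<epsilon> > 0"
  \<comment> \<open>Beyond this time the limit is at most \<open>\<epsilon>/4\<close>, and the near
    path at most twice that, or at most its own tolerance after the last cell.\<close>
  obtain S1 where S1: "S1 \<ge> 0" "\<And>s. s \<ge> S1 \<Longrightarrow> x s \<le> ln (\<epsilon>/4)" using drift by blast
  define S where "S = max S1 1"
  have S: "S > 0" "\<And>s. s \<ge> S \<Longrightarrow> x s \<le> ln (\<epsilon>/4)" using S1 by (auto simp: S_def)
  obtain Mb where Mb: "\<And>u. u \<in> {0..S} \<Longrightarrow> \<bar>x u\<bar> \<le> Mb" using cadlag_bounded[OF cad less_imp_le[OF S(1)]] by blast
  \<comment> \<open>The tolerance for logarithms that gives \<epsilon> for the values, as the limit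
    is at most \<open>exp Mb\<close> up to \<open>S\<close>. One third is spent on the oscillation
    of \<open>x\<close>, another on the near path.\<close>
  define \<delta> where "\<delta> = ln (1 + min 1 (\<epsilon> / exp Mb))"
  have "1 < 1 + min 1 (\<epsilon> / exp Mb)" using \<epsilon> by simp
  then have \<delta>: "\<delta> > 0" unfolding \<delta>_def by (rule ln_gt_zero)
  have e\<delta>: "exp \<delta> = 1 + min 1 (\<epsilon> / exp Mb)" unfolding \<delta>_def using \<epsilon> by (intro exp_ln) (simp add: add_pos_pos)
  have close: "\<bar>exp l - exp w\<bar> \<le> \<epsilon>" if "\<bar>l - w\<bar> \<le> \<delta>" "w \<le> Mb" for l w :: real
  proof -
    have "exp (l - w) \<le> exp \<delta>" using that by simp
    moreover have "exp (- \<delta>) \<le> exp (l - w)" using that by simp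
    moreover have "1 \<le> exp \<delta> * 1" using \<delta> by simp
    moreover have "1 - (exp \<delta> - 1) \<le> exp (- \<delta>)"
    proof -
      have "exp \<delta> + exp (- \<delta>) \<ge> 2"
        using cosh_real_ge_1[of \<delta>] by (simp add: cosh_def)
      then show ?thesis by linarith
    qed
    ultimately have 1: "\<bar>exp (l - w) - 1\<bar> \<le> \<epsilon> / exp Mb" unfolding e\<delta> by linarith
    have "\<bar>exp l - exp w\<bar> = exp w * \<bar>exp (l - w) - 1\<bar>"
      by (simp add: exp_diff abs_mult[symmetric] field_simps)
    also have "\<dots> \<le> exp Mb * (\<epsilon> / exp Mb)" using 1 that by (intro mult_mono) auto
    finally show ?thesis by simp
  qed
  obtain r t where t: "t 0 = 0" "t r = S" "\<And>k. k < r \<Longrightarrow> t k < t (Suc k)"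
    "\<And>k u w. k < r \<Longrightarrow> u \<in> {t k..<t (Suc k)} \<Longrightarrow> w \<in> {t k..<t (Suc k)} \<Longrightarrow> \<bar>x u - x w\<bar> \<le> \<delta>/3"
    using cadlag_partition[OF cad, of S "\<delta>/3"] S \<delta> by (auto simp: less_imp_le)
  have r0: "r > 0" using t S by (cases r) auto
  have tm: "t i \<le> t j" if "i \<le> j" "j \<le> r" for i j
    by (rule partition_mono[of r t]) (use t(3) that in auto)
  have tS: "t k \<le> S" if "k \<le> r" for k using tm[of k r] that t(2) by auto
  have t0: "0 \<le> t k" if "k \<le> r" for k using tm[of 0 k] that t(1) by auto
  have tpos: "0 < t k" if "0 < k" "k \<le> r" for k
    using t(3)[of 0] tm[of 1 k] that t(1) by (auto simp: Suc_le_eq)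
  define u where "u k = C (t k)" for k
  have u0: "u 0 = 0" by (simp add: u_def t C_0)
  have um: "u k < u (Suc k)" if "k < r" for k unfolding u_def by (rule C_less) (use t t0[of k] that in auto)
  \<comment> \<open>The cell is taken open on the left and closed on the right: its left end
    \<open>jn i k * h i\<close> lies strictly before \<open>t k\<close> and its right end at or
    after it, so a jump at \<open>t k\<close> happens inside.\<close>
  define jn where "jn i k = nat (\<lceil>t k / h i\<rceil> - 1)" for i k
  have jn: "real (jn i k) * h i < t k" "t k \<le> (real (jn i k) + 1) * h i" if "0 < k" "k \<le> r" for i k
  proof -
    have "t k / h i > 0" using tpos[OF that] h[of i] by simp
    then have "\<lceil>t k / h i\<rceil> \<ge> 1" by linarith
    then have "real (jn i k) = real_of_int \<lceil>t k / h i\<rceil> - 1" by (simp add: jn_def)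
    then have "real (jn i k) < t k / h i" "t k / h i \<le> real (jn i k) + 1" by linarith+
    then show "real (jn i k) * h i < t k" "t k \<le> (real (jn i k) + 1) * h i" using h[of i] by (simp_all add: field_simps)
  qed
  define d where "d i k = (if k = 0 then 0 else real (\<rho> i (jn i k)) / A i)" for i k
  \<comment> \<open>A mesh below the smallest block length puts distinct partition points into
    distinct cells, so that the nodes \<open>d i k\<close> increase strictly.\<close>
  define gap where "gap = Min ((\<lambda>k. t (Suc k) - t k) ` {..<r})"
  have gap: "gap > 0" "\<And>k. k < r \<Longrightarrow> gap \<le> t (Suc k) - t k"
    unfolding gap_def using t(3) r0 by (subst Min_gr_iff) (auto intro!: Min_le)
  have evm: "\<forall>\<^sub>F i in sequentially. real (m i) * h i \<ge> S" using mh by (simp add: filterlim_at_top)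
  have jm: "jn i k < m i" if "real (m i) * h i \<ge> S" "0 < k" "k \<le> r" for i k
  proof -
    have "real (jn i k) * h i < real (m i) * h i" using jn(1)[OF that(2,3), of i] tS[OF that(3)] that(1) by linarith
    then show ?thesis using h[of i] by simp
  qed
  have dlim: "(\<lambda>i. d i k) \<longlonglongrightarrow> u k" if k: "k \<le> r" for k
  proof (cases "k = 0")
    case True then show ?thesis by (simp add: d_def u0)
  next
    case False
    then have kk: "0 < k" "k \<le> r" using k by auto
    have l1: "(\<lambda>i. real (jn i k) * h i) \<longlonglongrightarrow> t k"
    proof (rule tendsto_sandwich[of "\<lambda>i. t k - h i" _ _ "\<lambda>i. t k"])
      show "\<forall>\<^sub>F i in sequentially. t k - h i \<le> real (jn i k) * h i"
      proof (intro always_eventually allI)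
        fix i show "t k - h i \<le> real (jn i k) * h i" using jn(2)[OF kk, of i] by (simp add: algebra_simps)
      qed
      show "\<forall>\<^sub>F i in sequentially. real (jn i k) * h i \<le> t k"
        by (intro always_eventually allI less_imp_le jn kk)
      show "(\<lambda>i. t k - h i) \<longlonglongrightarrow> t k" using tendsto_diff[OF tendsto_const h0] by simp
    qed simp
    have l2: "(\<lambda>i. real (Suc (jn i k)) * h i) \<longlonglongrightarrow> t k"
      using tendsto_add[OF l1 h0] by (simp add: algebra_simps)
    have c1: "(\<lambda>i. real (\<sigma> i (jn i k)) / A i) \<longlonglongrightarrow> C (t k)"
      by (rule real_time[OF _ l1]) (use evm jm[OF _ kk] t0[OF k] in \<open>auto elim!: eventually_mono intro: less_imp_le\<close>)
    have c2: "(\<lambda>i. real (\<sigma> i (Suc (jn i k))) / A i) \<longlonglongrightarrow> C (t k)"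
      by (rule real_time[OF _ l2]) (use evm jm[OF _ kk] t0[OF k] in \<open>auto elim!: eventually_mono simp: Suc_le_eq\<close>)
    show ?thesis unfolding u_def
    proof (rule tendsto_sandwich[OF _ _ c1 c2])
      show "\<forall>\<^sub>F i in sequentially. real (\<sigma> i (jn i k)) / A i \<le> d i k"
        using evm
      proof eventually_elim
        case (elim i)
        show ?case using sr[OF jm[OF elim kk]] A[of i] kk by (simp add: d_def divide_right_mono)
      qed
      show "\<forall>\<^sub>F i in sequentially. d i k \<le> real (\<sigma> i (Suc (jn i k))) / A i"
        using evm
      proof eventually_elim
        case (elim i)
        show ?case using sr[OF jm[OF elim kk]] A[of i] kk by (simp add: d_def divide_right_mono)
      qed
    qed
  qed
  have evd: "\<forall>\<^sub>F i in sequentially. \<forall>k\<in>{..r}. \<bar>d i k - u k\<bar> \<le> \<epsilon>"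
  proof (rule eventually_ball_finite)
    show "\<forall>k\<in>{..r}. \<forall>\<^sub>F i in sequentially. \<bar>d i k - u k\<bar> \<le> \<epsilon>"
    proof
      fix k assume "k \<in> {..r}"
      then have "(\<lambda>i. d i k) \<longlonglongrightarrow> u k" using dlim by simp
      from tendstoD[OF this \<epsilon>] show "\<forall>\<^sub>F i in sequentially. \<bar>d i k - u k\<bar> \<le> \<epsilon>"
        by eventually_elim (simp add: dist_real_def)
    qed
  qed simp
  \<comment> \<open>The bounds \<open>\<delta>/6\<close> and \<open>ln 2 / 2\<close> account for the
    tolerance \<open>2 * \<eta> i\<close> of \<open>locate\<close>, within a block and in the tail;
    \<open>\<epsilon>/2\<close> is for the time after the last cell.\<close>
  have "\<forall>\<^sub>F i in sequentially. \<eta> i < min (\<delta>/6) (min (\<epsilon>/2) (ln 2 / 2))"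
    using \<delta> \<epsilon> by (intro order_tendstoD(2)[OF \<eta>]) auto
  moreover have "\<forall>\<^sub>F i in sequentially. h i < gap" by (rule order_tendstoD(2)[OF h0 gap(1)])
  moreover have "\<forall>\<^sub>F i in sequentially. T i \<ge> Tm + \<epsilon>" using T by (simp add: filterlim_at_top)
  ultimately show "\<forall>\<^sub>F i in sequentially. \<exists>l. time_change l \<and> (\<forall>t\<ge>0. \<bar>l t - t\<bar> \<le> \<epsilon>) \<and> (\<forall>t\<in>{0..Tm}. \<bar>v i (nat \<lfloor>A i * l t\<rfloor>) - Y t\<bar> \<le> \<epsilon>)"
    using evd evm
  proof eventually_elim
    case (elim i)
    note jmi = jm[OF elim(5)]
    have sj: "Suc (jn i k) \<le> jn i (Suc k)" if "0 < k" "k < r" for k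
    proof -
      have "t k + h i \<le> (real (jn i (Suc k)) + 1) * h i" using jn(2)[of "Suc k" i] gap(2)[of k] elim(2) that by auto
      then have "real (jn i k) * h i < real (jn i (Suc k)) * h i" using jn(1)[of k i] that by (simp add: algebra_simps)
      then show ?thesis using h[of i] by simp
    qed
    have dm: "d i k < d i (Suc k)" if k: "k < r" for k
    proof (cases "k = 0")
      case True
      have "\<rho> i (jn i (Suc k)) > 0" using sr[OF jmi[of "Suc k"]] k by auto
      then show ?thesis using True A[of i] by (simp add: d_def)
    next
      case False
      have "\<rho> i (jn i k) \<le> \<sigma> i (Suc (jn i k))" using sr[OF jmi[of k]] k False by auto
      also have "\<dots> \<le> \<sigma> i (jn i (Suc k))" using sj[of k] jmi[of "Suc k"] k False by (intro s_mono) auto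
      also have "\<dots> < \<rho> i (jn i (Suc k))" using sr[OF jmi[of "Suc k"]] k by auto
      finally show ?thesis using False A[of i] by (simp add: d_def divide_strict_right_mono)
    qed
    define l where "l = pl u (d i) r"
    have d0: "d i 0 = 0" by (simp add: d_def)
    have du: "\<bar>d i k - u k\<bar> \<le> \<epsilon>" if "k \<le> r" for k using elim(4) that by simp
    have l: "strict_mono_on {0..} l" "\<And>k. k \<le> r \<Longrightarrow> l (u k) = d i k" "\<And>t. t \<ge> 0 \<Longrightarrow> \<bar>l t - t\<bar> \<le> \<epsilon>"
      using pl_props[of u "d i" \<epsilon> r, OF u0 d0 less_imp_le[OF \<epsilon>] um dm du] unfolding l_def by auto
    have ltc: "time_change l" unfolding l_def by (rule pl_time_change[OF u0 d0 less_imp_le[OF \<epsilon>] um dm du])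
    have unn: "0 \<le> u k" if "k \<le> r" for k unfolding u_def by (rule C_nonneg[OF t0[OF that]])
    have lmono: "l s \<le> l s'" if "0 \<le> s" "s \<le> s'" for s s'
      using that l(1) unfolding strict_mono_on_def by (cases "s = s'") (auto intro: less_imp_le)
    have main: "\<bar>v i (nat \<lfloor>A i * l s\<rfloor>) - Y s\<bar> \<le> \<epsilon>" if s: "s \<in> {0..Tm}" for s
    proof -
      define idx where "idx = nat \<lfloor>A i * l s\<rfloor>"
      have ls0: "0 \<le> l s" using lmono[of 0 s] s l(2)[of 0] u0 d0 by simp
      then have idx: "real idx \<le> A i * l s" "A i * l s < real idx + 1"
        unfolding idx_def using A[of i] by (simp_all add: of_nat_floor less_imp_le)
      have rho_le: "\<rho> i (jn i k) \<le> idx" if "0 < k" "k \<le> r" "u k \<le> s" for k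
      proof -
        have "d i k \<le> l s" using lmono[of "u k" s] l(2)[of k] unn[of k] that by auto
        then have "real (\<rho> i (jn i k)) \<le> A i * l s" using that A[of i] by (simp add: d_def field_simps)
        then have "int (\<rho> i (jn i k)) \<le> \<lfloor>A i * l s\<rfloor>" by linarith
        then show ?thesis unfolding idx_def by linarith
      qed
      have rho_gt: "idx < \<rho> i (jn i k)" if "0 < k" "k \<le> r" "s < u k" for k
      proof -
        have "l s < l (u k)" using that s unn[of k] by (intro strict_mono_onD[OF l(1)]) auto
        then have "l s < d i k" using l(2)[of k] that by simp
        then have "A i * l s < real (\<rho> i (jn i k))" using that A[of i] by (simp add: d_def field_simps)
        then show ?thesis using idx by linarith
      qed
      show ?thesis
      proof (cases "s < u r")
        case True
        then obtain k where k: "k < r" "u k \<le> s" "s < u (Suc k)"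
          using partition_cell[of r u s] um s u0 by auto
        have "idx < \<rho> i (jn i (Suc k))" using rho_gt[of "Suc k"] k by simp
        also have "\<dots> \<le> \<sigma> i (m i)" using sr[OF jmi[of "Suc k"]] s_mono[of "Suc (jn i (Suc k))" "m i" i] jmi[of "Suc k"] k by simp
        finally have im: "idx < \<sigma> i (m i)" .
        obtain j where j: "j \<le> m i" "\<bar>ln (v i idx) - x (real j * h i)\<bar> \<le> 2 * \<eta> i"
          "\<forall>j0<m i. \<rho> i j0 \<le> idx \<longrightarrow> j0 + 1 \<le> j" "\<forall>j1<m i. idx < \<rho> i j1 \<longrightarrow> j \<le> j1"
          using locate[OF im] by (elim exE conjE) (rule that)
        have j1: "t k \<le> real j * h i"
        proof (cases "k = 0")
          case True then show ?thesis using t h[of i] by simp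
        next
          case False
          then have "jn i k + 1 \<le> j" using j(3)[rule_format, of "jn i k"] rho_le[of k] jmi[of k] k by simp
          then have "(real (jn i k) + 1) * h i \<le> real j * h i" using h[of i] by (intro mult_right_mono) auto
          then show ?thesis using jn(2)[of k i] False k by simp
        qed
        have j2: "real j * h i < t (Suc k)"
        proof -
          have "j \<le> jn i (Suc k)" using j(4)[rule_format, of "jn i (Suc k)"] rho_gt[of "Suc k"] jmi[of "Suc k"] k by simp
          then have "real j * h i \<le> real (jn i (Suc k)) * h i" using h[of i] by (intro mult_right_mono) auto
          then show ?thesis using jn(1)[of "Suc k" i] k by simp
        qed
        have tk: "t k \<le> tau s" "tau s < t (Suc k)"
          using tau_ge[of "t k" s "t (Suc k)"] tau_less[of s "t (Suc k)"] k t0[of k] t0[of "Suc k"] s unfolding u_def by auto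
        have Ys: "Y s = exp (x (tau s))" using Y_before[of s "t (Suc k)"] k t0[of "Suc k"] s unfolding u_def by auto
        have "\<bar>x (real j * h i) - x (tau s)\<bar> \<le> \<delta>/3" by (rule t(4)[OF k(1)]) (use j1 j2 tk in auto)
        then have "\<bar>ln (v i idx) - x (tau s)\<bar> \<le> \<delta>" using j(2) elim(1) \<delta> by linarith
        moreover have "x (tau s) \<le> Mb" using Mb[of "tau s"] tk t0[of k] tS[of "Suc k"] k by fastforce
        ultimately have "\<bar>exp (ln (v i idx)) - exp (x (tau s))\<bar> \<le> \<epsilon>" by (rule close)
        then show ?thesis using vpos[of idx i] im by (simp add: Ys idx_def[symmetric])
      next
        case False
        have Y4: "0 \<le> Y s" "Y s \<le> \<epsilon>/4"
        proof -
          have "0 \<le> s" using s by simp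
          then show "0 \<le> Y s" by (rule Y_cases) auto
          from \<open>0 \<le> s\<close> show "Y s \<le> \<epsilon>/4"
          proof (rule Y_cases)
            assume "Y s = 0" then show ?thesis using \<epsilon> by simp
          next
            fix w assume w: "0 \<le> w" "s < C w" "Y s = exp (x (tau s))"
            have "S \<le> tau s" by (rule tau_ge[of S s w]) (use w False S t(2) in \<open>auto simp: u_def\<close>)
            then have "exp (x (tau s)) \<le> exp (ln (\<epsilon>/4))" using S by simp
            then show ?thesis using w \<epsilon> by simp
          qed
        qed
        have vs: "v i idx \<le> \<epsilon>/2"
        proof (cases "idx < \<sigma> i (m i)")
          case True
          obtain j where j: "j \<le> m i" "\<bar>ln (v i idx) - x (real j * h i)\<bar> \<le> 2 * \<eta> i"
            "\<forall>j0<m i. \<rho> i j0 \<le> idx \<longrightarrow> j0 + 1 \<le> j"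
            using locate[OF True] by (elim exE conjE) (rule that)
          have "jn i r + 1 \<le> j" using j(3)[rule_format, of "jn i r"] rho_le[of r] jmi[of r] r0 False by simp
          then have "(real (jn i r) + 1) * h i \<le> real j * h i" using h[of i] by (intro mult_right_mono) auto
          then have "S \<le> real j * h i" using jn(2)[of r i] r0 t(2) by simp
          then have "x (real j * h i) \<le> ln (\<epsilon>/4)" by (rule S(2))
          then have "ln (v i idx) \<le> ln (\<epsilon>/4) + ln 2" using j(2) elim(1) by linarith
          also have "\<dots> = ln (\<epsilon>/2)" using \<epsilon> by (simp flip: ln_mult_pos)
          finally show ?thesis using vpos[of idx i] True \<epsilon> by simp
        next
          case False
          have "l s \<le> T i" using l(3)[of s] s elim(3) by auto
          then have "A i * l s \<le> A i * T i" using A[of i] by simp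
          then have "v i idx \<le> \<eta> i" using D4[of i idx] False idx(1) by simp
          then show ?thesis using elim(1) by simp
        qed
        show ?thesis using vs Y4 v0[of i idx] \<epsilon> unfolding idx_def[symmetric] by linarith
      qed
    qed
    show ?case using ltc l(3) main by blast
  qed
qed

end

section \<open>Regularity of the Lamperti transform\<close>

context lamperti_path begin

lemma tau_nonneg: "0 \<le> t \<Longrightarrow> 0 \<le> u \<Longrightarrow> t < C u \<Longrightarrow> 0 \<le> tau t"
  using tau_ge[of 0 t u] C_0 by simp

lemma tau_mono: "0 \<le> t \<Longrightarrow> t \<le> t' \<Longrightarrow> 0 \<le> u \<Longrightarrow> t' < C u \<Longrightarrow> tau t \<le> tau t'"
proof (rule tau_ge[of "tau t" t' u])
  assume *: "0 \<le> t" "t \<le> t'" "0 \<le> u" "t' < C u"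
  then show "0 \<le> tau t" using tau_nonneg[of t u] by simp
  show "C (tau t) \<le> t'"
  proof (rule ccontr)
    assume "\<not> C (tau t) \<le> t'"
    then have "t < C (tau t)" using * by simp
    from tau_less[OF *(1) \<open>0 \<le> tau t\<close> this] show False by simp
  qed
qed auto

text \<open>Otherwise the Lipschitz bound would keep \<open>C\<close> at most \<open>t\<close> a
  little beyond \<open>tau t\<close>, against \<open>tau_ge\<close>.\<close>

lemma C_tau: "0 \<le> t \<Longrightarrow> 0 \<le> u \<Longrightarrow> t < C u \<Longrightarrow> t \<le> C (tau t)"
proof (rule ccontr)
  assume *: "0 \<le> t" "0 \<le> u" "t < C u" "\<not> t \<le> C (tau t)"
  define s where "s = tau t"
  have s: "0 \<le> s" using tau_nonneg * by (simp add: s_def)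
  obtain B where B: "\<And>u. u \<in> {0..s+1} \<Longrightarrow> \<bar>x u\<bar> \<le> B" using cadlag_bounded[OF cad, of "s+1"] add_nonneg_nonneg[OF s zero_le_one] by blast
  define d where "d = min 1 ((t - C s) / exp (\<gamma> * B))"
  have d: "0 < d" "d \<le> 1" using * by (auto simp: d_def s_def)
  have "C (s + d) - C s \<le> exp (\<gamma> * B) * (s + d - s)" by (rule C_diff) (use s d B in auto)
  also have "\<dots> \<le> exp (\<gamma> * B) * ((t - C s) / exp (\<gamma> * B))" by (intro mult_left_mono) (auto simp: d_def)
  finally have "C (s + d) \<le> t" by simp
  from tau_ge[OF _ this *(2,3)] s d show False by (simp add: s_def)
qed

text \<open>Before absorption \<open>Y\<close> is the exponential of \<open>x\<close> along the
  monotone \<open>tau\<close>. At the absorption time the left limit exists because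
  \<open>drift\<close> forces it to be 0.\<close>

lemma Y_cadlag:
  assumes drift: "\<And>R. \<exists>S\<ge>0. \<forall>s\<ge>S. x s \<le> R"
  shows "cadlag Y"
  unfolding cadlag_def
proof (intro conjI allI impI)
  fix t :: real assume t: "0 \<le> t"
  show "(Y \<longlongrightarrow> Y t) (at_right t)"
  proof (cases "\<exists>u\<ge>0. t < C u")
    case True
    then obtain u where u: "u \<ge> 0" "t < C u" by blast
    define s where "s = tau t"
    have s: "0 \<le> s" using tau_nonneg[OF t u] by (simp add: s_def)
    have "((\<lambda>s. exp (x s)) \<longlongrightarrow> exp (x s)) (at_right s)" using cad s by (auto simp: cadlag_def intro!: tendsto_intros)
    show ?thesis
    proof (rule tendstoI)
      fix e :: real assume "e > 0"
      then have "\<forall>\<^sub>F w in at_right s. dist (exp (x w)) (exp (x s)) < e"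
        using \<open>((\<lambda>s. exp (x s)) \<longlongrightarrow> exp (x s)) (at_right s)\<close> by (intro tendstoD)
      then obtain s1 where s1: "s1 > s" "\<And>w. s < w \<Longrightarrow> w < s1 \<Longrightarrow> dist (exp (x w)) (exp (x s)) < e"
        by (auto simp: eventually_at_right_field)
      have lt: "t < C s1"
      proof (rule ccontr)
        assume "\<not> t < C s1"
        then have "s1 \<le> s" unfolding s_def using tau_ge[of s1 t u] u s s1(1) by (simp add: s_def)
        then show False using s1(1) by simp
      qed
      have "dist (Y t') (Y t) < e" if t': "t < t'" "t' < C s1" for t'
      proof -
        have Y: "Y t' = exp (x (tau t'))" "Y t = exp (x s)" using Y_before[of t' s1] Y_before[OF t u] t t' s s1 by (auto simp: s_def)
        have "s \<le> tau t'" unfolding s_def using tau_mono[of t t' s1] t t' s s1(1) by simp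
        moreover have "tau t' < s1" using tau_less[of t' s1] t t' s s1(1) by simp
        ultimately show ?thesis unfolding Y using s1(2)[of "tau t'"] \<open>e > 0\<close> by (cases "tau t' = s") auto
      qed
      then show "\<forall>\<^sub>F t' in at_right t. dist (Y t') (Y t) < e"
        using lt by (auto simp: eventually_at_right_field)
    qed
  next
    case False
    have "Y t' = 0" if "t \<le> t'" for t'
    proof -
      have "0 \<le> t'" using t that by simp
      then show ?thesis by (rule Y_cases) (use False that in force)+
    qed
    then show ?thesis
      by (intro tendsto_eventually) (auto simp: eventually_at_filter)
  qed
next
  fix t :: real assume t: "0 < t"
  show "\<exists>l. (Y \<longlongrightarrow> l) (at_left t)"
  proof (cases "\<exists>u\<ge>0. t < C u")
    case True
    then obtain u where u: "u \<ge> 0" "t < C u" by blast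
    have t0: "0 \<le> t" using t by simp
    define s where "s = tau t"
    have Cs: "t \<le> C s" using C_tau[OF t0 u] by (simp add: s_def)
    have s: "0 < s" using tau_nonneg[OF t0 u] Cs t C_0 by (cases "s = 0") (auto simp: s_def)
    obtain l where l: "(x \<longlongrightarrow> l) (at_left s)" using cad s unfolding cadlag_def by blast
    show ?thesis
    proof (intro exI tendstoI)
      fix e :: real assume e: "e > 0"
      have "((\<lambda>s. exp (x s)) \<longlongrightarrow> exp l) (at_left s)" by (intro tendsto_intros l)
      then have "\<forall>\<^sub>F w in at_left s. dist (exp (x w)) (exp l) < e" using e by (intro tendstoD)
      then obtain s1 where s1: "s1 < s" "\<And>w. s1 < w \<Longrightarrow> w < s \<Longrightarrow> dist (exp (x w)) (exp l) < e"
        by (auto simp: eventually_at_left_field)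
      define s2 where "s2 = max 0 ((s1 + s) / 2)"
      have s2: "0 \<le> s2" "s1 < s2" "s2 < s" using s1(1) s by (auto simp: s2_def max_def)
      have C2: "C s2 < t"
      proof (rule ccontr)
        assume "\<not> C s2 < t"
        define s3 where "s3 = (s2 + s) / 2"
        have s3: "s2 < s3" "s3 < s" using s2 by (auto simp: s3_def)
        have "C s2 < C s3" using C_less s2 s3 by simp
        then have "t < C s3" using \<open>\<not> C s2 < t\<close> by simp
        then have "tau t < s3" using tau_less[of t s3] t s2 s3 by simp
        then show False using s3 by (simp add: s_def)
      qed
      have C20: "0 \<le> C s2" by (rule C_nonneg[OF s2(1)])
      have "dist (Y t') (exp l) < e" if t': "C s2 < t'" "t' < t" for t'
      proof -
        have t'0: "0 \<le> t'" using t' C20 by simp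
        have Y: "Y t' = exp (x (tau t'))" using Y_before[of t' s] t'0 t' Cs s by simp
        have "s2 \<le> tau t'" using tau_ge[of s2 t' s] t' Cs s s2 by simp
        moreover have "tau t' < s" using tau_less[of t' s] t'0 t' Cs s by simp
        ultimately show ?thesis unfolding Y using s1(2)[of "tau t'"] s2 by auto
      qed
      then show "\<forall>\<^sub>F t' in at_left t. dist (Y t') (exp l) < e"
        using C2 by (auto simp: eventually_at_left_field)
    qed
  next
    case False
    have "(Y \<longlongrightarrow> 0) (at_left t)"
    proof (rule tendstoI)
      fix e :: real assume e: "e > 0"
      obtain S where S: "S \<ge> 0" "\<And>s. s \<ge> S \<Longrightarrow> x s \<le> ln (e/2)" using drift by blast
      have C1: "C S < C (S + 1)" using C_less S by simp
      have "C (S + 1) \<le> t" using False S(1) by (meson add_nonneg_nonneg linorder_not_le zero_le_one)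
      then have "C S < t" using C1 by simp
      moreover have "dist (Y t') 0 < e" if t': "C S < t'" "t' < t" for t'
      proof -
        have "0 \<le> t'" using t' C_nonneg[OF S(1)] by simp
        then show ?thesis
        proof (rule Y_cases)
          fix w assume w: "0 \<le> w" "t' < C w" "Y t' = exp (x (tau t'))"
          have "S \<le> tau t'" by (rule tau_ge[of S t' w]) (use w S t' in auto)
          then have "exp (x (tau t')) \<le> exp (ln (e/2))" using S by simp
          then show ?thesis using w e by simp
        qed (use e in simp)
      qed
      ultimately show "\<forall>\<^sub>F t' in at_left t. dist (Y t') 0 < e"
        by (auto simp: eventually_at_left_field)
    qed
    then show ?thesis by blast
  qed
qed

text \<open>\<open>tau t\<close> is approached from the right by the first grid time after which
  \<open>C\<close> exceeds \<open>t\<close>; this approximation depends on countably many values of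
  \<open>C\<close>, hence measurably on the path.\<close>

lemma Y_approx:
  assumes t: "0 \<le> t" "0 \<le> u" "t < C u"
  shows "(\<lambda>n. x ((real (LEAST j. t < C ((real j + 1) / real (Suc n))) + 1) / real (Suc n))) \<longlonglongrightarrow> x (tau t)"
proof -
  define s where "s = tau t"
  have s: "0 \<le> s" using tau_nonneg[OF t] by (simp add: s_def)
  define k where "k n = (LEAST j. t < C ((real j + 1) / real (Suc n)))" for n
  define f where "f n = (real (k n) + 1) / real (Suc n)" for n
  have f1: "s < f n" "f n \<le> s + 1 / real (Suc n)" for n
  proof -
    obtain j :: nat where "u * real (Suc n) \<le> real j" using real_arch_simple by blast
    then have "u \<le> (real j + 1) / real (Suc n)" by (simp add: field_simps)
    then have "t < C ((real j + 1) / real (Suc n))" using C_le_iff[of u "(real j + 1) / real (Suc n)"] t by (simp add: order.strict_trans2)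
    then have lt: "t < C (f n)" unfolding f_def k_def by (rule LeastI)
    have f0: "0 \<le> f n" by (simp add: f_def)
    show "s < f n" unfolding s_def by (rule tau_less[OF t(1) f0 lt])
    have "real (k n) / real (Suc n) \<le> s"
    proof (cases "k n")
      case 0 then show ?thesis using s by simp
    next
      case (Suc i)
      have "\<not> t < C ((real i + 1) / real (Suc n))" by (rule not_less_Least) (use Suc in \<open>simp add: k_def\<close>)
      then have "C (real (k n) / real (Suc n)) \<le> t" by (simp add: Suc add.commute)
      from tau_ge[OF _ this t(2,3)] show ?thesis by (simp add: s_def)
    qed
    then show "f n \<le> s + 1 / real (Suc n)" by (simp add: f_def add_divide_distrib)
  qed
  have "f \<longlonglongrightarrow> s"
  proof (rule tendsto_sandwich[of "\<lambda>_. s" f _ "\<lambda>n. s + 1 / real (Suc n)"])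
    show "(\<lambda>n. s + 1 / real (Suc n)) \<longlonglongrightarrow> s" by real_asymp
  qed (auto intro!: always_eventually less_imp_le[OF f1(1)] f1(2)[simplified])
  then have "filterlim f (at_right s) sequentially"
    using f1(1) by (simp add: filterlim_at less_imp_neq[symmetric])
  moreover have "(x \<longlongrightarrow> x s) (at_right s)" using cad s by (simp add: cadlag_def)
  ultimately show ?thesis unfolding f_def[symmetric] k_def[symmetric] s_def[symmetric]
    by (rule filterlim_compose[rotated])
qed

end

section \<open>The Levy process\<close>

lemma (in prob_space) indep_var_nn_integral:
  fixes X Y :: "'a \<Rightarrow> ennreal"
  assumes "indep_var borel X borel Y"
  shows "(\<integral>\<^sup>+\<omega>. X \<omega> * Y \<omega> \<partial>M) = (\<integral>\<^sup>+\<omega>. X \<omega> \<partial>M) * (\<integral>\<^sup>+\<omega>. Y \<omega> \<partial>M)"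
proof -
  have eq: "case_bool borel borel = (\<lambda>_. borel :: ennreal measure)" by (auto split: bool.split)
  have "indep_vars (\<lambda>_. borel) (case_bool X Y) UNIV" using assms unfolding indep_var_def eq .
  from indep_vars_nn_integral[OF _ this]
  have "(\<integral>\<^sup>+\<omega>. (\<Prod>i\<in>UNIV. case_bool X Y i \<omega>) \<partial>M) = (\<Prod>i\<in>UNIV. \<integral>\<^sup>+\<omega>. case_bool X Y i \<omega> \<partial>M)" by simp
  then show ?thesis by (simp add: UNIV_bool mult.commute)
qed

locale levy_limit = chain_kernel a \<gamma> p Lv b s2 \<beta>0 C0
  for a :: "nat \<Rightarrow> real" and \<gamma> and p :: "nat \<Rightarrow> nat \<Rightarrow> real" and Lv :: "real measure" and b s2 \<beta>0 C0 :: real +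
  fixes N :: "'b measure" and \<xi> :: "real \<Rightarrow> 'b \<Rightarrow> real"
  assumes levy: "levy_process N \<xi> s2 b Lv"
begin

lemma probN: "prob_space N" using levy by (simp add: levy_process_def)

sublocale N: prob_space N by (rule probN)

lemma xi_meas[measurable]: "\<xi> t \<in> borel_measurable N" using levy by (simp add: levy_process_def)

lemma xi_0: "\<omega> \<in> space N \<Longrightarrow> \<xi> 0 \<omega> = 0" and xi_cadlag: "\<omega> \<in> space N \<Longrightarrow> cadlag (\<lambda>t. \<xi> t \<omega>)"
  using levy by (auto simp: levy_process_def)

lemma xi_path: "\<omega> \<in> space N \<Longrightarrow> lamperti_path (\<lambda>t. \<xi> t \<omega>) \<gamma>"
  by unfold_locales (auto intro: xi_cadlag gamma_pos)

definition \<nu> :: "real \<Rightarrow> real measure" where "\<nu> h = distr N borel (\<xi> h)"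

lemma nu_rd: "real_distribution (\<nu> h)"
  unfolding \<nu>_def real_distribution_def real_distribution_axioms_def by (auto intro!: N.prob_space_distr)

lemma incr_law:
  assumes st: "0 \<le> s" "s \<le> t"
  shows "distr N borel (\<lambda>\<omega>. \<xi> t \<omega> - \<xi> s \<omega>) = \<nu> (t - s)"
    and "char (\<nu> (t - s)) \<theta> = exp (complex_of_real (t - s) * levy_exponent s2 b Lv \<theta>)"
proof -
  have c: "char (distr N borel (\<lambda>\<omega>. \<xi> t \<omega> - \<xi> s \<omega>)) \<theta> = exp (complex_of_real (t - s) * levy_exponent s2 b Lv \<theta>)"
    if "0 \<le> s" "s \<le> t" for s t \<theta> using levy that by (simp add: levy_process_def)
  have n: "\<nu> u = distr N borel (\<lambda>\<omega>. \<xi> u \<omega> - \<xi> 0 \<omega>)" for u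
    unfolding \<nu>_def by (rule distr_cong) (simp_all add: xi_0)
  have cn: "char (\<nu> u) \<theta> = exp (complex_of_real u * levy_exponent s2 b Lv \<theta>)" if "u \<ge> 0" for u \<theta>
    unfolding n using c[of 0 u] that by simp
  show "char (\<nu> (t - s)) \<theta> = exp (complex_of_real (t - s) * levy_exponent s2 b Lv \<theta>)" using cn st by simp
  show "distr N borel (\<lambda>\<omega>. \<xi> t \<omega> - \<xi> s \<omega>) = \<nu> (t - s)"
  proof (rule Levy_uniqueness[OF _ nu_rd])
    show "real_distribution (distr N borel (\<lambda>\<omega>. \<xi> t \<omega> - \<xi> s \<omega>))"
      unfolding real_distribution_def real_distribution_axioms_def by (auto intro!: N.prob_space_distr)
    show "char (distr N borel (\<lambda>\<omega>. \<xi> t \<omega> - \<xi> s \<omega>)) = char (\<nu> (t - s))" using c[OF st] cn[of "t - s"] st by auto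
  qed
qed

lemma nu_char: "h > 0 \<Longrightarrow> char (\<nu> h) \<theta> = exp (complex_of_real h * levy_exponent s2 b Lv \<theta>)"
  using incr_law(2)[of 0 h \<theta>] by simp

lemma nu_moment: "h > 0 \<Longrightarrow> (\<integral>\<^sup>+x. ennreal (exp (\<beta> * x)) \<partial>\<nu> h) \<le> ennreal (exp (- c0 * h))"
  by (rule nu_exp[OF nu_rd _ nu_char])

definition incr :: "real \<Rightarrow> nat \<Rightarrow> 'b \<Rightarrow> real" where
  "incr h j \<omega> = \<xi> ((real j + 1) * h) \<omega> - \<xi> (real j * h) \<omega>"

lemma incr_meas[measurable]: "incr h j \<in> borel_measurable N" unfolding incr_def by measurable

lemma incr_indep: "h > 0 \<Longrightarrow> N.indep_vars (\<lambda>_. borel) (incr h) {..<k}"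
proof -
  assume h: "h > 0"
  have "\<forall>k (t::nat \<Rightarrow> real). 0 \<le> t 0 \<and> (\<forall>j<k. t j \<le> t (Suc j)) \<longrightarrow>
        N.indep_vars (\<lambda>_. borel) (\<lambda>j \<omega>. \<xi> (t (Suc j)) \<omega> - \<xi> (t j) \<omega>) {..<k}"
    using levy by (simp add: levy_process_def)
  from this[rule_format, of "\<lambda>j. real j * h" k]
  have "N.indep_vars (\<lambda>_. borel) (\<lambda>j \<omega>. \<xi> (real (Suc j) * h) \<omega> - \<xi> (real j * h) \<omega>) {..<k}"
    using h by (simp add: mult_right_mono)
  moreover have "incr h = (\<lambda>j \<omega>. \<xi> (real (Suc j) * h) \<omega> - \<xi> (real j * h) \<omega>)"
    by (auto simp: incr_def fun_eq_iff add.commute)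
  ultimately show ?thesis by simp
qed

lemma incr_distr: "h > 0 \<Longrightarrow> distr N borel (incr h j) = \<nu> h"
proof -
  assume h: "h > 0"
  have "real j * h \<le> (real j + 1) * h" using h by (simp add: algebra_simps)
  from incr_law(1)[OF _ this] h show ?thesis unfolding incr_def by (simp add: algebra_simps)
qed

lemma incr_sum: "\<omega> \<in> space N \<Longrightarrow> \<xi> (real j * h) \<omega> = (\<Sum>l<j. incr h l \<omega>)"
proof (induction j)
  case 0 then show ?case by (simp add: xi_0)
next
  case (Suc j) then show ?case by (simp add: incr_def algebra_simps)
qed

text \<open>Doob's inequality by hand: \<open>V M\<close> freezes the weight at
  \<open>exp (\<beta> * r)\<close> once the level \<open>r\<close> has been passed. It decreases in
  \<open>M\<close> because an independent increment has exponential moment at most 1, and its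
  initial value already contains the decay over the time \<open>n0 * h\<close>.\<close>

lemma grid_maximal:
  assumes h: "h > 0" and n0: "n0 > 0"
  shows "emeasure N {\<omega>\<in>space N. \<exists>j\<in>{n0..<M}. \<xi> (real j * h) \<omega> > r} \<le> ennreal (exp (- c0 * (real n0 * h) - \<beta> * r))"
proof -
  define alive where "alive M \<omega> \<longleftrightarrow> (\<forall>j\<in>{n0..<M}. \<xi> (real j * h) \<omega> \<le> r)" for M \<omega>
  have am[measurable]: "Measurable.pred N (alive M)" for M unfolding alive_def by measurable
  define E where "E M \<omega> = ennreal (exp (\<beta> * \<xi> (real M * h) \<omega>))" for M \<omega>
  have Em[measurable]: "E M \<in> borel_measurable N" for M unfolding E_def by measurable
  define V where "V M = (\<integral>\<^sup>+\<omega>. E M \<omega> * indicator {\<omega>. alive M \<omega>} \<omega> + ennreal (exp (\<beta> * r)) * indicator {\<omega>. \<not> alive M \<omega>} \<omega> \<partial>N)" for M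
  have Vn0: "V n0 \<le> ennreal (exp (- c0 * (real n0 * h)))"
  proof -
    have "V n0 = (\<integral>\<^sup>+\<omega>. ennreal (exp (\<beta> * \<xi> (real n0 * h) \<omega>)) \<partial>N)"
      unfolding V_def by (rule nn_integral_cong) (auto simp: alive_def E_def)
    also have "\<dots> = (\<integral>\<^sup>+x. ennreal (exp (\<beta> * x)) \<partial>\<nu> (real n0 * h))"
      unfolding \<nu>_def by (subst nn_integral_distr) auto
    also have "\<dots> \<le> ennreal (exp (- c0 * (real n0 * h)))" by (rule nu_moment) (use h n0 in simp)
    finally show ?thesis .
  qed
  have step: "(\<integral>\<^sup>+\<omega>. E (Suc M) \<omega> * indicator {\<omega>. alive (Suc M) \<omega>} \<omega> \<partial>N) \<le> (\<integral>\<^sup>+\<omega>. E M \<omega> * indicator {\<omega>. alive (Suc M) \<omega>} \<omega> \<partial>N)" for M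
  proof -
    \<comment> \<open>The past is written as a function of the first \<open>M\<close> increments, so
      that its independence from the increment with index \<open>M\<close> can be used.\<close>
    define F where "F v = ennreal (exp (\<beta> * (\<Sum>l<M. v l))) * indicator {v. \<forall>j\<in>{n0..<Suc M}. (\<Sum>l<j. v l) \<le> r} v" for v :: "nat \<Rightarrow> real"
    have comp: "(\<lambda>v. v l) \<in> borel_measurable (PiM {..<M} (\<lambda>_. borel :: real measure))" if "l < M" for l
      using that by simp
    have sm: "(\<lambda>v. \<Sum>l<j. v l) \<in> borel_measurable (PiM {..<M} (\<lambda>_. borel :: real measure))" if "j \<le> M" for j
      by (rule borel_measurable_sum) (use that comp in auto)
    have pm: "Measurable.pred (PiM {..<M} (\<lambda>_. borel :: real measure)) (\<lambda>v. \<forall>j\<in>{n0..<Suc M}. (\<Sum>l<j. v l) \<le> r)"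
    proof (rule pred_intros_finite)
      fix j assume "j \<in> {n0..<Suc M}"
      then show "Measurable.pred (PiM {..<M} (\<lambda>_. borel :: real measure)) (\<lambda>v. (\<Sum>l<j. v l) \<le> r)"
        using sm[of j] by simp
    qed simp
    have "(\<lambda>v. indicator {v. \<forall>j\<in>{n0..<Suc M}. (\<Sum>l<j. v l) \<le> r} v :: ennreal) \<in> borel_measurable (PiM {..<M} (\<lambda>_. borel :: real measure))"
      using pm by (intro borel_measurable_indicator') simp
    then have Fm: "F \<in> borel_measurable (PiM {..<M} (\<lambda>_. borel :: real measure))"
      unfolding F_def using sm[of M] by (intro borel_measurable_times_ennreal measurable_compose[OF _ measurable_ennreal]) auto
    have ind: "N.indep_var borel (F \<circ> (\<lambda>\<omega>. restrict (\<lambda>i. incr h i \<omega>) {..<M})) borel ((\<lambda>v. ennreal (exp (\<beta> * v M))) \<circ> (\<lambda>\<omega>. restrict (\<lambda>i. incr h i \<omega>) {M}))"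
    proof (rule N.indep_var_compose[OF N.indep_var_restrict[OF incr_indep[OF h, of "Suc M"]] Fm])
      show "(\<lambda>v. ennreal (exp (\<beta> * v M))) \<in> borel_measurable (PiM {M} (\<lambda>_. borel :: real measure))" by measurable
    qed auto
    have e1: "(F \<circ> (\<lambda>\<omega>. restrict (\<lambda>i. incr h i \<omega>) {..<M})) \<omega> = E M \<omega> * indicator {\<omega>. alive (Suc M) \<omega>} \<omega>" if "\<omega> \<in> space N" for \<omega>
    proof -
      have "(\<Sum>l<j. restrict (\<lambda>i. incr h i \<omega>) {..<M} l) = \<xi> (real j * h) \<omega>" if "j \<le> M" for j
        unfolding incr_sum[OF \<open>\<omega> \<in> space N\<close>] using that by (intro sum.cong) auto
      then show ?thesis by (auto simp: F_def E_def alive_def indicator_def)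
    qed
    have e2: "E (Suc M) \<omega> = E M \<omega> * ennreal (exp (\<beta> * incr h M \<omega>))" for \<omega>
    proof -
      have "exp (\<beta> * \<xi> (real (Suc M) * h) \<omega>) = exp (\<beta> * \<xi> (real M * h) \<omega>) * exp (\<beta> * incr h M \<omega>)"
        unfolding exp_add[symmetric] by (simp add: incr_def algebra_simps)
      then show ?thesis by (simp add: E_def ennreal_mult)
    qed
    have "(\<integral>\<^sup>+\<omega>. E (Suc M) \<omega> * indicator {\<omega>. alive (Suc M) \<omega>} \<omega> \<partial>N)
       = (\<integral>\<^sup>+\<omega>. (F \<circ> (\<lambda>\<omega>. restrict (\<lambda>i. incr h i \<omega>) {..<M})) \<omega> * ((\<lambda>v. ennreal (exp (\<beta> * v M))) \<circ> (\<lambda>\<omega>. restrict (\<lambda>i. incr h i \<omega>) {M})) \<omega> \<partial>N)"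
      by (rule nn_integral_cong) (simp only: e1 e2, simp add: mult_ac)
    also have "\<dots> = (\<integral>\<^sup>+\<omega>. (F \<circ> (\<lambda>\<omega>. restrict (\<lambda>i. incr h i \<omega>) {..<M})) \<omega> \<partial>N) * (\<integral>\<^sup>+\<omega>. ((\<lambda>v. ennreal (exp (\<beta> * v M))) \<circ> (\<lambda>\<omega>. restrict (\<lambda>i. incr h i \<omega>) {M})) \<omega> \<partial>N)"
      by (rule N.indep_var_nn_integral[OF ind])
    also have "(\<integral>\<^sup>+\<omega>. (F \<circ> (\<lambda>\<omega>. restrict (\<lambda>i. incr h i \<omega>) {..<M})) \<omega> \<partial>N) = (\<integral>\<^sup>+\<omega>. E M \<omega> * indicator {\<omega>. alive (Suc M) \<omega>} \<omega> \<partial>N)"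
      by (rule nn_integral_cong) (rule e1)
    also have "(\<integral>\<^sup>+\<omega>. ((\<lambda>v. ennreal (exp (\<beta> * v M))) \<circ> (\<lambda>\<omega>. restrict (\<lambda>i. incr h i \<omega>) {M})) \<omega> \<partial>N) = (\<integral>\<^sup>+\<omega>. ennreal (exp (\<beta> * incr h M \<omega>)) \<partial>N)"
      by (rule nn_integral_cong) simp
    also have "\<dots> = (\<integral>\<^sup>+x. ennreal (exp (\<beta> * x)) \<partial>\<nu> h)"
      unfolding incr_distr[OF h, of M, symmetric] by (subst nn_integral_distr) auto
    finally have eq: "(\<integral>\<^sup>+\<omega>. E (Suc M) \<omega> * indicator {\<omega>. alive (Suc M) \<omega>} \<omega> \<partial>N)
      = (\<integral>\<^sup>+\<omega>. E M \<omega> * indicator {\<omega>. alive (Suc M) \<omega>} \<omega> \<partial>N) * (\<integral>\<^sup>+x. ennreal (exp (\<beta> * x)) \<partial>\<nu> h)" .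
    have "exp (- c0 * h) \<le> 1" using c0 h by simp
    then have "ennreal (exp (- c0 * h)) \<le> 1" by (metis ennreal_1 ennreal_leI)
    then have le1: "(\<integral>\<^sup>+x. ennreal (exp (\<beta> * x)) \<partial>\<nu> h) \<le> 1" using nu_moment[OF h] by (rule order_trans[rotated])
    show ?thesis unfolding eq
      using mult_left_mono[OF le1, of "\<integral>\<^sup>+\<omega>. E M \<omega> * indicator {\<omega>. alive (Suc M) \<omega>} \<omega> \<partial>N"] by simp
  qed
  have dec: "V (Suc M) \<le> V M" if "M \<ge> n0" for M
  proof -
    have "V (Suc M) = (\<integral>\<^sup>+\<omega>. E (Suc M) \<omega> * indicator {\<omega>. alive (Suc M) \<omega>} \<omega> \<partial>N) + (\<integral>\<^sup>+\<omega>. ennreal (exp (\<beta> * r)) * indicator {\<omega>. \<not> alive (Suc M) \<omega>} \<omega> \<partial>N)"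
      unfolding V_def by (rule nn_integral_add) measurable
    also have "\<dots> \<le> (\<integral>\<^sup>+\<omega>. E M \<omega> * indicator {\<omega>. alive (Suc M) \<omega>} \<omega> \<partial>N) + (\<integral>\<^sup>+\<omega>. ennreal (exp (\<beta> * r)) * indicator {\<omega>. \<not> alive (Suc M) \<omega>} \<omega> \<partial>N)"
      by (rule add_right_mono[OF step])
    also have "\<dots> = (\<integral>\<^sup>+\<omega>. E M \<omega> * indicator {\<omega>. alive (Suc M) \<omega>} \<omega> + ennreal (exp (\<beta> * r)) * indicator {\<omega>. \<not> alive (Suc M) \<omega>} \<omega> \<partial>N)"
      by (rule nn_integral_add[symmetric]) measurable
    also have "\<dots> \<le> V M" unfolding V_def
    proof (rule nn_integral_mono)
      fix \<omega>
      have "alive (Suc M) \<omega> \<longleftrightarrow> alive M \<omega> \<and> \<xi> (real M * h) \<omega> \<le> r"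
        using that by (auto simp: alive_def less_Suc_eq)
      moreover have "ennreal (exp (\<beta> * r)) \<le> E M \<omega>" if "\<not> \<xi> (real M * h) \<omega> \<le> r"
        unfolding E_def using that \<beta>(3) by (intro ennreal_leI) simp
      ultimately show "E M \<omega> * indicator {\<omega>. alive (Suc M) \<omega>} \<omega> + ennreal (exp (\<beta> * r)) * indicator {\<omega>. \<not> alive (Suc M) \<omega>} \<omega>
        \<le> E M \<omega> * indicator {\<omega>. alive M \<omega>} \<omega> + ennreal (exp (\<beta> * r)) * indicator {\<omega>. \<not> alive M \<omega>} \<omega>"
        by (cases "alive M \<omega>"; cases "\<xi> (real M * h) \<omega> \<le> r") auto
    qed
    finally show ?thesis .
  qed
  have VM: "V M \<le> ennreal (exp (- c0 * (real n0 * h)))" if "M \<ge> n0" for M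
    using that
  proof (induction M rule: dec_induct)
    case base show ?case by (rule Vn0)
  next
    case (step M) then show ?case using dec[of M] order_trans by auto
  qed
  show ?thesis
  proof (cases "M \<ge> n0")
    case True
    let ?D = "{\<omega>\<in>space N. \<exists>j\<in>{n0..<M}. \<xi> (real j * h) \<omega> > r}"
    have Dm: "?D \<in> sets N" by measurable
    have "ennreal (exp (\<beta> * r)) * emeasure N ?D = (\<integral>\<^sup>+\<omega>. ennreal (exp (\<beta> * r)) * indicator ?D \<omega> \<partial>N)"
      using Dm by (simp add: nn_integral_cmult_indicator)
    also have "\<dots> \<le> V M" unfolding V_def
      by (rule nn_integral_mono) (auto simp: indicator_def alive_def not_le)
    also have "\<dots> \<le> ennreal (exp (- c0 * (real n0 * h)))" by (rule VM[OF True])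
    finally have "ennreal (exp (- \<beta> * r)) * (ennreal (exp (\<beta> * r)) * emeasure N ?D) \<le> ennreal (exp (- \<beta> * r)) * ennreal (exp (- c0 * (real n0 * h)))"
      by (rule mult_left_mono) simp
    moreover have "- \<beta> * r + - c0 * (real n0 * h) = - c0 * (real n0 * h) - \<beta> * r" by simp
    ultimately show ?thesis by (simp only: mult.assoc[symmetric] ennreal_mult[symmetric] exp_ge_zero exp_add[symmetric]) simp
  next
    case False
    then have "{n0..<M} = {}" by simp
    then show ?thesis by simp
  qed
qed

text \<open>Dyadic grids refine each other, so their exceedance events increase and the bound
  persists in the limit; right continuity carries a strict exceedance at \<open>s\<close> to a
  nearby grid point. A measurable superset is stated because the event is an uncountable
  union.\<close>

lemma sup_bound:
  assumes n0: "n0 > 0"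
  shows "\<exists>D\<in>sets N. {\<omega>\<in>space N. \<exists>s\<ge>real n0. \<xi> s \<omega> > r} \<subseteq> D \<and> emeasure N D \<le> ennreal (exp (- c0 * real n0 - \<beta> * r))"
proof -
  define A where "A k M = {\<omega>\<in>space N. \<exists>j\<in>{n0 * 2^k..<M}. \<xi> (real j * (1 / 2^k)) \<omega> > r}" for k M
  have Am[measurable]: "A k M \<in> sets N" for k M unfolding A_def by measurable
  have Ab: "emeasure N (A k M) \<le> ennreal (exp (- c0 * real n0 - \<beta> * r))" for k M
    using grid_maximal[of "1 / 2^k" "n0 * 2^k" M r] n0 unfolding A_def by simp
  define B where "B k = (\<Union>M. A k M)" for k
  have Bm[measurable]: "B k \<in> sets N" for k unfolding B_def by measurable
  have Bb: "emeasure N (B k) \<le> ennreal (exp (- c0 * real n0 - \<beta> * r))" for k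
  proof -
    have "emeasure N (B k) = (SUP M. emeasure N (A k M))" unfolding B_def
      by (rule SUP_emeasure_incseq[symmetric]) (force simp: incseq_def A_def)+
    also have "\<dots> \<le> ennreal (exp (- c0 * real n0 - \<beta> * r))" by (rule SUP_least) (rule Ab)
    finally show ?thesis .
  qed
  have Binc: "B k \<subseteq> B (Suc k)" for k
  proof
    fix \<omega> assume "\<omega> \<in> B k"
    then obtain j where j: "\<omega> \<in> space N" "j \<ge> n0 * 2^k" "\<xi> (real j * (1 / 2^k)) \<omega> > r" by (auto simp: B_def A_def)
    have "real (2 * j) * (1 / 2^Suc k) = real j * (1 / 2^k)" by simp
    then show "\<omega> \<in> B (Suc k)" using j unfolding B_def A_def
      by (intro UN_I[of "Suc (2 * j)"]) (auto intro!: bexI[of _ "2 * j"])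
  qed
  have D: "emeasure N (\<Union>k. B k) \<le> ennreal (exp (- c0 * real n0 - \<beta> * r))"
  proof -
    have "emeasure N (\<Union>k. B k) = (SUP k. emeasure N (B k))"
      by (rule SUP_emeasure_incseq[symmetric]) (auto intro!: incseq_SucI Binc)
    also have "\<dots> \<le> ennreal (exp (- c0 * real n0 - \<beta> * r))" by (rule SUP_least) (rule Bb)
    finally show ?thesis .
  qed
  have sub: "{\<omega>\<in>space N. \<exists>s\<ge>real n0. \<xi> s \<omega> > r} \<subseteq> (\<Union>k. B k)"
  proof
    fix \<omega> assume "\<omega> \<in> {\<omega>\<in>space N. \<exists>s\<ge>real n0. \<xi> s \<omega> > r}"
    then obtain s where s: "\<omega> \<in> space N" "s \<ge> real n0" "\<xi> s \<omega> > r" by auto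
    have "((\<lambda>t. \<xi> t \<omega>) \<longlongrightarrow> \<xi> s \<omega>) (at_right s)" using xi_cadlag[OF s(1)] s(2) by (simp add: cadlag_def)
    from order_tendstoD(1)[OF this s(3)] obtain s1 where s1: "s1 > s" "\<And>u. s < u \<Longrightarrow> u < s1 \<Longrightarrow> \<xi> u \<omega> > r"
      by (auto simp: eventually_at_right_field)
    obtain k where k: "1 / 2^k < s1 - s" using s1(1) real_arch_pow_inv[of "s1 - s" "1/2"] by (auto simp: power_one_over)
    define j where "j = nat (\<lfloor>s * 2^k\<rfloor> + 1)"
    have s0: "s \<ge> 0" using s(2) by simp
    have jr: "real j = real_of_int \<lfloor>s * 2^k\<rfloor> + 1" unfolding j_def using s0 by simp
    have j1: "s * 2^k < real j" "real j \<le> s * 2^k + 1" unfolding jr by linarith+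
    have "s < real j * (1 / 2^k)" using j1(1) by (simp add: field_simps)
    moreover have "real j * (1 / 2^k) \<le> s + 1 / 2^k" using j1(2) by (simp add: field_simps)
    then have "real j * (1 / 2^k) < s1" using k by linarith
    ultimately have x: "\<xi> (real j * (1 / 2^k)) \<omega> > r" by (rule s1(2))
    have "real n0 * 2^k \<le> s * 2^k" using s(2) by simp
    then have "real n0 * 2^k < real j" using j1(1) by linarith
    then have "real (n0 * 2^k) < real j" by simp
    then have "n0 * 2^k \<le> j" by linarith
    then show "\<omega> \<in> (\<Union>k. B k)" using x s(1) unfolding B_def A_def
      by (intro UN_I[of k] UN_I[of "Suc j"]) (auto intro!: bexI[of _ j])
  qed
  show ?thesis using D sub by (intro bexI[of _ "\<Union>k. B k"]) auto
qed

text \<open>For each level the bounds of \<open>sup_bound\<close> tend to 0 as the starting time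
  grows, so the intersection of the supersets is null; countably many levels suffice.\<close>

lemma AE_drift: "AE \<omega> in N. \<forall>R. \<exists>S\<ge>0. \<forall>s\<ge>S. \<xi> s \<omega> \<le> R"
proof -
  have "AE \<omega> in N. \<exists>S\<ge>0. \<forall>s\<ge>S. \<xi> s \<omega> \<le> r" for r
  proof -
    have "\<forall>n. \<exists>D. D \<in> sets N \<and> {\<omega>\<in>space N. \<exists>s\<ge>real (Suc n). \<xi> s \<omega> > r} \<subseteq> D \<and> emeasure N D \<le> ennreal (exp (- c0 * real (Suc n) - \<beta> * r))"
      using sup_bound[OF zero_less_Suc, of _ r] unfolding Bex_def by blast
    from choice[OF this] obtain D where DD: "\<forall>n. D n \<in> sets N \<and> {\<omega>\<in>space N. \<exists>s\<ge>real (Suc n). \<xi> s \<omega> > r} \<subseteq> D n \<and> emeasure N (D n) \<le> ennreal (exp (- c0 * real (Suc n) - \<beta> * r))" ..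
    then have D: "\<And>n. D n \<in> sets N" "\<And>n. {\<omega>\<in>space N. \<exists>s\<ge>real (Suc n). \<xi> s \<omega> > r} \<subseteq> D n"
      "\<And>n. emeasure N (D n) \<le> ennreal (exp (- c0 * real (Suc n) - \<beta> * r))" by blast+
    have sets: "(\<Inter>n. D n) \<in> sets N" using D(1) by auto
    have "emeasure N (\<Inter>n. D n) \<le> ennreal (exp (- c0 * real (Suc n) - \<beta> * r))" for n
      using emeasure_mono[of "\<Inter>n. D n" "D n" N] D(1)[of n] D(3)[of n] order_trans by blast
    moreover have "(\<lambda>n. ennreal (exp (- c0 * real (Suc n) - \<beta> * r))) \<longlonglongrightarrow> ennreal 0"
    proof (rule tendsto_ennrealI)
      have "c0 > 0" by (rule c0)
      then show "(\<lambda>n. exp (- c0 * real (Suc n) - \<beta> * r)) \<longlonglongrightarrow> 0" by real_asymp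
    qed
    ultimately have "emeasure N (\<Inter>n. D n) \<le> ennreal 0" by (intro LIMSEQ_le_const) auto
    then have "(\<Inter>n. D n) \<in> null_sets N" using sets by (auto simp: null_sets_def)
    then have "AE \<omega> in N. \<omega> \<notin> (\<Inter>n. D n)" by (rule AE_not_in)
    then show ?thesis using AE_space
    proof eventually_elim
      case (elim \<omega>)
      then obtain n where "\<omega> \<notin> D n" by auto
      then have "\<forall>s\<ge>real (Suc n). \<xi> s \<omega> \<le> r" using D(2)[of n] elim(2) by force
      then show ?case by (intro exI[of _ "real (Suc n)"]) auto
    qed
  qed
  then have "AE \<omega> in N. \<forall>k::nat. \<exists>S\<ge>0. \<forall>s\<ge>S. \<xi> s \<omega> \<le> - real k" by (simp add: AE_all_countable)
  then show ?thesis
  proof eventually_elim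
    case (elim \<omega>)
    show ?case
    proof
      fix R :: real
      obtain k :: nat where "- R \<le> real k" using real_arch_simple by blast
      then show "\<exists>S\<ge>0. \<forall>s\<ge>S. \<xi> s \<omega> \<le> R" using elim[rule_format, of k] by fastforce
    qed
  qed
qed

section \<open>Measurability of the Lamperti transform in the sample point\<close>

lemma xi_joint: "(\<lambda>(\<omega>, u). indicator {0..} u * \<xi> u \<omega>) \<in> borel_measurable (N \<Otimes>\<^sub>M lborel)"
proof (rule borel_measurable_LIMSEQ_real)
  define X where "X n = (\<lambda>(\<omega>, u). indicator {0..} u * \<xi> ((real_of_int \<lfloor>u * real (Suc n)\<rfloor> + 1) / real (Suc n)) \<omega>)" for n
  show "X n \<in> borel_measurable (N \<Otimes>\<^sub>M lborel)" for n
  proof -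
    have "(\<lambda>z. \<xi> ((real_of_int \<lfloor>snd z * real (Suc n)\<rfloor> + 1) / real (Suc n)) (fst z)) \<in> borel_measurable (N \<Otimes>\<^sub>M lborel)"
      by (rule measurable_compose_countable[where f = "\<lambda>i z. \<xi> ((real_of_int i + 1) / real (Suc n)) (fst z)"]) measurable
    then show ?thesis unfolding X_def case_prod_beta by measurable
  qed
  fix z :: "'b \<times> real" assume z: "z \<in> space (N \<Otimes>\<^sub>M lborel)"
  then obtain \<omega> u where zu: "z = (\<omega>, u)" "\<omega> \<in> space N" by (auto simp: space_pair_measure)
  show "(\<lambda>n. X n z) \<longlonglongrightarrow> (case z of (\<omega>, u) \<Rightarrow> indicator {0..} u * \<xi> u \<omega>)"
    using cadlag_approx[OF xi_cadlag[OF zu(2)], of u] by (cases "u \<ge> 0") (auto simp: zu X_def intro!: tendsto_intros)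
qed

lemma lamperti_meas: "(\<lambda>\<omega>. lamperti \<gamma> \<xi> \<omega> t) \<in> borel_measurable N"
proof -
  have ind: "(\<lambda>(\<omega>, u). ennreal (exp (\<gamma> * (indicator {0..} u * \<xi> u \<omega>)))) \<in> borel_measurable (N \<Otimes>\<^sub>M lborel)"
    using xi_joint unfolding case_prod_beta by measurable
  have Cm: "(\<lambda>\<omega>. \<integral>\<^sup>+u. ennreal (exp (\<gamma> * \<xi> u \<omega>)) * indicator A u \<partial>lborel) \<in> borel_measurable N"
    if A[measurable]: "A \<in> sets borel" "A \<subseteq> {0..}" for A
  proof -
    have "(\<lambda>\<omega>. \<integral>\<^sup>+u. ennreal (exp (\<gamma> * (indicator {0..} u * \<xi> u \<omega>))) * indicator A u \<partial>lborel) \<in> borel_measurable N"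
      using ind by (intro lborel.borel_measurable_nn_integral) (simp add: case_prod_beta)
    moreover have "(\<integral>\<^sup>+u. ennreal (exp (\<gamma> * (indicator {0..} u * \<xi> u \<omega>))) * indicator A u \<partial>lborel) = (\<integral>\<^sup>+u. ennreal (exp (\<gamma> * \<xi> u \<omega>)) * indicator A u \<partial>lborel)" for \<omega>
      using A(2) by (intro nn_integral_cong) (auto simp: indicator_def)
    ultimately show ?thesis by simp
  qed
  have Im[measurable]: "I_infty \<gamma> \<xi> \<in> borel_measurable N"
    unfolding I_infty_def by (rule Cm) auto
  have CC[measurable]: "(\<lambda>\<omega>. \<integral>\<^sup>+u. ennreal (exp (\<gamma> * \<xi> u \<omega>)) * indicator {0..s} u \<partial>lborel) \<in> borel_measurable N" for s
    by (rule Cm) auto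
  have pos: "(\<lambda>\<omega>. lamperti \<gamma> \<xi> \<omega> t) \<in> borel_measurable N" if t: "t \<ge> 0" for t
  proof -
    define k where "k n \<omega> = (LEAST j. ennreal t < (\<integral>\<^sup>+u. ennreal (exp (\<gamma> * \<xi> u \<omega>)) * indicator {0..(real j + 1) / real (Suc n)} u \<partial>lborel))" for n \<omega>
    have km: "k n \<in> measurable N (count_space UNIV)" for n unfolding k_def by measurable
    have "(\<lambda>\<omega>. if ennreal t < I_infty \<gamma> \<xi> \<omega> then exp (\<xi> ((real (k n \<omega>) + 1) / real (Suc n)) \<omega>) else 0) \<in> borel_measurable N" for n
    proof -
      have "(\<lambda>\<omega>. \<xi> ((real (k n \<omega>) + 1) / real (Suc n)) \<omega>) \<in> borel_measurable N"
        by (rule measurable_compose_countable[where f = "\<lambda>i. \<xi> ((real i + 1) / real (Suc n))", OF _ km]) measurable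
      then show ?thesis by measurable
    qed
    then show ?thesis
    proof (rule borel_measurable_LIMSEQ_real[rotated])
      fix \<omega> assume w: "\<omega> \<in> space N"
      interpret P: lamperti_path "\<lambda>t. \<xi> t \<omega>" \<gamma> by (rule xi_path[OF w])
      have Ieq: "I_infty \<gamma> \<xi> \<omega> = I_infty \<gamma> (\<lambda>s (_::unit). \<xi> s \<omega>) ()" by (simp add: I_infty_def)
      have teq: "time_inv \<gamma> \<xi> \<omega> t = P.tau t" by (simp add: P.tau_def time_inv_def)
      show "(\<lambda>n. if ennreal t < I_infty \<gamma> \<xi> \<omega> then exp (\<xi> ((real (k n \<omega>) + 1) / real (Suc n)) \<omega>) else 0) \<longlonglongrightarrow> lamperti \<gamma> \<xi> \<omega> t"
      proof (cases "ennreal t < I_infty \<gamma> \<xi> \<omega>")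
        case True
        then obtain u where u: "u \<ge> 0" "t < P.C u" using P.I_inf_ex[OF t] Ieq by auto
        have "k n \<omega> = (LEAST j. t < P.C ((real j + 1) / real (Suc n)))" for n
          unfolding k_def P.C_nn using t by (simp add: ennreal_less_iff)
        then show ?thesis using True P.Y_approx[OF t u] by (auto simp: lamperti_def teq intro!: tendsto_intros)
      qed (simp add: lamperti_def)
    qed
  qed
  \<comment> \<open>\<open>PathM\<close> has a coordinate for every real time; negative ones reduce
    to 0 because \<open>ennreal\<close> sends them to 0.\<close>
  have "lamperti \<gamma> \<xi> \<omega> t = lamperti \<gamma> \<xi> \<omega> 0" if "t < 0" for \<omega>
    using that by (simp add: lamperti_def time_inv_def ennreal_neg)
  then show ?thesis using pos[of t] pos[of 0] by (cases "t \<ge> 0") auto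
qed

end

section \<open>From trajectories to near paths\<close>

text \<open>Serves to exchange the quantised grid values for the true values of the Levy
  path.\<close>

lemma near_path_mono:
  assumes np: "near_path \<gamma> A h m T \<eta> g v \<sigma> \<rho>" and g: "\<And>j. j \<le> m \<Longrightarrow> \<bar>g j - g' j\<bar> \<le> \<eta>" and h: "h > 0" and \<eta>: "\<eta> \<ge> 0"
  shows "near_path \<gamma> A h m T (2 * \<eta>) g' v \<sigma> \<rho>"
proof -
  have lo: "h * exp (- (2 * \<eta>)) * exp c \<le> h * exp (- \<eta>) * exp c" for c
    using h \<eta> by (intro mult_right_mono mult_left_mono) auto
  have hi: "h * exp \<eta> * exp c \<le> h * exp (2 * \<eta>) * exp c" for c
    using h \<eta> by (intro mult_right_mono mult_left_mono) auto
  have le: "z \<le> \<eta> \<Longrightarrow> z \<le> 2 * \<eta>" for z using \<eta> by simp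
  have 1: "A > 0 \<and> (\<forall>k. v k \<ge> 0) \<and> \<sigma> 0 = 0 \<and> (\<forall>j<m. \<sigma> j < \<rho> j \<and> \<rho> j \<le> \<sigma> (Suc j)) \<and> (\<forall>k\<le>\<sigma> m. v k > 0)"
    and 2: "\<And>j. j \<le> m \<Longrightarrow> \<bar>ln (v (\<sigma> j)) - g j\<bar> \<le> \<eta>"
    and 3: "\<And>j k. j < m \<Longrightarrow> \<sigma> j \<le> k \<and> k < \<rho> j \<Longrightarrow> \<bar>ln (v k) - ln (v (\<sigma> j))\<bar> \<le> \<eta>"
    and 4: "\<And>j k. j < m \<Longrightarrow> \<rho> j \<le> k \<and> k \<le> \<sigma> (Suc j) \<Longrightarrow> \<bar>ln (v k) - ln (v (\<sigma> (Suc j)))\<bar> \<le> \<eta>"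
    and 5: "\<And>j. j < m \<Longrightarrow> h * exp (- \<eta>) * exp (\<gamma> * min (ln (v (\<sigma> j))) (ln (v (\<sigma> (Suc j))))) \<le> (real (\<sigma> (Suc j)) - real (\<sigma> j)) / A"
    and 6: "\<And>j. j < m \<Longrightarrow> (real (\<sigma> (Suc j)) - real (\<sigma> j)) / A \<le> h * exp \<eta> * exp (\<gamma> * max (ln (v (\<sigma> j))) (ln (v (\<sigma> (Suc j)))))"
    and 7: "\<And>k. \<sigma> m \<le> k \<and> real k \<le> A * T \<Longrightarrow> v k \<le> \<eta>"
    using np unfolding near_path_def by (blast, blast, blast, blast, blast, blast, blast)
  have "\<forall>j\<le>m. \<bar>ln (v (\<sigma> j)) - g' j\<bar> \<le> 2 * \<eta>"
  proof (intro allI impI)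
    fix j assume "j \<le> m"
    then show "\<bar>ln (v (\<sigma> j)) - g' j\<bar> \<le> 2 * \<eta>" using 2[of j] g[of j] by linarith
  qed
  moreover have "\<forall>j<m. \<forall>k. \<sigma> j \<le> k \<and> k < \<rho> j \<longrightarrow> \<bar>ln (v k) - ln (v (\<sigma> j))\<bar> \<le> 2 * \<eta>"
    by (intro allI impI, rule le, rule 3)
  moreover have "\<forall>j<m. \<forall>k. \<rho> j \<le> k \<and> k \<le> \<sigma> (Suc j) \<longrightarrow> \<bar>ln (v k) - ln (v (\<sigma> (Suc j)))\<bar> \<le> 2 * \<eta>"
    by (intro allI impI, rule le, rule 4)
  moreover have "\<forall>j<m. h * exp (- (2 * \<eta>)) * exp (\<gamma> * min (ln (v (\<sigma> j))) (ln (v (\<sigma> (Suc j))))) \<le> (real (\<sigma> (Suc j)) - real (\<sigma> j)) / A \<and>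
       (real (\<sigma> (Suc j)) - real (\<sigma> j)) / A \<le> h * exp (2 * \<eta>) * exp (\<gamma> * max (ln (v (\<sigma> j))) (ln (v (\<sigma> (Suc j)))))"
    by (intro allI impI conjI order_trans[OF lo 5] order_trans[OF 6 hi])
  moreover have "\<forall>k. \<sigma> m \<le> k \<and> real k \<le> A * T \<longrightarrow> v k \<le> 2 * \<eta>"
    by (intro allI impI, rule le, rule 7)
  ultimately show ?thesis unfolding near_path_def using 1 by (intro conjI) (elim conjE, assumption)+
qed

text \<open>\<open>k\<close> is the position of the exit, or the last position if there is none.
  From the exit on, states are compared with the final one through the exit state, whence
  \<open>2 * \<eta>\<close>. The head \<open>s\<close> is arbitrary so that the induction can shift
  it, which is why index 0 is exempt.\<close>

lemma good2_split:
  "good2 \<eta> r ys \<Longrightarrow> ys \<noteq> [] \<Longrightarrow> \<eta> \<ge> 0 \<Longrightarrow> \<exists>k>0. k \<le> length ys \<and> (\<forall>i<k. \<bar>lr r ((s # ys) ! i)\<bar> \<le> \<eta> \<or> i = 0) \<and>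
     (\<forall>i. k \<le> i \<and> i \<le> length ys \<longrightarrow> \<bar>lr (fin s ys) ((s # ys) ! i)\<bar> \<le> 2 * \<eta>)"
proof (induction ys arbitrary: s)
  case (Cons y ys)
  show ?case
  proof (cases "\<bar>lr r y\<bar> \<le> \<eta>")
    case False
    then have c: "calm \<eta> y ys" using Cons.prems by simp
    have near: "\<bar>lr y ((y # ys) ! i)\<bar> \<le> \<eta>" if "i \<le> length ys" for i
    proof (cases i)
      case 0 then show ?thesis using Cons.prems by simp
    next
      case (Suc i') then show ?thesis using c that by (auto simp: calm_def)
    qed
    have fin: "\<bar>lr y (fin y ys)\<bar> \<le> \<eta>"
    proof (cases "ys = []")
      case True then show ?thesis using Cons.prems by simp
    next
      case False
      then have "fin y ys \<in> set ys" by (simp add: fin_def)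
      then show ?thesis using c by (auto simp: calm_def)
    qed
    show ?thesis
    proof (intro exI[of _ 1] conjI allI impI)
      fix i assume i: "1 \<le> i \<and> i \<le> length (y # ys)"
      then obtain i' where i': "i = Suc i'" "i' \<le> length ys" by (cases i) auto
      have "lr (fin s (y # ys)) ((s # y # ys) ! i) = lr y ((y # ys) ! i') - lr y (fin y ys)" by (simp add: i' lr_def)
      then show "\<bar>lr (fin s (y # ys)) ((s # y # ys) ! i)\<bar> \<le> 2 * \<eta>" using near[OF i'(2)] fin by linarith
    qed auto
  next
    case True
    show ?thesis
    proof (cases "ys = []")
      case e: True
      show ?thesis using Cons.prems e by (intro exI[of _ 1]) (auto simp: le_Suc_eq)
    next
      case False
      then obtain k where k: "k > 0" "k \<le> length ys" "\<And>i. i < k \<Longrightarrow> \<bar>lr r ((y # ys) ! i)\<bar> \<le> \<eta> \<or> i = 0"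
        "\<And>i. k \<le> i \<Longrightarrow> i \<le> length ys \<Longrightarrow> \<bar>lr (fin y ys) ((y # ys) ! i)\<bar> \<le> 2 * \<eta>"
        using Cons.IH[of y] Cons.prems True by auto
      show ?thesis
      proof (intro exI[of _ "Suc k"] conjI allI impI)
        fix i assume i: "i < Suc k"
        show "\<bar>lr r ((s # y # ys) ! i)\<bar> \<le> \<eta> \<or> i = 0"
        proof (cases i)
          case (Suc i')
          then show ?thesis using k(3)[of i'] i True by (cases "i' = 0") auto
        qed simp
      next
        fix i assume i: "Suc k \<le> i \<and> i \<le> length (y # ys)"
        then obtain i' where i': "i = Suc i'" by (cases i) auto
        then show "\<bar>lr (fin s (y # ys)) ((s # y # ys) ! i)\<bar> \<le> 2 * \<eta>" using k(4)[of i'] i by simp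
      qed (use k in auto)
    qed
  qed
qed simp

context chain_kernel begin

lemma clk_sum: "clk ys x = (\<Sum>i<length ys. 1 / a ((x # ys) ! i))"
proof (induction ys arbitrary: x)
  case (Cons y ys)
  have "(\<Sum>i<length (y # ys). 1 / a ((x # y # ys) ! i)) = 1 / a x + (\<Sum>i<length ys. 1 / a ((y # ys) ! i))"
    by (simp add: sum.lessThan_Suc_shift del: sum.lessThan_Suc)
  then show ?case using Cons by simp
qed simp

text \<open>\<open>\<sigma>\<close> are the cell boundaries and \<open>\<rho>\<close> the instants of the only possibly large move in a cell.\<close>
lemma okc_split:
  assumes h: "h > 0" and \<eta>: "\<eta> \<ge> 0"
  shows "okc h \<delta> \<eta> cs (x s) \<Longrightarrow> \<forall>k<length (concat cs). x (Suc (s + k)) = concat cs ! k \<Longrightarrow>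
    \<exists>\<sigma> \<rho>. \<sigma> 0 = s \<and> \<sigma> (length cs) = s + length (concat cs) \<and> (\<forall>j<length cs. \<sigma> j < \<rho> j \<and> \<rho> j \<le> \<sigma> (Suc j) \<and>
      (\<forall>k. \<sigma> j \<le> k \<and> k < \<rho> j \<longrightarrow> \<bar>lr (x (\<sigma> j)) (x k)\<bar> \<le> \<eta>) \<and>
      (\<forall>k. \<rho> j \<le> k \<and> k \<le> \<sigma> (Suc j) \<longrightarrow> \<bar>lr (x (\<sigma> (Suc j))) (x k)\<bar> \<le> 2 * \<eta>) \<and>
      h \<le> (\<Sum>k=\<sigma> j..<\<sigma> (Suc j). 1 / a (x k)) \<and> (\<Sum>k=\<sigma> j..<\<sigma> (Suc j). 1 / a (x k)) \<le> h + \<delta> \<and>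
      quants o' q cs (x s) ! j = quant o' q (lr (x (\<sigma> j)) (x (\<sigma> (Suc j)))))"
proof (induction cs arbitrary: s)
  case Nil
  then show ?case by (intro exI[of _ "\<lambda>_. s"]) auto
next
  case (Cons ys cs)
  let ?r = "x s"
  have xs: "x (s + i) = (?r # ys) ! i" if "i \<le> length ys" for i
  proof (cases i)
    case (Suc i')
    then show ?thesis using Cons.prems(2)[rule_format, of i'] that by (simp add: nth_append)
  qed simp
  have f: "x (s + length ys) = fin ?r ys"
    using xs[of "length ys"] by (simp add: fin_def last_conv_nth)
  have ne: "ys \<noteq> []" using Cons.prems(1) h by auto
  obtain k where k: "k > 0" "k \<le> length ys" "\<And>i. i < k \<Longrightarrow> \<bar>lr ?r ((?r # ys) ! i)\<bar> \<le> \<eta> \<or> i = 0"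
    "\<And>i. k \<le> i \<Longrightarrow> i \<le> length ys \<Longrightarrow> \<bar>lr (fin ?r ys) ((?r # ys) ! i)\<bar> \<le> 2 * \<eta>"
    using good2_split[of \<eta> ?r ys ?r] Cons.prems(1) ne \<eta> by auto
  define s' where "s' = s + length ys"
  have "okc h \<delta> \<eta> cs (x s')" using Cons.prems(1) f by (simp add: s'_def)
  moreover have "\<forall>k<length (concat cs). x (Suc (s' + k)) = concat cs ! k"
  proof (intro allI impI)
    fix k assume "k < length (concat cs)"
    then show "x (Suc (s' + k)) = concat cs ! k"
      using Cons.prems(2)[rule_format, of "length ys + k"] by (simp add: s'_def nth_append add.assoc)
  qed
  ultimately obtain \<sigma> \<rho> where IH: "\<sigma> 0 = s'" "\<sigma> (length cs) = s' + length (concat cs)"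
    "\<And>j. j < length cs \<Longrightarrow> \<sigma> j < \<rho> j \<and> \<rho> j \<le> \<sigma> (Suc j) \<and>
      (\<forall>k. \<sigma> j \<le> k \<and> k < \<rho> j \<longrightarrow> \<bar>lr (x (\<sigma> j)) (x k)\<bar> \<le> \<eta>) \<and>
      (\<forall>k. \<rho> j \<le> k \<and> k \<le> \<sigma> (Suc j) \<longrightarrow> \<bar>lr (x (\<sigma> (Suc j))) (x k)\<bar> \<le> 2 * \<eta>) \<and>
      h \<le> (\<Sum>k=\<sigma> j..<\<sigma> (Suc j). 1 / a (x k)) \<and> (\<Sum>k=\<sigma> j..<\<sigma> (Suc j). 1 / a (x k)) \<le> h + \<delta> \<and>
      quants o' q cs (x s') ! j = quant o' q (lr (x (\<sigma> j)) (x (\<sigma> (Suc j))))"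
    using Cons.IH[of s'] by blast
  have sumeq: "(\<Sum>k=s..<s'. 1 / a (x k)) = clk ys ?r"
  proof -
    have "(\<Sum>k=s..<s'. 1 / a (x k)) = (\<Sum>i=0..<length ys. 1 / a (x (i + s)))"
      using sum.shift_bounds_nat_ivl[of "\<lambda>k. 1 / a (x k)" 0 s "length ys"] by (simp add: s'_def add.commute)
    also have "\<dots> = (\<Sum>i<length ys. 1 / a ((?r # ys) ! i))"
      unfolding atLeast0LessThan by (rule sum.cong) (use xs in \<open>auto simp: add.commute\<close>)
    finally show ?thesis by (simp add: clk_sum)
  qed
  define \<sigma>' where "\<sigma>' j = (case j of 0 \<Rightarrow> s | Suc j' \<Rightarrow> \<sigma> j')" for j
  define \<rho>' where "\<rho>' j = (case j of 0 \<Rightarrow> s + k | Suc j' \<Rightarrow> \<rho> j')" for j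
  have first: "\<bar>lr ?r (x i)\<bar> \<le> \<eta>" if "s \<le> i" "i < s + k" for i
    using k(3)[of "i - s"] xs[of "i - s"] k(2) that \<eta> by (cases "i = s") auto
  have second: "\<bar>lr (x s') (x i)\<bar> \<le> 2 * \<eta>" if "s + k \<le> i" "i \<le> s'" for i
    using k(4)[of "i - s"] xs[of "i - s"] that f by (auto simp: s'_def)
  show ?case
  proof (rule exI[of _ \<sigma>'], rule exI[of _ \<rho>'], intro conjI allI impI)
    show "\<sigma>' 0 = s" by (simp add: \<sigma>'_def)
    show "\<sigma>' (length (ys # cs)) = s + length (concat (ys # cs))" using IH by (simp add: \<sigma>'_def s'_def)
  next
    fix j assume "j < length (ys # cs)"
    then show "\<sigma>' j < \<rho>' j" "\<rho>' j \<le> \<sigma>' (Suc j)"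
      using IH k by (auto simp: \<sigma>'_def \<rho>'_def s'_def split: nat.splits)
  next
    fix j i assume "j < length (ys # cs)" "\<sigma>' j \<le> i \<and> i < \<rho>' j"
    then show "\<bar>lr (x (\<sigma>' j)) (x i)\<bar> \<le> \<eta>"
      using IH first by (auto simp: \<sigma>'_def \<rho>'_def split: nat.splits)
  next
    fix j i assume "j < length (ys # cs)" "\<rho>' j \<le> i \<and> i \<le> \<sigma>' (Suc j)"
    then show "\<bar>lr (x (\<sigma>' (Suc j))) (x i)\<bar> \<le> 2 * \<eta>"
      using IH second by (auto simp: \<sigma>'_def \<rho>'_def split: nat.splits)
  next
    fix j assume j: "j < length (ys # cs)"
    show "h \<le> (\<Sum>k=\<sigma>' j..<\<sigma>' (Suc j). 1 / a (x k))"
      using j IH sumeq Cons.prems(1) by (auto simp: \<sigma>'_def split: nat.splits)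
    show "(\<Sum>k=\<sigma>' j..<\<sigma>' (Suc j). 1 / a (x k)) \<le> h + \<delta>"
      using j IH sumeq Cons.prems(1) by (auto simp: \<sigma>'_def split: nat.splits)
    show "quants o' q (ys # cs) (x s) ! j = quant o' q (lr (x (\<sigma>' j)) (x (\<sigma>' (Suc j))))"
      using j IH f by (auto simp: \<sigma>'_def s'_def split: nat.splits)
  qed
qed

lemma lr_pos: "x \<ge> 1 \<Longrightarrow> y \<ge> 1 \<Longrightarrow> ln (real y / real x) = lr x y"
  by (simp add: lr_def ln_divide_pos)

text \<open>A deterministic statement. The tolerance \<open>H\<close> for the durations is split
  into three equal shares: the overshoot \<delta> of the clock, the error of \<open>a_ratio\<close>,
  and the oscillation \<open>\<gamma> * (2 * \<eta>)\<close> within a cell.\<close>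

lemma good_near_path:
  assumes h: "h > 0" and H: "0 < H" "H \<le> 1" and m: "m > 0" and q: "q > 0" and mq: "real m * q \<le> H"
    and \<eta>: "\<eta> > 0" "2 * \<eta> \<le> H" "\<gamma> * (2 * \<eta>) \<le> H / 3" and \<delta>: "0 \<le> \<delta>" "h + \<delta> \<le> h * exp (H / 3)" and F: "finite (F::int set)"
  shows "\<exists>T0. \<forall>T\<ge>T0. \<forall>\<^sub>F n in sequentially. \<forall>cs zs x.
     okc h \<delta> \<eta> cs n \<and> length cs = m \<and> set (quants o' q cs n) \<subseteq> F \<and> (\<forall>y\<in>set (concat cs). y \<ge> 1) \<and>
     real (fin n (concat cs)) \<le> H * real n \<and> (\<forall>y\<in>set (take (nat \<lceil>a n * T\<rceil>) zs). real y \<le> H * real n) \<and>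
     length zs = nat \<lceil>a n * T\<rceil> - length (concat cs) \<and> x 0 = n \<and>
     map x [1..<Suc (nat \<lceil>a n * T\<rceil>)] = take (nat \<lceil>a n * T\<rceil>) (concat cs @ zs) \<longrightarrow>
     (\<exists>\<sigma> \<rho>. near_path \<gamma> (a n) h m T H (\<lambda>j. \<Sum>l<j. o' + q * real_of_int (quants o' q cs n ! l)) (\<lambda>k. real (x k) / real n) \<sigma> \<rho>)"
proof -
  obtain Z where Z: "\<And>z. z \<in> F \<Longrightarrow> \<bar>real_of_int z\<bar> \<le> Z"
  proof -
    have "finite ((\<lambda>z. \<bar>real_of_int z\<bar>) ` F)" using F by simp
    then show ?thesis using that[of "Max (insert 0 ((\<lambda>z. \<bar>real_of_int z\<bar>) ` F))"] by auto
  qed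
  \<comment> \<open>\<open>c\<close> bounds the displacement of the logarithm over one cell with
    quantised increment in \<open>F\<close>; \<open>Lm\<close> bounds its range over all cells, with
    1 in reserve for the oscillation; \<open>T0\<close> bounds the real time that all cells together
    can take.\<close>
  define c where "c = max 0 (\<bar>o'\<bar> + q * Z + q)"
  define Lm where "Lm = real m * c + 1"
  define T0 where "T0 = real m * ((h + \<delta>) * exp (H / 3) * exp (\<gamma> * Lm))"
  have c0: "c \<ge> 0" by (simp add: c_def)
  have "exp Lm \<ge> 1" using c0 by (simp add: Lm_def)
  have "H / 3 > 0" using H by simp
  obtain n0 where n0: "\<And>n y. n \<ge> n0 \<Longrightarrow> real n / exp Lm \<le> real y \<Longrightarrow> real y \<le> exp Lm * real n \<Longrightarrow>
     exp (- (H / 3)) * (real y / real n) powr \<gamma> \<le> a y / a n \<and> a y / a n \<le> exp (H / 3) * (real y / real n) powr \<gamma>"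
    using a_ratio[OF \<open>exp Lm \<ge> 1\<close> \<open>H / 3 > 0\<close>] by blast
  show ?thesis
  proof (intro exI[of _ T0] allI impI)
    fix T assume T: "T \<ge> T0"
    show "\<forall>\<^sub>F n in sequentially. \<forall>cs zs x.
     okc h \<delta> \<eta> cs n \<and> length cs = m \<and> set (quants o' q cs n) \<subseteq> F \<and> (\<forall>y\<in>set (concat cs). y \<ge> 1) \<and>
     real (fin n (concat cs)) \<le> H * real n \<and> (\<forall>y\<in>set (take (nat \<lceil>a n * T\<rceil>) zs). real y \<le> H * real n) \<and>
     length zs = nat \<lceil>a n * T\<rceil> - length (concat cs) \<and> x 0 = n \<and>
     map x [1..<Suc (nat \<lceil>a n * T\<rceil>)] = take (nat \<lceil>a n * T\<rceil>) (concat cs @ zs) \<longrightarrow>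
     (\<exists>\<sigma> \<rho>. near_path \<gamma> (a n) h m T H (\<lambda>j. \<Sum>l<j. o' + q * real_of_int (quants o' q cs n ! l)) (\<lambda>k. real (x k) / real n) \<sigma> \<rho>)"
      using eventually_ge_at_top[of n0] eventually_ge_at_top[of 1]
    proof (eventually_elim, intro allI impI, elim conjE)
      fix n cs zs x
      assume n: "n0 \<le> n" "1 \<le> n" and ok: "okc h \<delta> \<eta> cs n" and len: "length cs = m" and qF: "set (quants o' q cs n) \<subseteq> F"
        and pos: "\<forall>y\<in>set (concat cs). y \<ge> 1" and finH: "real (fin n (concat cs)) \<le> H * real n"
        and zsH: "\<forall>y\<in>set (take (nat \<lceil>a n * T\<rceil>) zs). real y \<le> H * real n"
        and lz: "length zs = nat \<lceil>a n * T\<rceil> - length (concat cs)" and x0: "x 0 = n"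
        and pre: "map x [1..<Suc (nat \<lceil>a n * T\<rceil>)] = take (nat \<lceil>a n * T\<rceil>) (concat cs @ zs)"
      define N where "N = nat \<lceil>a n * T\<rceil>"
      \<comment> \<open>The path \<open>x\<close> agrees with the lists only up to \<open>N\<close>,
        but the cells have to be analysed before it is known that they end by then;
        \<open>x'\<close> follows the lists all the way.\<close>
      define x' where "x' k = (if k = 0 then n else (concat cs @ zs) ! (k - 1))" for k
      have xx': "x k = x' k" if "k \<le> N" for k
      proof (cases k)
        case (Suc k')
        then have "x k = map x [1..<Suc N] ! k'" using that by (simp del: upt_Suc)
        also have "\<dots> = take N (concat cs @ zs) ! k'" using pre unfolding N_def[symmetric] by (rule arg_cong)
        also have "\<dots> = (concat cs @ zs) ! k'" using that Suc by (intro nth_take) simp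
        finally show ?thesis using Suc by (simp add: x'_def)
      qed (simp add: x0 x'_def)
      have x'0: "x' 0 = n" by (simp add: x'_def)
      have "\<forall>k<length (concat cs). x' (Suc (0 + k)) = concat cs ! k" by (simp add: x'_def nth_append)
      from okc_split[OF h less_imp_le[OF \<eta>(1)], of \<delta> cs x' 0 o' q, unfolded x'0, OF ok this]
      obtain \<sigma> \<rho> where S12: "\<sigma> 0 = 0" "\<sigma> (length cs) = 0 + length (concat cs)" and S0: "\<forall>j<length cs. \<sigma> j < \<rho> j \<and> \<rho> j \<le> \<sigma> (Suc j) \<and>
      (\<forall>k. \<sigma> j \<le> k \<and> k < \<rho> j \<longrightarrow> \<bar>lr (x' (\<sigma> j)) (x' k)\<bar> \<le> \<eta>) \<and>
      (\<forall>k. \<rho> j \<le> k \<and> k \<le> \<sigma> (Suc j) \<longrightarrow> \<bar>lr (x' (\<sigma> (Suc j))) (x' k)\<bar> \<le> 2 * \<eta>) \<and>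
      h \<le> (\<Sum>k=\<sigma> j..<\<sigma> (Suc j). 1 / a (x' k)) \<and> (\<Sum>k=\<sigma> j..<\<sigma> (Suc j). 1 / a (x' k)) \<le> h + \<delta> \<and>
      quants o' q cs n ! j = quant o' q (lr (x' (\<sigma> j)) (x' (\<sigma> (Suc j))))"
        by (elim exE conjE) (rule that)
      have S: "\<sigma> 0 = 0" "\<sigma> m = length (concat cs)" "\<And>j. j < m \<Longrightarrow> \<sigma> j < \<rho> j \<and> \<rho> j \<le> \<sigma> (Suc j)"
        "\<And>j k. j < m \<Longrightarrow> \<sigma> j \<le> k \<Longrightarrow> k < \<rho> j \<Longrightarrow> \<bar>lr (x' (\<sigma> j)) (x' k)\<bar> \<le> \<eta>"
        "\<And>j k. j < m \<Longrightarrow> \<rho> j \<le> k \<Longrightarrow> k \<le> \<sigma> (Suc j) \<Longrightarrow> \<bar>lr (x' (\<sigma> (Suc j))) (x' k)\<bar> \<le> 2 * \<eta>"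
        "\<And>j. j < m \<Longrightarrow> h \<le> (\<Sum>k=\<sigma> j..<\<sigma> (Suc j). 1 / a (x' k))" "\<And>j. j < m \<Longrightarrow> (\<Sum>k=\<sigma> j..<\<sigma> (Suc j). 1 / a (x' k)) \<le> h + \<delta>"
        "\<And>j. j < m \<Longrightarrow> quants o' q cs n ! j = quant o' q (lr (x' (\<sigma> j)) (x' (\<sigma> (Suc j))))"
        using S12 S0 unfolding len by (simp, simp, blast, blast, blast, blast, blast, blast)
      have smono: "i \<le> j \<Longrightarrow> j \<le> m \<Longrightarrow> \<sigma> i \<le> \<sigma> j" for i j
      proof (induction j)
        case (Suc j) then show ?case using S(3)[of j] by (cases "i = Suc j") auto
      qed simp
      have xpos: "x' k \<ge> 1" if "k \<le> \<sigma> m" for k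
      proof (cases k)
        case (Suc k')
        then have "concat cs ! k' \<in> set (concat cs)" using that unfolding S(2) by (intro nth_mem) simp
        then show ?thesis using pos Suc that unfolding S(2) x'_def by (simp add: nth_append del: set_concat length_concat)
      qed (use n in \<open>simp add: x'_def\<close>)
      define l where "l k = lr n (x' k)" for k
      have lln: "ln (real (x' k) / real n) = l k" if "k \<le> \<sigma> m" for k
        unfolding l_def by (rule lr_pos[OF n(2) xpos[OF that]])
      have ll: "l k - l k' = lr (x' k') (x' k)" for k k' by (simp add: l_def lr_def)
      have lq: "length (quants o' q cs n) = m" unfolding len[symmetric] by (induction cs arbitrary: n) auto
      define w where "w j = o' + q * real_of_int (quants o' q cs n ! j)" for j
      have dw: "\<bar>(l (\<sigma> (Suc j)) - l (\<sigma> j)) - w j\<bar> \<le> q" if "j < m" for j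
      proof -
        have "w j - q \<le> lr (x' (\<sigma> j)) (x' (\<sigma> (Suc j))) \<and> lr (x' (\<sigma> j)) (x' (\<sigma> (Suc j))) \<le> w j"
          using quant_eq[OF q, of o' "lr (x' (\<sigma> j)) (x' (\<sigma> (Suc j)))" "quants o' q cs n ! j"] S(8)[OF that]
          by (simp add: w_def algebra_simps)
        then show ?thesis using q by (simp add: ll abs_le_iff)
      qed
      have wb: "\<bar>w j\<bar> \<le> \<bar>o'\<bar> + q * Z" if "j < m" for j
      proof -
        have "quants o' q cs n ! j \<in> F" using qF lq that by (metis nth_mem subsetD)
        then have "\<bar>q * real_of_int (quants o' q cs n ! j)\<bar> \<le> q * Z" using Z q by (simp add: abs_mult)
        then show ?thesis unfolding w_def by linarith
      qed
      have D1: "\<bar>l (\<sigma> j) - (\<Sum>i<j. w i)\<bar> \<le> real j * q \<and> \<bar>l (\<sigma> j)\<bar> \<le> real j * c" if "j \<le> m" for j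
        using that
      proof (induction j)
        case 0 then show ?case by (simp add: S l_def x'0)
      next
        case (Suc j)
        have "\<bar>l (\<sigma> (Suc j)) - l (\<sigma> j)\<bar> \<le> c" using dw[of j] wb[of j] Suc.prems unfolding c_def by linarith
        moreover have "\<bar>l (\<sigma> j) - (\<Sum>i<j. w i)\<bar> \<le> real j * q" "\<bar>l (\<sigma> j)\<bar> \<le> real j * c" using Suc by auto
        moreover have "\<bar>(l (\<sigma> (Suc j)) - l (\<sigma> j)) - w j\<bar> \<le> q" using dw[of j] Suc.prems by simp
        ultimately show ?case unfolding sum.lessThan_Suc of_nat_Suc distrib_right mult_1_left by linarith
      qed
      have lb: "\<bar>l (\<sigma> j)\<bar> \<le> real m * c" if "j \<le> m" for j
      proof -
        have "real j * c \<le> real m * c" using that c0 by (intro mult_right_mono) auto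
        then show ?thesis using D1[OF that] by linarith
      qed
      have cellb: "min (l (\<sigma> j)) (l (\<sigma> (Suc j))) - 2 * \<eta> \<le> l k \<and> l k \<le> max (l (\<sigma> j)) (l (\<sigma> (Suc j))) + 2 * \<eta>"
        if "j < m" "\<sigma> j \<le> k" "k \<le> \<sigma> (Suc j)" for j k
      proof (cases "k < \<rho> j")
        case True
        then have "\<bar>l k - l (\<sigma> j)\<bar> \<le> \<eta>" unfolding ll using S(4)[of j k] that by simp
        then show ?thesis using \<eta> by linarith
      next
        case False
        then have "\<bar>l k - l (\<sigma> (Suc j))\<bar> \<le> 2 * \<eta>" unfolding ll using S(5)[of j k] that by simp
        then show ?thesis by linarith
      qed
      have ratio: "exp (- (H / 3)) * exp (\<gamma> * l k) \<le> a (x' k) / a n \<and> a (x' k) / a n \<le> exp (H / 3) * exp (\<gamma> * l k)"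
        if "j < m" "\<sigma> j \<le> k" "k \<le> \<sigma> (Suc j)" for j k
      proof -
        have km: "k \<le> \<sigma> m" using that smono[of "Suc j" m] by simp
        have "\<bar>l k\<bar> \<le> Lm" using cellb[OF that] lb[of j] lb[of "Suc j"] that \<eta> H unfolding Lm_def by linarith
        then have e: "exp (l k) \<le> exp Lm" "exp (- Lm) \<le> exp (l k)" by auto
        have x1: "real (x' k) > 0" using xpos[OF km] by simp
        have el: "real (x' k) / real n = exp (l k)" using lln[OF km, symmetric] x1 n by simp
        then have xe: "real (x' k) = exp (l k) * real n" using n by (simp add: field_simps)
        have "real n / exp Lm \<le> real (x' k)"
          using e(2) n unfolding xe by (simp add: exp_minus field_simps mult_right_mono)
        moreover have "real (x' k) \<le> exp Lm * real n" unfolding xe using e(1) n by (intro mult_right_mono) auto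
        ultimately have "exp (- (H / 3)) * (real (x' k) / real n) powr \<gamma> \<le> a (x' k) / a n \<and> a (x' k) / a n \<le> exp (H / 3) * (real (x' k) / real n) powr \<gamma>"
          by (rule n0[OF n(1)])
        moreover have "(real (x' k) / real n) powr \<gamma> = exp (\<gamma> * l k)" unfolding el by (simp add: powr_def)
        ultimately show ?thesis by simp
      qed
      \<comment> \<open>Each step counts 1, written as \<open>a\<close> at the visited state times
        the tick of the clock there, so that the known sum of the ticks can be used.\<close>
      have durs: "(real (\<sigma> (Suc j)) - real (\<sigma> j)) / a n = (\<Sum>k=\<sigma> j..<\<sigma> (Suc j). (a (x' k) / a n) * (1 / a (x' k)))" if "j < m" for j
      proof -
        have "(\<Sum>k=\<sigma> j..<\<sigma> (Suc j). (a (x' k) / a n) * (1 / a (x' k))) = (\<Sum>k=\<sigma> j..<\<sigma> (Suc j). 1 / a n)"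
        proof (rule sum.cong)
          fix k show "(a (x' k) / a n) * (1 / a (x' k)) = 1 / a n" using a_pos[of "x' k"] by simp
        qed simp
        also have "\<dots> = (real (\<sigma> (Suc j)) - real (\<sigma> j)) / a n" using S(3)[OF that] by (simp add: of_nat_diff)
        finally show ?thesis by simp
      qed
      have up: "(real (\<sigma> (Suc j)) - real (\<sigma> j)) / a n \<le> (h + \<delta>) * exp (H / 3) * exp (\<gamma> * (max (l (\<sigma> j)) (l (\<sigma> (Suc j))) + 2 * \<eta>))" if j: "j < m" for j
      proof -
        let ?E = "exp (H / 3) * exp (\<gamma> * (max (l (\<sigma> j)) (l (\<sigma> (Suc j))) + 2 * \<eta>))"
        have "(\<Sum>k=\<sigma> j..<\<sigma> (Suc j). (a (x' k) / a n) * (1 / a (x' k))) \<le> (\<Sum>k=\<sigma> j..<\<sigma> (Suc j). ?E * (1 / a (x' k)))"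
        proof (rule sum_mono, rule mult_right_mono)
          fix k assume k: "k \<in> {\<sigma> j..<\<sigma> (Suc j)}"
          then have r: "\<sigma> j \<le> k" "k \<le> \<sigma> (Suc j)" by auto
          have "\<gamma> * l k \<le> \<gamma> * (max (l (\<sigma> j)) (l (\<sigma> (Suc j))) + 2 * \<eta>)" using cellb[OF j r] gamma_pos by (intro mult_left_mono) auto
          then have "exp (H / 3) * exp (\<gamma> * l k) \<le> ?E" by simp
          then show "a (x' k) / a n \<le> ?E" using ratio[OF j r] by linarith
        qed (use a_pos in \<open>simp add: less_imp_le\<close>)
        also have "\<dots> = ?E * (\<Sum>k=\<sigma> j..<\<sigma> (Suc j). 1 / a (x' k))" by (simp add: sum_distrib_left)
        also have "\<dots> \<le> ?E * (h + \<delta>)" by (intro mult_left_mono S(7) j) simp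
        finally show ?thesis unfolding durs[OF j] by (simp add: mult_ac)
      qed
      have lo: "h * exp (- (H / 3)) * exp (\<gamma> * (min (l (\<sigma> j)) (l (\<sigma> (Suc j))) - 2 * \<eta>)) \<le> (real (\<sigma> (Suc j)) - real (\<sigma> j)) / a n" if j: "j < m" for j
      proof -
        let ?E = "exp (- (H / 3)) * exp (\<gamma> * (min (l (\<sigma> j)) (l (\<sigma> (Suc j))) - 2 * \<eta>))"
        have "?E * h \<le> ?E * (\<Sum>k=\<sigma> j..<\<sigma> (Suc j). 1 / a (x' k))" by (intro mult_left_mono S(6) j) simp
        also have "\<dots> = (\<Sum>k=\<sigma> j..<\<sigma> (Suc j). ?E * (1 / a (x' k)))" by (simp add: sum_distrib_left)
        also have "\<dots> \<le> (\<Sum>k=\<sigma> j..<\<sigma> (Suc j). (a (x' k) / a n) * (1 / a (x' k)))"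
        proof (rule sum_mono, rule mult_right_mono)
          fix k assume k: "k \<in> {\<sigma> j..<\<sigma> (Suc j)}"
          then have r: "\<sigma> j \<le> k" "k \<le> \<sigma> (Suc j)" by auto
          have "\<gamma> * (min (l (\<sigma> j)) (l (\<sigma> (Suc j))) - 2 * \<eta>) \<le> \<gamma> * l k" using cellb[OF j r] gamma_pos by (intro mult_left_mono) auto
          then have "?E \<le> exp (- (H / 3)) * exp (\<gamma> * l k)" by simp
          then show "?E \<le> a (x' k) / a n" using ratio[OF j r] by linarith
        qed (use a_pos in \<open>simp add: less_imp_le\<close>)
        finally show ?thesis unfolding durs[OF j] by (simp add: mult_ac)
      qed
      have sT: "real (\<sigma> m) \<le> a n * T"
      proof -
        have "real (\<sigma> (Suc j)) - real (\<sigma> j) \<le> a n * ((h + \<delta>) * exp (H / 3) * exp (\<gamma> * Lm))" if j: "j < m" for j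
        proof -
          have "max (l (\<sigma> j)) (l (\<sigma> (Suc j))) + 2 * \<eta> \<le> Lm" using lb[of j] lb[of "Suc j"] j \<eta> H unfolding Lm_def by linarith
          then have "\<gamma> * (max (l (\<sigma> j)) (l (\<sigma> (Suc j))) + 2 * \<eta>) \<le> \<gamma> * Lm" using gamma_pos by (intro mult_left_mono) auto
          then have "(h + \<delta>) * exp (H / 3) * exp (\<gamma> * (max (l (\<sigma> j)) (l (\<sigma> (Suc j))) + 2 * \<eta>)) \<le> (h + \<delta>) * exp (H / 3) * exp (\<gamma> * Lm)"
            using h \<delta> by (intro mult_left_mono) auto
          then have "(real (\<sigma> (Suc j)) - real (\<sigma> j)) / a n \<le> (h + \<delta>) * exp (H / 3) * exp (\<gamma> * Lm)" using up[OF j] by linarith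
          then show ?thesis using a_pos[of n] by (simp add: field_simps)
        qed
        then have "(\<Sum>j<m. real (\<sigma> (Suc j)) - real (\<sigma> j)) \<le> (\<Sum>j<m. a n * ((h + \<delta>) * exp (H / 3) * exp (\<gamma> * Lm)))"
          by (intro sum_mono) auto
        then have "real (\<sigma> m) \<le> a n * T0" by (subst (asm) sum_lessThan_telescope) (simp add: S T0_def mult_ac)
        also have "\<dots> \<le> a n * T" using T a_pos[of n] by simp
        finally show ?thesis .
      qed
      then have sN: "\<sigma> m \<le> N" unfolding N_def by linarith
      have v: "ln (real (x k) / real n) = l k" if "k \<le> \<sigma> m" for k using xx'[of k] lln[OF that] that sN by simp
      have sm: "\<sigma> j \<le> \<sigma> m" if "j \<le> m" for j using smono[of j m] that by simp
      show "\<exists>\<sigma> \<rho>. near_path \<gamma> (a n) h m T H (\<lambda>j. \<Sum>l<j. o' + q * real_of_int (quants o' q cs n ! l)) (\<lambda>k. real (x k) / real n) \<sigma> \<rho>"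
      proof (rule exI[of _ \<sigma>], rule exI[of _ \<rho>], unfold near_path_def, intro conjI allI impI)
        show "0 < a n" by (rule a_pos)
        show "0 \<le> real (x k) / real n" for k by simp
        show "\<sigma> 0 = 0" by (rule S)
        show "\<sigma> j < \<rho> j" "\<rho> j \<le> \<sigma> (Suc j)" if "j < m" for j using S(3)[OF that] by auto
        show "0 < real (x k) / real n" if "k \<le> \<sigma> m" for k using xpos[OF that] xx'[of k] that sN n by simp
        show "\<bar>ln (real (x (\<sigma> j)) / real n) - (\<Sum>l<j. o' + q * real_of_int (quants o' q cs n ! l))\<bar> \<le> H" if "j \<le> m" for j
        proof -
          have "real j * q \<le> real m * q" using that q by (intro mult_right_mono) auto
          then show ?thesis using D1[OF that] v[OF sm[OF that]] mq unfolding w_def by linarith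
        qed
        show "\<bar>ln (real (x k) / real n) - ln (real (x (\<sigma> j)) / real n)\<bar> \<le> H" if "j < m" "\<sigma> j \<le> k \<and> k < \<rho> j" for j k
        proof -
          have "k \<le> \<sigma> m" using that S(3)[OF that(1)] sm[of "Suc j"] by simp
          then show ?thesis using S(4)[OF that(1), of k] that v[of k] v[OF sm[of j]] \<eta> by (simp add: ll)
        qed
        show "\<bar>ln (real (x k) / real n) - ln (real (x (\<sigma> (Suc j))) / real n)\<bar> \<le> H" if "j < m" "\<rho> j \<le> k \<and> k \<le> \<sigma> (Suc j)" for j k
        proof -
          have "k \<le> \<sigma> m" using that sm[of "Suc j"] by simp
          then show ?thesis using S(5)[OF that(1), of k] that v[of k] v[OF sm[of "Suc j"]] \<eta> by (simp add: ll)
        qed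
        fix j assume j: "j < m"
        have vj: "ln (real (x (\<sigma> j)) / real n) = l (\<sigma> j)" "ln (real (x (\<sigma> (Suc j))) / real n) = l (\<sigma> (Suc j))"
          using v sm[of j] sm[of "Suc j"] j by auto
        show "h * exp (- H) * exp (\<gamma> * min (ln (real (x (\<sigma> j)) / real n)) (ln (real (x (\<sigma> (Suc j))) / real n))) \<le> (real (\<sigma> (Suc j)) - real (\<sigma> j)) / a n"
        proof -
          have "- H + \<gamma> * min (l (\<sigma> j)) (l (\<sigma> (Suc j))) \<le> - (H / 3) + \<gamma> * (min (l (\<sigma> j)) (l (\<sigma> (Suc j))) - 2 * \<eta>)"
            using \<eta>(3) H unfolding right_diff_distrib by linarith
          then have "h * exp (- H + \<gamma> * min (l (\<sigma> j)) (l (\<sigma> (Suc j)))) \<le> h * exp (- (H / 3) + \<gamma> * (min (l (\<sigma> j)) (l (\<sigma> (Suc j))) - 2 * \<eta>))"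
            using h by simp
          then show ?thesis using lo[OF j] unfolding vj exp_add by (simp add: mult.assoc)
        qed
        show "(real (\<sigma> (Suc j)) - real (\<sigma> j)) / a n \<le> h * exp H * exp (\<gamma> * max (ln (real (x (\<sigma> j)) / real n)) (ln (real (x (\<sigma> (Suc j))) / real n)))"
        proof -
          let ?m = "max (l (\<sigma> j)) (l (\<sigma> (Suc j)))"
          have "(h + \<delta>) * (exp (H / 3) * exp (\<gamma> * (?m + 2 * \<eta>))) \<le> (h * exp (H / 3)) * (exp (H / 3) * exp (\<gamma> * (?m + 2 * \<eta>)))"
            by (rule mult_right_mono[OF \<delta>(2)]) simp
          also have "\<dots> = h * exp (H / 3 + H / 3 + \<gamma> * (?m + 2 * \<eta>))" unfolding exp_add by (simp only: mult.assoc)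
          also have "\<dots> \<le> h * exp (H + \<gamma> * ?m)"
          proof -
            have "H / 3 + H / 3 + \<gamma> * (?m + 2 * \<eta>) \<le> H + \<gamma> * ?m" using \<eta>(3) unfolding distrib_left by linarith
            then show ?thesis using h by simp
          qed
          finally have "(h + \<delta>) * exp (H / 3) * exp (\<gamma> * (?m + 2 * \<eta>)) \<le> h * exp H * exp (\<gamma> * ?m)"
            unfolding exp_add by (simp only: mult.assoc)
          then show ?thesis using up[OF j] unfolding vj by linarith
        qed
      next
        fix k assume k: "\<sigma> m \<le> k \<and> real k \<le> a n * T"
        then have kN: "k \<le> N" unfolding N_def by linarith
        have "real (x' k) \<le> H * real n"
        proof (cases "k = \<sigma> m")
          case True
          have "x' (\<sigma> m) = fin n (concat cs)"
          proof (cases "concat cs = []")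
            case True
            then have "\<sigma> m = 0" unfolding S(2) by simp
            then show ?thesis unfolding x'_def True by simp
          next
            case False
            then have l: "length (concat cs) > 0" by (simp only: length_greater_0_conv) simp
            have "x' (length (concat cs)) = concat cs ! (length (concat cs) - 1)"
            proof -
              have "(if length L = 0 then n else (L @ zs) ! (length L - 1)) = L ! (length L - 1)" if "length L > 0" for L :: "nat list"
                using that by (simp add: nth_append)
              from this[OF l] show ?thesis unfolding x'_def .
            qed
            then show ?thesis unfolding S(2) fin_def last_ConsR[OF False] last_conv_nth[OF False] .
          qed
          then show ?thesis using finH True by simp
        next
          case False
          define i where "i = k - 1 - \<sigma> m"
          have ki: "k = Suc (\<sigma> m + i)" using False k unfolding i_def by arith
          have lz': "length zs = N - \<sigma> m" using lz unfolding N_def[symmetric] S(2)[symmetric] .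
          have i: "i < length zs" "i < N" using kN ki unfolding lz' by arith+
          have "x' k = zs ! i" unfolding x'_def ki nth_append S(2)[symmetric] by simp
          then have "x' k = take N zs ! i" "i < length (take N zs)" using i by simp_all
          then have "x' k \<in> set (take N zs)" by (metis nth_mem)
          then show ?thesis using zsH unfolding N_def by blast
        qed
        then show "real (x k) / real n \<le> H" using xx'[OF kN] n by (simp add: field_simps)
      qed
    qed
  qed
qed

end

section \<open>Bounding expectations by suprema\<close>

lemma cadlag_floor_path:
  fixes f :: "nat \<Rightarrow> real"
  assumes A: "A > 0"
  shows "cadlag (\<lambda>t. f (nat \<lfloor>A * t\<rfloor>))"
  unfolding cadlag_def
proof (intro conjI allI impI)
  fix t :: real assume "0 \<le> t"
  have "t < (of_int \<lfloor>A * t\<rfloor> + 1) / A" using A by (simp add: field_simps) linarith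
  then have "\<forall>\<^sub>F s in at_right t. s < (of_int \<lfloor>A * t\<rfloor> + 1) / A \<and> t < s"
    unfolding eventually_at_right_field by blast
  then have "\<forall>\<^sub>F s in at_right t. f (nat \<lfloor>A * s\<rfloor>) = f (nat \<lfloor>A * t\<rfloor>)"
  proof eventually_elim
    case (elim s)
    have "A * t < A * s" using elim A by simp
    moreover have "A * s < of_int \<lfloor>A * t\<rfloor> + 1" using elim A by (simp add: field_simps)
    ultimately have "\<lfloor>A * s\<rfloor> = \<lfloor>A * t\<rfloor>" by linarith
    then show ?case by simp
  qed
  then show "((\<lambda>t. f (nat \<lfloor>A * t\<rfloor>)) \<longlongrightarrow> f (nat \<lfloor>A * t\<rfloor>)) (at_right t)" by (rule tendsto_eventually)
next
  fix t :: real assume "0 < t"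
  define k where "k = \<lceil>A * t\<rceil> - 1"
  have k: "of_int k < A * t" "A * t \<le> of_int k + 1" unfolding k_def by linarith+
  then have "of_int k / A < t" using A by (simp add: field_simps)
  then have "\<forall>\<^sub>F s in at_left t. of_int k / A < s \<and> s < t"
    unfolding eventually_at_left_field by blast
  then have "\<forall>\<^sub>F s in at_left t. f (nat \<lfloor>A * s\<rfloor>) = f (nat k)"
  proof eventually_elim
    case (elim s)
    have "A * s < A * t" using elim A by simp
    moreover have "of_int k < A * s" using elim A by (simp add: field_simps)
    ultimately have "\<lfloor>A * s\<rfloor> = k" using k by linarith
    then show ?case by simp
  qed
  then show "\<exists>l. ((\<lambda>t. f (nat \<lfloor>A * t\<rfloor>)) \<longlongrightarrow> l) (at_left t)" by (intro exI tendsto_eventually)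
qed

text \<open>The value 0 is inserted because the set may be empty; test functionals are nonnegative here.\<close>
definition supG :: "('a \<Rightarrow> real) \<Rightarrow> 'a set \<Rightarrow> real" where "supG G A = Sup (insert 0 (G ` A))"

lemma supG:
  assumes "\<And>z. 0 \<le> G z \<and> G z \<le> B"
  shows supG_upper: "z \<in> A \<Longrightarrow> G z \<le> supG G A" and supG_bounds: "0 \<le> supG G A \<and> supG G A \<le> B"
    and supG_less: "0 \<le> c \<Longrightarrow> c < supG G A \<Longrightarrow> \<exists>z\<in>A. c < G z"
proof -
  have B: "0 \<le> B" using assms order_trans by blast
  have bdd: "bdd_above (insert 0 (G ` A))" by (rule bdd_aboveI[of _ B]) (use assms B in auto)
  show "z \<in> A \<Longrightarrow> G z \<le> supG G A" unfolding supG_def by (rule cSup_upper[OF _ bdd]) simp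
  show "0 \<le> supG G A \<and> supG G A \<le> B" unfolding supG_def
    by (auto intro!: cSup_upper[OF _ bdd] cSup_least simp: assms B)
  show "\<exists>z\<in>A. c < G z" if "0 \<le> c" "c < supG G A"
    using that less_cSup_iff[OF _ bdd, of c] unfolding supG_def by auto
qed

context chain_kernel begin

lemma pmf_traj:
  "x \<ge> 1 \<Longrightarrow> length ys = N \<Longrightarrow> pmf (traj N x) ys = (\<Prod>j<N. p ((x # ys) ! j) ((x # ys) ! Suc j))"
proof (induction N arbitrary: x ys)
  case 0 then show ?case by simp
next
  case (Suc N)
  then obtain y zs where ys: "ys = y # zs" "length zs = N" by (cases ys) auto
  have "pmf (map_pmf ((#) y') (traj N y')) (y # zs) = indicator {y} y' * pmf (traj N y) zs" for y'
  proof (cases "y' = y")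
    case True
    then show ?thesis using pmf_map_inj'[of "(#) y" "traj N y" zs] by simp
  next
    case False
    then have "y # zs \<notin> set_pmf (map_pmf ((#) y') (traj N y'))" by auto
    then have "pmf (map_pmf ((#) y') (traj N y')) (y # zs) = 0" by (metis set_pmf_iff)
    then show ?thesis using False by simp
  qed
  then have "pmf (traj (Suc N) x) ys = (\<integral>y'. indicator {y} y' * pmf (traj N y) zs \<partial>K x)"
    by (simp add: ys pmf_bind)
  also have "\<dots> = pmf (K x) y * pmf (traj N y) zs" by (simp add: measure_pmf_single)
  finally have e: "pmf (traj (Suc N) x) ys = p x y * pmf (traj N y) zs" using pmf_K[OF Suc.prems(1)] by simp
  show ?case
  proof (cases "y \<ge> 1")
    case True
    then show ?thesis unfolding e using Suc.IH[OF True ys(2)]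
      by (simp add: ys prod.lessThan_Suc_shift del: prod.lessThan_Suc)
  next
    case False
    then have "y = 0" by simp
    then show ?thesis unfolding e using p_zero[OF Suc.prems(1)]
      by (simp add: ys prod.lessThan_Suc_shift del: prod.lessThan_Suc)
  qed
qed

text \<open>The bridge from the given chain to \<open>traj\<close>: lists form a countable set, so
  it suffices to compare point masses, and these are the products in
  \<open>markov_chain_from\<close>.\<close>

lemma prefix_law:
  assumes mc: "markov_chain_from M X p x" and x: "x \<ge> 1"
  shows prefix_meas: "(\<lambda>\<omega>. map (X \<omega>) [1..<Suc N]) \<in> measurable M (count_space UNIV)"
    and prefix_distr: "distr M (count_space UNIV) (\<lambda>\<omega>. map (X \<omega>) [1..<Suc N]) = measure_pmf (traj N x)"
    and prefix_start: "AE \<omega> in M. X \<omega> 0 = x"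
proof -
  interpret M: prob_space M using mc by (simp add: markov_chain_from_def)
  have Xm[measurable]: "(\<lambda>\<omega>. X \<omega> k) \<in> measurable M (count_space UNIV)" for k
    using mc by (simp add: markov_chain_from_def)
  have law: "M.prob {\<omega>\<in>space M. \<forall>j\<le>k. X \<omega> j = s j} = (if s 0 = x then 1 else 0) * (\<Prod>j<k. p (s j) (s (Suc j)))" for k s
    using mc by (simp add: markov_chain_from_def)
  have eqv: "map (X \<omega>) [1..<Suc N] = ys \<longleftrightarrow> length ys = N \<and> (\<forall>j<N. X \<omega> (Suc j) = ys ! j)" for \<omega> ys
    by (auto simp: list_eq_iff_nth_eq simp del: upt_Suc)
  have pm: "{\<omega>\<in>space M. map (X \<omega>) [1..<Suc N] = ys} \<in> sets M" for ys
    unfolding eqv by measurable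
  show meas: "(\<lambda>\<omega>. map (X \<omega>) [1..<Suc N]) \<in> measurable M (count_space UNIV)"
    by (subst measurable_count_space_eq_countable)
       (use pm in \<open>auto simp: vimage_def Int_def conj_commute simp del: upt_Suc\<close>)
  have "M.prob {\<omega>\<in>space M. X \<omega> 0 = x} = 1" using law[of 0 "\<lambda>_. x"] by simp
  then show start: "AE \<omega> in M. X \<omega> 0 = x"
    by (subst (asm) M.prob_Collect_eq_1) auto
  show "distr M (count_space UNIV) (\<lambda>\<omega>. map (X \<omega>) [1..<Suc N]) = measure_pmf (traj N x)"
  proof (rule measure_eqI_countable[where A = UNIV])
    fix ys :: "nat list"
    have "emeasure (distr M (count_space UNIV) (\<lambda>\<omega>. map (X \<omega>) [1..<Suc N])) {ys} = emeasure M {\<omega>\<in>space M. map (X \<omega>) [1..<Suc N] = ys}"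
      by (subst emeasure_distr[OF meas]) (auto intro!: arg_cong[where f = "emeasure M"] simp del: upt_Suc)
    also have "\<dots> = ennreal (pmf (traj N x) ys)"
    proof (cases "length ys = N")
      case True
      have "M.prob {\<omega>\<in>space M. map (X \<omega>) [1..<Suc N] = ys} = M.prob {\<omega>\<in>space M. \<forall>j\<le>N. X \<omega> j = (x # ys) ! j}"
      proof (rule M.finite_measure_eq_AE)
        show "AE \<omega> in M. (\<omega> \<in> {\<omega>\<in>space M. map (X \<omega>) [1..<Suc N] = ys}) = (\<omega> \<in> {\<omega>\<in>space M. \<forall>j\<le>N. X \<omega> j = (x # ys) ! j})"
          using start
        proof eventually_elim
          case (elim \<omega>)
          have "(\<forall>j\<le>N. X \<omega> j = (x # ys) ! j) \<longleftrightarrow> (\<forall>j<N. X \<omega> (Suc j) = ys ! j)"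
          proof
            assume R: "\<forall>j<N. X \<omega> (Suc j) = ys ! j"
            show "\<forall>j\<le>N. X \<omega> j = (x # ys) ! j"
            proof (intro allI impI)
              fix j assume "j \<le> N" then show "X \<omega> j = (x # ys) ! j" using R elim by (cases j) auto
            qed
          qed (auto dest!: spec[of _ "Suc _"])
          then show ?case unfolding mem_Collect_eq eqv using True by blast
        qed
      qed (use pm in auto)
      then show ?thesis using law[of N "\<lambda>j. (x # ys) ! j"] pmf_traj[OF x True] by (simp add: M.emeasure_eq_measure)
    next
      case False
      then have "ys \<notin> set_pmf (traj N x)" using traj_length by blast
      then have "pmf (traj N x) ys = 0" by (simp add: set_pmf_iff)
      moreover have "{\<omega>\<in>space M. map (X \<omega>) [1..<Suc N] = ys} = {}" unfolding eqv using False by simp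
      ultimately show ?thesis by (simp only: emeasure_empty ennreal_0)
    qed
    finally show "emeasure (distr M (count_space UNIV) (\<lambda>\<omega>. map (X \<omega>) [1..<Suc N])) {ys} = emeasure (traj N x) {ys}"
      by (simp add: emeasure_pmf_single)
  qed auto
qed

definition zpath :: "nat \<Rightarrow> (nat \<Rightarrow> nat) \<Rightarrow> real \<Rightarrow> real" where
  "zpath n x t = real (x (nat \<lfloor>a n * t\<rfloor>)) / real n"

lemma zpath_cadlag: "cadlag (zpath n x)"
  unfolding zpath_def using cadlag_floor_path[OF a_pos[of n], of "\<lambda>k. real (x k) / real n"] .

text \<open>The worst value of \<open>G\<close> over all continuations of a prefix. As a function on
  a countable set it is measurable, whatever \<open>G\<close> is, and it reduces the problem to
  trajectories of finite length.\<close>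

definition prefixG :: "((real \<Rightarrow> real) \<Rightarrow> real) \<Rightarrow> nat \<Rightarrow> nat \<Rightarrow> nat list \<Rightarrow> real" where
  "prefixG G n k ys = supG G {zpath n x | x. x 0 = n \<and> map x [1..<Suc k] = ys}"

lemma expectation_le_prefix:
  assumes mc: "markov_chain_from M X p n" and n: "n \<ge> 1" and G: "\<And>z. 0 \<le> G z \<and> G z \<le> B"
    and m: "(\<lambda>\<omega>. G (zpath n (X \<omega>))) \<in> borel_measurable M"
  shows "(\<integral>\<omega>. G (zpath n (X \<omega>)) \<partial>M) \<le> (\<integral>ys. prefixG G n k ys \<partial>traj k n)"
proof -
  interpret M: prob_space M using mc by (simp add: markov_chain_from_def)
  note [measurable] = prefix_meas[OF mc n, of k]
  have b: "0 \<le> prefixG G n k ys \<and> prefixG G n k ys \<le> B" for ys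
    unfolding prefixG_def by (rule supG_bounds[OF G])
  have pm: "(\<lambda>\<omega>. prefixG G n k (map (X \<omega>) [1..<Suc k])) \<in> borel_measurable M"
    by (rule measurable_compose[OF prefix_meas[OF mc n]]) simp
  have "(\<integral>\<omega>. G (zpath n (X \<omega>)) \<partial>M) \<le> (\<integral>\<omega>. prefixG G n k (map (X \<omega>) [1..<Suc k]) \<partial>M)"
  proof (rule integral_mono_AE)
    show "integrable M (\<lambda>\<omega>. G (zpath n (X \<omega>)))" by (rule M.integrable_const_bound[where B = B]) (use G m in auto)
    show "integrable M (\<lambda>\<omega>. prefixG G n k (map (X \<omega>) [1..<Suc k]))"
      by (rule M.integrable_const_bound[where B = B]) (use b pm in auto)
    show "AE \<omega> in M. G (zpath n (X \<omega>)) \<le> prefixG G n k (map (X \<omega>) [1..<Suc k])"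
      using prefix_start[OF mc n]
    proof eventually_elim
      case (elim \<omega>)
      show ?case unfolding prefixG_def by (rule supG_upper[OF G]) (use elim in blast)
    qed
  qed
  also have "\<dots> = (\<integral>ys. prefixG G n k ys \<partial>distr M (count_space UNIV) (\<lambda>\<omega>. map (X \<omega>) [1..<Suc k]))"
    by (rule integral_distr[symmetric, OF prefix_meas[OF mc n]]) simp
  also have "\<dots> = (\<integral>ys. prefixG G n k ys \<partial>traj k n)" unfolding prefix_distr[OF mc n] ..
  finally show ?thesis .
qed

lemma prog_set: "cs \<in> set_pmf (prog m h x) \<Longrightarrow> length cs = m"
  and prog_pos: "cs \<in> set_pmf (prog m h x) \<Longrightarrow> x \<ge> 1 \<Longrightarrow> \<forall>y\<in>set (concat cs). y \<ge> 1"
proof -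
  show "cs \<in> set_pmf (prog m h x) \<Longrightarrow> length cs = m" by (induction m arbitrary: x cs) auto
  show "cs \<in> set_pmf (prog m h x) \<Longrightarrow> x \<ge> 1 \<Longrightarrow> \<forall>y\<in>set (concat cs). y \<ge> 1"
  proof (induction m arbitrary: x cs)
    case (Suc m)
    from Suc.prems obtain ys cs' where c: "cs = ys # cs'" "ys \<in> set_pmf (cell h x)" "cs' \<in> set_pmf (prog m h (fin x ys))" by auto
    have "\<forall>y\<in>set (x # ys). y \<ge> 1" using run_pos c(2) Suc.prems(2) unfolding cell_def by blast
    moreover have "\<forall>y\<in>set (concat cs'). y \<ge> 1" using Suc.IH[OF c(3) cell_fin_pos[OF c(2) Suc.prems(2)]] .
    ultimately show ?case unfolding c(1) by auto
  qed simp
qed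

lemma quants_length[simp]: "length (quants o' q cs x) = length cs"
  by (induction cs arbitrary: x) auto

text \<open>\<open>quant\<close> rounds up, so the quantised sum dominates the true displacement; a
  very negative sum therefore forces a small end state.\<close>

lemma quants_sum:
  assumes q: "q > 0"
  shows "lr x (fin x (concat cs)) \<le> (\<Sum>l<length cs. o' + q * real_of_int (quants o' q cs x ! l))"
proof (induction cs arbitrary: x)
  case Nil then show ?case by simp
next
  case (Cons ys cs)
  have "lr x (fin x ys) \<le> o' + q * real_of_int (quant o' q (lr x (fin x ys)))"
    using quant_eq[OF q, of o' "lr x (fin x ys)"] by blast
  moreover have "lr x (fin x (concat (ys # cs))) = lr x (fin x ys) + lr (fin x ys) (fin (fin x ys) (concat cs))"
    by (simp add: fin_append lr_add)
  ultimately show ?case using Cons.IH[of "fin x ys"]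
    by (simp add: sum.lessThan_Suc_shift del: sum.lessThan_Suc)
qed

text \<open>The starting state \<open>n\<close> is existentially quantified, so that one set,
  depending on \<open>w\<close> and the level only, serves all the chains at once.\<close>

definition Near :: "real \<Rightarrow> nat \<Rightarrow> real \<Rightarrow> real \<Rightarrow> real \<Rightarrow> real \<Rightarrow> int list \<Rightarrow> (real \<Rightarrow> real) set" where
  "Near h m T H o' q w = {z. \<exists>n x \<sigma> \<rho>. 1 \<le> n \<and> z = zpath n x \<and>
     near_path \<gamma> (a n) h m T H (\<lambda>j. \<Sum>l<j. o' + q * real_of_int (w ! l)) (\<lambda>k. real (x k) / real n) \<sigma> \<rho>}"

text \<open>Of the four failures, too large an overshoot eventually has probability 0;
  incompleteness and an increment outside \<open>F\<close> cost \<epsilon> each, and two large moves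
  cost \<open>C * h\<^sup>2\<close>. The event outside \<open>F\<close> is a complement, so finitely
  many limits determine its probability.\<close>

lemma cell_bad:
  assumes h: "h > 0" and q: "q > 0" and \<delta>: "\<delta> > 0" and F: "finite F" and e: "\<epsilon> > 0"
    and C: "\<forall>\<^sub>F x in sequentially. measure_pmf.prob (cell h x) {ys. \<not> good2 \<eta> x ys} \<le> C * h\<^sup>2"
    and lim: "\<And>z. (\<lambda>x. measure_pmf.prob (cell h x) {ys. quant o' q (lr x (fin x ys)) = z}) \<longlonglongrightarrow> \<pi> z"
    and pF: "1 - (\<Sum>z\<in>F. \<pi> z) < \<epsilon>"
  shows "\<forall>\<^sub>F x in sequentially. measure_pmf.prob (cell h x)
      {ys. \<not> (h \<le> clk ys x \<and> clk ys x \<le> h + \<delta> \<and> good2 \<eta> x ys \<and> quant o' q (lr x (fin x ys)) \<in> F)} \<le> C * h\<^sup>2 + 2 * \<epsilon>"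
proof -
  let ?Q = "\<lambda>x. {ys. quant o' q (lr x (fin x ys)) \<in> F}"
  have Q: "measure_pmf.prob (cell h x) (- ?Q x) = 1 - (\<Sum>z\<in>F. measure_pmf.prob (cell h x) {ys. quant o' q (lr x (fin x ys)) = z})" for x
  proof -
    have "?Q x = (\<Union>z\<in>F. {ys. quant o' q (lr x (fin x ys)) = z})" by auto
    moreover have "measure_pmf.prob (cell h x) (\<Union>z\<in>F. {ys. quant o' q (lr x (fin x ys)) = z}) = (\<Sum>z\<in>F. measure_pmf.prob (cell h x) {ys. quant o' q (lr x (fin x ys)) = z})"
      by (rule measure_pmf.finite_measure_finite_Union[OF F]) (auto simp: disjoint_family_on_def)
    ultimately show ?thesis using measure_pmf.prob_compl[of "?Q x" "cell h x"] by (simp add: Compl_eq_Diff_UNIV)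
  qed
  have "(\<lambda>x. measure_pmf.prob (cell h x) (- ?Q x)) \<longlonglongrightarrow> 1 - (\<Sum>z\<in>F. \<pi> z)"
    unfolding Q by (intro tendsto_intros lim)
  from order_tendstoD(2)[OF this pF] have "\<forall>\<^sub>F x in sequentially. measure_pmf.prob (cell h x) (- ?Q x) < \<epsilon>" .
  then show ?thesis using C cell_clk[OF h \<delta>] cell_complete[OF h e]
  proof eventually_elim
    case (elim x)
    let ?P = "measure_pmf.prob (cell h x)"
    have "?P {ys. \<not> (h \<le> clk ys x \<and> clk ys x \<le> h + \<delta> \<and> good2 \<eta> x ys \<and> quant o' q (lr x (fin x ys)) \<in> F)}
      \<le> ?P ({ys. clk ys x < h} \<union> {ys. \<not> good2 \<eta> x ys} \<union> - ?Q x)"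
      by (rule measure_pmf.finite_measure_mono_AE) (use elim(3) in \<open>auto simp: AE_measure_pmf_iff\<close>)
    also have "\<dots> \<le> ?P {ys. clk ys x < h} + ?P {ys. \<not> good2 \<eta> x ys} + ?P (- ?Q x)"
      using measure_Un_le[of "{ys. clk ys x < h} \<union> {ys. \<not> good2 \<eta> x ys}" "cell h x" "- ?Q x"]
        measure_Un_le[of "{ys. clk ys x < h}" "cell h x" "{ys. \<not> good2 \<eta> x ys}"] by simp
    finally show ?case using elim by linarith
  qed
qed

text \<open>Only finitely many quantised increment sequences are kept: the increments lie in \<open>F\<close> and
  their sum is so negative that the chain is likely to remain small after the last cell.\<close>
lemma level_bound:
  assumes h: "h > 0" and H: "0 < H" "H \<le> 1" and m: "m > 0" and q: "q > 0" and mq: "real m * q \<le> H"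
    and \<eta>: "\<eta> > 0" "2 * \<eta> \<le> H" "\<gamma> * (2 * \<eta>) \<le> H / 3" and F: "finite (F::int set)" and e: "\<epsilon> > 0"
    and C: "\<forall>\<^sub>F x in sequentially. measure_pmf.prob (cell h x) {ys. \<not> good2 \<eta> x ys} \<le> C * h\<^sup>2"
    and lim: "\<And>z. (\<lambda>x. measure_pmf.prob (cell h x) {ys. quant o' q (lr x (fin x ys)) = z}) \<longlonglongrightarrow> \<pi> z"
    and pF: "1 - (\<Sum>z\<in>F. \<pi> z) < \<epsilon>" and bad: "0 \<le> C" "real m * (C * h\<^sup>2 + 2 * \<epsilon>) \<le> H / 4"
    and L: "exp L \<le> H * (H / 8) powr (1 / \<beta>)"
    and W: "W = {w. length w = m \<and> set w \<subseteq> F \<and> (\<Sum>l<m. o' + q * real_of_int (w ! l)) \<le> L}"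
  shows "\<exists>T0. \<forall>T\<ge>T0. T > 0 \<longrightarrow> (\<forall>G B. (\<forall>z. 0 \<le> G z \<and> G z \<le> B) \<longrightarrow> (\<forall>e>0. \<forall>\<^sub>F n in sequentially.
     (\<integral>ys. prefixG G n (nat \<lceil>a n * T\<rceil>) ys \<partial>traj (nat \<lceil>a n * T\<rceil>) n)
       \<le> B + (\<Sum>w\<in>W. (supG G (Near h m T H o' q w) - B) * prod_list (map \<pi> w)) + B * (H / 2) + e))"
proof -
  \<comment> \<open>The largest overshoot that costs the durations no more than the factor
    \<open>exp (H / 3)\<close>.\<close>
  define \<delta> where "\<delta> = h * (exp (H / 3) - 1)"
  have \<delta>: "\<delta> > 0" "h + \<delta> \<le> h * exp (H / 3)" using h H by (simp_all add: \<delta>_def algebra_simps)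
  obtain T0 where T0: "\<forall>T\<ge>T0. \<forall>\<^sub>F n in sequentially. \<forall>cs zs x.
     okc h \<delta> \<eta> cs n \<and> length cs = m \<and> set (quants o' q cs n) \<subseteq> F \<and> (\<forall>y\<in>set (concat cs). y \<ge> 1) \<and>
     real (fin n (concat cs)) \<le> H * real n \<and> (\<forall>y\<in>set (take (nat \<lceil>a n * T\<rceil>) zs). real y \<le> H * real n) \<and>
     length zs = nat \<lceil>a n * T\<rceil> - length (concat cs) \<and> x 0 = n \<and>
     map x [1..<Suc (nat \<lceil>a n * T\<rceil>)] = take (nat \<lceil>a n * T\<rceil>) (concat cs @ zs) \<longrightarrow>
     (\<exists>\<sigma> \<rho>. near_path \<gamma> (a n) h m T H (\<lambda>j. \<Sum>l<j. o' + q * real_of_int (quants o' q cs n ! l)) (\<lambda>k. real (x k) / real n) \<sigma> \<rho>)"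
    using good_near_path[OF h H m q mq \<eta> less_imp_le[OF \<delta>(1)] \<delta>(2) F] by blast
  obtain CV where CV: "CV \<ge> 0" "\<And>n. n \<ge> 1 \<Longrightarrow> (\<integral>k. real k powr \<beta> \<partial>K n) \<le> real n powr \<beta> + CV" using powr_drift by blast
  have finW: "finite W" unfolding W using finite_lists_length_eq[OF F, of m] by (rule finite_subset[rotated]) auto
  show ?thesis
  proof (intro exI[of _ T0] allI impI)
    fix T B e' :: real and G :: "(real \<Rightarrow> real) \<Rightarrow> real"
    assume T: "T0 \<le> T" "T > 0" and G: "\<forall>z. 0 \<le> G z \<and> G z \<le> B" and e': "e' > 0"
    define U where "U w = supG G (Near h m T H o' q w)" for w
    have G': "\<And>z. 0 \<le> G z \<and> G z \<le> B" using G by blast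
    have U: "0 \<le> U w \<and> U w \<le> B" for w unfolding U_def by (rule supG_bounds[OF G'])
    have B0: "B \<ge> 0" using U order_trans by blast
    define Pw where "Pw n w = measure_pmf.prob (prog m h n) {cs. quants o' q cs n = w}" for n w
    have "(\<lambda>n. \<Sum>w\<in>W. (U w - B) * Pw n w) \<longlonglongrightarrow> (\<Sum>w\<in>W. (U w - B) * prod_list (map \<pi> w))"
    proof (intro tendsto_sum tendsto_mult tendsto_const)
      fix w assume "w \<in> W"
      then have "length w = m" unfolding W by simp
      then show "(\<lambda>n. Pw n w) \<longlonglongrightarrow> prod_list (map \<pi> w)" unfolding Pw_def using prog_quants[OF q lim, of w] by simp
    qed
    then have E1: "\<forall>\<^sub>F n in sequentially. (\<Sum>w\<in>W. (U w - B) * Pw n w) < (\<Sum>w\<in>W. (U w - B) * prod_list (map \<pi> w)) + e'"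
      by (rule order_tendstoD) (use e' in simp)
    have "C * h\<^sup>2 + 2 * \<epsilon> \<ge> 0" using bad(1) e by simp
    from prog_bad[OF q F cell_bad[OF h q \<delta>(1) F e C lim pF] this, of m]
    have E2: "\<forall>\<^sub>F n in sequentially. measure_pmf.prob (prog m h n) {cs. \<not> (okc h \<delta> \<eta> cs n \<and> set (quants o' q cs n) \<subseteq> F)} \<le> H / 4"
      by eventually_elim (use bad in linarith)
    \<comment> \<open>The drift \<open>CV\<close> accumulated over the \<open>a n * T\<close> steps,
      up to rounding, relative to the level \<open>(H * n) powr \<beta>\<close>; it vanishes because
      \<beta> > \<gamma>.\<close>
    have "(\<lambda>n. CV / H powr \<beta> * (T * (a n / real n powr \<beta>) + 1 / real n powr \<beta>)) \<longlonglongrightarrow> CV / H powr \<beta> * (T * 0 + 0)"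
    proof (intro tendsto_intros a_powr_lim \<beta>)
      show "(\<lambda>n. 1 / real n powr \<beta>) \<longlonglongrightarrow> 0" using \<beta>(3) by real_asymp
    qed
    then have E3: "\<forall>\<^sub>F n in sequentially. CV / H powr \<beta> * (T * (a n / real n powr \<beta>) + 1 / real n powr \<beta>) < H / 8"
      by (rule order_tendstoD) (use H in simp)
    show "\<forall>\<^sub>F n in sequentially. (\<integral>ys. prefixG G n (nat \<lceil>a n * T\<rceil>) ys \<partial>traj (nat \<lceil>a n * T\<rceil>) n)
       \<le> B + (\<Sum>w\<in>W. (supG G (Near h m T H o' q w) - B) * prod_list (map \<pi> w)) + B * (H / 2) + e'"
      using E1 E2 E3 T0[rule_format, OF T(1)] eventually_ge_at_top[of 1]
    proof eventually_elim
      case (elim n)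
      define k where "k = nat \<lceil>a n * T\<rceil>"
      have n: "real n > 0" using elim(5) by simp
      have kb: "real k \<le> a n * T + 1" using a_pos[of n] T unfolding k_def by (simp add: of_nat_nat)
      have pb: "0 \<le> prefixG G n k ys \<and> prefixG G n k ys \<le> B" for ys
        unfolding prefixG_def by (rule supG_bounds[OF G'])
      define gd where "gd cs \<longleftrightarrow> okc h \<delta> \<eta> cs n \<and> quants o' q cs n \<in> W" for cs
      \<comment> \<open>Cell sequences that are not good receive the trivial bound
        \<open>B\<close>.\<close>
      define \<Phi> where "\<Phi> cs = (if gd cs then U (quants o' q cs n) else B)" for cs
      have \<Phi>: "0 \<le> \<Phi> cs \<and> \<Phi> cs \<le> B" for cs unfolding \<Phi>_def using U B0 by simp
      have inner: "(\<integral>zs. prefixG G n k (take k (concat cs @ zs)) \<partial>traj (k - length (concat cs)) (fin n (concat cs))) \<le> \<Phi> cs + B * (H / 4)"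
        if cs: "cs \<in> set_pmf (prog m h n)" for cs
      proof (cases "gd cs")
        case False
        have "(\<integral>zs. prefixG G n k (take k (concat cs @ zs)) \<partial>traj (k - length (concat cs)) (fin n (concat cs))) \<le> B"
          by (rule measure_pmf.integral_le_const) (use pb in \<open>auto intro!: pmf_integrable_bdd[where B = B]\<close>)
        moreover have "B * (H / 4) \<ge> 0" using B0 H by simp
        ultimately show ?thesis using False unfolding \<Phi>_def by simp
      next
        case True
        have len: "length cs = m" using prog_set[OF cs] .
        have pos: "\<forall>y\<in>set (concat cs). y \<ge> 1" using prog_pos[OF cs elim(5)] .
        let ?y = "fin n (concat cs)"
        have y1: "?y \<ge> 1" by (rule fin_pos) (use pos elim(5) in auto)
        have "lr n ?y \<le> L" using quants_sum[OF q, of n cs o'] True unfolding gd_def W len by simp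
        then have "ln (real ?y) \<le> ln (real n) + L" unfolding lr_def by simp
        then have "exp (ln (real ?y)) \<le> exp (ln (real n) + L)" by simp
        then have "real ?y \<le> real n * exp L" using y1 n by (simp add: exp_add)
        also have "\<dots> \<le> real n * (H * (H / 8) powr (1 / \<beta>))" using L n by (intro mult_left_mono) auto
        \<comment> \<open>By the choice of \<open>L\<close> this end state contributes
          \<open>H / 8\<close> to the maximal inequality; the accumulated drift contributes another
          \<open>H / 8\<close>.\<close>
        finally have yb: "real ?y \<le> (H * real n) * (H / 8) powr (1 / \<beta>)" by (simp add: mult_ac)
        have "(H / 8) powr (1 / \<beta>) \<le> 1" using H \<beta>(3) by (intro powr_le1) auto
        then have "(H * real n) * (H / 8) powr (1 / \<beta>) \<le> H * real n * 1" using H n by (intro mult_left_mono) auto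
        then have yH: "real ?y \<le> H * real n" using yb by simp
        have Hn: "H * real n > 0" using H n by simp
        have "real ?y powr \<beta> \<le> ((H * real n) * (H / 8) powr (1 / \<beta>)) powr \<beta>"
          by (rule powr_mono2) (use yb \<beta>(3) in auto)
        also have "\<dots> = (H * real n) powr \<beta> * (H / 8)" using H Hn \<beta>(3) by (simp add: powr_mult powr_powr)
        finally have y2: "real ?y powr \<beta> / (H * real n) powr \<beta> \<le> H / 8"
          using powr_gt_zero[of "H * real n" \<beta>] Hn by (simp only: pos_divide_le_eq mult.commute)
        have "CV * real k / (H * real n) powr \<beta> \<le> CV * (a n * T + 1) / (H * real n) powr \<beta>"
          using kb CV(1) by (intro divide_right_mono mult_left_mono) auto
        also have "\<dots> = CV / H powr \<beta> * (T * (a n / real n powr \<beta>) + 1 / real n powr \<beta>)"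
          using H n by (simp add: powr_mult field_simps)
        also have "\<dots> < H / 8" by (rule elim(3))
        finally have y3: "CV * real k / (H * real n) powr \<beta> < H / 8" .
        let ?Q = "traj (k - length (concat cs)) ?y"
        let ?A = "{zs. \<exists>y\<in>set (take k zs). real y > H * real n}"
        have "measure_pmf.prob ?Q ?A \<le> (real ?y powr \<beta> + CV * real k) / (H * real n) powr \<beta>"
          by (rule max_inequality[OF CV Hn y1])
        also have "\<dots> \<le> H / 4" unfolding add_divide_distrib using y2 y3 by linarith
        finally have tail: "measure_pmf.prob ?Q ?A \<le> H / 4" .
        have "(\<integral>zs. prefixG G n k (take k (concat cs @ zs)) \<partial>?Q) \<le> (\<integral>zs. U (quants o' q cs n) + B * indicator ?A zs \<partial>?Q)"
        proof (rule integral_mono_AE)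
          show "integrable ?Q (\<lambda>zs. prefixG G n k (take k (concat cs @ zs)))"
            by (rule pmf_integrable_bdd[where B = B]) (use pb in auto)
          show "integrable ?Q (\<lambda>zs. U (quants o' q cs n) + B * indicator ?A zs)"
            by (rule pmf_integrable_bdd[where B = "2 * B"]) (use U[of "quants o' q cs n"] B0 in \<open>auto simp: indicator_def\<close>)
          show "AE zs in ?Q. prefixG G n k (take k (concat cs @ zs)) \<le> U (quants o' q cs n) + B * indicator ?A zs"
            unfolding AE_measure_pmf_iff
          proof
            fix zs assume zs: "zs \<in> set_pmf ?Q"
            show "prefixG G n k (take k (concat cs @ zs)) \<le> U (quants o' q cs n) + B * indicator ?A zs"
            proof (cases "zs \<in> ?A")
              case True
              then show ?thesis using pb[of "take k (concat cs @ zs)"] U[of "quants o' q cs n"] by simp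
            next
              case False
              have "prefixG G n k (take k (concat cs @ zs)) \<le> U (quants o' q cs n)"
              proof (rule ccontr)
                assume "\<not> ?thesis"
                then have "\<exists>z\<in>{zpath n x | x. x 0 = n \<and> map x [1..<Suc k] = take k (concat cs @ zs)}. U (quants o' q cs n) < G z"
                  unfolding prefixG_def not_le by (rule supG_less[where G = G and B = B, OF G' conjunct1[OF U]])
                then obtain x where x: "x 0 = n" "map x [1..<Suc k] = take k (concat cs @ zs)" "U (quants o' q cs n) < G (zpath n x)"
                  by blast
                have "\<exists>\<sigma> \<rho>. near_path \<gamma> (a n) h m T H (\<lambda>j. \<Sum>l<j. o' + q * real_of_int (quants o' q cs n ! l)) (\<lambda>k. real (x k) / real n) \<sigma> \<rho>"
                proof (rule elim(4)[rule_format, of cs zs x], intro conjI)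
                  show "okc h \<delta> \<eta> cs n" "set (quants o' q cs n) \<subseteq> F" using \<open>gd cs\<close> unfolding gd_def W by auto
                  show "\<forall>y\<in>set (take (nat \<lceil>a n * T\<rceil>) zs). real y \<le> H * real n" using False unfolding k_def by (auto simp: not_less)
                  show "length zs = nat \<lceil>a n * T\<rceil> - length (concat cs)" using traj_length[OF zs] unfolding k_def .
                  show "map x [1..<Suc (nat \<lceil>a n * T\<rceil>)] = take (nat \<lceil>a n * T\<rceil>) (concat cs @ zs)" using x(2) unfolding k_def .
                qed (fact len pos yH x(1))+
                then have "zpath n x \<in> Near h m T H o' q (quants o' q cs n)" unfolding Near_def using elim(5) by blast
                then have "G (zpath n x) \<le> U (quants o' q cs n)" unfolding U_def by (rule supG_upper[OF G'])
                then show False using x(3) by simp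
              qed
              then show ?thesis using False by simp
            qed
          qed
        qed
        also have "\<dots> = U (quants o' q cs n) + B * measure_pmf.prob ?Q ?A" by (rule expectation_affine_indicator)
        also have "\<dots> \<le> \<Phi> cs + B * (H / 4)" using mult_left_mono[OF tail B0] True unfolding \<Phi>_def by simp
        finally show ?thesis .
      qed
      let ?P = "prog m h n"
      let ?N = "{cs. \<not> (okc h \<delta> \<eta> cs n \<and> set (quants o' q cs n) \<subseteq> F)}"
      let ?I = "\<lambda>w. {cs. quants o' q cs n = w}"
      have II: "integrable ?P (indicator A :: _ \<Rightarrow> real)" for A
        by (rule pmf_integrable_bdd[where B = 1]) (auto simp: indicator_def)
      have "(\<integral>ys. prefixG G n k ys \<partial>traj k n) =
        (\<integral>ys. prefixG G n k ys \<partial>bind_pmf ?P (\<lambda>cs. map_pmf (\<lambda>zs. take k (concat cs @ zs)) (traj (k - length (concat cs)) (fin n (concat cs)))))"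
        unfolding prog_traj ..
      also have "\<dots> = (\<integral>cs. (\<integral>ys. prefixG G n k ys \<partial>map_pmf (\<lambda>zs. take k (concat cs @ zs)) (traj (k - length (concat cs)) (fin n (concat cs)))) \<partial>?P)"
        by (rule integral_bind_real[where B = B]) (use pb in auto)
      also have "\<dots> = (\<integral>cs. (\<integral>zs. prefixG G n k (take k (concat cs @ zs)) \<partial>traj (k - length (concat cs)) (fin n (concat cs))) \<partial>?P)"
        by (simp only: integral_map_pmf)
      also have "\<dots> \<le> (\<integral>cs. \<Phi> cs + B * (H / 4) \<partial>?P)"
      proof (rule integral_mono_AE)
        show "integrable ?P (\<lambda>cs. \<integral>zs. prefixG G n k (take k (concat cs @ zs)) \<partial>traj (k - length (concat cs)) (fin n (concat cs)))"
        proof (rule pmf_integrable_bdd[where B = B])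
          fix cs
          have "(\<integral>zs. prefixG G n k (take k (concat cs @ zs)) \<partial>traj (k - length (concat cs)) (fin n (concat cs))) \<le> B"
            by (rule measure_pmf.integral_le_const) (use pb in \<open>auto intro!: pmf_integrable_bdd[where B = B]\<close>)
          moreover have "0 \<le> (\<integral>zs. prefixG G n k (take k (concat cs @ zs)) \<partial>traj (k - length (concat cs)) (fin n (concat cs)))"
            by (rule Bochner_Integration.integral_nonneg) (use pb in auto)
          ultimately show "norm (\<integral>zs. prefixG G n k (take k (concat cs @ zs)) \<partial>traj (k - length (concat cs)) (fin n (concat cs))) \<le> B" by simp
        qed
        show "integrable ?P (\<lambda>cs. \<Phi> cs + B * (H / 4))"
        proof (intro Bochner_Integration.integrable_add)
          show "integrable ?P \<Phi>" by (rule pmf_integrable_bdd[where B = B]) (use \<Phi> in auto)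
        qed simp
      qed (use inner in \<open>simp add: AE_measure_pmf_iff\<close>)
      also have "\<dots> = (\<integral>cs. \<Phi> cs \<partial>?P) + B * (H / 4)"
        by (subst Bochner_Integration.integral_add) (use \<Phi> in \<open>auto intro!: pmf_integrable_bdd[where B = B]\<close>)
      \<comment> \<open>Written as a deviation from \<open>B\<close>, the bound involves only the
        finitely many sequences in \<open>W\<close>, each through a probability whose limit is
        known.\<close>
      also have "(\<integral>cs. \<Phi> cs \<partial>?P) \<le> (\<integral>cs. (B + B * indicator ?N cs) + (\<Sum>w\<in>W. (U w - B) * indicator (?I w) cs) \<partial>?P)"
      proof (rule integral_mono_AE)
        show "integrable ?P \<Phi>" by (rule pmf_integrable_bdd[where B = B]) (use \<Phi> in auto)
        show "integrable ?P (\<lambda>cs. (B + B * indicator ?N cs) + (\<Sum>w\<in>W. (U w - B) * indicator (?I w) cs))"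
          by (intro Bochner_Integration.integrable_add Bochner_Integration.integrable_sum integrable_mult_right II) simp
        have sumI: "(\<Sum>w\<in>W. (U w - B) * indicator (?I w) cs) = (if quants o' q cs n \<in> W then U (quants o' q cs n) - B else 0)" for cs
        proof -
          have "(\<Sum>w\<in>W. (U w - B) * indicator (?I w) cs) = (\<Sum>w\<in>W. if w = quants o' q cs n then U w - B else 0)"
            by (rule sum.cong) (auto simp: indicator_def)
          then show ?thesis using finW by (simp add: sum.delta)
        qed
        show "AE cs in ?P. \<Phi> cs \<le> (B + B * indicator ?N cs) + (\<Sum>w\<in>W. (U w - B) * indicator (?I w) cs)"
        proof (rule AE_I2)
          fix cs
          have "indicator ?N cs = (1::real)" if "\<not> okc h \<delta> \<eta> cs n" using that by simp
          moreover have "(0::real) \<le> indicator ?N cs" by simp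
          ultimately show "\<Phi> cs \<le> (B + B * indicator ?N cs) + (\<Sum>w\<in>W. (U w - B) * indicator (?I w) cs)"
            unfolding sumI \<Phi>_def gd_def using U[of "quants o' q cs n"] B0 by (auto simp: mult_nonneg_nonneg)
        qed
      qed
      also have "\<dots> = B + B * measure_pmf.prob ?P ?N + (\<Sum>w\<in>W. (U w - B) * Pw n w)"
      proof -
        have s: "integrable ?P (\<lambda>cs. \<Sum>w\<in>W. (U w - B) * indicator (?I w) cs)"
          by (intro Bochner_Integration.integrable_sum integrable_mult_right II)
        have i: "integrable ?P (\<lambda>cs. B + B * indicator ?N cs)" by (intro Bochner_Integration.integrable_add integrable_mult_right II) simp
        have "(\<integral>cs. (\<Sum>w\<in>W. (U w - B) * indicator (?I w) cs) \<partial>?P) = (\<Sum>w\<in>W. \<integral>cs. (U w - B) * indicator (?I w) cs \<partial>?P)"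
          by (intro Bochner_Integration.integral_sum integrable_mult_right II)
        also have "\<dots> = (\<Sum>w\<in>W. (U w - B) * Pw n w)" unfolding Pw_def by simp
        finally show ?thesis unfolding Bochner_Integration.integral_add[OF i s] expectation_affine_indicator by simp
      qed
      also have "\<dots> \<le> B + B * (H / 4) + ((\<Sum>w\<in>W. (U w - B) * prod_list (map \<pi> w)) + e')"
        using elim(1) mult_left_mono[OF elim(2) B0] by linarith
      finally show ?case unfolding k_def[symmetric] U_def[symmetric] by (simp add: algebra_simps)
    qed
  qed
qed

end

section \<open>Comparison with the quantised increments of the Levy process\<close>

context levy_limit begin

definition qincrs :: "real \<Rightarrow> real \<Rightarrow> real \<Rightarrow> nat \<Rightarrow> 'b \<Rightarrow> int list" where
  "qincrs o' q h m \<omega> = map (\<lambda>j. quant o' q (incr h j \<omega>)) [0..<m]"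

lemma qincrs_eq: "qincrs o' q h m \<omega> = w \<longleftrightarrow> length w = m \<and> (\<forall>j<m. quant o' q (incr h j \<omega>) = w ! j)"
  by (auto simp: qincrs_def list_eq_iff_nth_eq)

lemma qincrs_meas: "qincrs o' q h m \<in> measurable N (count_space UNIV)"
proof -
  have "{\<omega>\<in>space N. qincrs o' q h m \<omega> = w} \<in> sets N" for w
    unfolding qincrs_eq by measurable
  then show ?thesis
    by (subst measurable_count_space_eq_countable) (auto simp: vimage_def Int_def conj_commute)
qed

text \<open>The product that appears as a limit in \<open>prog_quants\<close>; here it is exact, by
  independence of the increments.\<close>

lemma qincrs_law:
  assumes h: "h > 0" and m: "m > 0" and w: "length w = m"
  shows "N.prob {\<omega>\<in>space N. qincrs o' q h m \<omega> = w} = prod_list (map (\<lambda>z. measure (\<nu> h) {d. quant o' q d = z}) w)"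
proof -
  have A[measurable]: "{d. quant o' q d = z} \<in> sets borel" for z
    using measurable_sets[OF quant_measurable, of "{z}" o' q] by (simp add: vimage_def)
  have "{\<omega>\<in>space N. qincrs o' q h m \<omega> = w} = (\<Inter>j\<in>{..<m}. incr h j -` {d. quant o' q d = w ! j} \<inter> space N)"
    using m w by (auto simp: qincrs_eq)
  also have "N.prob \<dots> = (\<Prod>j<m. N.prob (incr h j -` {d. quant o' q d = w ! j} \<inter> space N))"
    by (rule N.indep_varsD[OF incr_indep[OF h, of m]]) (use m in auto)
  also have "\<dots> = (\<Prod>j<m. measure (\<nu> h) {d. quant o' q d = w ! j})"
  proof (rule prod.cong)
    fix j
    show "N.prob (incr h j -` {d. quant o' q d = w ! j} \<inter> space N) = measure (\<nu> h) {d. quant o' q d = w ! j}"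
      unfolding incr_distr[OF h, symmetric, of j] by (subst measure_distr) auto
  qed simp
  also have "\<dots> = prod_list (map (\<lambda>z. measure (\<nu> h) {d. quant o' q d = z}) w)"
    by (simp add: prod.list_conv_set_nth w atLeast0LessThan)
  finally show ?thesis .
qed

lemma quant_tail:
  assumes q: "q > 0" and e: "\<epsilon> > 0"
  shows "\<exists>F. finite F \<and> measure (\<nu> h) {d. quant o' q d \<notin> F} < \<epsilon> \<and>
    measure (\<nu> h) {d. quant o' q d \<notin> F} = 1 - (\<Sum>z\<in>F. measure (\<nu> h) {d. quant o' q d = z})"
proof -
  interpret R: real_distribution "\<nu> h" by (rule nu_rd)
  have A[measurable]: "{d. quant o' q d \<in> F} \<in> sets borel" for F
    using measurable_sets[OF quant_measurable, of F o' q] by (simp add: vimage_def)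
  define A where "A Z = {d. quant o' q d \<in> {- int Z..int Z}}" for Z
  have "(\<lambda>Z. R.prob (A Z)) \<longlonglongrightarrow> R.prob (\<Union>Z. A Z)"
    by (rule R.finite_Lim_measure_incseq) (auto simp: A_def incseq_def)
  moreover have "(\<Union>Z. A Z) = UNIV"
  proof -
    have "d \<in> A (nat \<bar>quant o' q d\<bar>)" for d unfolding A_def by auto
    then show ?thesis by blast
  qed
  ultimately have "(\<lambda>Z. R.prob (A Z)) \<longlonglongrightarrow> 1" using R.prob_space by simp
  from order_tendstoD(1)[OF this, of "1 - \<epsilon>"] e obtain Z where Z: "1 - \<epsilon> < R.prob (A Z)"
    by (auto simp: eventually_sequentially)
  define F where "F = {- int Z..int Z}"
  have c: "{d. quant o' q d \<notin> F} = UNIV - {d. quant o' q d \<in> F}" by auto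
  have p: "R.prob {d. quant o' q d \<notin> F} = 1 - R.prob {d. quant o' q d \<in> F}"
    using R.prob_compl[of "{d. quant o' q d \<in> F}"] unfolding c by simp
  have "{d. quant o' q d \<in> F} = (\<Union>z\<in>F. {d. quant o' q d = z})" by auto
  also have "R.prob \<dots> = (\<Sum>z\<in>F. R.prob {d. quant o' q d = z})"
    by (rule R.finite_measure_finite_Union) (use A[of "{_}"] in \<open>auto simp: disjoint_family_on_def F_def\<close>)
  finally show ?thesis using p Z by (intro exI[of _ F]) (auto simp: F_def A_def)
qed

lemma qincrs_sum:
  assumes q: "q > 0" and \<omega>: "\<omega> \<in> space N" and j: "j \<le> m"
  shows "\<bar>(\<Sum>l<j. o' + q * real_of_int (qincrs o' q h m \<omega> ! l)) - \<xi> (real j * h) \<omega>\<bar> \<le> real j * q"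
proof -
  have "(\<Sum>l<j. o' + q * real_of_int (qincrs o' q h m \<omega> ! l)) - \<xi> (real j * h) \<omega>
     = (\<Sum>l<j. o' + q * real_of_int (quant o' q (incr h l \<omega>)) - incr h l \<omega>)"
    unfolding incr_sum[OF \<omega>] sum_subtractf using j by (simp add: qincrs_def)
  also have "\<bar>\<dots>\<bar> \<le> (\<Sum>l<j. \<bar>o' + q * real_of_int (quant o' q (incr h l \<omega>)) - incr h l \<omega>\<bar>)" by (rule sum_abs)
  also have "\<dots> \<le> (\<Sum>l<j. q)"
  proof (rule sum_mono)
    fix l
    have "o' + q * (real_of_int (quant o' q (incr h l \<omega>)) - 1) < incr h l \<omega> \<and> incr h l \<omega> \<le> o' + q * real_of_int (quant o' q (incr h l \<omega>))"
      using quant_eq[OF q, of o' "incr h l \<omega>"] by blast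
    then show "\<bar>o' + q * real_of_int (quant o' q (incr h l \<omega>)) - incr h l \<omega>\<bar> \<le> q"
      unfolding right_diff_distrib by linarith
  qed
  finally show ?thesis by simp
qed

text \<open>\<open>grid_maximal\<close> on a grid that consists of the single time
  \<open>s\<close>.\<close>

lemma xi_tail:
  assumes s: "s > 0"
  shows "N.prob {\<omega>\<in>space N. \<xi> s \<omega> > r} \<le> exp (- c0 * s - \<beta> * r)"
proof -
  have "emeasure N {\<omega>\<in>space N. \<xi> s \<omega> > r} \<le> ennreal (exp (- c0 * s - \<beta> * r))"
    using grid_maximal[OF s zero_less_one, of 2 r] by (simp add: atLeastLessThan_nat_numeral)
  then show ?thesis unfolding N.emeasure_eq_measure by simp
qed

text \<open>The margin \<open>H\<close> in \<open>L - H\<close> covers the total rounding error of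
  the \<open>m\<close> increments.\<close>

lemma qincrs_exceptional:
  assumes q: "q > 0" and h: "h > 0" and m: "m > 0" and mq: "real m * q \<le> H"
  shows "N.prob {\<omega>\<in>space N. qincrs o' q h m \<omega> \<notin> {w. length w = m \<and> set w \<subseteq> F \<and> (\<Sum>l<m. o' + q * real_of_int (w ! l)) \<le> L}}
    \<le> real m * measure (\<nu> h) {d. quant o' q d \<notin> F} + exp (- c0 * (real m * h) - \<beta> * (L - H))"
proof -
  have Am[measurable]: "{d. quant o' q d \<notin> F} \<in> sets borel"
    using measurable_sets[OF quant_measurable, of "- F" o' q] by (simp add: vimage_def)
  let ?A = "\<lambda>j. incr h j -` {d. quant o' q d \<notin> F} \<inter> space N"
  let ?X = "{\<omega>\<in>space N. \<xi> (real m * h) \<omega> > L - H}"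
  have X[measurable]: "?X \<in> sets N" using xi_meas by measurable
  have Aj[measurable]: "?A j \<in> sets N" for j by (rule measurable_sets[OF incr_meas Am])
  have "{\<omega>\<in>space N. qincrs o' q h m \<omega> \<notin> {w. length w = m \<and> set w \<subseteq> F \<and> (\<Sum>l<m. o' + q * real_of_int (w ! l)) \<le> L}} \<subseteq> (\<Union>j\<in>{..<m}. ?A j) \<union> ?X"
  proof
    fix \<omega> assume a: "\<omega> \<in> {\<omega>\<in>space N. qincrs o' q h m \<omega> \<notin> {w. length w = m \<and> set w \<subseteq> F \<and> (\<Sum>l<m. o' + q * real_of_int (w ! l)) \<le> L}}"
    then have \<omega>: "\<omega> \<in> space N" by simp
    have "length (qincrs o' q h m \<omega>) = m" by (simp add: qincrs_def)
    then have "\<not> set (qincrs o' q h m \<omega>) \<subseteq> F \<or> (\<Sum>l<m. o' + q * real_of_int (qincrs o' q h m \<omega> ! l)) > L" using a by auto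
    then show "\<omega> \<in> (\<Union>j\<in>{..<m}. ?A j) \<union> ?X"
    proof
      assume "\<not> set (qincrs o' q h m \<omega>) \<subseteq> F"
      then show ?thesis using \<omega> by (auto simp: qincrs_def)
    next
      assume "(\<Sum>l<m. o' + q * real_of_int (qincrs o' q h m \<omega> ! l)) > L"
      then have "\<xi> (real m * h) \<omega> > L - H" using qincrs_sum[where q = q and j = m and m = m and o' = o' and h = h, OF q \<omega> order_refl] mq by linarith
      then show ?thesis using \<omega> by simp
    qed
  qed
  then have "N.prob {\<omega>\<in>space N. qincrs o' q h m \<omega> \<notin> {w. length w = m \<and> set w \<subseteq> F \<and> (\<Sum>l<m. o' + q * real_of_int (w ! l)) \<le> L}} \<le> N.prob ((\<Union>j\<in>{..<m}. ?A j) \<union> ?X)"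
    by (rule N.finite_measure_mono) auto
  also have "\<dots> \<le> N.prob (\<Union>j\<in>{..<m}. ?A j) + N.prob ?X" by (rule measure_Un_le) auto
  also have "N.prob (\<Union>j\<in>{..<m}. ?A j) \<le> (\<Sum>j<m. N.prob (?A j))"
    by (rule N.finite_measure_subadditive_finite) auto
  also have "\<dots> = (\<Sum>j<m. measure (\<nu> h) {d. quant o' q d \<notin> F})"
  proof (rule sum.cong)
    fix j show "N.prob (?A j) = measure (\<nu> h) {d. quant o' q d \<notin> F}"
      unfolding incr_distr[OF h, symmetric, of j] by (subst measure_distr) auto
  qed simp
  finally show ?thesis using xi_tail[of "real m * h" "L - H"] h m by simp
qed

text \<open>The order of choices is \<eta>, \<open>C\<close> and \<open>L\<close>, the Levy horizon
  \<open>S\<close>, the mesh \<open>h\<close>, the number \<open>m\<close> of cells, the lattice,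
  the finite set \<open>F\<close>, and \<open>T\<close> last. All of them precede \<open>G\<close>,
  so one level serves every test functional. The error \<open>B * H\<close> has two halves, from
  \<open>level_bound\<close> and from the sequences outside \<open>W\<close>.\<close>

lemma level:
  assumes H: "0 < H" "H \<le> 1"
  shows "\<exists>h m q o' T. 0 < h \<and> h \<le> H \<and> 1 / H \<le> real m * h \<and> 1 / H \<le> T \<and> 0 < q \<and> real m * q \<le> H \<and>
    (\<forall>G B. (\<forall>z. 0 \<le> G z \<and> G z \<le> B) \<longrightarrow> (\<forall>e>0. \<forall>\<^sub>F n in sequentially.
     (\<integral>ys. prefixG G n (nat \<lceil>a n * T\<rceil>) ys \<partial>traj (nat \<lceil>a n * T\<rceil>) n)
       \<le> (\<integral>\<omega>. supG G (Near h m T H o' q (qincrs o' q h m \<omega>)) \<partial>N) + B * H + e))"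
proof -
  \<comment> \<open>The denominator meets both demands \<open>2 * \<eta> \<le> H\<close> and
    \<open>\<gamma> * (2 * \<eta>) \<le> H / 3\<close>.\<close>
  define \<eta> where "\<eta> = H / (6 * (\<gamma> + 1))"
  have "\<gamma> * (2 * \<eta>) = (\<gamma> / (\<gamma> + 1)) * (H / 3)" using gamma_pos by (simp add: \<eta>_def field_simps)
  also have "\<dots> \<le> 1 * (H / 3)" using gamma_pos H by (intro mult_right_mono) auto
  finally have \<eta>3: "\<gamma> * (2 * \<eta>) \<le> H / 3" by simp
  have \<eta>1: "\<eta> > 0" using gamma_pos H by (simp add: \<eta>_def)
  have "H * 1 \<le> H * (3 * (\<gamma> + 1))" using gamma_pos H by (intro mult_left_mono) auto
  then have \<eta>2: "2 * \<eta> \<le> H" using gamma_pos by (simp add: \<eta>_def field_simps)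
  obtain C where C: "C \<ge> 0" "\<And>h. h > 0 \<Longrightarrow> \<forall>\<^sub>F x in sequentially. measure_pmf.prob (cell h x) {ys. \<not> good2 \<eta> x ys} \<le> C * h\<^sup>2"
    using cell_good2[OF \<eta>1] by blast
  define L where "L = ln (H * (H / 8) powr (1 / \<beta>))"
  have L: "exp L \<le> H * (H / 8) powr (1 / \<beta>)" unfolding L_def using H by simp
  \<comment> \<open>The second entry is the time from which, by \<open>xi_tail\<close>, the Levy
    process exceeds \<open>L - H\<close> with probability at most \<open>H / 8\<close>.\<close>
  define S where "S = max (1 / H) ((- ln (H / 8) - \<beta> * (L - H)) / c0)"
  have S: "S > 0" "1 / H \<le> S" "(- ln (H / 8) - \<beta> * (L - H)) / c0 \<le> S" using H by (auto simp: S_def less_max_iff_disj)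
  \<comment> \<open>With about \<open>S / h\<close> cells, the cost \<open>C * h\<^sup>2\<close> of
    two large moves in a cell then adds up to at most \<open>H / 8\<close>.\<close>
  define h where "h = min H (H / (8 * (S + 1) * (C + 1)))"
  have h: "h > 0" "h \<le> H" "h \<le> H / (8 * (S + 1) * (C + 1))" using H S C by (auto simp: h_def)
  define m where "m = nat \<lceil>S / h\<rceil>"
  have "S / h > 0" using S h by simp
  then have m: "m > 0" "S / h \<le> real m" "real m \<le> S / h + 1" unfolding m_def by linarith+
  then have mh: "S \<le> real m * h" "real m * h \<le> S + 1" using h H by (simp_all add: field_simps)
  have "real m * (C * h\<^sup>2) = (real m * h) * (C * h)" by (simp add: power2_eq_square)
  also have "\<dots> \<le> (S + 1) * ((C + 1) * h)" using mh S C h by (intro mult_mono) auto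
  also have "\<dots> \<le> (S + 1) * ((C + 1) * (H / (8 * (S + 1) * (C + 1))))" using h S C by (intro mult_left_mono) auto
  also have "\<dots> = H / 8"
  proof -
    have "s * (c * (H / (8 * s * c))) = H / 8" if "s > 0" "c > 0" for s c :: real using that by (simp add: field_simps)
    from this[of "S + 1" "C + 1"] show ?thesis using S C by simp
  qed
  finally have mC: "real m * (C * h\<^sup>2) \<le> H / 8" .
  define q where "q = H / real m"
  have q: "q > 0" "real m * q \<le> H" using H m by (auto simp: q_def)
  obtain o' where o': "\<And>z::int. measure (\<nu> h) {o' + q * real_of_int z} = 0" using exists_offset[OF nu_rd, of h q] by blast
  \<comment> \<open>Over \<open>m\<close> cells the two losses of \<epsilon> from
    \<open>cell_bad\<close> add up to another \<open>H / 8\<close>.\<close>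
  define \<epsilon> where "\<epsilon> = H / (16 * real m)"
  have e: "\<epsilon> > 0" "real m * \<epsilon> = H / 16" using H m by (simp_all add: \<epsilon>_def)
  obtain F where F: "finite F" "measure (\<nu> h) {d. quant o' q d \<notin> F} < \<epsilon>"
    "measure (\<nu> h) {d. quant o' q d \<notin> F} = 1 - (\<Sum>z\<in>F. measure (\<nu> h) {d. quant o' q d = z})"
    using quant_tail[OF q(1) e(1)] by blast
  have bad: "real m * (C * h\<^sup>2 + 2 * \<epsilon>) \<le> H / 4" using mC e(2) by (simp add: distrib_left)
  define W where "W = {w. length w = m \<and> set w \<subseteq> F \<and> (\<Sum>l<m. o' + q * real_of_int (w ! l)) \<le> L}"
  have finW: "finite W" unfolding W_def using finite_lists_length_eq[OF F(1), of m] by (rule finite_subset[rotated]) auto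
  let ?\<pi> = "\<lambda>z. measure (\<nu> h) {d. quant o' q d = z}"
  have pF: "1 - (\<Sum>z\<in>F. ?\<pi> z) < \<epsilon>" using F by simp
  obtain T0 where T0: "\<forall>T\<ge>T0. T > 0 \<longrightarrow> (\<forall>G B. (\<forall>z. 0 \<le> G z \<and> G z \<le> B) \<longrightarrow> (\<forall>e>0. \<forall>\<^sub>F n in sequentially.
     (\<integral>ys. prefixG G n (nat \<lceil>a n * T\<rceil>) ys \<partial>traj (nat \<lceil>a n * T\<rceil>) n)
       \<le> B + (\<Sum>w\<in>W. (supG G (Near h m T H o' q w) - B) * prod_list (map ?\<pi> w)) + B * (H / 2) + e))"
    using level_bound[OF h(1) H m(1) q \<eta>1 \<eta>2 \<eta>3 F(1) e(1) C(2)[OF h(1)] cell_quant[OF nu_rd h(1) nu_char[OF h(1)] q(1) o'] pF C(1) bad L W_def]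
    by blast
  define T where "T = max T0 (1 / H)"
  have "0 < 1 / H" using H by simp
  then have T: "T0 \<le> T" "1 / H \<le> T" "T > 0" unfolding T_def by linarith+
  have exc: "N.prob {\<omega>\<in>space N. qincrs o' q h m \<omega> \<notin> W} \<le> H / 2"
  proof -
    have "N.prob {\<omega>\<in>space N. qincrs o' q h m \<omega> \<notin> W} \<le> real m * measure (\<nu> h) {d. quant o' q d \<notin> F} + exp (- c0 * (real m * h) - \<beta> * (L - H))"
      unfolding W_def by (rule qincrs_exceptional[OF q(1) h(1) m(1) q(2)])
    also have "real m * measure (\<nu> h) {d. quant o' q d \<notin> F} \<le> real m * \<epsilon>" using F(2) by (intro mult_left_mono) auto
    also have "exp (- c0 * (real m * h) - \<beta> * (L - H)) \<le> exp (ln (H / 8))"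
    proof -
      have "- ln (H / 8) - \<beta> * (L - H) \<le> S * c0" using S(3) c0 by (simp add: pos_divide_le_eq)
      also have "\<dots> \<le> (real m * h) * c0" using mh(1) c0 by (intro mult_right_mono) auto
      finally show ?thesis by (simp add: mult_ac)
    qed
    finally show ?thesis using e(2) H by simp
  qed
  \<comment> \<open>Rewrites the finite sum as an expectation over the Levy process; the sequences
    outside \<open>W\<close> cost \<open>B\<close> times their probability, which is at most
    \<open>H / 2\<close>.\<close>
  have "(\<integral>ys. prefixG G n k ys \<partial>traj k n) \<le> (\<integral>\<omega>. supG G (Near h m T H o' q (qincrs o' q h m \<omega>)) \<partial>N) + B * H + e"
    if G: "\<And>z. 0 \<le> G z \<and> G z \<le> B" and le: "(\<integral>ys. prefixG G n k ys \<partial>traj k n) \<le> B + (\<Sum>w\<in>W. (supG G (Near h m T H o' q w) - B) * prod_list (map ?\<pi> w)) + B * (H / 2) + e"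
    for G B e n k
  proof -
    define U where "U w = supG G (Near h m T H o' q w)" for w
    have U: "0 \<le> U w \<and> U w \<le> B" for w unfolding U_def by (rule supG_bounds[OF G])
    have B0: "B \<ge> 0" using U order_trans by blast
    let ?V = "qincrs o' q h m"
    have V[measurable]: "?V \<in> measurable N (count_space UNIV)" by (rule qincrs_meas)
    have Ei[measurable]: "{\<omega>\<in>space N. ?V \<omega> \<in> A} \<in> sets N" for A
      using measurable_sets[OF V, of A] by (simp add: vimage_def Int_def conj_commute)
    have Vw[measurable]: "{\<omega>\<in>space N. ?V \<omega> = w} \<in> sets N" for w using Ei[of "{w}"] by simp
    have nW[measurable]: "{\<omega>\<in>space N. ?V \<omega> \<notin> W} \<in> sets N" using Ei[of "- W"] by simp
    have ii: "integrable N (indicator A :: _ \<Rightarrow> real)" if "A \<in> sets N" for A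
      using that by (simp add: N.emeasure_eq_measure)
    have "B + (\<Sum>w\<in>W. (U w - B) * prod_list (map ?\<pi> w)) = B + (\<Sum>w\<in>W. (U w - B) * N.prob {\<omega>\<in>space N. ?V \<omega> = w})"
      using qincrs_law[OF h(1) m(1), of _ o' q] by (auto simp: W_def intro!: sum.cong)
    also have "\<dots> = (\<integral>\<omega>. B + (\<Sum>w\<in>W. (U w - B) * indicator {\<omega>\<in>space N. ?V \<omega> = w} \<omega>) \<partial>N)"
    proof -
      have s: "integrable N (\<lambda>\<omega>. \<Sum>w\<in>W. (U w - B) * indicator {\<omega>\<in>space N. ?V \<omega> = w} \<omega>)"
        by (intro Bochner_Integration.integrable_sum integrable_mult_right ii Vw)
      have "(\<integral>\<omega>. (\<Sum>w\<in>W. (U w - B) * indicator {\<omega>\<in>space N. ?V \<omega> = w} \<omega>) \<partial>N) = (\<Sum>w\<in>W. \<integral>\<omega>. (U w - B) * indicator {\<omega>\<in>space N. ?V \<omega> = w} \<omega> \<partial>N)"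
        by (intro Bochner_Integration.integral_sum integrable_mult_right ii Vw)
      also have "\<dots> = (\<Sum>w\<in>W. (U w - B) * N.prob {\<omega>\<in>space N. ?V \<omega> = w})" using Vw by simp
      finally show ?thesis using s by (simp add: N.prob_space)
    qed
    also have "\<dots> \<le> (\<integral>\<omega>. U (?V \<omega>) + B * indicator {\<omega>\<in>space N. ?V \<omega> \<notin> W} \<omega> \<partial>N)"
    proof (rule integral_mono_AE)
      show "integrable N (\<lambda>\<omega>. B + (\<Sum>w\<in>W. (U w - B) * indicator {\<omega>\<in>space N. ?V \<omega> = w} \<omega>))"
        by (intro Bochner_Integration.integrable_add Bochner_Integration.integrable_sum integrable_mult_right ii Vw) simp
      show "integrable N (\<lambda>\<omega>. U (?V \<omega>) + B * indicator {\<omega>\<in>space N. ?V \<omega> \<notin> W} \<omega>)"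
      proof (intro Bochner_Integration.integrable_add integrable_mult_right ii nW)
        show "integrable N (\<lambda>\<omega>. U (?V \<omega>))"
          by (rule N.integrable_const_bound[where B = B]) (use U measurable_compose[OF V, of U] in auto)
      qed
      show "AE \<omega> in N. B + (\<Sum>w\<in>W. (U w - B) * indicator {\<omega>\<in>space N. ?V \<omega> = w} \<omega>) \<le> U (?V \<omega>) + B * indicator {\<omega>\<in>space N. ?V \<omega> \<notin> W} \<omega>"
      proof (rule AE_I2)
        fix \<omega> assume \<omega>: "\<omega> \<in> space N"
        have "(\<Sum>w\<in>W. (U w - B) * indicator {\<omega>\<in>space N. ?V \<omega> = w} \<omega>) = (\<Sum>w\<in>W. if w = ?V \<omega> then U w - B else 0)"
          by (rule sum.cong) (use \<omega> in \<open>auto simp: indicator_def\<close>)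
        also have "\<dots> = (if ?V \<omega> \<in> W then U (?V \<omega>) - B else 0)" using finW by (simp add: sum.delta)
        finally show "B + (\<Sum>w\<in>W. (U w - B) * indicator {\<omega>\<in>space N. ?V \<omega> = w} \<omega>) \<le> U (?V \<omega>) + B * indicator {\<omega>\<in>space N. ?V \<omega> \<notin> W} \<omega>"
          using \<omega> U[of "?V \<omega>"] by simp
      qed
    qed
    also have "\<dots> = (\<integral>\<omega>. U (?V \<omega>) \<partial>N) + B * N.prob {\<omega>\<in>space N. ?V \<omega> \<notin> W}"
    proof (subst Bochner_Integration.integral_add)
      show "integrable N (\<lambda>\<omega>. U (?V \<omega>))"
        by (rule N.integrable_const_bound[where B = B]) (use U measurable_compose[OF V, of U] in auto)
      show "integrable N (\<lambda>\<omega>. B * indicator {\<omega>\<in>space N. ?V \<omega> \<notin> W} \<omega>)" by (intro integrable_mult_right ii nW)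
    qed (use nW in simp)
    also have "\<dots> \<le> (\<integral>\<omega>. U (?V \<omega>) \<partial>N) + B * (H / 2)" using mult_left_mono[OF exc B0] by simp
    finally have "B + (\<Sum>w\<in>W. (U w - B) * prod_list (map ?\<pi> w)) \<le> (\<integral>\<omega>. U (?V \<omega>) \<partial>N) + B * (H / 2)" .
    moreover have "B * H = B * (H / 2) + B * (H / 2)" by simp
    ultimately show ?thesis using le unfolding U_def[symmetric] by linarith
  qed
  note key = this
  show ?thesis
  proof (intro exI conjI allI impI)
    fix G :: "(real \<Rightarrow> real) \<Rightarrow> real" and B e :: real
    assume G: "\<forall>z. 0 \<le> G z \<and> G z \<le> B" and e: "e > 0"
    show "\<forall>\<^sub>F n in sequentially. (\<integral>ys. prefixG G n (nat \<lceil>a n * T\<rceil>) ys \<partial>traj (nat \<lceil>a n * T\<rceil>) n)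
       \<le> (\<integral>\<omega>. supG G (Near h m T H o' q (qincrs o' q h m \<omega>)) \<partial>N) + B * H + e"
      using T0[rule_format, OF T(1,3), of G B, rule_format, OF _ e] G by (auto elim!: eventually_mono intro: key)
  qed (use h mh S T q in auto)
qed

section \<open>From deterministic convergence to convergence in law\<close>

lemma lamperti_path_Y: "\<omega> \<in> space N \<Longrightarrow> lamperti_path.Y (\<lambda>t. \<xi> t \<omega>) \<gamma> = lamperti \<gamma> \<xi> \<omega>"
  by (rule ext) (simp add: lamperti_path.Y_def[OF xi_path] lamperti_def I_infty_def time_inv_def)

text \<open>A failure along a subsequence would provide near paths with values of \<open>G\<close>
  above the bound, picked with no regard to measurability; \<open>near_seq.J1\<close> makes them
  converge to the Lamperti path, against the continuity of \<open>G\<close>.\<close>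

lemma near_upper:
  assumes \<omega>: "\<omega> \<in> space N" and drift: "\<And>R. \<exists>S\<ge>0. \<forall>s\<ge>S. \<xi> s \<omega> \<le> R"
    and G: "\<And>z. 0 \<le> G z \<and> G z \<le> B" "J1_continuous G" and e: "e > 0"
    and H: "\<And>i. H i > 0" "H \<longlonglongrightarrow> 0"
    and lev: "\<And>i. 0 < h i" "\<And>i. h i \<le> H i" "\<And>i. 1 / H i \<le> real (m i) * h i" "\<And>i. 1 / H i \<le> T i" "\<And>i. 0 < q i" "\<And>i. real (m i) * q i \<le> H i"
  shows "\<forall>\<^sub>F i in sequentially. supG G (Near (h i) (m i) (T i) (H i) (o' i) (q i) (qincrs (o' i) (q i) (h i) (m i) \<omega>)) \<le> G (lamperti \<gamma> \<xi> \<omega>) + e"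
proof (rule ccontr)
  let ?c = "G (lamperti \<gamma> \<xi> \<omega>) + e"
  let ?w = "\<lambda>i. qincrs (o' i) (q i) (h i) (m i) \<omega>"
  assume "\<not> ?thesis"
  from not_eventually_sequentiallyD[OF this] obtain r :: "nat \<Rightarrow> nat" where r: "strict_mono r"
    and up: "\<And>k. ?c < supG G (Near (h (r k)) (m (r k)) (T (r k)) (H (r k)) (o' (r k)) (q (r k)) (?w (r k)))"
    by (auto simp: not_le)
  have c0: "0 \<le> ?c" using G(1)[of "lamperti \<gamma> \<xi> \<omega>"] e by simp
  have "\<forall>k. \<exists>n x \<sigma> \<rho>. ?c < G (zpath n x) \<and> near_path \<gamma> (a n) (h (r k)) (m (r k)) (T (r k)) (H (r k))
      (\<lambda>j. \<Sum>l<j. o' (r k) + q (r k) * real_of_int (?w (r k) ! l)) (\<lambda>k. real (x k) / real n) \<sigma> \<rho>"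
  proof
    fix k
    from supG_less[where G = G and B = B, OF G(1) c0 up[of k]] obtain z
      where z: "z \<in> Near (h (r k)) (m (r k)) (T (r k)) (H (r k)) (o' (r k)) (q (r k)) (?w (r k))" "?c < G z" by blast
    from z(1) obtain n x \<sigma> \<rho> where "z = zpath n x" "near_path \<gamma> (a n) (h (r k)) (m (r k)) (T (r k)) (H (r k))
      (\<lambda>j. \<Sum>l<j. o' (r k) + q (r k) * real_of_int (?w (r k) ! l)) (\<lambda>k. real (x k) / real n) \<sigma> \<rho>"
      unfolding Near_def by blast
    then show "\<exists>n x \<sigma> \<rho>. ?c < G (zpath n x) \<and> near_path \<gamma> (a n) (h (r k)) (m (r k)) (T (r k)) (H (r k))
      (\<lambda>j. \<Sum>l<j. o' (r k) + q (r k) * real_of_int (?w (r k) ! l)) (\<lambda>k. real (x k) / real n) \<sigma> \<rho>"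
      using z(2) by blast
  qed
  then obtain n x \<sigma> \<rho> where x: "\<forall>k. ?c < G (zpath (n k) (x k)) \<and> near_path \<gamma> (a (n k)) (h (r k)) (m (r k)) (T (r k)) (H (r k))
      (\<lambda>j. \<Sum>l<j. o' (r k) + q (r k) * real_of_int (?w (r k) ! l)) (\<lambda>i. real (x k i) / real (n k)) (\<sigma> k) (\<rho> k)"
    unfolding choice_iff by (elim exE) (rule that)
  have np: "near_path \<gamma> (a (n k)) (h (r k)) (m (r k)) (T (r k)) (2 * H (r k)) (\<lambda>j. \<xi> (real j * h (r k)) \<omega>) (\<lambda>i. real (x k i) / real (n k)) (\<sigma> k) (\<rho> k)" for k
  proof (rule near_path_mono)
    show "near_path \<gamma> (a (n k)) (h (r k)) (m (r k)) (T (r k)) (H (r k))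
      (\<lambda>j. \<Sum>l<j. o' (r k) + q (r k) * real_of_int (?w (r k) ! l)) (\<lambda>i. real (x k i) / real (n k)) (\<sigma> k) (\<rho> k)" using x by blast
    show "\<bar>(\<Sum>l<j. o' (r k) + q (r k) * real_of_int (?w (r k) ! l)) - \<xi> (real j * h (r k)) \<omega>\<bar> \<le> H (r k)" if "j \<le> m (r k)" for j
    proof -
      have "real j * q (r k) \<le> real (m (r k)) * q (r k)" using that lev(5)[of "r k"] by (intro mult_right_mono) auto
      then show ?thesis using qincrs_sum[OF lev(5) \<omega> that, of "o' (r k)" "r k" "h (r k)"] lev(6)[of "r k"] by linarith
    qed
  qed (use lev(1) H(1)[of "r k"] in auto)
  have Hr: "(\<lambda>k. H (r k)) \<longlonglongrightarrow> 0" using LIMSEQ_subseq_LIMSEQ[OF H(2) r] by (simp add: o_def)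
  have Hinv: "filterlim (\<lambda>k. 1 / H (r k)) at_top sequentially"
    using filterlim_inverse_at_top[OF Hr] H(1) by (simp add: inverse_eq_divide)
  have "near_seq (\<lambda>t. \<xi> t \<omega>) \<gamma> (\<lambda>k. a (n k)) (\<lambda>k. h (r k)) (\<lambda>k. T (r k)) (\<lambda>k. 2 * H (r k)) (\<lambda>k. m (r k)) (\<lambda>k i. real (x k i) / real (n k)) \<sigma> \<rho>"
  proof (intro near_seq.intro near_seq_axioms.intro xi_path[OF \<omega>] drift lev(1) np)
    show "(\<lambda>k. h (r k)) \<longlonglongrightarrow> 0"
      by (rule tendsto_sandwich[OF _ _ tendsto_const Hr]) (use lev(1,2) in \<open>auto intro!: always_eventually less_imp_le\<close>)
    show "filterlim (\<lambda>k. real (m (r k)) * h (r k)) at_top sequentially"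
      by (rule filterlim_at_top_mono[OF Hinv]) (use lev(3) in auto)
    show "filterlim (\<lambda>k. T (r k)) at_top sequentially"
      by (rule filterlim_at_top_mono[OF Hinv]) (use lev(4) in auto)
    show "(\<lambda>k. 2 * H (r k)) \<longlonglongrightarrow> 0" using tendsto_mult_right_zero[OF Hr] .
  qed
  from near_seq.J1[OF this] have "J1_conv (\<lambda>k. zpath (n k) (x k)) (lamperti \<gamma> \<xi> \<omega>)"
    unfolding lamperti_path_Y[OF \<omega>] zpath_def .
  moreover have "cadlag (lamperti \<gamma> \<xi> \<omega>)"
    using lamperti_path.Y_cadlag[OF xi_path[OF \<omega>] drift] unfolding lamperti_path_Y[OF \<omega>] .
  ultimately have "(\<lambda>k. G (zpath (n k) (x k))) \<longlonglongrightarrow> G (lamperti \<gamma> \<xi> \<omega>)"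
    using G(2)[unfolded J1_continuous_def, rule_format, of "lamperti \<gamma> \<xi> \<omega>" "\<lambda>k. zpath (n k) (x k)"] zpath_cadlag by simp
  from order_tendstoD(2)[OF this, of ?c] e have "\<forall>\<^sub>F k in sequentially. G (zpath (n k) (x k)) < ?c" by simp
  then show False using x by (auto simp: eventually_sequentially dest: less_asym)
qed

lemma lamperti_path_measurable: "lamperti \<gamma> \<xi> \<in> measurable N PathM"
  unfolding PathM_def using measurable_PiM_single'[of UNIV "\<lambda>t \<omega>. lamperti \<gamma> \<xi> \<omega> t" N "\<lambda>_. borel"] lamperti_meas
  by auto

lemma zpath_measurable:
  assumes mc: "markov_chain_from M X p n"
  shows "(\<lambda>\<omega>. zpath n (X \<omega>)) \<in> measurable M PathM"
proof -
  have [measurable]: "(\<lambda>\<omega>. X \<omega> k) \<in> measurable M (count_space UNIV)" for k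
    using mc by (simp add: markov_chain_from_def)
  have "(\<lambda>\<omega>. zpath n (X \<omega>) t) \<in> borel_measurable M" for t unfolding zpath_def by measurable
  then show ?thesis unfolding PathM_def
    by (rule measurable_PiM_single'[of UNIV "\<lambda>t \<omega>. zpath n (X \<omega>) t" M "\<lambda>_. borel"]) auto
qed

text \<open>A level \<open>i\<close> with small error is fixed first, and only then \<open>n\<close>
  tends to infinity; no rate relating the two is required.\<close>

lemma expectation_upper:
  assumes mc: "\<And>n. n \<ge> 1 \<Longrightarrow> markov_chain_from (M n) (X n) p n"
    and Gm: "G \<in> borel_measurable PathM" and Gb: "\<And>z. 0 \<le> G z \<and> G z \<le> B" and GJ: "J1_continuous G" and e: "e > 0"
  shows "\<forall>\<^sub>F n in sequentially. (\<integral>\<omega>. G (zpath n (X n \<omega>)) \<partial>M n) \<le> (\<integral>\<omega>. G (lamperti \<gamma> \<xi> \<omega>) \<partial>N) + e"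
proof -
  define H where "H i = 1 / (real i + 2)" for i
  have H: "H i > 0" "H i \<le> 1" for i by (auto simp: H_def)
  have H0: "H \<longlonglongrightarrow> 0" unfolding H_def by real_asymp
  have "\<forall>i. \<exists>h m q o' T. 0 < h \<and> h \<le> H i \<and> 1 / H i \<le> real m * h \<and> 1 / H i \<le> T \<and> 0 < q \<and> real m * q \<le> H i \<and>
    (\<forall>G B. (\<forall>z. 0 \<le> G z \<and> G z \<le> B) \<longrightarrow> (\<forall>e>0. \<forall>\<^sub>F n in sequentially.
     (\<integral>ys. prefixG G n (nat \<lceil>a n * T\<rceil>) ys \<partial>traj (nat \<lceil>a n * T\<rceil>) n)
       \<le> (\<integral>\<omega>. supG G (Near h m T (H i) o' q (qincrs o' q h m \<omega>)) \<partial>N) + B * H i + e))"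
    using level[OF H] by blast
  then obtain h m q o' T where lev: "\<forall>i. 0 < h i \<and> h i \<le> H i \<and> 1 / H i \<le> real (m i) * h i \<and> 1 / H i \<le> T i \<and> 0 < q i \<and> real (m i) * q i \<le> H i \<and>
    (\<forall>G B. (\<forall>z. 0 \<le> G z \<and> G z \<le> B) \<longrightarrow> (\<forall>e>0. \<forall>\<^sub>F n in sequentially.
     (\<integral>ys. prefixG G n (nat \<lceil>a n * T i\<rceil>) ys \<partial>traj (nat \<lceil>a n * T i\<rceil>) n)
       \<le> (\<integral>\<omega>. supG G (Near (h i) (m i) (T i) (H i) (o' i) (q i) (qincrs (o' i) (q i) (h i) (m i) \<omega>)) \<partial>N) + B * H i + e))"
    unfolding choice_iff by (elim exE) (rule that)
  define U where "U i \<omega> = supG G (Near (h i) (m i) (T i) (H i) (o' i) (q i) (qincrs (o' i) (q i) (h i) (m i) \<omega>))" for i \<omega>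
  have U: "0 \<le> U i \<omega> \<and> U i \<omega> \<le> B" for i \<omega> unfolding U_def by (rule supG_bounds[OF Gb])
  have Um[measurable]: "U i \<in> borel_measurable N" for i
    unfolding U_def by (rule measurable_compose[OF qincrs_meas]) simp
  define g where "g \<omega> = G (lamperti \<gamma> \<xi> \<omega>)" for \<omega>
  have gm[measurable]: "g \<in> borel_measurable N"
    unfolding g_def by (rule measurable_compose[OF lamperti_path_measurable Gm])
  \<comment> \<open>\<open>near_upper\<close> controls the suprema from above only; the maximum with
    the limiting value turns this into pointwise convergence, to which dominated convergence
    applies.\<close>
  have "(\<lambda>i. \<integral>\<omega>. max (U i \<omega>) (g \<omega>) \<partial>N) \<longlonglongrightarrow> (\<integral>\<omega>. g \<omega> \<partial>N)"
  proof (rule integral_dominated_convergence[where w = "\<lambda>_. B"])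
    show "AE \<omega> in N. (\<lambda>i. max (U i \<omega>) (g \<omega>)) \<longlonglongrightarrow> g \<omega>"
      using AE_drift AE_space
    proof eventually_elim
      case (elim \<omega>)
      show ?case
      proof (rule order_tendstoI)
        fix c assume "c < g \<omega>"
        then show "\<forall>\<^sub>F i in sequentially. c < max (U i \<omega>) (g \<omega>)" by (simp add: less_max_iff_disj)
      next
        fix c assume c: "g \<omega> < c"
        then have "(c - g \<omega>) / 2 > 0" by simp
        from near_upper[OF elim(2) elim(1)[rule_format] Gb GJ this H(1) H0, of h m T q o'] lev
        have "\<forall>\<^sub>F i in sequentially. U i \<omega> \<le> g \<omega> + (c - g \<omega>) / 2" unfolding U_def g_def by blast
        then show "\<forall>\<^sub>F i in sequentially. max (U i \<omega>) (g \<omega>) < c"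
          by eventually_elim (use c in \<open>simp add: field_simps\<close>)
      qed
    qed
    show "AE \<omega> in N. norm (max (U i \<omega>) (g \<omega>)) \<le> B" for i
    proof (rule AE_I2)
      fix \<omega> show "norm (max (U i \<omega>) (g \<omega>)) \<le> B" using U[of i \<omega>] Gb[of "lamperti \<gamma> \<xi> \<omega>"] unfolding g_def by (simp add: max_def)
    qed
  qed auto
  then have "\<forall>\<^sub>F i in sequentially. (\<integral>\<omega>. max (U i \<omega>) (g \<omega>) \<partial>N) < (\<integral>\<omega>. g \<omega> \<partial>N) + e / 3"
    by (rule order_tendstoD) (use e in simp)
  moreover have "\<forall>\<^sub>F i in sequentially. B * H i < e / 3"
    by (rule order_tendstoD[OF tendsto_mult_right_zero[OF H0]]) (use e in simp)
  ultimately have "\<forall>\<^sub>F i in sequentially. (\<integral>\<omega>. max (U i \<omega>) (g \<omega>) \<partial>N) < (\<integral>\<omega>. g \<omega> \<partial>N) + e / 3 \<and> B * H i < e / 3"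
    by (rule eventually_conj)
  then obtain i where i: "(\<integral>\<omega>. max (U i \<omega>) (g \<omega>) \<partial>N) < (\<integral>\<omega>. g \<omega> \<partial>N) + e / 3" "B * H i < e / 3"
    by (auto simp: eventually_sequentially)
  have "(\<integral>\<omega>. U i \<omega> \<partial>N) \<le> (\<integral>\<omega>. max (U i \<omega>) (g \<omega>) \<partial>N)"
  proof (rule integral_mono)
    show "integrable N (U i)" by (rule N.integrable_const_bound[where B = B]) (use U in auto)
    show "integrable N (\<lambda>\<omega>. max (U i \<omega>) (g \<omega>))"
    proof (rule N.integrable_const_bound[where B = B], rule AE_I2)
      fix \<omega> show "norm (max (U i \<omega>) (g \<omega>)) \<le> B" using U[of i \<omega>] Gb[of "lamperti \<gamma> \<xi> \<omega>"] unfolding g_def by (simp add: max_def)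
    qed simp
  qed simp
  then have Ui: "(\<integral>\<omega>. U i \<omega> \<partial>N) + B * H i + e / 3 \<le> (\<integral>\<omega>. g \<omega> \<partial>N) + e" using i by linarith
  have "\<forall>\<^sub>F n in sequentially. (\<integral>ys. prefixG G n (nat \<lceil>a n * T i\<rceil>) ys \<partial>traj (nat \<lceil>a n * T i\<rceil>) n) \<le> (\<integral>\<omega>. U i \<omega> \<partial>N) + B * H i + e / 3"
  proof -
    have "e / 3 > 0" using e by simp
    then show ?thesis using lev[rule_format, of i] Gb unfolding U_def by blast
  qed
  then show ?thesis using eventually_ge_at_top[of 1]
  proof eventually_elim
    case (elim n)
    have "(\<integral>\<omega>. G (zpath n (X n \<omega>)) \<partial>M n) \<le> (\<integral>ys. prefixG G n (nat \<lceil>a n * T i\<rceil>) ys \<partial>traj (nat \<lceil>a n * T i\<rceil>) n)"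
      by (rule expectation_le_prefix[OF mc[OF elim(2)] elim(2) Gb measurable_compose[OF zpath_measurable[OF mc[OF elim(2)]] Gm]])
    then show ?case using elim(1) Ui unfolding g_def by linarith
  qed
qed

text \<open>The upper bounds for \<open>G + B\<close> and for \<open>B - G\<close>, both nonnegative
  as \<open>supG\<close> requires, squeeze the expectation of \<open>G\<close> from the two
  sides.\<close>

theorem scaling_limit:
  assumes mc: "\<And>n. n \<ge> 1 \<Longrightarrow> markov_chain_from (M n) (X n) p n"
  shows "conv_distr_J1 M (\<lambda>n \<omega>. zpath n (X n \<omega>)) N (lamperti \<gamma> \<xi>)"
  unfolding conv_distr_J1_def
proof (intro allI impI, elim conjE exE)
  fix G B assume Gm: "G \<in> borel_measurable PathM" and GB: "\<forall>x. \<bar>G x\<bar> \<le> B" and GJ: "J1_continuous G"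
  have b: "- B \<le> G z" "G z \<le> B" for z using GB abs_le_iff[of "G z" B] by (auto simp: abs_le_iff minus_le_iff)
  let ?E = "\<lambda>n. \<integral>\<omega>. G (zpath n (X n \<omega>)) \<partial>M n" and ?l = "\<integral>\<omega>. G (lamperti \<gamma> \<xi> \<omega>) \<partial>N"
  have Gi: "integrable Q (\<lambda>\<omega>. G (f \<omega>))" if "prob_space Q" "f \<in> measurable Q PathM" for Q :: "'c measure" and f
  proof -
    interpret Q: prob_space Q by fact
    show ?thesis by (rule Q.integrable_const_bound[where B = B]) (use GB measurable_compose[OF that(2) Gm] in auto)
  qed
  have Nl: "integrable N (\<lambda>\<omega>. G (lamperti \<gamma> \<xi> \<omega>))" by (rule Gi[OF probN lamperti_path_measurable])
  have bounds: "\<forall>\<^sub>F n in sequentially. ?E n \<le> ?l + e \<and> ?l - e \<le> ?E n" if e: "e > 0" for e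
  proof -
    have "\<forall>\<^sub>F n in sequentially. (\<integral>\<omega>. G (zpath n (X n \<omega>)) + B \<partial>M n) \<le> (\<integral>\<omega>. G (lamperti \<gamma> \<xi> \<omega>) + B \<partial>N) + e"
    proof (rule expectation_upper[OF mc, where G = "\<lambda>z. G z + B" and B = "2 * B"])
      show "J1_continuous (\<lambda>z. G z + B)" using GJ unfolding J1_continuous_def by (auto intro!: tendsto_intros)
      show "0 \<le> G z + B \<and> G z + B \<le> 2 * B" for z using b[of z] by linarith
    qed (use Gm e in auto)
    moreover have "\<forall>\<^sub>F n in sequentially. (\<integral>\<omega>. B - G (zpath n (X n \<omega>)) \<partial>M n) \<le> (\<integral>\<omega>. B - G (lamperti \<gamma> \<xi> \<omega>) \<partial>N) + e"
    proof (rule expectation_upper[OF mc, where G = "\<lambda>z. B - G z" and B = "2 * B"])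
      show "J1_continuous (\<lambda>z. B - G z)" using GJ unfolding J1_continuous_def by (auto intro!: tendsto_intros)
      show "0 \<le> B - G z \<and> B - G z \<le> 2 * B" for z using b[of z] by linarith
    qed (use Gm e in auto)
    ultimately show ?thesis using eventually_ge_at_top[of 1]
    proof eventually_elim
      case (elim n)
      interpret Mn: prob_space "M n" using mc[OF elim(3)] by (simp add: markov_chain_from_def)
      have "integrable (M n) (\<lambda>\<omega>. G (zpath n (X n \<omega>)))"
        by (rule Gi[OF Mn.prob_space_axioms zpath_measurable[OF mc[OF elim(3)]]])
      then show ?case using elim(1,2) Nl by (simp add: Mn.prob_space N.prob_space)
    qed
  qed
  show "?E \<longlonglongrightarrow> ?l"
  proof (rule tendstoI)
    fix e :: real assume "e > 0"
    then have "e / 2 > 0" by simp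
    from bounds[OF this] show "\<forall>\<^sub>F n in sequentially. dist (?E n) ?l < e"
      by eventually_elim (use \<open>e > 0\<close> in \<open>simp add: dist_real_def abs_less_iff field_simps\<close>)
  qed
qed

end

theorem theorem4:
  fixes p :: "nat \<Rightarrow> nat \<Rightarrow> real" and a :: "nat \<Rightarrow> real" and \<gamma> :: real
    and Lv :: "real measure" and b s2 :: real
    and M :: "nat \<Rightarrow> 'a measure" and X :: "nat \<Rightarrow> 'a \<Rightarrow> nat \<Rightarrow> nat"
    and N :: "'b measure" and \<xi> :: "real \<Rightarrow> 'b \<Rightarrow> real"
  assumes p_nonneg: "\<forall>n\<ge>1. \<forall>k. 0 \<le> p n k"
    and p_zero: "\<forall>n\<ge>1. p n 0 = 0"
    and p_sums: "\<forall>n\<ge>1. p n sums 1"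
    and chain: "\<forall>n\<ge>1. markov_chain_from (M n) (X n) p n"
    and a_pos: "\<forall>n. 0 < a n"
    and gamma_pos: "0 < \<gamma>"
    and reg_var: "\<forall>x>0. (\<lambda>n. a (nat \<lfloor>x * real n\<rfloor>) / a n) \<longlonglongrightarrow> x powr \<gamma>"
    and Pi_sets: "sets Lv = sets borel"
    and Pi_0: "emeasure Lv {0} = 0"
    and Pi_pm1: "emeasure Lv {-1, 1} = 0"
    and Pi_int: "(\<integral>\<^sup>+ x. ennreal (min 1 (x\<^sup>2)) \<partial>Lv) < \<infinity>"
    and A1: "\<forall>f. A1_test f \<longrightarrow>
               (\<lambda>n. a n * (\<Sum>k. p n k * f (real k / real n))) \<longlonglongrightarrow> (\<integral>x. f (exp x) \<partial>Lv)"
    and A2_b: "(\<lambda>n. a n * (\<Sum>k\<in>{k. 1 \<le> k \<and> \<bar>ln (real k) - ln (real n)\<bar> \<le> 1}.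
                  p n k * (ln (real k) - ln (real n)))) \<longlonglongrightarrow> b"
    and A2_s: "0 \<le> s2"
    and A2_s2: "(\<lambda>n. a n * (\<Sum>k\<in>{k. 1 \<le> k \<and> \<bar>ln (real k) - ln (real n)\<bar> \<le> 1}.
                  p n k * (ln (real k) - ln (real n))\<^sup>2))
                \<longlonglongrightarrow> s2 + (\<integral>x. x\<^sup>2 * indicator {-1..1} x \<partial>Lv)"
    and A5: "\<exists>\<beta>0>\<gamma>.
               (\<exists>C. \<forall>\<^sub>F n in sequentially.
                  summable (\<lambda>k. p n k * exp (\<beta>0 * (ln (real k) - ln (real n)))
                                 * indicator {1<..} (ln (real k) - ln (real n))) \<and>
                  a n * (\<Sum>k. p n k * exp (\<beta>0 * (ln (real k) - ln (real n)))
                                 * indicator {1<..} (ln (real k) - ln (real n))) \<le> C) \<and>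
               integrable Lv (laplace_integrand \<beta>0) \<and> Psi s2 b Lv \<beta>0 < 0 \<and>
               (\<forall>n\<ge>1. summable (\<lambda>k. real k powr \<beta>0 * p n k))"
    and levy: "levy_process N \<xi> s2 b Lv"
  shows "conv_distr_J1 M (\<lambda>n \<omega> t. real (X n \<omega> (nat \<lfloor>a n * t\<rfloor>)) / real n) N (lamperti \<gamma> \<xi>)"
proof -
  from A5 obtain \<beta>0 C where \<beta>0: "\<beta>0 > \<gamma>"
    "\<forall>\<^sub>F n in sequentially.
                  summable (\<lambda>k. p n k * exp (\<beta>0 * (ln (real k) - ln (real n)))
                                 * indicator {1<..} (ln (real k) - ln (real n))) \<and>
                  a n * (\<Sum>k. p n k * exp (\<beta>0 * (ln (real k) - ln (real n)))
                                 * indicator {1<..} (ln (real k) - ln (real n))) \<le> C"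
    "integrable Lv (laplace_integrand \<beta>0)" "Psi s2 b Lv \<beta>0 < 0" "\<forall>n\<ge>1. summable (\<lambda>k. real k powr \<beta>0 * p n k)"
    by (elim exE conjE) (rule that)
  interpret levy_limit a \<gamma> p Lv b s2 \<beta>0 C N \<xi>
    by unfold_locales
      (rule p_nonneg[rule_format] p_zero[rule_format] p_sums[rule_format] a_pos[rule_format] gamma_pos reg_var[rule_format]
        Pi_sets Pi_0 Pi_pm1 Pi_int A1[rule_format] A2_b A2_s A2_s2 \<beta>0(1-4) \<beta>0(5)[rule_format] levy; assumption)+
  have "(\<lambda>n \<omega> t. real (X n \<omega> (nat \<lfloor>a n * t\<rfloor>)) / real n) = (\<lambda>n \<omega>. zpath n (X n \<omega>))"
    by (simp add: fun_eq_iff zpath_def)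
  then show ?thesis using scaling_limit[of M X] chain by simp
qed

end
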